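(* There exist exactly $9$ candidate surface branched covers inducing a candidate 2-orbifold cover $\widetilde X\dashrightarrow X$ with $\widetilde X$ and $X$ both hyperbolic triangular orbifolds. All of them but two are realizable. The two exceptional ones have degrees $8$ and $16$ (which are not prime).
   Context: A partition of $d$ is a finite unordered list (multiset) of positive integers with sum $d$; $\ell(\Pi)$ is the number of entries of $\Pi$. For closed connected orientable surfaces $\widetilde\Sigma,\Sigma$, a branched cover $f:\widetilde\Sigma\to\Sigma$ is a map locally modelled on $(\mathbb{C},0)\to(\mathbb{C},0)$, $z\mapsto z^k$ with $k\geq 1$; $k$ is the local degree at the source point, and a point of $\Sigma$ having a preimage with local degree $>1$ is a branching point. The degree $d$ of $f$ is the degree of the genuine cover obtained by removing the branching points and their preimages; the local degrees at the preimages of a branching point form a partition of $d$. A candidate surface branched cover consists of closed connected orientable surfaces $\widetilde\Sigma,\Sigma$ (up to homeomorphism), integers $d\geq 2$ and $n\geq 1$, and an unordered collection (repetitions allowed) $\Pi_1,\ldots,\Pi_n$ of partitions of $d$, each with at least one entry $>1$, satisfying the Riemann-Hurwitz condition $\chi(\widetilde\Sigma)-\sum_i\ell(\Pi_i)=d\,(\chi(\Sigma)-n)$. It is realizable if there is a degree-$d$ branched cover $f:\widetilde\Sigma\to\Sigma$ with $n$ branching points whose associated partitions of local degrees are $\Pi_1,\ldots,\Pi_n$, and exceptional otherwise. A 2-orbifold $X=\Sigma(p_1,\ldots,p_n)$ is a closed connected orientable surface $\Sigma$ with $n$ cone points of orders $p_i\geq 2$; $\chi^{\mathrm{orb}}(X)=\chi(\Sigma)-\sum_i(1-1/p_i)$,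 and $X$ is hyperbolic if $\chi^{\mathrm{orb}}(X)<0$. $X$ is triangular if it has the form $S(p,q,r)$, with $S$ the 2-sphere and $p,q,r\geq 2$. With $\Pi_i=(d_{ij})_j$, set $p_i=\mathrm{lcm}_j\, d_{ij}$ and $p_{ij}=p_i/d_{ij}$. The induced candidate 2-orbifold cover is $\widetilde X\dashrightarrow X$ with $X=\Sigma(p_1,\ldots,p_n)$ and $\widetilde X=\widetilde\Sigma((p_{ij})_{i,j})$, where orders equal to $1$ are dropped. *)

theory Defs
  imports
    "HOL-Library.Multiset"
    "HOL-Computational_Algebra.Primes"
    "HOL-Complex_Analysis.Complex_Analysis"
    "HOL-Homology.Homology"
begin

section \<open>Closed connected orientable surfaces\<close>

definition chart :: "'a topology \<Rightarrow> 'a set \<Rightarrow> ('a \<Rightarrow> complex) \<Rightarrow> bool" where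
  "chart X U \<phi> \<longleftrightarrow> openin X U \<and> open (\<phi> ` U) \<and>
     homeomorphic_map (subtopology X U) (top_of_set (\<phi> ` U)) \<phi>"

text \<open>For a homeomorphism between open subsets of the plane, the image of every circle bounding
  a disc inside the domain winds once, positively, around the image of the centre if orientation
  is preserved, and negatively otherwise.\<close>

definition orientation_preserving_on :: "complex set \<Rightarrow> (complex \<Rightarrow> complex) \<Rightarrow> bool" where
  "orientation_preserving_on W h \<longleftrightarrow>
     (\<forall>z\<in>W. \<forall>r>0. cball z r \<subseteq> W \<longrightarrow> winding_number (h \<circ> circlepath z r) (h z) = 1)"

definition orientable_surface :: "'a topology \<Rightarrow> bool" where
  "orientable_surface X \<longleftrightarrow>
     (\<exists>\<A>. (\<forall>(U, \<phi>)\<in>\<A>. chart X U \<phi>) \<and> (\<Union>(U, \<phi>)\<in>\<A>. U) = topspace X \<and>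
        (\<forall>(U, \<phi>)\<in>\<A>. \<forall>(V, \<psi>)\<in>\<A>.
           orientation_preserving_on (\<phi> ` (U \<inter> V)) (\<psi> \<circ> inv_into U \<phi>)))"

text \<open>Charts at all points are part of \<open>orientable_surface\<close>; second countability is automatic by
  compactness.\<close>

definition closed_surface :: "'a topology \<Rightarrow> bool" where
  "closed_surface X \<longleftrightarrow> topspace X \<noteq> {} \<and> compact_space X \<and> Hausdorff_space X \<and>
     connected_space X \<and> orientable_surface X"

text \<open>The rank of an abelian group (written multiplicatively) is the largest number of elements
  that are linearly independent over the integers.\<close>

definition int_independent :: "('b, 'c) monoid_scheme \<Rightarrow> 'b set \<Rightarrow> bool" where
  "int_independent G B \<longleftrightarrow> finite B \<and> B \<subseteq> carrier G \<and>
     (\<forall>c :: 'b \<Rightarrow> int. finprod G (\<lambda>b. b [^]\<^bsub>G\<^esub> c b) B = \<one>\<^bsub>G\<^esub> \<longrightarrow> (\<forall>b\<in>B. c b = 0))"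

definition abelian_rank :: "('b, 'c) monoid_scheme \<Rightarrow> nat" where
  "abelian_rank G = Sup (card ` {B. int_independent G B})"

definition betti_number :: "nat \<Rightarrow> 'a topology \<Rightarrow> nat" where
  "betti_number p X = abelian_rank (homology_group (int p) X)"

definition euler_characteristic :: "'a topology \<Rightarrow> int" where
  "euler_characteristic X = (\<Sum>p | betti_number p X \<noteq> 0. (-1) ^ p * int (betti_number p X))"


section \<open>Branched covers\<close>

definition locally_power :: "'a topology \<Rightarrow> 'b topology \<Rightarrow> ('a \<Rightarrow> 'b) \<Rightarrow> 'a \<Rightarrow> nat \<Rightarrow> bool" where
  "locally_power X Y f x k \<longleftrightarrow> k \<ge> 1 \<and>
     (\<exists>U \<phi> V \<psi>. chart X U \<phi> \<and> chart Y V \<psi> \<and> x \<in> U \<and> \<phi> x = 0 \<and> f ` U \<subseteq> V \<and> \<psi> (f x) = 0 \<and>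
        (\<forall>u\<in>U. \<psi> (f u) = \<phi> u ^ k))"

definition branched_cover :: "'a topology \<Rightarrow> 'b topology \<Rightarrow> ('a \<Rightarrow> 'b) \<Rightarrow> bool" where
  "branched_cover X Y f \<longleftrightarrow> closed_surface X \<and> closed_surface Y \<and>
     (\<forall>x\<in>topspace X. \<exists>k. locally_power X Y f x k)"

definition local_degree :: "'a topology \<Rightarrow> 'b topology \<Rightarrow> ('a \<Rightarrow> 'b) \<Rightarrow> 'a \<Rightarrow> nat" where
  "local_degree X Y f x = (THE k. locally_power X Y f x k)"

definition fibre :: "'a topology \<Rightarrow> ('a \<Rightarrow> 'b) \<Rightarrow> 'b \<Rightarrow> 'a set" where
  "fibre X f y = {x \<in> topspace X. f x = y}"

definition branching_points :: "'a topology \<Rightarrow> 'b topology \<Rightarrow> ('a \<Rightarrow> 'b) \<Rightarrow> 'b set" where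
  "branching_points X Y f = {y \<in> topspace Y. \<exists>x\<in>fibre X f y. local_degree X Y f x > 1}"

text \<open>The degree is the number of sheets of the genuine cover over the complement of the branching
  points; for a branched cover between closed surfaces the branching points form a finite set and
  the restriction over their complement is automatically a covering map.\<close>

definition has_cover_degree :: "'a topology \<Rightarrow> 'b topology \<Rightarrow> ('a \<Rightarrow> 'b) \<Rightarrow> nat \<Rightarrow> bool" where
  "has_cover_degree X Y f d \<longleftrightarrow>
     (\<forall>y \<in> topspace Y - branching_points X Y f. finite (fibre X f y) \<and> card (fibre X f y) = d)"

definition local_degree_partition ::
    "'a topology \<Rightarrow> 'b topology \<Rightarrow> ('a \<Rightarrow> 'b) \<Rightarrow> 'b \<Rightarrow> nat multiset" where
  "local_degree_partition X Y f y = image_mset (local_degree X Y f) (mset_set (fibre X f y))"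

definition branch_data :: "'a topology \<Rightarrow> 'b topology \<Rightarrow> ('a \<Rightarrow> 'b) \<Rightarrow> nat multiset multiset" where
  "branch_data X Y f = image_mset (local_degree_partition X Y f) (mset_set (branching_points X Y f))"


section \<open>Candidate surface branched covers\<close>

definition partition_of :: "nat \<Rightarrow> nat multiset \<Rightarrow> bool" where
  "partition_of d P \<longleftrightarrow> 0 \<notin># P \<and> sum_mset P = d"

text \<open>The number \<open>n\<close> of partitions is \<open>size (partitions c)\<close>.\<close>

record 'a surface_cover_data =
  cover_surface :: "'a topology"
  base_surface :: "'a topology"
  cover_degree :: nat
  partitions :: "nat multiset multiset"

definition candidate_cover :: "'a surface_cover_data \<Rightarrow> bool" where
  "candidate_cover c \<longleftrightarrow>
     closed_surface (cover_surface c) \<and> closed_surface (base_surface c) \<and>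
     cover_degree c \<ge> 2 \<and> size (partitions c) \<ge> 1 \<and>
     (\<forall>P \<in># partitions c. partition_of (cover_degree c) P \<and> (\<exists>k \<in># P. k > 1)) \<and>
     euler_characteristic (cover_surface c) - (\<Sum>P \<in># partitions c. int (size P)) =
       int (cover_degree c) * (euler_characteristic (base_surface c) - int (size (partitions c)))"

definition realizable :: "'a surface_cover_data \<Rightarrow> bool" where
  "realizable c \<longleftrightarrow>
     (\<exists>f. branched_cover (cover_surface c) (base_surface c) f \<and>
        has_cover_degree (cover_surface c) (base_surface c) f (cover_degree c) \<and>
        branch_data (cover_surface c) (base_surface c) f = partitions c)"

definition exceptional :: "'a surface_cover_data \<Rightarrow> bool" where
  "exceptional c \<longleftrightarrow> candidate_cover c \<and> \<not> realizable c"

text \<open>The surfaces of a candidate only matter up to homeomorphism, so candidates are counted modulo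
  the following equivalence.\<close>

definition same_candidate :: "('a surface_cover_data \<times> 'a surface_cover_data) set" where
  "same_candidate = {(c, c').
     cover_surface c homeomorphic_space cover_surface c' \<and>
     base_surface c homeomorphic_space base_surface c' \<and>
     cover_degree c = cover_degree c' \<and> partitions c = partitions c'}"

lemma equiv_same_candidate: "equiv UNIV same_candidate"
  by (auto simp: equiv_def refl_on_def sym_def trans_def same_candidate_def
      homeomorphic_space_refl intro: homeomorphic_space_trans
      dest: homeomorphic_space_sym [THEN iffD1])


section \<open>2-orbifolds\<close>

record 'a two_orbifold =
  underlying_surface :: "'a topology"
  cone_orders :: "nat multiset"

definition is_two_orbifold :: "'a two_orbifold \<Rightarrow> bool" where
  "is_two_orbifold X \<longleftrightarrow> closed_surface (underlying_surface X) \<and> (\<forall>p \<in># cone_orders X. p \<ge> 2)"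

definition orbifold_euler_characteristic :: "'a two_orbifold \<Rightarrow> real" where
  "orbifold_euler_characteristic X =
     of_int (euler_characteristic (underlying_surface X)) - (\<Sum>p \<in># cone_orders X. 1 - 1 / real p)"

definition hyperbolic_orbifold :: "'a two_orbifold \<Rightarrow> bool" where
  "hyperbolic_orbifold X \<longleftrightarrow> is_two_orbifold X \<and> orbifold_euler_characteristic X < 0"

definition triangular_orbifold :: "'a two_orbifold \<Rightarrow> bool" where
  "triangular_orbifold X \<longleftrightarrow> is_two_orbifold X \<and>
     underlying_surface X homeomorphic_space nsphere 2 \<and>
     (\<exists>p q r. p \<ge> 2 \<and> q \<ge> 2 \<and> r \<ge> 2 \<and> cone_orders X = {#p, q, r#})"

definition induced_base_orbifold :: "'a surface_cover_data \<Rightarrow> 'a two_orbifold" where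
  "induced_base_orbifold c =
     \<lparr>underlying_surface = base_surface c,
      cone_orders = filter_mset (\<lambda>p. p \<noteq> 1) (image_mset (\<lambda>P. Lcm (set_mset P)) (partitions c))\<rparr>"

definition induced_cover_orbifold :: "'a surface_cover_data \<Rightarrow> 'a two_orbifold" where
  "induced_cover_orbifold c =
     \<lparr>underlying_surface = cover_surface c,
      cone_orders = filter_mset (\<lambda>p. p \<noteq> 1)
        (\<Sum>P \<in># partitions c. image_mset (\<lambda>k. Lcm (set_mset P) div k) P)\<rparr>"

definition induces_hyperbolic_triangular :: "'a surface_cover_data \<Rightarrow> bool" where
  "induces_hyperbolic_triangular c \<longleftrightarrow> candidate_cover c \<and>
     hyperbolic_orbifold (induced_cover_orbifold c) \<and>
     triangular_orbifold (induced_cover_orbifold c) \<and>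
     hyperbolic_orbifold (induced_base_orbifold c) \<and>
     triangular_orbifold (induced_base_orbifold c)"

text \<open>A set of the cardinality of the continuum carries a homeomorphic copy of every closed surface,
  so topologies on subsets of \<open>nat \<Rightarrow> real\<close> (the type of the spheres \<open>nsphere n\<close>) represent all of
  them.\<close>

type_synonym candidate = "(nat \<Rightarrow> real) surface_cover_data"

end

theory Submission
  imports Defs "HOL-Computational_Algebra.Computational_Algebra"
begin

text \<open>For triangular orbifolds over the sphere, Riemann--Hurwitz says that the three partitions
  together have \<open>d + 2\<close> entries, exactly three of which differ from the least common multiple of
  their own partition, and hyperbolicity of the base says \<open>1/p + 1/q + 1/r < 1\<close>. Distinguishing how
  the three defective entries are distributed leaves nine data.

  Seven of them are realized by rational functions \<open>A / C\<close> with \<open>A = P\<^sup>e R\<close>, \<open>C = T\<^sup>g U\<close> and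
  \<open>A - C = Q\<^sup>2 V\<close>: these factorizations already account for all roots of the Wronskian
  \<open>A' C - A C'\<close>, so nothing branches away from \<open>0\<close>, \<open>1\<close> and \<open>\<infinity>\<close>.

  For the other two, the sheets of a hypothetical cover over the upper and the lower half plane are
  matched by continuation across the three real intervals between the branching points. This gives
  permutations \<open>\<sigma>\<close> and \<open>\<tau>\<close> of \<open>d\<close> sheets that act transitively, with the cycle types of \<open>\<sigma>\<close>, \<open>\<tau>\<close>
  and \<open>\<tau> \<circ> \<sigma>\<close> prescribed by the partitions; following the short cycles shows that there are none.\<close>

section \<open>Charts and local degrees\<close>

text \<open>A branched cover is here only a map that looks like a power in suitable charts, so
  non-realizability has to be shown by topology alone. Removing one point from each sphere turns the
  unbranched part into a covering of the plane minus two points by a cofinite subset of the plane,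
  and sections over three simply connected slit planes stand in for loops and the fundamental group.
  The delicate point is that local degrees must reappear as cycle lengths: the sheets near one point
  form a single cycle because a punctured neighbourhood of that point is connected. Since the Euler
  characteristic is defined by Betti numbers, its value 2 for the sphere is computed from homology
  before Riemann--Hurwitz says anything numerical. In the seven rational functions the largest entry
  of the third partition is the order of the pole at infinity. Four of them are classical: they
  express \<open>j / 1728\<close> on the modular curves X_0(7), X_0(8), X_0(9) and X_1(7), whose
  cusp widths form the third partition. The other three come from expanding a square root at
  infinity and asking for vanishing coefficients.\<close>

lemma chart_maps:
  assumes "chart X U \<phi>"
  shows chart_inj: "inj_on \<phi> U" and chart_openin: "openin X U" and chart_open_image: "open (\<phi> ` U)"
    and chart_homeomorphic_maps: "homeomorphic_maps (subtopology X U) (top_of_set (\<phi> ` U)) \<phi> (inv_into U \<phi>)"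
proof -
  have U: "openin X U" "open (\<phi> ` U)" and h: "homeomorphic_map (subtopology X U) (top_of_set (\<phi> ` U)) \<phi>"
    using assms by (auto simp: chart_def)
  have ts: "topspace (subtopology X U) = U"
    using openin_subset[OF U(1)] by auto
  show inj: "inj_on \<phi> U"
    using homeomorphic_imp_injective_map[OF h] ts by simp
  show "openin X U" "open (\<phi> ` U)" by fact+
  obtain g where g: "homeomorphic_maps (subtopology X U) (top_of_set (\<phi> ` U)) \<phi> g"
    using h homeomorphic_map_maps by blast
  have "inv_into U \<phi> y = g y" if "y \<in> \<phi> ` U" for y
    using that g ts inj by (auto simp: homeomorphic_maps_def)
  then show "homeomorphic_maps (subtopology X U) (top_of_set (\<phi> ` U)) \<phi> (inv_into U \<phi>)"
    using g by (intro homeomorphic_maps_eq[OF g]) auto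
qed

lemma chart_preimage_open:
  assumes "chart X U \<phi>" "open B"
  shows "openin X {u \<in> U. \<phi> u \<in> B}"
proof -
  have "continuous_map (subtopology X U) (top_of_set (\<phi> ` U)) \<phi>"
    using chart_homeomorphic_maps[OF assms(1)] by (simp add: homeomorphic_maps_def)
  then have "continuous_map (subtopology X U) euclidean \<phi>"
    by (simp add: continuous_map_in_subtopology)
  then have "openin (subtopology X U) {u \<in> topspace (subtopology X U). \<phi> u \<in> B}"
    using assms(2) by (intro openin_continuous_map_preimage) auto
  moreover have "{u \<in> topspace (subtopology X U). \<phi> u \<in> B} = {u \<in> U. \<phi> u \<in> B}"
    using openin_subset[OF chart_openin[OF assms(1)]] by auto
  ultimately show ?thesis
    using chart_openin[OF assms(1)] openin_trans_full by fastforce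
qed

lemma chart_image_open:
  assumes "chart X U \<phi>" "openin X W" "W \<subseteq> U"
  shows "open (\<phi> ` W)"
proof -
  have "homeomorphic_map (subtopology X U) (top_of_set (\<phi> ` U)) \<phi>"
    using assms(1) by (simp add: chart_def)
  then have "open_map (subtopology X U) (top_of_set (\<phi> ` U)) \<phi>"
    by (simp add: homeomorphic_imp_open_map)
  moreover have "openin (subtopology X U) W"
    using assms(2,3) by (simp add: openin_subtopology_Int2 openin_subset_topspace_eq openin_subtopology)
       (metis inf.absorb_iff1)
  ultimately have "openin (top_of_set (\<phi> ` U)) (\<phi> ` W)"
    by (auto simp: open_map_def)
  then show ?thesis
    using chart_open_image[OF assms(1)] openin_open_eq by blast
qed

text \<open>In charts centred at \<open>x\<close> and \<open>f x\<close> the map is the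
  \<open>k\<close>-th power, so the disc of radius \<open>r\<close> goes onto the disc of radius
  \<open>r ^ k\<close>: a nonzero value has exactly its \<open>k\<close> roots as preimages, and 0
  has only the centre. The punctured disc is connected, which later makes the sheets around
  \<open>x\<close> a single cycle.\<close>

lemma locally_power_nbhd:
  assumes lp: "locally_power X Y f x k" and W: "openin X W" "x \<in> W"
  obtains U where "openin X U" "x \<in> U" "U \<subseteq> W" "openin Y (f ` U)" "connectedin X (U - {x})"
    "\<And>u. u \<in> U \<Longrightarrow> f u = f x \<Longrightarrow> u = x"
    "\<And>t. t \<in> f ` U - {f x} \<Longrightarrow> card {u \<in> U. f u = t} = k"
    "continuous_map (subtopology X U) Y f"
proof -
  obtain U0 \<phi> V0 \<psi> where k: "k \<ge> 1" and \<phi>: "chart X U0 \<phi>" and \<psi>: "chart Y V0 \<psi>"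
    and x: "x \<in> U0" "\<phi> x = 0" and fU: "f ` U0 \<subseteq> V0" "\<psi> (f x) = 0"
    and pow: "\<And>u. u \<in> U0 \<Longrightarrow> \<psi> (f u) = \<phi> u ^ k"
    using lp unfolding locally_power_def by blast
  have "open (\<phi> ` (W \<inter> U0))"
    using W \<phi> by (intro chart_image_open[OF \<phi>]) (auto simp: chart_openin)
  moreover have "0 \<in> \<phi> ` (W \<inter> U0)"
    using W x by force
  ultimately obtain r where r: "r > 0" "ball 0 r \<subseteq> \<phi> ` (W \<inter> U0)"
    using open_contains_ball by blast
  define U where "U = {u \<in> U0. \<phi> u \<in> ball 0 r}"
  note injs = chart_inj[OF \<phi>] chart_inj[OF \<psi>]
  have lift: "\<exists>u\<in>U. \<phi> u = z" if "z \<in> ball 0 r" for z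
    using r(2) that unfolding U_def by blast
  have fimg: "f ` U = {v \<in> V0. \<psi> v \<in> ball 0 (r ^ k)}"
  proof (intro subset_antisym subsetI)
    fix v assume "v \<in> f ` U"
    then obtain u where "u \<in> U0" "norm (\<phi> u) < r" "v = f u" by (auto simp: U_def)
    moreover have "norm (\<phi> u) ^ k < r ^ k"
      using \<open>norm (\<phi> u) < r\<close> k by (intro power_strict_mono) auto
    moreover have "f u \<in> V0" using fU(1) \<open>u \<in> U0\<close> by blast
    ultimately show "v \<in> {v \<in> V0. \<psi> v \<in> ball 0 (r ^ k)}"
      by (simp add: pow norm_power)
  next
    fix v assume v: "v \<in> {v \<in> V0. \<psi> v \<in> ball 0 (r ^ k)}"
    obtain z where z: "z ^ k = \<psi> v"
    proof (cases "\<psi> v = 0")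
      case True
      then show ?thesis using that[of 0] k by auto
    next
      case False
      then have "card {z. z ^ k = \<psi> v} \<noteq> 0"
        using card_nth_roots[of "\<psi> v" k] k by simp
      then have "{z. z ^ k = \<psi> v} \<noteq> {}" by force
      then show ?thesis using that by blast
    qed
    have "norm z ^ k < r ^ k" using v z by (simp flip: norm_power)
    then have "z \<in> ball 0 r"
      using r(1) by (auto intro: power_less_imp_less_base)
    then obtain u where u: "u \<in> U" "\<phi> u = z" using lift by blast
    then have "\<psi> (f u) = \<psi> v" using z pow by (auto simp: U_def)
    then have "f u = v" using v injs(2) u fU by (auto simp: inj_on_def U_def)
    then show "v \<in> f ` U" using u by blast
  qed
  show ?thesis
  proof
    show "openin X U"
      unfolding U_def by (intro chart_preimage_open[OF \<phi>]) auto
    show "x \<in> U" using x r(1) by (auto simp: U_def)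
    show "U \<subseteq> W"
    proof
      fix u assume u: "u \<in> U"
      then obtain u' where "u' \<in> W \<inter> U0" "\<phi> u = \<phi> u'"
        using r(2) by (auto simp: U_def)
      then show "u \<in> W" using injs(1) u by (auto simp: inj_on_def U_def)
    qed
    show "openin Y (f ` U)"
      unfolding fimg by (intro chart_preimage_open[OF \<psi>]) auto
    show "connectedin X (U - {x})"
    proof -
      have cg: "continuous_map (top_of_set (\<phi> ` U0)) X (inv_into U0 \<phi>)"
        using chart_homeomorphic_maps[OF \<phi>] by (simp add: homeomorphic_maps_def continuous_map_in_subtopology)
      have sub: "ball 0 r \<subseteq> \<phi> ` U0" using r(2) by auto
      have "connected (ball (0::complex) r - {0})"
        by (intro connected_punctured_ball) auto
      then have "connectedin (top_of_set (\<phi> ` U0)) (ball 0 r - {0})"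
        using sub by (auto simp: connectedin_subtopology)
      then have "connectedin X (inv_into U0 \<phi> ` (ball 0 r - {0}))"
        using connectedin_continuous_map_image[OF cg] by blast
      moreover have "inv_into U0 \<phi> ` (ball 0 r - {0}) = U - {x}"
      proof (intro subset_antisym subsetI)
        fix u assume "u \<in> inv_into U0 \<phi> ` (ball 0 r - {0})"
        then obtain z where z: "z \<in> ball 0 r" "z \<noteq> 0" "u = inv_into U0 \<phi> z" by blast
        have "z \<in> \<phi> ` U0" using z(1) sub by blast
        then have "u \<in> U0" "\<phi> u = z" using z by (auto simp: inv_into_into f_inv_into_f)
        then show "u \<in> U - {x}" using z x by (auto simp: U_def)
      next
        fix u assume u: "u \<in> U - {x}"
        then have "\<phi> u \<noteq> 0" using injs(1) x by (auto simp: U_def inj_on_def)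
        moreover have "u = inv_into U0 \<phi> (\<phi> u)" using u injs by (auto simp: U_def)
        ultimately show "u \<in> inv_into U0 \<phi> ` (ball 0 r - {0})" using u by (auto simp: U_def)
      qed
      ultimately show ?thesis by simp
    qed
    show "u = x" if "u \<in> U" "f u = f x" for u
    proof -
      have "\<phi> u ^ k = 0" using that pow[of u] fU(2) by (auto simp: U_def)
      then have "\<phi> u = \<phi> x" using x by auto
      then show ?thesis using that x injs(1) by (auto simp: inj_on_def U_def)
    qed
    show "card {u \<in> U. f u = t} = k" if t: "t \<in> f ` U - {f x}" for t
    proof -
      have t': "t \<in> V0" "\<psi> t \<in> ball 0 (r ^ k)" using t fimg by auto
      have "f x \<in> V0" using fU(1) x(1) by auto
      then have "\<psi> t \<noteq> 0" using injs(2) t' t fU(2) by (auto simp: inj_on_def)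
      then have "card {z. z ^ k = \<psi> t} = k"
        using card_nth_roots k by auto
      moreover have "bij_betw \<phi> {u \<in> U. f u = t} {z. z ^ k = \<psi> t}"
      proof (rule bij_betw_imageI)
        show "inj_on \<phi> {u \<in> U. f u = t}"
          using injs(1) by (auto simp: inj_on_def U_def)
        show "\<phi> ` {u \<in> U. f u = t} = {z. z ^ k = \<psi> t}"
        proof (intro subset_antisym subsetI)
          fix z assume z: "z \<in> {z. z ^ k = \<psi> t}"
          then have "norm z ^ k < r ^ k" using t' by (auto simp flip: norm_power)
          then have "z \<in> ball 0 r"
            using r(1) by (auto intro: power_less_imp_less_base)
          then obtain u where u: "u \<in> U" "\<phi> u = z" using lift by blast
          then have "\<psi> (f u) = \<psi> t" using z pow by (auto simp: U_def)
          then have "f u = t" using t' injs(2) u fU by (auto simp: inj_on_def U_def)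
          then show "z \<in> \<phi> ` {u \<in> U. f u = t}" using u by auto
        qed (auto simp: U_def pow)
      qed
      ultimately show ?thesis by (simp add: bij_betw_same_card)
    qed
    show "continuous_map (subtopology X U) Y f"
    proof -
      have c1: "continuous_map (subtopology X U0) euclidean \<phi>"
        using chart_homeomorphic_maps[OF \<phi>] by (simp add: homeomorphic_maps_def continuous_map_in_subtopology)
      have c2: "continuous_map (top_of_set (\<psi> ` V0)) Y (inv_into V0 \<psi>)"
        using chart_homeomorphic_maps[OF \<psi>] by (simp add: homeomorphic_maps_def continuous_map_in_subtopology)
      have "continuous_map (subtopology X U0) euclidean (\<lambda>u. \<phi> u ^ k)"
        using c1 by (intro continuous_map_compose[OF c1, where g = "\<lambda>z. z ^ k", unfolded o_def])
           (auto intro!: continuous_intros)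
      then have "continuous_map (subtopology X U0) (top_of_set (\<psi> ` V0)) (\<lambda>u. \<phi> u ^ k)"
        using fU by (auto simp: continuous_map_in_subtopology simp flip: pow)
      then have "continuous_map (subtopology X U0) Y (inv_into V0 \<psi> \<circ> (\<lambda>u. \<phi> u ^ k))"
        using c2 continuous_map_compose by blast
      then have "continuous_map (subtopology X U0) Y f"
        by (rule continuous_map_eq) (use fU injs in \<open>auto simp flip: pow\<close>)
      then show ?thesis
        using continuous_map_from_subtopology_mono[of X U0 Y f U] by (auto simp: U_def)
    qed
  qed
qed

text \<open>Nested neighbourhoods compare the exponents: a value close to \<open>f x\<close> has
  \<open>k\<close> preimages in the small one and \<open>l\<close> in the large one, so
  \<open>k \<le> l\<close>, and the roles can be exchanged.\<close>

lemma locally_power_unique: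
  assumes "locally_power X Y f x k" "locally_power X Y f x l"
  shows "k = l"
proof -
  have le: "k \<le> l" if k: "locally_power X Y f x k" and l: "locally_power X Y f x l" for k l
  proof -
    obtain U0 \<phi> where \<phi>: "chart X U0 \<phi>" "x \<in> U0"
      using k unfolding locally_power_def by blast
    then have x: "x \<in> topspace X" using chart_openin openin_subset by blast
    obtain U where U: "openin X U" "x \<in> U" "openin Y (f ` U)" 
        "\<And>t. t \<in> f ` U - {f x} \<Longrightarrow> card {u \<in> U. f u = t} = l"
      by (rule locally_power_nbhd[OF l openin_topspace x]) blast
    obtain U' where U': "openin X U'" "x \<in> U'" "U' \<subseteq> U" "connectedin X (U' - {x})" 
        "\<And>u. u \<in> U' \<Longrightarrow> f u = f x \<Longrightarrow> u = x"
        "\<And>t. t \<in> f ` U' - {f x} \<Longrightarrow> card {u \<in> U'. f u = t} = k"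
      by (rule locally_power_nbhd[OF k U(1,2)]) blast
    \<comment> \<open>An isolated \<open>x\<close> would be sent by the chart to an open singleton
      of the plane.\<close>
    have "U' \<noteq> {x}"
    proof
      assume "U' = {x}"
      have "open (\<phi> ` (U' \<inter> U0))"
        using U' \<phi> by (intro chart_image_open[OF \<phi>(1)]) (auto simp: chart_openin)
      moreover have "\<phi> ` (U' \<inter> U0) = {\<phi> x}" using \<open>U' = {x}\<close> \<phi> by auto
      ultimately show False by (simp add: not_open_singleton)
    qed
    then obtain u where u: "u \<in> U'" "u \<noteq> x" using U'(2) by blast
    then have t: "f u \<in> f ` U' - {f x}" "f u \<in> f ` U - {f x}" using U' by auto
    \<comment> \<open>An infinite set has \<open>card\<close> 0, while the exponent \<open>l\<close>
      is at least 1.\<close>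
    have "finite {v \<in> U. f v = f u}"
    proof (rule ccontr)
      assume "infinite {v \<in> U. f v = f u}"
      then have "l = 0" using U(4)[OF t(2)] by simp
      then show False using l by (simp add: locally_power_def)
    qed
    then have "card {v \<in> U'. f v = f u} \<le> card {v \<in> U. f v = f u}"
      using U'(3) by (intro card_mono) auto
    then show ?thesis using U'(6)[OF t(1)] U(4)[OF t(2)] by simp
  qed
  show ?thesis using le[of k l] le[of l k] assms by auto
qed

lemma local_degree_eq: "locally_power X Y f x k \<Longrightarrow> local_degree X Y f x = k"
  unfolding local_degree_def by (rule the_equality) (auto intro: locally_power_unique)

section \<open>Monodromy over the plane minus two points\<close>

text \<open>The intervals left of 0, between 0 and 1, and right of 1 are the three gates between the
  half planes. Each slit plane is simply connected, so a covering splits into sheets over it, and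
  any two of the three meet only off the real axis.\<close>

definition slit :: "real set \<Rightarrow> complex set" where
  "slit I = {z. Im z \<noteq> 0 \<or> Re z \<in> I}"

abbreviation "slit0 \<equiv> slit {..<0}"
abbreviation "slit1 \<equiv> slit {0<..<1}"
abbreviation "slit2 \<equiv> slit {1<..}"

text \<open>The fixed point in the upper half plane of \<open>z \<mapsto> 1 / (1 - z)\<close>, which permutes \<open>0\<close>, \<open>1\<close> and \<open>\<infinity>\<close>
  cyclically; what is proved at \<open>0\<close> is transferred to the other two points by this map.\<close>

definition base_pt :: complex where "base_pt = Complex (1/2) (sqrt 3 / 2)"

definition section_on :: "complex set \<Rightarrow> (complex \<Rightarrow> complex) \<Rightarrow> complex set \<Rightarrow> (complex \<Rightarrow> complex) \<Rightarrow> bool" where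
  "section_on E g D s \<longleftrightarrow> continuous_on D s \<and> s \<in> D \<rightarrow> E \<and> (\<forall>z\<in>D. g (s z) = z)"

text \<open>A sheet over the upper half plane is named by its point above \<open>base_pt\<close>,
  one over the lower half plane by its point above \<open>cnj base_pt\<close>; continuation through
  the gate in \<open>D\<close> sends the first name to the second. The description is unique because
  a section over a slit plane is determined by one value.\<close>

definition transport :: "complex set \<Rightarrow> (complex \<Rightarrow> complex) \<Rightarrow> complex set \<Rightarrow> complex \<Rightarrow> complex" where
  "transport E g D x = (THE y. \<exists>s. section_on E g D s \<and> s base_pt = x \<and> s (cnj base_pt) = y)"

lemma base_pt_in_slit [simp]: "base_pt \<in> slit I" "cnj base_pt \<in> slit I"
  by (auto simp: slit_def base_pt_def)

lemma open_slit: "open I \<Longrightarrow> open (slit I)"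
proof -
  assume "open I"
  have "slit I = {z. Im z \<noteq> 0} \<union> Re -` I" by (auto simp: slit_def)
  moreover have "open {z. Im z \<noteq> 0}"
    by (intro open_Collect_neq continuous_intros)
  moreover have "open (Re -` I)"
    using \<open>open I\<close> by (intro open_vimage continuous_intros) auto
  ultimately show ?thesis by auto
qed

text \<open>A segment from the real point \<open>c\<close> to a nonreal point meets the real axis
  only at \<open>c\<close>. The convex \<open>T\<close> is the whole plane for the slit plane itself
  and a disc for its part near a branching point.\<close>

lemma starlike_slit:
  assumes "convex I" "convex T" "c \<in> I" "of_real c \<in> T"
  shows "starlike (slit I \<inter> T)"
  unfolding starlike_def
proof (intro bexI ballI subsetI)
  show "of_real c \<in> slit I \<inter> T" using assms by (auto simp: slit_def)
  fix z w assume z: "z \<in> slit I \<inter> T" and w: "w \<in> closed_segment (complex_of_real c) z"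
  then have wT: "w \<in> T" using assms by (meson IntD2 closed_segment_subset subsetD)
  obtain u where u: "0 \<le> u" "u \<le> 1" "w = (1 - u) *\<^sub>R complex_of_real c + u *\<^sub>R z"
    using w by (auto simp: in_segment)
  have im: "Im w = u * Im z" "Re w = (1 - u) * c + u * Re z" using u by auto
  have "w \<in> slit I"
  proof (cases "Im w = 0")
    case True
    then have "u = 0 \<or> Im z = 0" using im by auto
    then have "Re w \<in> I"
    proof
      assume "Im z = 0"
      then have "Re z \<in> I" using z by (auto simp: slit_def)
      then show ?thesis using assms(1,3) u im convexD[OF assms(1), of c "Re z" "1-u" u] by auto
    qed (use im assms in auto)
    then show ?thesis by (auto simp: slit_def)
  qed (auto simp: slit_def)
  then show "w \<in> slit I \<inter> T" using wT by auto
qed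

lemma section_unique:
  assumes "covering_space E g S" "section_on E g D s" "section_on E g D' s'"
    "connected T" "T \<subseteq> D" "T \<subseteq> D'" "T \<subseteq> S" "a \<in> T" "s a = s' a" "z \<in> T"
  shows "s z = s' z"
proof (rule covering_space_lift_unique[where T = T and f = "\<lambda>x. x" and ?g1.0 = s and ?g2.0 = s' and a = a,
      OF assms(1) assms(9)])
  show "continuous_on T s" "continuous_on T s'"
    using assms by (auto simp: section_on_def intro: continuous_on_subset)
  show "s \<in> T \<rightarrow> E" "s' \<in> T \<rightarrow> E" using assms by (auto simp: section_on_def)
  show "\<And>x. x \<in> T \<Longrightarrow> x = g (s x)" "\<And>x. x \<in> T \<Longrightarrow> x = g (s' x)"
    using assms unfolding section_on_def by auto
qed (use assms in auto)

context
  fixes E :: "complex set" and g :: "complex \<Rightarrow> complex"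
  assumes cov: "covering_space E g (- {0, 1})"
begin

definition "slits \<equiv> {slit0, slit1, slit2}"

lemma slits_props:
  assumes "D \<in> slits"
  shows "open D" "simply_connected D" "connected D" "D \<subseteq> - {0, 1}" "base_pt \<in> D" "cnj base_pt \<in> D"
    "{z. Im z > 0} \<subseteq> D" "{z. Im z < 0} \<subseteq> D"
proof -
  obtain I c where I: "D = slit I" "open I" "convex I" "c \<in> I" "0 \<notin> I" "1 \<notin> I"
  proof -
    consider "D = slit0" | "D = slit1" | "D = slit2" using assms by (auto simp: slits_def)
    then show ?thesis
    proof cases
      case 1 then show ?thesis by (intro that[of "{..<0}" "-1"]) auto
    next
      case 2 then show ?thesis by (intro that[of "{0<..<1}" "1/2"]) auto
    next
      case 3 then show ?thesis by (intro that[of "{1<..}" "2"]) auto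
    qed
  qed
  have st: "starlike D" using starlike_slit[of I UNIV c] I by auto
  show "open D" using I open_slit by auto
  show "simply_connected D" using st starlike_imp_simply_connected by blast
  show "connected D" using st starlike_imp_connected by blast
  show "D \<subseteq> - {0, 1}" using I by (auto simp: slit_def)
  show "base_pt \<in> D" "cnj base_pt \<in> D" using I by auto
  show "{z. Im z > 0} \<subseteq> D" "{z. Im z < 0} \<subseteq> D" using I by (auto simp: slit_def)
qed

text \<open>The section is a lift of the identity of \<open>D\<close>, which exists because
  \<open>D\<close> is simply connected and locally path connected.\<close>

lemma section_exists:
  assumes "D \<in> slits" "x \<in> E" "g x \<in> D"
  obtains s where "section_on E g D s" "s (g x) = x"
proof -
  have "locally path_connected D"
    using slits_props[OF assms(1)] open_imp_locally_path_connected by blast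
  then obtain s where "continuous_on D s" "s \<in> D \<rightarrow> E" "s (g x) = x" "\<And>y. y \<in> D \<Longrightarrow> g (s y) = y"
    using covering_space_lift_strong[OF cov assms(2) assms(3), where f = "\<lambda>x. x"] slits_props[OF assms(1)]
    by auto
  then show ?thesis by (intro that[of s]) (auto simp: section_on_def)
qed

lemma section_unique_slit:
  assumes "D \<in> slits" "section_on E g D s" "section_on E g D s'" "a \<in> D" "s a = s' a" "z \<in> D"
  shows "s z = s' z"
  by (rule section_unique[OF cov assms(2,3) slits_props(3)[OF assms(1)]])
     (use assms slits_props(4)[OF assms(1)] in auto)

lemma section_unique_upper:
  assumes "D \<in> slits" "D' \<in> slits" "section_on E g D s" "section_on E g D' s'"
    "Im a > 0" "s a = s' a" "Im z > 0"
  shows "s z = s' z"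
proof (rule section_unique[OF cov assms(3,4), of "{z. Im z > 0}"])
  show "connected {z. Im z > 0}"
    using convex_halfspace_Im_gt convex_connected by blast
  show "{z. Im z > 0} \<subseteq> - {0, 1}" by auto
qed (use assms slits_props(7)[OF assms(1)] slits_props(7)[OF assms(2)] in auto)

lemma section_unique_lower:
  assumes "D \<in> slits" "D' \<in> slits" "section_on E g D s" "section_on E g D' s'"
    "Im a < 0" "s a = s' a" "Im z < 0"
  shows "s z = s' z"
proof (rule section_unique[OF cov assms(3,4), of "{z. Im z < 0}"])
  show "connected {z. Im z < 0}"
    using convex_halfspace_Im_lt convex_connected by blast
  show "{z. Im z < 0} \<subseteq> - {0, 1}" by auto
qed (use assms slits_props(8)[OF assms(1)] slits_props(8)[OF assms(2)] in auto)

lemma base_pt_Im [simp]: "Im base_pt > 0" "Im (cnj base_pt) < 0"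
  by (auto simp: base_pt_def)

lemma transport_eq:
  assumes "D \<in> slits" "section_on E g D s"
  shows "transport E g D (s base_pt) = s (cnj base_pt)"
  unfolding transport_def
proof (rule the_equality)
  fix y assume "\<exists>s'. section_on E g D s' \<and> s' base_pt = s base_pt \<and> s' (cnj base_pt) = y"
  then show "y = s (cnj base_pt)"
    using section_unique_slit[OF assms(1) _ assms(2)] slits_props(5,6)[OF assms(1)] by metis
qed (use assms in auto)

definition "sheet D x = (SOME s. section_on E g D s \<and> s base_pt = x)"

abbreviation "Fb \<equiv> {x \<in> E. g x = base_pt}"

lemma sheet:
  assumes "D \<in> slits" "x \<in> Fb"
  shows "section_on E g D (sheet D x)" "sheet D x base_pt = x"
proof -
  obtain s where "section_on E g D s" "s base_pt = x"
    using section_exists[OF assms(1), of x] assms slits_props(5)[OF assms(1)] by auto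
  then have "section_on E g D (sheet D x) \<and> sheet D x base_pt = x"
    unfolding sheet_def by (intro someI[of "\<lambda>s. section_on E g D s \<and> s base_pt = x"]) auto
  then show "section_on E g D (sheet D x)" "sheet D x base_pt = x" by auto
qed

lemma transport_sheet:
  assumes "D \<in> slits" "x \<in> Fb"
  shows "transport E g D x = sheet D x (cnj base_pt)"
  using transport_eq[OF assms(1) sheet(1)[OF assms]] sheet(2)[OF assms] by simp

lemma section_base_in_fibre: "D \<in> slits \<Longrightarrow> section_on E g D s \<Longrightarrow> s base_pt \<in> Fb"
  using slits_props(5) by (auto simp: section_on_def)

lemma transport_bij:
  assumes "D \<in> slits"
  shows "bij_betw (transport E g D) Fb {x \<in> E. g x = cnj base_pt}"
proof (rule bij_betw_imageI)
  note D = slits_props[OF assms]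
  show "inj_on (transport E g D) Fb"
  proof (rule inj_onI)
    fix x y assume xy: "x \<in> Fb" "y \<in> Fb" "transport E g D x = transport E g D y"
    then have "sheet D x (cnj base_pt) = sheet D y (cnj base_pt)"
      using transport_sheet[OF assms] by metis
    then have "sheet D x base_pt = sheet D y base_pt"
      by (intro section_unique_slit[OF assms sheet(1)[OF assms xy(1)] sheet(1)[OF assms xy(2)] D(6) _ D(5)])
    then show "x = y" using sheet(2)[OF assms] xy by metis
  qed
  show "transport E g D ` Fb = {x \<in> E. g x = cnj base_pt}"
  proof (intro subset_antisym subsetI)
    fix y assume "y \<in> transport E g D ` Fb"
    then obtain x where x: "x \<in> Fb" "y = sheet D x (cnj base_pt)" using transport_sheet[OF assms] by auto
    then show "y \<in> {x \<in> E. g x = cnj base_pt}"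
      using sheet(1)[OF assms x(1)] D(6) by (auto simp: section_on_def)
  next
    fix y assume y: "y \<in> {x \<in> E. g x = cnj base_pt}"
    then obtain s where s: "section_on E g D s" "s (cnj base_pt) = y"
      using section_exists[OF assms, of y] D(6) by auto
    then have "transport E g D (s base_pt) = y" using transport_eq[OF assms] by auto
    then show "y \<in> transport E g D ` Fb" using section_base_in_fibre[OF assms s(1)] by blast
  qed
qed

definition "sheets D A = (\<Union>x\<in>A. sheet D x ` D)"

text \<open>A section is injective because \<open>g\<close> inverts it, so invariance of domain
  makes its image open.\<close>

lemma open_sheets:
  assumes "D \<in> slits" "A \<subseteq> Fb"
  shows "open (sheets D A)"
  unfolding sheets_def
proof (intro open_UN ballI)
  fix x assume "x \<in> A"
  then have s: "section_on E g D (sheet D x)" using sheet assms by auto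
  show "open (sheet D x ` D)"
  proof (rule invariance_of_domain)
    show "inj_on (sheet D x) D"
      by (rule inj_on_inverseI[where g = g]) (use s in \<open>auto simp: section_on_def\<close>)
  qed (use s slits_props(1)[OF assms(1)] in \<open>auto simp: section_on_def\<close>)
qed

lemma in_sheets:
  assumes "D \<in> slits" "p \<in> E" "g p \<in> D"
  shows "p \<in> sheets D Fb"
proof -
  obtain s where s: "section_on E g D s" "s (g p) = p" using section_exists assms by blast
  define x where "x = s base_pt"
  have x: "x \<in> Fb" unfolding x_def using section_base_in_fibre[OF assms(1) s(1)] .
  have "sheet D x (g p) = s (g p)"
    by (rule section_unique_slit[OF assms(1) sheet(1)[OF assms(1) x] s(1) slits_props(5)[OF assms(1)] _ assms(3)])
       (use sheet(2)[OF assms(1) x] x_def in auto)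
  then have "p = sheet D x (g p)" using s by simp
  then show ?thesis using x assms(3) unfolding sheets_def by blast
qed

text \<open>A point common to two sheets over the same slit plane makes them equal. Over different
  slit planes it lies above an open half plane; following both sheets from there to
  \<open>base_pt\<close> gives equal names, or to \<open>cnj base_pt\<close> equal
  transports.\<close>

lemma sheets_disjoint:
  assumes D: "D \<in> slits" "D' \<in> slits" and A: "A \<subseteq> Fb" "A' \<subseteq> Fb" "A \<inter> A' = {}"
    and tr: "transport E g D ` A \<inter> transport E g D' ` A' = {}"
  shows "sheets D A \<inter> sheets D' A' = {}"
proof (rule ccontr)
  assume "sheets D A \<inter> sheets D' A' \<noteq> {}"
  then obtain x x' z z' where x: "x \<in> A" "x' \<in> A'" "z \<in> D" "z' \<in> D'" "sheet D x z = sheet D' x' z'"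
    by (auto simp: sheets_def)
  note s = sheet[OF D(1), of x] and s' = sheet[OF D(2), of x']
  have xF: "x \<in> Fb" "x' \<in> Fb" using x A by auto
  have zz: "z = z'" using s(1)[OF xF(1)] s'(1)[OF xF(2)] x unfolding section_on_def by metis
  show False
  proof (cases "D = D'")
    case True
    then have "sheet D x base_pt = sheet D' x' base_pt"
      using section_unique_slit[OF D(1) s(1)[OF xF(1)], of "sheet D' x'" z base_pt] s'(1)[OF xF(2)] x zz slits_props(5)[OF D(1)]
      by auto
    then have "x = x'" using s(2) s'(2) xF by metis
    then show False using x A(3) by auto
  next
    case False
    then have "Im z \<noteq> 0" using x zz D by (auto simp: slits_def slit_def)
    then consider "Im z > 0" | "Im z < 0" by linarith
    then show False
    proof cases
      case 1
      have "sheet D x base_pt = sheet D' x' base_pt"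
        by (rule section_unique_upper[OF D s(1)[OF xF(1)] s'(1)[OF xF(2)] 1]) (use x zz in auto)
      then have "x = x'" using s(2) s'(2) xF by metis
      then show False using x A(3) by auto
    next
      case 2
      have "sheet D x (cnj base_pt) = sheet D' x' (cnj base_pt)"
        by (rule section_unique_lower[OF D s(1)[OF xF(1)] s'(1)[OF xF(2)] 2]) (use x zz in auto)
      then have "transport E g D x = transport E g D' x'" using transport_sheet D xF by metis
      then show False using x tr by blast
    qed
  qed
qed

text \<open>Because the continuations of \<open>A\<close> agree for all gates in
  \<open>\<D>\<close>, the sheets through \<open>A\<close> and the sheets through the rest of the
  fibre are disjoint open sets that together cover \<open>C\<close>, and connectedness allows only
  one of them. With all three gates this gives transitivity; with two it shows that the sheets
  around one point form one cycle.\<close>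

lemma connected_sheets:
  assumes Ds: "\<D> \<subseteq> slits" and C: "connected C" "C \<subseteq> E" "g ` C \<subseteq> \<Union>\<D>" and A: "A \<subseteq> Fb"
    and inv: "\<And>D D'. D \<in> \<D> \<Longrightarrow> D' \<in> \<D> \<Longrightarrow> transport E g D ` A = transport E g D' ` A"
  shows "C \<subseteq> (\<Union>D\<in>\<D>. sheets D A) \<or> C \<inter> (\<Union>D\<in>\<D>. sheets D A) = {}"
proof -
  let ?U = "\<Union>D\<in>\<D>. sheets D A" and ?V = "\<Union>D\<in>\<D>. sheets D (Fb - A)"
  have op: "open (\<Union>D\<in>\<D>. sheets D B)" if "B \<subseteq> Fb" for B
  proof (rule open_UN, rule ballI)
    fix D assume "D \<in> \<D>"
    then have "D \<in> slits" using Ds by blast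
    then show "open (sheets D B)" using that by (rule open_sheets)
  qed
  have "open ?U" by (rule op[OF A])
  moreover have "open ?V" by (rule op[OF Diff_subset])
  moreover have UV: "?U \<inter> ?V = {}"
  proof -
    have "sheets D A \<inter> sheets D' (Fb - A) = {}" if "D \<in> \<D>" "D' \<in> \<D>" for D D'
    proof (rule sheets_disjoint)
      have "transport E g D ` A = transport E g D' ` A" by (rule inv[OF that])
      moreover have "inj_on (transport E g D') Fb"
        using transport_bij that Ds by (meson bij_betw_def subsetD)
      then have "transport E g D' ` A \<inter> transport E g D' ` (Fb - A) = {}"
        using A by (auto dest: inj_onD)
      ultimately show "transport E g D ` A \<inter> transport E g D' ` (Fb - A) = {}" by argo
      show "D \<in> slits" "D' \<in> slits" using that Ds by blast+
      show "A \<subseteq> Fb" by fact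
      show "Fb - A \<subseteq> Fb" "A \<inter> (Fb - A) = {}" by blast+
    qed
    then show ?thesis by blast
  qed
  moreover have CUV: "C \<subseteq> ?U \<union> ?V"
  proof
    fix p assume p: "p \<in> C"
    then obtain D where D: "D \<in> \<D>" "g p \<in> D" using C by blast
    then have "p \<in> sheets D Fb" using in_sheets p C Ds by blast
    then show "p \<in> ?U \<union> ?V" using D unfolding sheets_def by blast
  qed
  ultimately have "?U \<inter> C = {} \<or> ?V \<inter> C = {}"
    by (intro connectedD[OF C(1)]) auto
  then show ?thesis using CUV by blast
qed

text \<open>This is \<open>connected_sheets\<close> for \<open>C = E\<close>: the three slit planes
  together cover the plane without 0 and 1.\<close>

lemma monodromy_transitive:
  assumes "connected E" and A: "A \<subseteq> Fb"
    and inv: "transport E g slit0 ` A = transport E g slit1 ` A" "transport E g slit1 ` A = transport E g slit2 ` A"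
  shows "A = {} \<or> A = Fb"
proof -
  have "\<Union>slits = - {0, 1}"
    by (auto simp: slits_def slit_def complex_eq_iff)
  then have "g ` E \<subseteq> \<Union>slits"
    using cov covering_space_imp_surjective by blast
  then have alt: "E \<subseteq> (\<Union>D\<in>slits. sheets D A) \<or> E \<inter> (\<Union>D\<in>slits. sheets D A) = {}"
  proof (intro connected_sheets assms)
    fix D D' assume "D \<in> slits" "D' \<in> slits"
    then show "transport E g D ` A = transport E g D' ` A"
      using inv unfolding slits_def by (elim insertE emptyE) simp_all
  qed auto
  have mem: "x \<in> (\<Union>D\<in>slits. sheets D A) \<longleftrightarrow> x \<in> A" if x: "x \<in> Fb" for x
  proof
    assume "x \<in> A"
    moreover have "x \<in> sheet slit0 x ` slit0" using sheet(2)[of slit0 x] x by (auto simp: slits_def intro!: image_eqI[of _ _ base_pt])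
    ultimately show "x \<in> (\<Union>D\<in>slits. sheets D A)" by (auto simp: sheets_def slits_def)
  next
    assume "x \<in> (\<Union>D\<in>slits. sheets D A)"
    then obtain D y z where y: "D \<in> slits" "y \<in> A" "z \<in> D" "x = sheet D y z" by (auto simp: sheets_def)
    then have "g x = z" using sheet(1)[OF y(1), of y] A unfolding section_on_def by auto
    then show "x \<in> A" using y sheet(2)[OF y(1), of y] x A by auto
  qed
  show ?thesis
  proof (rule ccontr)
    assume "\<not> ?thesis"
    then obtain x y where "x \<in> A" "y \<in> Fb" "y \<notin> A" using A by blast
    then show False using alt mem[of x] mem[of y] A by blast
  qed
qed

text \<open>The \<open>U i\<close> are to be punctured neighbourhoods of the points over 0, and
  \<open>v x\<close> is the one that the sheet \<open>x\<close> enters near 0. Two radii occur: each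
  \<open>U i\<close> lies over the unit disc, where \<open>slit0\<close> and \<open>slit1\<close>
  already cover, but only over the disc of radius \<open>r\<close> is every point known to lie in
  some \<open>U i\<close>. The last two conclusions identify the classes of \<open>v\<close> with
  the cycles of continuation around 0.\<close>

lemma vertex_monodromy:
  assumes U: "\<And>i. i \<in> I \<Longrightarrow> open (U i)" "\<And>i. i \<in> I \<Longrightarrow> connected (U i)" "\<And>i. i \<in> I \<Longrightarrow> U i \<subseteq> E"
      "\<And>i j. i \<in> I \<Longrightarrow> j \<in> I \<Longrightarrow> i \<noteq> j \<Longrightarrow> U i \<inter> U j = {}"
      "\<And>i. i \<in> I \<Longrightarrow> g ` U i \<subseteq> ball 0 1 - {0}"
    and r: "0 < r" "r \<le> 1" "\<And>p. p \<in> E \<Longrightarrow> g p \<in> ball 0 r - {0} \<Longrightarrow> \<exists>i\<in>I. p \<in> U i"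
    and k: "\<And>i w. i \<in> I \<Longrightarrow> w \<in> ball 0 r - {0} \<Longrightarrow> card {u \<in> U i. g u = w} = k i"
  obtains v where "v \<in> Fb \<rightarrow> I" "\<And>i. i \<in> I \<Longrightarrow> card {x \<in> Fb. v x = i} = k i"
    "\<And>x y. x \<in> Fb \<Longrightarrow> y \<in> Fb \<Longrightarrow> transport E g slit0 x = transport E g slit1 y \<Longrightarrow> v x = v y"
    "\<And>A x y. A \<subseteq> Fb \<Longrightarrow> transport E g slit0 ` A = transport E g slit1 ` A \<Longrightarrow> x \<in> A \<Longrightarrow> y \<in> Fb \<Longrightarrow> v x = v y \<Longrightarrow> y \<in> A"
proof -
  let ?B = "ball 0 r :: complex set"
  have sl: "slit0 \<in> slits" "slit1 \<in> slits" by (auto simp: slits_def)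
  \<comment> \<open>A point close to 0 in the upper half plane whose negative is in the lower one;
    both lie in both slit planes.\<close>
  define q where "q = \<i> * of_real (r / 2)"
  have q: "q \<in> ?B" "q \<noteq> 0" "Im q > 0" "Im (- q) < 0" "- q \<in> ?B" using r by (auto simp: q_def norm_mult)
  have qD: "q \<in> slit0" "q \<in> slit1" "- q \<in> slit0" "-q \<in> slit1" using r by (auto simp: q_def slit_def)
  have conn: "connected (slit0 \<inter> ?B)" "connected (slit1 \<inter> ?B)"
  proof -
    show "connected (slit0 \<inter> ?B)"
      by (rule starlike_imp_connected, rule starlike_slit[of _ _ "- r/2"]) (use r in \<open>auto simp: norm_mult\<close>)
    show "connected (slit1 \<inter> ?B)"
      by (rule starlike_imp_connected, rule starlike_slit[of _ _ "r/2"]) (use r in \<open>auto simp: norm_mult\<close>)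
  qed
  have nz: "0 \<notin> slit0" "0 \<notin> slit1" by (auto simp: slit_def)
  \<comment> \<open>Over the connected part of \<open>D\<close> inside the small disc a section
    cannot leave the \<open>U i\<close> in which it starts, since the others are open and disjoint
    from it.\<close>
  have one: "s ` (D \<inter> ?B) \<subseteq> U i"
    if D: "D = slit0 \<or> D = slit1" and s: "section_on E g D s" and i: "i \<in> I" and z: "z \<in> D \<inter> ?B" "s z \<in> U i" for D s i z
  proof -
    have cs: "connected (s ` (D \<inter> ?B))"
      using s D conn by (intro connected_continuous_image) (auto simp: section_on_def intro: continuous_on_subset)
    have sub: "s ` (D \<inter> ?B) \<subseteq> U i \<union> (\<Union>j\<in>I - {i}. U j)"
    proof
      fix p assume "p \<in> s ` (D \<inter> ?B)"
      then obtain w where w: "w \<in> D" "w \<in> ?B" "p = s w" by auto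
      then have "p \<in> E" "g p = w" "w \<noteq> 0" using s D nz by (auto simp: section_on_def)
      then show "p \<in> U i \<union> (\<Union>j\<in>I - {i}. U j)" using r(3)[of p] w by auto
    qed
    have dis: "U i \<inter> (\<Union>j\<in>I - {i}. U j) = {}" using U(4)[OF i] by auto
    moreover have "open (\<Union>j\<in>I - {i}. U j)" using U(1) by blast
    ultimately have "U i \<inter> s ` (D \<inter> ?B) = {} \<or> (\<Union>j\<in>I - {i}. U j) \<inter> s ` (D \<inter> ?B) = {}"
      using connectedD[OF cs U(1)[OF i], of "\<Union>j\<in>I - {i}. U j"] sub by blast
    moreover have "U i \<inter> s ` (D \<inter> ?B) \<noteq> {}" using z by blast
    ultimately show ?thesis using sub by blast
  qed
  have exi: "\<exists>i\<in>I. sheet slit0 x q \<in> U i" if "x \<in> Fb" for x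
    using r(3)[of "sheet slit0 x q"] sheet(1)[OF sl(1) that] qD q by (auto simp: section_on_def)
  define v where "v x = (SOME i. i \<in> I \<and> sheet slit0 x q \<in> U i)" for x
  have v: "v x \<in> I" "sheet slit0 x q \<in> U (v x)" if "x \<in> Fb" for x
  proof -
    have "v x \<in> I \<and> sheet slit0 x q \<in> U (v x)"
      unfolding v_def by (rule someI_ex) (use exi[OF that] in blast)
    then show "v x \<in> I" "sheet slit0 x q \<in> U (v x)" by auto
  qed
  have vI: "v x = i" if "x \<in> Fb" "i \<in> I" "sheet slit0 x q \<in> U i" for x i
    using v[OF that(1)] that U(4) by blast
  have s01: "sheet slit1 x q = sheet slit0 x q" if "x \<in> Fb" for x
    by (rule section_unique_upper[OF sl(2,1) sheet(1)[OF sl(2) that] sheet(1)[OF sl(1) that], of base_pt])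
       (use sheet(2)[OF sl(1) that] sheet(2)[OF sl(2) that] q in auto)
  show ?thesis
  proof
    show "v \<in> Fb \<rightarrow> I" using v by blast
    fix i assume i: "i \<in> I"
    have "bij_betw (\<lambda>x. sheet slit0 x q) {x \<in> Fb. v x = i} {u \<in> U i. g u = q}"
    proof (rule bij_betw_imageI)
      show "inj_on (\<lambda>x. sheet slit0 x q) {x \<in> Fb. v x = i}"
      proof (rule inj_onI)
        fix x y assume xy: "x \<in> {x \<in> Fb. v x = i}" "y \<in> {x \<in> Fb. v x = i}" "sheet slit0 x q = sheet slit0 y q"
        have "sheet slit0 x base_pt = sheet slit0 y base_pt"
          by (rule section_unique_slit[OF sl(1) sheet(1)[OF sl(1)] sheet(1)[OF sl(1)] qD(1)])
             (use xy in auto)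
        then show "x = y" using sheet(2)[OF sl(1)] xy by auto
      qed
      show "(\<lambda>x. sheet slit0 x q) ` {x \<in> Fb. v x = i} = {u \<in> U i. g u = q}"
      proof (intro subset_antisym subsetI)
        fix u assume "u \<in> (\<lambda>x. sheet slit0 x q) ` {x \<in> Fb. v x = i}"
        then obtain x where x: "x \<in> Fb" "v x = i" "u = sheet slit0 x q" by auto
        then show "u \<in> {u \<in> U i. g u = q}"
          using v[OF x(1)] sheet(1)[OF sl(1) x(1)] qD by (auto simp: section_on_def)
      next
        fix u assume u: "u \<in> {u \<in> U i. g u = q}"
        then have uE: "u \<in> E" using U(3)[OF i] by auto
        then have "u \<in> sheets slit0 Fb" using in_sheets[OF sl(1) uE] u qD by auto
        then obtain x z where x: "x \<in> Fb" "z \<in> slit0" "u = sheet slit0 x z" by (auto simp: sheets_def)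
        then have "g u = z" using sheet(1)[OF sl(1) x(1)] by (auto simp: section_on_def)
        then have "u = sheet slit0 x q" using x u by auto
        then show "u \<in> (\<lambda>x. sheet slit0 x q) ` {x \<in> Fb. v x = i}" using x vI[OF x(1) i] u by auto
      qed
    qed
    then have "card {x \<in> Fb. v x = i} = card {u \<in> U i. g u = q}" by (rule bij_betw_same_card)
    then show "card {x \<in> Fb. v x = i} = k i" using k[OF i, of q] q by auto
  next
    fix x y assume x: "x \<in> Fb" and y: "y \<in> Fb" and tr: "transport E g slit0 x = transport E g slit1 y"
    \<comment> \<open>The two sheets agree in the lower half plane because their points above
      \<open>cnj base_pt\<close> do. Passing at \<open>- q\<close> carries the label of
      \<open>x\<close> over to \<open>y\<close>.\<close>
    have "sheet slit0 x (- q) = sheet slit1 y (- q)"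
      by (rule section_unique_lower[OF sl sheet(1)[OF sl(1) x] sheet(1)[OF sl(2) y], of "cnj base_pt"])
         (use tr transport_sheet[OF sl(1) x] transport_sheet[OF sl(2) y] q in auto)
    moreover have "sheet slit0 x (- q) \<in> U (v x)"
      using one[of slit0 "sheet slit0 x" "v x" q] sheet(1)[OF sl(1) x] v[OF x] q qD by auto
    ultimately have "sheet slit1 y q \<in> U (v x)"
      using one[of slit1 "sheet slit1 y" "v x" "- q"] sheet(1)[OF sl(2) y] v[OF x] q qD by auto
    then have "v y = v x" using vI[OF y v(1)[OF x]] s01[OF y] by simp
    then show "v x = v y" ..
  next
    fix A x y assume A: "A \<subseteq> Fb" "transport E g slit0 ` A = transport E g slit1 ` A" and x: "x \<in> A"
      and y: "y \<in> Fb" and xy: "v x = v y"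
    have xF: "x \<in> Fb" using x A by auto
    let ?\<D> = "{slit0, slit1}"
    \<comment> \<open>In the unit disc the real part is below 1, so no real point right of 1 occurs
      and the first two slit planes cover the punctured disc.\<close>
    have "ball 0 1 - {0} \<subseteq> \<Union>?\<D>"
    proof
      fix z :: complex assume z: "z \<in> ball 0 1 - {0}"
      then have "Re z < 1" using complex_Re_le_cmod[of z] by auto
      then show "z \<in> \<Union>?\<D>" using z by (auto simp: slit_def complex_eq_iff)
    qed
    then have "U (v x) \<subseteq> (\<Union>D\<in>?\<D>. sheets D A) \<or> U (v x) \<inter> (\<Union>D\<in>?\<D>. sheets D A) = {}"
    proof (intro connected_sheets A(1))
      show "?\<D> \<subseteq> slits" by (auto simp: slits_def)
      show "connected (U (v x))" "U (v x) \<subseteq> E" using v(1)[OF xF] U by blast+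
      show "g ` U (v x) \<subseteq> \<Union>?\<D>"
        using U(5)[OF v(1)[OF xF]] \<open>ball 0 1 - {0} \<subseteq> \<Union>?\<D>\<close> by (rule subset_trans)
      fix D D' assume "D \<in> ?\<D>" "D' \<in> ?\<D>"
      then show "transport E g D ` A = transport E g D' ` A"
        using A(2) by (elim insertE emptyE) simp_all
    qed
    moreover have "sheet slit0 x q \<in> (\<Union>D\<in>?\<D>. sheets D A)" using x qD by (auto simp: sheets_def)
    ultimately have "sheet slit0 y q \<in> (\<Union>D\<in>?\<D>. sheets D A)"
      using v(2)[OF xF] v(2)[OF y] xy by (auto simp del: UN_simps)
    then obtain D x' z where D: "D \<in> ?\<D>" "x' \<in> A" "z \<in> D" "sheet slit0 y q = sheet D x' z"
      by (auto simp: sheets_def)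
    have D': "D \<in> slits" using D by (auto simp: slits_def)
    have x': "x' \<in> Fb" using D A by auto
    have "z = q" using D(3,4) sheet(1)[OF D' x'] sheet(1)[OF sl(1) y] qD unfolding section_on_def by metis
    have "sheet slit0 y base_pt = sheet D x' base_pt"
      by (rule section_unique_upper[OF sl(1) D' sheet(1)[OF sl(1) y] sheet(1)[OF D' x'], of q])
         (use D \<open>z = q\<close> q in auto)
    then have "y = x'" using sheet(2)[OF sl(1) y] sheet(2)[OF D' x'] by simp
    then show "y \<in> A" using D by simp
  qed
qed

end

section \<open>The cyclic symmetry of the three branching points\<close>

text \<open>It sends 0 to 1, 1 to infinity and infinity to 0, and preserves the upper half
  plane.\<close>

definition mob :: "complex \<Rightarrow> complex" where "mob z = 1 / (1 - z)"

lemma mob_inverse: "z \<noteq> 0 \<Longrightarrow> z \<noteq> 1 \<Longrightarrow> mob ((z - 1) / z) = z" "z \<noteq> 0 \<Longrightarrow> z \<noteq> 1 \<Longrightarrow> (mob z - 1) / mob z = z"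
  by (auto simp: mob_def field_simps)

lemma mob_neq: "z \<noteq> 0 \<Longrightarrow> z \<noteq> 1 \<Longrightarrow> mob z \<noteq> 0" "z \<noteq> 0 \<Longrightarrow> z \<noteq> 1 \<Longrightarrow> mob z \<noteq> 1"
  by (auto simp: mob_def field_simps)

lemma homeomorphism_mob: "homeomorphism (- {0, 1}) (- {0, 1}) mob (\<lambda>z. (z - 1) / z)"
  unfolding homeomorphism_def
proof (intro conjI)
  show "mob ` (- {0, 1}) = - {0, 1}"
  proof (intro subset_antisym subsetI)
    fix z :: complex assume "z \<in> - {0, 1}"
    then have "z = mob ((z - 1) / z)" "(z - 1) / z \<in> - {0, 1}" using mob_inverse(1)[of z] by (auto simp: field_simps)
    then show "z \<in> mob ` (- {0, 1})" by blast
  qed (use mob_neq in auto)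
  show "(\<lambda>z. (z - 1) / z) ` (- {0, 1}) = - {0, 1 :: complex}"
  proof (intro subset_antisym subsetI)
    fix z :: complex assume z: "z \<in> - {0, 1}"
    then have "z = (mob z - 1) / mob z" using mob_inverse(2)[of z] by auto
    moreover have "mob z \<in> - {0, 1}" using z mob_neq by auto
    ultimately show "z \<in> (\<lambda>z. (z - 1) / z) ` (- {0, 1})" by blast
  qed (auto simp: field_simps)
  show "continuous_on (- {0, 1}) mob" unfolding mob_def by (intro continuous_intros) auto
  show "continuous_on (- {0, 1}) (\<lambda>z :: complex. (z - 1) / z)" by (intro continuous_intros) auto
  show "\<forall>x\<in>- {0, 1}. (mob x - 1) / mob x = x" "\<forall>y\<in>- {0, 1}. mob ((y - 1) / y) = y"
    using mob_inverse by auto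
qed

lemma covering_space_compose_homeomorphism:
  assumes cov: "covering_space E g S" and h: "homeomorphism S S' h h'"
  shows "covering_space E (h \<circ> g) S'"
proof
  note hD = homeomorphism_cont1[OF h] homeomorphism_cont2[OF h] homeomorphism_image1[OF h] homeomorphism_image2[OF h]
  show "continuous_on E (h \<circ> g)"
    using cov hD(1) by (intro continuous_on_compose) (auto simp: covering_space_def)
  show "(h \<circ> g) ` E = S'" using cov hD by (auto simp: covering_space_def image_comp[symmetric])
  fix x assume x: "x \<in> S'"
  then have "h' x \<in> S" using hD by blast
  then obtain T v where T: "h' x \<in> T" "openin (top_of_set S) T" and v: "\<Union>v = E \<inter> g -` T"
    "\<forall>u\<in>v. openin (top_of_set E) u" "pairwise disjnt v" "\<forall>u\<in>v. \<exists>q. homeomorphism u T g q"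
    using cov unfolding covering_space_def by metis
  have TS: "T \<subseteq> S" using T by (simp add: openin_imp_subset)
  have hT: "homeomorphism T (h ` T) h h'"
    by (rule homeomorphism_of_subsets[OF h TS _ refl]) (use TS hD in blast)
  show "\<exists>T. x \<in> T \<and> openin (top_of_set S') T \<and> (\<exists>v. \<Union>v = E \<inter> (h \<circ> g) -` T \<and>
      (\<forall>u\<in>v. openin (top_of_set E) u) \<and> pairwise disjnt v \<and> (\<forall>u\<in>v. \<exists>q. homeomorphism u T (h \<circ> g) q))"
  proof (intro exI[of _ "h ` T"] exI[of _ v] conjI)
    have "h (h' x) = x" using h x by (auto simp: homeomorphism_def)
    then show "x \<in> h ` T" using T(1) by force
    show "openin (top_of_set S') (h ` T)"
      using homeomorphism_imp_open_map[OF h T(2)] .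
    have "E \<inter> (h \<circ> g) -` (h ` T) = E \<inter> g -` T"
    proof (intro subset_antisym subsetI)
      fix p assume p: "p \<in> E \<inter> (h \<circ> g) -` (h ` T)"
      then obtain t where t: "t \<in> T" "h (g p) = h t" by auto
      have "g p \<in> S" using p cov by (auto simp: covering_space_def)
      then have "g p = t" using t TS h unfolding homeomorphism_def by (metis subsetD)
      then show "p \<in> E \<inter> g -` T" using t p by auto
    qed auto
    then show "\<Union>v = E \<inter> (h \<circ> g) -` (h ` T)" using v by simp
    show "\<forall>u\<in>v. \<exists>q. homeomorphism u (h ` T) (h \<circ> g) q"
      using v(4) homeomorphism_compose[OF _ hT] by blast
  qed (use v in auto)
qed

lemma covering_mob: "covering_space E g (- {0, 1}) \<Longrightarrow> covering_space E (mob \<circ> g) (- {0, 1})"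
  using covering_space_compose_homeomorphism homeomorphism_mob by blast

lemma mob_real_intervals:
  fixes x :: real
  assumes "x \<noteq> 0" "x \<noteq> 1"
  shows "(0 < 1 / (1 - x) \<and> 1 / (1 - x) < 1 \<longleftrightarrow> x < 0) \<and> (1 < 1 / (1 - x) \<longleftrightarrow> 0 < x \<and> x < 1) \<and>
    (1 / (1 - x) < 0 \<longleftrightarrow> 1 < x)"
proof -
  consider "x < 0" | "0 < x" "x < 1" | "1 < x" using assms by linarith
  then show ?thesis by cases (auto simp: divide_simps)
qed

lemma mob_slit:
  assumes "z \<noteq> 0" "z \<noteq> 1"
  shows "mob z \<in> slit1 \<longleftrightarrow> z \<in> slit0" "mob z \<in> slit2 \<longleftrightarrow> z \<in> slit1" "mob z \<in> slit0 \<longleftrightarrow> z \<in> slit2"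
proof -
  have *: "(mob z \<in> slit1 \<longleftrightarrow> z \<in> slit0) \<and> (mob z \<in> slit2 \<longleftrightarrow> z \<in> slit1) \<and> (mob z \<in> slit0 \<longleftrightarrow> z \<in> slit2)"
  proof (cases "Im z = 0")
    case True
    then have z: "z = of_real (Re z)" by (simp add: complex_eq_iff)
    have ne: "Re z \<noteq> 0" "Re z \<noteq> 1" using assms z by auto
    have "mob z = of_real (1 / (1 - Re z))" unfolding mob_def by (subst z) (simp only: of_real_divide of_real_diff of_real_1)
    then have "Im (mob z) = 0" "Re (mob z) = 1 / (1 - Re z)" by auto
    then show ?thesis using True mob_real_intervals[OF ne] by (simp add: slit_def)
  next
    case False
    then have "Im (mob z) \<noteq> 0" unfolding mob_def by (auto simp: Im_divide complex_eq_iff)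
    then show ?thesis using False by (auto simp: slit_def)
  qed
  then show "mob z \<in> slit1 \<longleftrightarrow> z \<in> slit0" "mob z \<in> slit2 \<longleftrightarrow> z \<in> slit1" "mob z \<in> slit0 \<longleftrightarrow> z \<in> slit2" by auto
qed

text \<open>The fixed points solve \<open>z * (1 - z) = 1\<close>; its roots are the two primitive
  sixth roots of unity.\<close>

lemma mob_base_pt [simp]: "mob base_pt = base_pt" "mob (cnj base_pt) = cnj base_pt"
proof -
  have "base_pt * (1 - base_pt) = 1" "cnj base_pt * (1 - cnj base_pt) = 1"
    by (auto simp: base_pt_def complex_eq_iff)
  then show "mob base_pt = base_pt" "mob (cnj base_pt) = cnj base_pt"
    unfolding mob_def by (metis mult_not_zero nonzero_eq_divide_eq zero_neq_one)+
qed

lemma slit_neq: "z \<in> slit0 \<or> z \<in> slit1 \<or> z \<in> slit2 \<Longrightarrow> z \<noteq> 0 \<and> z \<noteq> 1"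
  by (auto simp: slit_def)

lemma section_mob:
  assumes D: "D \<subseteq> - {0, 1}" "D' \<subseteq> - {0, 1}" "\<And>z. z \<noteq> 0 \<Longrightarrow> z \<noteq> 1 \<Longrightarrow> mob z \<in> D' \<longleftrightarrow> z \<in> D"
    and gE: "g ` E \<subseteq> - {0, 1}"
  shows "section_on E (mob \<circ> g) D' s \<Longrightarrow> section_on E g D (s \<circ> mob)"
    and "section_on E g D s \<Longrightarrow> section_on E (mob \<circ> g) D' (s \<circ> (\<lambda>z. (z - 1) / z))"
proof -
  have mD: "mob ` D \<subseteq> D'" using D by auto
  have iD: "(z - 1) / z \<in> D" if "z \<in> D'" for z
  proof -
    have "z \<noteq> 0" "z \<noteq> 1" using that D by auto
    then have "(z - 1) / z \<noteq> 0" "(z - 1) / z \<noteq> 1" "mob ((z - 1) / z) \<in> D'" using that mob_inverse by (auto simp: field_simps)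
    then show ?thesis using D(3) by blast
  qed
  have cm: "continuous_on D mob" unfolding mob_def using D(1) by (intro continuous_intros) auto
  have ci: "continuous_on D' (\<lambda>z. (z - 1) / z)" using D(2) by (intro continuous_intros) auto
  show "section_on E g D (s \<circ> mob)" if s: "section_on E (mob \<circ> g) D' s"
    unfolding section_on_def
  proof (intro conjI ballI)
    show "continuous_on D (s \<circ> mob)"
      using s mD cm by (intro continuous_on_compose) (auto simp: section_on_def intro: continuous_on_subset)
    show "s \<circ> mob \<in> D \<rightarrow> E" using s mD by (simp add: section_on_def Pi_iff image_subset_iff)
    fix z assume z: "z \<in> D"
    have "mob z \<in> D'" using z mD by auto
    then have 1: "mob (g (s (mob z))) = mob z" "s (mob z) \<in> E" using s by (auto simp: section_on_def Pi_iff)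
    have "g (s (mob z)) = (mob (g (s (mob z))) - 1) / mob (g (s (mob z)))"
    proof -
      have "g (s (mob z)) \<in> - {0, 1}" using 1(2) gE by blast
      then show ?thesis using mob_inverse(2)[of "g (s (mob z))"] by simp
    qed
    also have "\<dots> = z" using 1(1) mob_inverse(2)[of z] z D(1) by auto
    finally show "g ((s \<circ> mob) z) = z" by simp
  qed
  show "section_on E (mob \<circ> g) D' (s \<circ> (\<lambda>z. (z - 1) / z))" if s: "section_on E g D s"
    unfolding section_on_def
  proof (intro conjI ballI)
    show "continuous_on D' (s \<circ> (\<lambda>z. (z - 1) / z))"
      using s iD ci by (intro continuous_on_compose) (auto simp: section_on_def intro: continuous_on_subset)
    show "s \<circ> (\<lambda>z. (z - 1) / z) \<in> D' \<rightarrow> E" using s iD by (simp add: section_on_def Pi_iff)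
    fix z assume z: "z \<in> D'"
    then show "(mob \<circ> g) ((s \<circ> (\<lambda>z. (z - 1) / z)) z) = z"
      using iD[OF z] s D(2) mob_inverse(1)[of z] by (auto simp: section_on_def)
  qed
qed

text \<open>Composition with \<open>mob\<close> or its inverse matches the sections over
  \<open>D'\<close> with those over \<open>D\<close>. Both end points are fixed by
  \<open>mob\<close>, so the two descriptions select the same point.\<close>

lemma transport_mob_gen:
  assumes D: "D \<subseteq> - {0, 1}" "D' \<subseteq> - {0, 1}" "\<And>z. z \<noteq> 0 \<Longrightarrow> z \<noteq> 1 \<Longrightarrow> mob z \<in> D' \<longleftrightarrow> z \<in> D"
    and gE: "g ` E \<subseteq> - {0, 1}"
  shows "transport E (mob \<circ> g) D' = transport E g D"
proof -
  have inv: "(base_pt - 1) / base_pt = base_pt" "(cnj base_pt - 1) / cnj base_pt = cnj base_pt"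
  proof -
    have "base_pt \<noteq> 0" "base_pt \<noteq> 1" "cnj base_pt \<noteq> 0" "cnj base_pt \<noteq> 1"
      by (auto simp: base_pt_def complex_eq_iff)
    then show "(base_pt - 1) / base_pt = base_pt" "(cnj base_pt - 1) / cnj base_pt = cnj base_pt"
      using mob_inverse(2)[of base_pt] mob_inverse(2)[of "cnj base_pt"] by simp_all
  qed
  have "(\<exists>s. section_on E (mob \<circ> g) D' s \<and> s base_pt = x \<and> s (cnj base_pt) = y) \<longleftrightarrow>
        (\<exists>s. section_on E g D s \<and> s base_pt = x \<and> s (cnj base_pt) = y)" (is "?L \<longleftrightarrow> ?R") for x y
  proof
    assume ?L
    then obtain s where s: "section_on E (mob \<circ> g) D' s" "s base_pt = x" "s (cnj base_pt) = y" by blast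
    have "section_on E g D (s \<circ> mob)" by (rule section_mob(1)[OF D gE s(1)])
    then show ?R using s by (intro exI[of _ "s \<circ> mob"]) auto
  next
    assume ?R
    then obtain s where s: "section_on E g D s" "s base_pt = x" "s (cnj base_pt) = y" by blast
    have "section_on E (mob \<circ> g) D' (s \<circ> (\<lambda>z. (z - 1) / z))" by (rule section_mob(2)[OF D gE s(1)])
    then show ?L using s inv by (intro exI[of _ "s \<circ> (\<lambda>z. (z - 1) / z)"]) auto
  qed
  then show ?thesis by (intro ext) (simp add: transport_def)
qed

text \<open>\<open>mob\<close> moves each slit plane to the next one in cyclic order, so composing
  \<open>g\<close> with it shifts the three continuation maps.\<close>

lemma transport_mob:
  assumes "covering_space E g (- {0, 1})"
  shows "transport E (mob \<circ> g) slit1 = transport E g slit0"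
    "transport E (mob \<circ> g) slit2 = transport E g slit1"
    "transport E (mob \<circ> g) slit0 = transport E g slit2"
proof -
  have gE: "g ` E \<subseteq> - {0, 1}" using assms by (auto simp: covering_space_def)
  have s: "slit0 \<subseteq> - {0, 1}" "slit1 \<subseteq> - {0, 1}" "slit2 \<subseteq> - {0, 1}" using slit_neq by blast+
  show "transport E (mob \<circ> g) slit1 = transport E g slit0"
    by (rule transport_mob_gen[OF s(1,2) mob_slit(1) gE])
  show "transport E (mob \<circ> g) slit2 = transport E g slit1"
    by (rule transport_mob_gen[OF s(2,3) mob_slit(2) gE])
  show "transport E (mob \<circ> g) slit0 = transport E g slit2"
    by (rule transport_mob_gen[OF s(3,1) mob_slit(3) gE])
qed

section \<open>Neighbourhoods of a whole fibre of a branched cover\<close>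

lemma Hausdorff_finite_separation:
  assumes "Hausdorff_space X" "finite S" "S \<subseteq> topspace X"
  obtains W where "\<And>x. x \<in> S \<Longrightarrow> openin X (W x)" "\<And>x. x \<in> S \<Longrightarrow> x \<in> W x"
    "\<And>x y. x \<in> S \<Longrightarrow> y \<in> S \<Longrightarrow> x \<noteq> y \<Longrightarrow> W x \<inter> W y = {}"
proof -
  have "\<exists>A B. openin X A \<and> openin X B \<and> x \<in> A \<and> S - {x} \<subseteq> B \<and> disjnt A B" if "x \<in> S" for x
  proof -
    have c: "compactin X {x}" "compactin X (S - {x})"
      using that assms by (auto intro!: finite_imp_compactin)
    have d: "disjnt {x} (S - {x})" by simp
    show ?thesis
      by (rule Hausdorff_space_compact_separation[OF assms(1) c d]) auto
  qed
  then obtain A B where AB: "\<And>x. x \<in> S \<Longrightarrow> openin X (A x) \<and> openin X (B x) \<and> x \<in> A x \<and> S - {x} \<subseteq> B x \<and> disjnt (A x) (B x)"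
    by metis
  \<comment> \<open>\<open>B y\<close> contains every point of \<open>S\<close> except
    \<open>y\<close>, so \<open>W x\<close> still contains \<open>x\<close>, and it is disjoint from
    \<open>W y\<close>, which lies in \<open>A y\<close>.\<close>
  define W where "W x = A x \<inter> (\<Inter>y\<in>S - {x}. B y) \<inter> topspace X" for x
  show ?thesis
  proof
    fix x assume x: "x \<in> S"
    have "W x = (if S - {x} = {} then A x \<inter> topspace X else A x \<inter> topspace X \<inter> (\<Inter>y\<in>S - {x}. B y))"
      by (auto simp: W_def)
    then show "openin X (W x)"
      using AB x assms(2) by (auto intro!: openin_Int openin_INT2)
    show "x \<in> W x" using AB x assms(3) by (auto simp: W_def)
    fix y assume y: "y \<in> S" "x \<noteq> y"
    have "W x \<subseteq> A x" "W y \<subseteq> B x" using x y by (auto simp: W_def)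
    then show "W x \<inter> W y = {}" using AB[OF x] by (auto simp: disjnt_def)
  qed
qed

lemma branched_cover_continuous:
  assumes "branched_cover X Y f"
  shows "continuous_map X Y f"
  unfolding continuous_map_def
proof (intro conjI allI impI)
  have loc: "\<exists>U. openin X U \<and> x \<in> U \<and> continuous_map (subtopology X U) Y f" if x: "x \<in> topspace X" for x
  proof -
    obtain k where k: "locally_power X Y f x k" using assms x by (auto simp: branched_cover_def)
    show ?thesis by (rule locally_power_nbhd[OF k openin_topspace x]) blast
  qed
  show "f \<in> topspace X \<rightarrow> topspace Y"
  proof
    fix x assume x: "x \<in> topspace X"
    then obtain U where U: "openin X U" "x \<in> U" "continuous_map (subtopology X U) Y f" using loc by blast
    have "x \<in> topspace (subtopology X U)" using U x by simp
    then show "f x \<in> topspace Y" using U(3) by (auto simp: continuous_map_def Pi_iff)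
  qed
  fix V assume V: "openin Y V"
  show "openin X {x \<in> topspace X. f x \<in> V}"
  proof (subst openin_subopen, rule ballI)
    fix x assume x: "x \<in> {x \<in> topspace X. f x \<in> V}"
    then obtain U where U: "openin X U" "x \<in> U" "continuous_map (subtopology X U) Y f" using loc by blast
    have "openin (subtopology X U) {x \<in> topspace (subtopology X U). f x \<in> V}"
      using openin_continuous_map_preimage[OF U(3) V] .
    then have "openin X {x \<in> topspace (subtopology X U). f x \<in> V}"
      using U(1) openin_trans_full by blast
    then show "\<exists>T. openin X T \<and> x \<in> T \<and> T \<subseteq> {x \<in> topspace X. f x \<in> V}"
      using x U(2) by (intro exI[of _ "{x \<in> topspace (subtopology X U). f x \<in> V}"]) auto
  qed
qed

text \<open>Compactness makes \<open>f\<close> a closed map. The points outside all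
  \<open>U x\<close> therefore have a closed image, which misses \<open>b\<close>; removing it
  leaves a neighbourhood \<open>T\<close> of \<open>b\<close> whose entire preimage lies in the
  union of the \<open>U x\<close>.\<close>

lemma fibre_nbhds:
  assumes X: "compact_space X" "Hausdorff_space X" and Y: "Hausdorff_space Y" and f: "continuous_map X Y f"
    and fin: "finite (fibre X f b)" and k: "\<And>x. x \<in> fibre X f b \<Longrightarrow> locally_power X Y f x (k x)"
    and V: "openin Y V" "b \<in> V"
  obtains U T where "openin Y T" "b \<in> T" "T \<subseteq> V"
    "\<And>x. x \<in> fibre X f b \<Longrightarrow> openin X (U x) \<and> x \<in> U x \<and> f ` U x \<subseteq> V \<and> connectedin X (U x - {x})"
    "\<And>x u. x \<in> fibre X f b \<Longrightarrow> u \<in> U x \<Longrightarrow> f u = b \<Longrightarrow> u = x"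
    "\<And>x y. x \<in> fibre X f b \<Longrightarrow> y \<in> fibre X f b \<Longrightarrow> x \<noteq> y \<Longrightarrow> U x \<inter> U y = {}"
    "\<And>p. p \<in> topspace X \<Longrightarrow> f p \<in> T \<Longrightarrow> \<exists>x\<in>fibre X f b. p \<in> U x"
    "\<And>x t. x \<in> fibre X f b \<Longrightarrow> t \<in> T - {b} \<Longrightarrow> card {u \<in> U x. f u = t} = k x"
proof -
  have fX: "fibre X f b \<subseteq> topspace X" by (auto simp: fibre_def)
  obtain W where W: "\<And>x. x \<in> fibre X f b \<Longrightarrow> openin X (W x)" "\<And>x. x \<in> fibre X f b \<Longrightarrow> x \<in> W x"
    "\<And>x y. x \<in> fibre X f b \<Longrightarrow> y \<in> fibre X f b \<Longrightarrow> x \<noteq> y \<Longrightarrow> W x \<inter> W y = {}"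
    by (rule Hausdorff_finite_separation[OF X(2) fin fX]) blast
  have fb: "f x = b" if "x \<in> fibre X f b" for x using that by (simp add: fibre_def)
  have preV: "openin X {x \<in> topspace X. f x \<in> V}" by (rule openin_continuous_map_preimage[OF f V(1)])
  define nb where "nb x U \<longleftrightarrow> openin X U \<and> x \<in> U \<and> U \<subseteq> W x \<inter> {x \<in> topspace X. f x \<in> V} \<and> openin Y (f ` U) \<and>
     connectedin X (U - {x}) \<and> (\<forall>u\<in>U. f u = b \<longrightarrow> u = x) \<and> (\<forall>t\<in>f ` U - {b}. card {u \<in> U. f u = t} = k x)" for x U
  have "\<exists>U. nb x U" if x: "x \<in> fibre X f b" for x
  proof -
    have "openin X (W x \<inter> {x \<in> topspace X. f x \<in> V})" using W(1)[OF x] preV by blast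
    moreover have "x \<in> W x \<inter> {x \<in> topspace X. f x \<in> V}" using W(2)[OF x] x V(2) by (auto simp: fibre_def)
    ultimately show ?thesis
      by (rule locally_power_nbhd[OF k[OF x]]) (unfold fb[OF x] nb_def, blast)
  qed
  then have "\<exists>U. \<forall>x\<in>fibre X f b. nb x (U x)" by (intro bchoice ballI)
  then obtain U where nb: "\<And>x. x \<in> fibre X f b \<Longrightarrow> nb x (U x)" by blast
  have U1: "openin X (U x)" "x \<in> U x" "U x \<subseteq> W x" "U x \<subseteq> {x \<in> topspace X. f x \<in> V}" "openin Y (f ` U x)"
    "connectedin X (U x - {x})" if "x \<in> fibre X f b" for x
    using nb[OF that] unfolding nb_def by auto
  have U2: "u = x" if "x \<in> fibre X f b" "u \<in> U x" "f u = b" for x u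
    using nb[OF that(1)] that unfolding nb_def by auto
  have U3: "card {u \<in> U x. f u = t} = k x" if "x \<in> fibre X f b" "t \<in> f ` U x - {b}" for x t
    using nb[OF that(1)] that unfolding nb_def by auto
  define C where "C = topspace X - (\<Union>x\<in>fibre X f b. U x)"
  have "closedin X C" unfolding C_def using U1(1) by (intro closedin_diff closedin_topspace openin_Union) auto
  then have "closedin Y (f ` C)"
    using continuous_imp_closed_map[OF f X(1) Y] by (auto simp: closed_map_def)
  \<comment> \<open>Inserting \<open>V\<close> keeps the intersected family nonempty even for an
    empty fibre.\<close>
  define T where "T = (V - f ` C) \<inter> \<Inter>(insert V ((\<lambda>x. f ` U x) ` fibre X f b))"
  show ?thesis
  proof
    show "openin Y T" unfolding T_def
      using V(1) \<open>closedin Y (f ` C)\<close> U1(5) fin by (intro openin_Int openin_diff openin_Inter) auto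
    have "b \<notin> f ` C"
    proof
      assume "b \<in> f ` C"
      then obtain c where c: "c \<in> C" "f c = b" by auto
      then have "c \<in> fibre X f b" by (simp add: C_def fibre_def)
      then show False using U1(2) c by (auto simp: C_def)
    qed
    moreover have "b \<in> f ` U x" if "x \<in> fibre X f b" for x
      using U1(2)[OF that] fb[OF that] by blast
    ultimately show "b \<in> T" unfolding T_def using V(2) by auto
    show "T \<subseteq> V" by (auto simp: T_def)
    show "openin X (U x) \<and> x \<in> U x \<and> f ` U x \<subseteq> V \<and> connectedin X (U x - {x})" if "x \<in> fibre X f b" for x
      using U1(1,2,4,6)[OF that] by auto
    show "u = x" if "x \<in> fibre X f b" "u \<in> U x" "f u = b" for x u using U2 that by blast
    show "U x \<inter> U y = {}" if "x \<in> fibre X f b" "y \<in> fibre X f b" "x \<noteq> y" for x y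
      using U1(3)[OF that(1)] U1(3)[OF that(2)] W(3)[OF that] by blast
    show "\<exists>x\<in>fibre X f b. p \<in> U x" if "p \<in> topspace X" "f p \<in> T" for p
    proof (rule ccontr)
      assume "\<not> ?thesis"
      then have "p \<in> C" using that(1) by (auto simp: C_def)
      then show False using that(2) by (auto simp: T_def)
    qed
    show "card {u \<in> U x. f u = t} = k x" if "x \<in> fibre X f b" "t \<in> T - {b}" for x t
      by (rule U3[OF that(1)]) (use that in \<open>auto simp: T_def\<close>)
  qed
qed

text \<open>The product of the complex plane and the real line serves as Euclidean 3-space; its unit
  sphere without a point is homeomorphic to a plane by stereographic projection.\<close>

lemma sphere_minus_point:
  assumes X: "X homeomorphic_space nsphere 2" and x: "x \<in> topspace X"
  shows "subtopology X (topspace X - {x}) homeomorphic_space (euclidean :: complex topology)"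
proof -
  let ?S = "sphere (0 :: complex \<times> real) 1"
  obtain f g where fg: "homeomorphic_maps (nsphere 2) (top_of_set ?S) f g"
    using homeomorphic_maps_nsphere_euclidean_sphere[of "Basis :: (complex \<times> real) set" 3]
    by (auto simp: independent_Basis orthogonal_Basis)
  then have "nsphere 2 homeomorphic_space top_of_set ?S" by (auto simp: homeomorphic_space_def)
  then have "X homeomorphic_space top_of_set ?S" using X homeomorphic_space_trans by blast
  then obtain h where h: "homeomorphic_map X (top_of_set ?S) h" using homeomorphic_space by blast
  have hx: "h x \<in> ?S" using h x homeomorphic_imp_surjective_map by fastforce
  have "h ` (topspace X - {x}) = ?S - {h x}"
    using homeomorphic_imp_surjective_map[OF h] homeomorphic_imp_injective_map[OF h] x
    by (auto simp: inj_on_def)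
  then have "homeomorphic_map (subtopology X (topspace X - {x})) (subtopology (top_of_set ?S) (?S - {h x})) h"
    by (intro homeomorphic_map_subtopologies_alt[OF h])
       (use homeomorphic_imp_injective_map[OF h] in \<open>auto simp: inj_on_def\<close>)
  then have 1: "subtopology X (topspace X - {x}) homeomorphic_space top_of_set (?S - {h x})"
    by (metis homeomorphic_space subtopology_subtopology Diff_subset inf.absorb_iff2)
  have "(?S - {h x}) homeomorphic (UNIV :: complex set)"
    using hx by (intro homeomorphic_punctured_sphere_affine) (auto simp: affine_UNIV)
  then obtain p q where "homeomorphism (?S - {h x}) (UNIV :: complex set) p q"
    by (auto simp: homeomorphic_def)
  then have "homeomorphic_maps (top_of_set (?S - {h x})) (euclidean :: complex topology) p q"
    by (auto simp: homeomorphism_def homeomorphic_maps_def continuous_map_in_subtopology)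
  then have "top_of_set (?S - {h x}) homeomorphic_space (euclidean :: complex topology)"
    unfolding homeomorphic_space_def by blast
  with 1 show ?thesis by (rule homeomorphic_space_trans)
qed

section \<open>Monodromy of a branched cover of the sphere\<close>

text \<open>\<open>v\<close> labels the sheets by the points over one branching point, coded as
  natural numbers. The second clause says that going over by \<open>a\<close> and back by
  \<open>b\<close> keeps the label, the third that a set of sheets invariant under this motion
  contains whole label classes. Hence the classes are the cycles of the motion, and \<open>P\<close>
  lists their sizes.\<close>

definition vertex_type :: "'c set \<Rightarrow> ('c \<Rightarrow> 'd) \<Rightarrow> ('c \<Rightarrow> 'd) \<Rightarrow> nat multiset \<Rightarrow> bool" where
  "vertex_type F a b P \<longleftrightarrow> (\<exists>v :: 'c \<Rightarrow> nat.
     image_mset (\<lambda>i. card {x \<in> F. v x = i}) (mset_set (v ` F)) = P \<and>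
     (\<forall>x\<in>F. \<forall>y\<in>F. a x = b y \<longrightarrow> v x = v y) \<and>
     (\<forall>A\<subseteq>F. a ` A = b ` A \<longrightarrow> (\<forall>x\<in>A. \<forall>y\<in>F. v x = v y \<longrightarrow> y \<in> A)))"

text \<open>Both spheres are made planar: one point \<open>x0\<close> over \<open>b3\<close> is
  removed upstairs and \<open>b3\<close> itself downstairs, while \<open>w\<close> puts
  \<open>b1\<close> and \<open>b2\<close> at 0 and 1. The other points over \<open>b3\<close> are
  simply left out of \<open>E\<close>, so the cover becomes a map between subsets of the plane with
  finite complement.\<close>

locale sphere_cover =
  fixes X :: "'a topology" and Y :: "'b topology" and f b1 b2 b3 x0 u w
  assumes bc: "branched_cover X Y f"
    and fin: "\<And>y. y \<in> topspace Y \<Longrightarrow> finite (fibre X f y)"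
    and bp: "branching_points X Y f = {b1, b2, b3}" and dist: "b1 \<noteq> b2" "b1 \<noteq> b3" "b2 \<noteq> b3"
    and x0: "x0 \<in> topspace X" "f x0 = b3"
    and u: "homeomorphic_map (euclidean :: complex topology) (subtopology X (topspace X - {x0})) u"
    and w: "homeomorphic_map (subtopology Y (topspace Y - {b3})) (euclidean :: complex topology) w"
    and wb: "w b1 = 0" "w b2 = 1"
    and fib: "\<And>y. y \<in> topspace Y - {b1, b2, b3} \<Longrightarrow> fibre X f y \<noteq> {}"
begin

abbreviation "B \<equiv> {b1, b2, b3}"
definition "E = {z. f (u z) \<notin> B}"
definition "g = (\<lambda>z. w (f (u z)))"

lemma BY: "b1 \<in> topspace Y" "b2 \<in> topspace Y" "b3 \<in> topspace Y"
  using bp by (auto simp: branching_points_def)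

lemma XY: "compact_space X" "Hausdorff_space X" "compact_space Y" "Hausdorff_space Y"
  using bc by (auto simp: branched_cover_def closed_surface_def)

lemma f: "continuous_map X Y f" using branched_cover_continuous[OF bc] .

lemma u_bij: "bij_betw u UNIV (topspace X - {x0})"
  using homeomorphic_imp_surjective_map[OF u] homeomorphic_imp_injective_map[OF u]
  by (auto simp: bij_betw_def)

lemma u_in: "u z \<in> topspace X" "u z \<noteq> x0"
  using u_bij by (auto simp: bij_betw_def)

lemma u_cont: "continuous_map euclidean X u"
  using homeomorphic_imp_continuous_map[OF u] by (simp add: continuous_map_in_subtopology)

lemma open_u_vimage: "openin X W \<Longrightarrow> open (u -` W)"
  using openin_continuous_map_preimage[OF u_cont, of W] by (simp add: vimage_def)

text \<open>The inverse of the homeomorphism \<open>u\<close> is continuous off \<open>x0\<close>,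
  so this preimage is the continuous image of \<open>C\<close> under it.\<close>

lemma connected_u_vimage:
  assumes "connectedin X C" "x0 \<notin> C"
  shows "connected (u -` C)"
proof -
  have CX: "C \<subseteq> topspace X - {x0}" using assms connectedin_subset_topspace by blast
  obtain v where v: "homeomorphic_maps euclidean (subtopology X (topspace X - {x0})) u v"
    using u homeomorphic_map_maps by blast
  then have "connectedin euclidean (v ` C)"
    using assms CX by (intro connectedin_continuous_map_image[of "subtopology X (topspace X - {x0})"])
      (auto simp: homeomorphic_maps_def connectedin_subtopology)
  moreover have "v ` C = u -` C"
  proof (intro subset_antisym subsetI)
    fix z assume "z \<in> v ` C"
    then obtain c where c: "c \<in> C" "z = v c" by blast
    moreover have "c \<in> topspace X \<inter> (topspace X - {x0})" using c CX by auto
    then have "u (v c) = c" using v by (simp add: homeomorphic_maps_def)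
    ultimately show "z \<in> u -` C" by simp
  next
    fix z assume "z \<in> u -` C"
    moreover have "v (u z) = z" using v by (auto simp: homeomorphic_maps_def)
    ultimately show "z \<in> v ` C" by (metis imageI vimageD)
  qed
  ultimately show ?thesis by simp
qed

lemma w_bij: "bij_betw w (topspace Y - {b3}) UNIV"
  using homeomorphic_imp_surjective_map[OF w] homeomorphic_imp_injective_map[OF w]
  by (simp add: bij_betw_def Int_absorb1 Diff_subset)

lemma openY: "openin Y (topspace Y - {b3})"
  using XY(4) BY by (auto intro!: openin_diff simp: closedin_Hausdorff_sing_eq)

lemma open_w_preimage:
  assumes "open S"
  shows "openin Y {y \<in> topspace Y - {b3}. w y \<in> S}"
proof -
  have "openin (subtopology Y (topspace Y - {b3})) {y \<in> topspace (subtopology Y (topspace Y - {b3})). w y \<in> S}"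
    using assms by (intro openin_continuous_map_preimage[OF homeomorphic_imp_continuous_map[OF w]]) auto
  then show ?thesis using openY openin_trans_full by fastforce
qed

lemma open_w_image:
  assumes "openin Y V" "b3 \<notin> V"
  shows "open (w ` V)"
proof -
  have "V \<subseteq> topspace Y - {b3}" using assms openin_subset by blast
  then have "openin (subtopology Y (topspace Y - {b3})) V"
    using assms unfolding openin_subtopology by (intro exI[of _ V]) auto
  then show ?thesis
    using homeomorphic_imp_open_map[OF w] by (auto simp: open_map_def)
qed

lemma g_eq_iff: "z \<in> E \<Longrightarrow> f (u z) \<in> topspace Y - B"
  using u_in f by (auto simp: E_def continuous_map_def Pi_iff)

lemma g_range: "g ` E \<subseteq> - {0, 1}"
proof
  fix y assume "y \<in> g ` E"
  then obtain z where z: "z \<in> E" "y = w (f (u z))" by (auto simp: g_def)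
  have inj: "inj_on w (topspace Y - {b3})" using w_bij by (auto simp: bij_betw_def)
  have "w (f (u z)) \<noteq> w b1" "w (f (u z)) \<noteq> w b2"
    using inj_onD[OF inj, of "f (u z)" b1] inj_onD[OF inj, of "f (u z)" b2] g_eq_iff[OF z(1)] BY dist by auto
  then show "y \<in> - {0, 1}" using wb z by auto
qed

lemma finite_compl_E: "finite (- E)"
proof -
  have "- E = u -` (fibre X f b1 \<union> fibre X f b2 \<union> fibre X f b3)"
    using u_in by (auto simp: E_def fibre_def)
  moreover have "finite (u -` (fibre X f b1 \<union> fibre X f b2 \<union> fibre X f b3))"
    using fin BY u_bij by (intro finite_vimageI) (auto simp: bij_betw_def)
  ultimately show ?thesis by simp
qed

lemma connected_E: "connected E"
proof -
  have "path_connected (- (- E))"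
    by (rule path_connected_complement_countable) (use finite_compl_E in \<open>auto intro: countable_finite\<close>)
  then show ?thesis using path_connected_imp_connected by auto
qed

lemma g_cont: "continuous_on E g"
proof -
  have "continuous_map (top_of_set E) Y (f \<circ> u)"
    using continuous_map_compose[OF u_cont f] continuous_map_from_subtopology by blast
  then have "continuous_map (top_of_set E) (subtopology Y (topspace Y - {b3})) (f \<circ> u)"
    using g_eq_iff by (auto simp: continuous_map_in_subtopology)
  then have "continuous_map (top_of_set E) euclidean (w \<circ> (f \<circ> u))"
    using continuous_map_compose homeomorphic_imp_continuous_map[OF w] by blast
  then show ?thesis by (simp add: g_def o_def)
qed

lemma lp: "x \<in> topspace X \<Longrightarrow> locally_power X Y f x (local_degree X Y f x)"
  using bc local_degree_eq by (metis branched_cover_def)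

lemma lift_point:
  assumes "p \<in> topspace X" "f p \<notin> B"
  obtains z where "z \<in> E" "u z = p"
proof -
  have "p \<in> u ` UNIV" using u_bij assms x0 by (auto simp: bij_betw_def)
  then show ?thesis using that assms by (auto simp: E_def)
qed


lemma g_surj: "g ` E = - {0, 1}"
proof (intro subset_antisym g_range subsetI)
  fix c :: complex assume c: "c \<in> - {0, 1}"
  have "c \<in> w ` (topspace Y - {b3})" using w_bij by (auto simp: bij_betw_def)
  then obtain y where y: "y \<in> topspace Y" "y \<noteq> b3" "w y = c" by auto
  then have yB: "y \<in> topspace Y - B" using c wb by auto
  then obtain p where "p \<in> topspace X" "f p = y" using fib[of y] by (auto simp: fibre_def)
  then obtain z where "z \<in> E" "u z = p" using lift_point[of p] yB by auto
  then show "c \<in> g ` E" using y \<open>f p = y\<close> by (auto simp: g_def)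
qed

text \<open>Above an unbranched value all local degrees are 1, so the neighbourhoods of the fibre
  points map bijectively to a common base. Invariance of domain turns these bijections into
  homeomorphisms.\<close>

lemma covering: "covering_space E g (- {0, 1})"
proof
  show "continuous_on E g" "g ` E = - {0, 1}" by (fact g_cont g_surj)+
  fix c :: complex assume c: "c \<in> - {0, 1}"
  have "c \<in> w ` (topspace Y - {b3})" using w_bij by (auto simp: bij_betw_def)
  then obtain b where b: "b \<in> topspace Y" "b \<noteq> b3" "w b = c" by auto
  then have bB: "b \<in> topspace Y - B" using c wb by auto
  have V: "openin Y (topspace Y - B)"
    using XY(4) BY by (intro openin_diff openin_topspace closedin_Hausdorff_finite) auto
  have k1: "locally_power X Y f x 1" if "x \<in> fibre X f b" for x
  proof -
    have "x \<in> topspace X" using that by (simp add: fibre_def)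
    then have l: "locally_power X Y f x (local_degree X Y f x)" by (rule lp)
    moreover have "\<not> local_degree X Y f x > 1"
      using that bB bp unfolding branching_points_def by blast
    moreover have "local_degree X Y f x \<ge> 1" using l by (simp add: locally_power_def)
    ultimately show ?thesis by (metis le_antisym linorder_not_less)
  qed
  obtain U T where T: "openin Y T" "b \<in> T" "T \<subseteq> topspace Y - B"
    and U: "\<And>x. x \<in> fibre X f b \<Longrightarrow> openin X (U x) \<and> x \<in> U x \<and> f ` U x \<subseteq> topspace Y - B \<and> connectedin X (U x - {x})"
    "\<And>x u. x \<in> fibre X f b \<Longrightarrow> u \<in> U x \<Longrightarrow> f u = b \<Longrightarrow> u = x"
    "\<And>x y. x \<in> fibre X f b \<Longrightarrow> y \<in> fibre X f b \<Longrightarrow> x \<noteq> y \<Longrightarrow> U x \<inter> U y = {}"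
    "\<And>p. p \<in> topspace X \<Longrightarrow> f p \<in> T \<Longrightarrow> \<exists>x\<in>fibre X f b. p \<in> U x"
    "\<And>x t. x \<in> fibre X f b \<Longrightarrow> t \<in> T - {b} \<Longrightarrow> card {u \<in> U x. f u = t} = 1"
    by (rule fibre_nbhds[OF XY(1,2,4) f fin[OF b(1)] _ V bB, where k = "\<lambda>_. 1"], erule k1) (rule that)
  \<comment> \<open>The preimage count of \<open>fibre_nbhds\<close> leaves out the centre
    \<open>b\<close>, which is therefore treated apart.\<close>
  have single: "\<exists>p. {q \<in> U x. f q = t} = {p}" if x: "x \<in> fibre X f b" and t: "t \<in> T" for x t
  proof (cases "t = b")
    case True
    have "f x = b" using x by (simp add: fibre_def)
    then have "{q \<in> U x. f q = t} = {x}" using U(1)[OF x] U(2)[OF x] True by auto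
    then show ?thesis by blast
  next
    case False
    then show ?thesis using U(5)[OF x, of t] t by (auto simp: card_1_singleton_iff)
  qed
  define S where "S x = {z \<in> E. u z \<in> U x \<and> f (u z) \<in> T}" for x
  have SE: "S x = (u -` U x) \<inter> (u -` {p \<in> topspace X. f p \<in> T})" for x
    using T(3) u_in by (auto simp: S_def E_def)
  have b3T: "b3 \<notin> T" using T(3) by auto
  show "\<exists>T. c \<in> T \<and> openin (top_of_set (- {0, 1})) T \<and> (\<exists>v. \<Union>v = E \<inter> g -` T \<and>
      (\<forall>u\<in>v. openin (top_of_set E) u) \<and> pairwise disjnt v \<and> (\<forall>u\<in>v. \<exists>q. homeomorphism u T g q))"
  proof (intro exI[of _ "w ` T"] exI[of _ "S ` fibre X f b"] conjI ballI)
    show "c \<in> w ` T" using b T by auto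
    have "w ` T \<subseteq> - {0, 1}"
    proof
      fix y assume "y \<in> w ` T"
      then obtain t where t: "t \<in> T" "y = w t" by auto
      have inj: "inj_on w (topspace Y - {b3})" using w_bij by (auto simp: bij_betw_def)
      have "w t \<noteq> w b1" "w t \<noteq> w b2"
        using inj_onD[OF inj, of t b1] inj_onD[OF inj, of t b2] t T BY dist by auto
      then show "y \<in> - {0, 1}" using t wb by auto
    qed
    then show "openin (top_of_set (- {0, 1})) (w ` T)"
      using open_w_image[OF T(1) b3T] by (rule open_subset)
    have gT: "f (u z) \<in> T" if zz: "z \<in> E" "g z \<in> w ` T" for z
    proof -
      obtain t where t: "t \<in> T" "w (f (u z)) = w t" using zz by (auto simp: g_def)
      have inj: "inj_on w (topspace Y - {b3})" using w_bij by (auto simp: bij_betw_def)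
      have "f (u z) = t" using inj_onD[OF inj t(2)] g_eq_iff[OF zz(1)] T t by auto
      then show ?thesis using t by simp
    qed
    show "\<Union>(S ` fibre X f b) = E \<inter> g -` (w ` T)"
    proof (intro subset_antisym subsetI)
      fix z assume "z \<in> E \<inter> g -` (w ` T)"
      then have z: "z \<in> E" "f (u z) \<in> T" using gT by auto
      then obtain x where "x \<in> fibre X f b" "u z \<in> U x" using U(4)[OF u_in(1)] by blast
      then show "z \<in> \<Union>(S ` fibre X f b)" using z by (auto simp: S_def)
    qed (auto simp: S_def g_def)
    show "pairwise disjnt (S ` fibre X f b)"
      using U(3) by (fastforce simp: pairwise_def disjnt_def S_def)
    fix s assume "s \<in> S ` fibre X f b"
    then obtain x where x: "x \<in> fibre X f b" "s = S x" by blast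
    have "open s"
      unfolding x(2) SE using U(1)[OF x(1)] openin_continuous_map_preimage[OF f T(1)]
      by (intro open_Int open_u_vimage) auto
    moreover have "s \<subseteq> E" using x by (auto simp: S_def)
    ultimately show "openin (top_of_set E) s" by (simp add: open_subset)
    have inj: "inj_on g s"
    proof (rule inj_onI)
      fix z z' assume z: "z \<in> s" "z' \<in> s" "g z = g z'"
      have inj: "inj_on w (topspace Y - {b3})" using w_bij by (auto simp: bij_betw_def)
      have "z \<in> E" "z' \<in> E" using z x by (auto simp: S_def)
      then have "f (u z) = f (u z')" using inj_onD[OF inj, of "f (u z)" "f (u z')"] z g_eq_iff by (auto simp: g_def)
      moreover have T': "f (u z) \<in> T" "u z \<in> U x" "u z' \<in> U x" using z x by (auto simp: S_def)
      obtain p where p: "{q \<in> U x. f q = f (u z)} = {p}" using single[OF x(1) T'(1)] by blast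
      ultimately have "u z \<in> {q \<in> U x. f q = f (u z)}" "u z' \<in> {q \<in> U x. f q = f (u z)}" using T' by auto
      then have "u z = u z'" unfolding p by auto
      then show "z = z'" using u_bij by (auto simp: bij_betw_def inj_def)
    qed
    have "g ` s = w ` T"
    proof (intro subset_antisym subsetI)
      fix y assume "y \<in> w ` T"
      then obtain t where t: "t \<in> T" "y = w t" by auto
      then obtain p where p: "p \<in> U x" "f p = t" using single[OF x(1) t(1)] by blast
      have "p \<in> topspace X" using p U(1)[OF x(1)] openin_subset by blast
      then obtain z where z: "z \<in> E" "u z = p" using lift_point[of p] p t T by auto
      then have "z \<in> s" using x p t by (auto simp: S_def)
      then show "y \<in> g ` s" using z p t by (auto simp: g_def)
    qed (use x in \<open>auto simp: S_def g_def\<close>)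
    moreover have "continuous_on s g" using g_cont x by (auto simp: S_def intro: continuous_on_subset)
    ultimately show "\<exists>q. homeomorphism s (w ` T) g q"
      using invariance_of_domain_homeomorphism[OF \<open>open s\<close> _ _ inj] by (metis order_refl)
  qed
qed

text \<open>\<open>c\<close> is the iterate of \<open>mob\<close> that moves the branching point
  \<open>b\<close> to 0, and \<open>N r\<close> is the neighbourhood of \<open>b\<close> that
  corresponds to the disc of radius \<open>r\<close> there. Open sets of \<open>Y\<close> are used
  in place of discs because \<open>b\<close> may be \<open>b3\<close>, where \<open>w\<close> is no
  coordinate.\<close>

lemma vertex:
  assumes b: "b \<in> B" and cov': "covering_space E (c \<circ> g) (- {0, 1})"
    and c: "bij_betw (c \<circ> w) (topspace Y - B) (- {0, 1})"
    and N: "\<And>r. 0 < r \<Longrightarrow> r \<le> 1 \<Longrightarrow> openin Y (N r)" "\<And>r. 0 < r \<Longrightarrow> r \<le> 1 \<Longrightarrow> N r \<inter> B = {b}"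
      "\<And>V. openin Y V \<Longrightarrow> b \<in> V \<Longrightarrow> \<exists>r. 0 < r \<and> r \<le> 1 \<and> N r \<subseteq> V"
      "\<And>r y. 0 < r \<Longrightarrow> r \<le> 1 \<Longrightarrow> y \<in> topspace Y - B \<Longrightarrow> y \<in> N r \<longleftrightarrow> norm (c (w y)) < r"
  shows "vertex_type {x \<in> E. (c \<circ> g) x = base_pt} (transport E (c \<circ> g) slit0) (transport E (c \<circ> g) slit1)
    (local_degree_partition X Y f b)"
proof -
  have bY: "b \<in> topspace Y" using b BY by auto
  note finb = fin[OF bY]
  have lp': "\<And>x. x \<in> fibre X f b \<Longrightarrow> locally_power X Y f x (local_degree X Y f x)"
    using lp by (auto simp: fibre_def)
  have N1: "openin Y (N 1)" "N 1 \<inter> B = {b}" using N(1,2)[of 1] by auto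
  then have bN: "b \<in> N 1" by blast
  obtain U T where T: "openin Y T" "b \<in> T" "T \<subseteq> N 1"
    and U: "\<And>x. x \<in> fibre X f b \<Longrightarrow> openin X (U x) \<and> x \<in> U x \<and> f ` U x \<subseteq> N 1 \<and> connectedin X (U x - {x})"
    "\<And>x u. x \<in> fibre X f b \<Longrightarrow> u \<in> U x \<Longrightarrow> f u = b \<Longrightarrow> u = x"
    "\<And>x y. x \<in> fibre X f b \<Longrightarrow> y \<in> fibre X f b \<Longrightarrow> x \<noteq> y \<Longrightarrow> U x \<inter> U y = {}"
    "\<And>p. p \<in> topspace X \<Longrightarrow> f p \<in> T \<Longrightarrow> \<exists>x\<in>fibre X f b. p \<in> U x"
    "\<And>x t. x \<in> fibre X f b \<Longrightarrow> t \<in> T - {b} \<Longrightarrow> card {u \<in> U x. f u = t} = local_degree X Y f x"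
    by (rule fibre_nbhds[OF XY(1,2,4) f finb _ N1(1) bN, where k = "local_degree X Y f"], erule lp') (rule that)
  obtain r where r: "0 < r" "r \<le> 1" "N r \<subseteq> T" using N(3)[OF T(1,2)] by blast
  have UX: "U x \<subseteq> topspace X" if "x \<in> fibre X f b" for x using U(1)[OF that] openin_subset by blast
  have fU: "f q \<in> topspace Y - B" if "x \<in> fibre X f b" "q \<in> U x - {x}" for x q
  proof -
    have "f q \<in> N 1" "f q \<noteq> b" using U(1)[OF that(1)] U(2)[OF that(1)] that by auto
    moreover have "f q \<in> topspace Y" using openin_subset[OF N1(1)] \<open>f q \<in> N 1\<close> by blast
    ultimately show ?thesis using N1(2) by blast
  qed
  \<comment> \<open>\<open>x0\<close> lies over \<open>b3\<close>, hence can only be the centre of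
    such a neighbourhood; the punctured neighbourhoods are visible in the plane.\<close>
  have x0U: "x0 \<notin> U x - {x}" if "x \<in> fibre X f b" for x
    using fU[OF that, of x0] x0 by auto
  define W where "W x = u -` (U x - {x})" for x
  have WE: "W x \<subseteq> E" if "x \<in> fibre X f b" for x
    using fU[OF that] by (auto simp: W_def E_def)
  have fib_ne: "fibre X f b \<noteq> {}"
  proof -
    have "b \<in> branching_points X Y f" using bp b by simp
    then show ?thesis by (auto simp: branching_points_def)
  qed
  obtain v where v: "v \<in> {x \<in> E. (c \<circ> g) x = base_pt} \<rightarrow> fibre X f b"
    "\<And>i. i \<in> fibre X f b \<Longrightarrow> card {x \<in> {x \<in> E. (c \<circ> g) x = base_pt}. v x = i} = local_degree X Y f i"
    "\<And>x y. x \<in> {x \<in> E. (c \<circ> g) x = base_pt} \<Longrightarrow> y \<in> {x \<in> E. (c \<circ> g) x = base_pt} \<Longrightarrow>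
       transport E (c \<circ> g) slit0 x = transport E (c \<circ> g) slit1 y \<Longrightarrow> v x = v y"
    "\<And>A x y. A \<subseteq> {x \<in> E. (c \<circ> g) x = base_pt} \<Longrightarrow> transport E (c \<circ> g) slit0 ` A = transport E (c \<circ> g) slit1 ` A \<Longrightarrow>
      x \<in> A \<Longrightarrow> y \<in> {x \<in> E. (c \<circ> g) x = base_pt} \<Longrightarrow> v x = v y \<Longrightarrow> y \<in> A"
  proof (rule vertex_monodromy[OF cov', where I = "fibre X f b" and U = W and r = r and k = "local_degree X Y f"])
    fix x assume x: "x \<in> fibre X f b"
    have "openin X (U x - {x})"
      using U(1)[OF x] XY(2) UX[OF x] by (auto intro!: openin_diff simp: closedin_Hausdorff_sing_eq)
    then show "open (W x)" unfolding W_def by (rule open_u_vimage)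
    show "connected (W x)" unfolding W_def using U(1)[OF x] x0U[OF x] by (intro connected_u_vimage) auto
    show "W x \<subseteq> E" by (rule WE[OF x])
    show "(c \<circ> g) ` W x \<subseteq> ball 0 1 - {0}"
    proof
      fix y assume "y \<in> (c \<circ> g) ` W x"
      then obtain z where z: "z \<in> W x" "y = c (g z)" by auto
      then have zE: "z \<in> E" using WE[OF x] by blast
      then have "y \<in> - {0, 1}" using cov' z covering_space_imp_surjective by fastforce
      moreover have "f (u z) \<in> N 1" using z U(1)[OF x] by (auto simp: W_def)
      then have "norm (c (w (f (u z)))) < 1" using N(4)[of 1] g_eq_iff[OF zE] by auto
      ultimately show "y \<in> ball 0 1 - {0}" using z by (auto simp: g_def)
    qed
  next
    fix x y assume "x \<in> fibre X f b" "y \<in> fibre X f b" "x \<noteq> y"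
    then show "W x \<inter> W y = {}" using U(3)[of x y] by (auto simp: W_def)
  next
    fix p assume p: "p \<in> E" "(c \<circ> g) p \<in> ball 0 r - {0}"
    then have "f (u p) \<in> N r" using N(4)[OF r(1,2)] g_eq_iff[OF p(1)] by (auto simp: g_def)
    then obtain x where x: "x \<in> fibre X f b" "u p \<in> U x" using U(4)[OF u_in(1)] r by blast
    moreover have "u p \<noteq> x" using x b p(1) by (auto simp: E_def fibre_def)
    ultimately show "\<exists>i\<in>fibre X f b. p \<in> W i" by (auto simp: W_def)
  next
    fix x y assume x: "x \<in> fibre X f b" and y: "y \<in> ball 0 r - {0 :: complex}"
    have "y \<in> - {0, 1}" using y r by auto
    then obtain t where t: "t \<in> topspace Y - B" "y = c (w t)" using c by (auto simp: bij_betw_def)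
    then have tT: "t \<in> T - {b}" using N(4)[OF r(1,2) t(1)] y r b by auto
    have "bij_betw u {z \<in> W x. (c \<circ> g) z = y} {q \<in> U x. f q = t}"
    proof (rule bij_betw_imageI)
      show "inj_on u {z \<in> W x. (c \<circ> g) z = y}" using u_bij by (auto simp: bij_betw_def inj_on_def)
      have inj: "inj_on (c \<circ> w) (topspace Y - B)" using c by (auto simp: bij_betw_def)
      show "u ` {z \<in> W x. (c \<circ> g) z = y} = {q \<in> U x. f q = t}"
      proof (intro subset_antisym subsetI)
        fix q assume "q \<in> u ` {z \<in> W x. (c \<circ> g) z = y}"
        then obtain z where z: "z \<in> W x" "c (g z) = y" "q = u z" by auto
        then have "f (u z) \<in> topspace Y - B" using g_eq_iff WE[OF x] by blast
        then have "f (u z) = t" using inj_onD[OF inj, of "f (u z)" t] t z by (auto simp: g_def)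
        then show "q \<in> {q \<in> U x. f q = t}" using z by (auto simp: W_def)
      next
        fix q assume q: "q \<in> {q \<in> U x. f q = t}"
        then obtain z where z: "z \<in> E" "u z = q" using lift_point[of q] UX[OF x] t by auto
        moreover have "f x = b" using x by (simp add: fibre_def)
        then have "q \<noteq> x" using q tT by auto
        ultimately have "z \<in> {z \<in> W x. (c \<circ> g) z = y}" using q t by (auto simp: W_def g_def)
        then show "q \<in> u ` {z \<in> W x. (c \<circ> g) z = y}" using z by blast
      qed
    qed
    then have "card {z \<in> W x. (c \<circ> g) z = y} = card {q \<in> U x. f q = t}" by (rule bij_betw_same_card)
    then show "card {z \<in> W x. (c \<circ> g) z = y} = local_degree X Y f x" using U(5)[OF x tT] by simp
  next
    show "0 < r" "r \<le> 1" by (fact r)+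
  qed (rule that)
  let ?F = "{x \<in> E. (c \<circ> g) x = base_pt}"
  \<comment> \<open>Labels in \<open>vertex_type\<close> are natural numbers, so the finite fibre is
    numbered.\<close>
  obtain e :: "'a \<Rightarrow> nat" where e: "inj_on e (fibre X f b)"
    using finite_imp_inj_to_nat_seg[OF finb] by blast
  have vF: "v ` ?F = fibre X f b"
  proof (intro subset_antisym subsetI)
    fix i assume i: "i \<in> fibre X f b"
    have "local_degree X Y f i \<ge> 1" using lp'[OF i] by (simp add: locally_power_def)
    then have "{x \<in> ?F. v x = i} \<noteq> {}" using v(2)[OF i] by (metis card.empty not_one_le_zero)
    then show "i \<in> v ` ?F" by blast
  qed (use v(1) in auto)
  have ev: "e (v x) = e (v y) \<longleftrightarrow> v x = v y" if "x \<in> ?F" "y \<in> ?F" for x y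
  proof -
    have "v x \<in> fibre X f b" "v y \<in> fibre X f b" using v(1) that by blast+
    then show ?thesis using e by (auto simp: inj_on_def)
  qed
  have card_e: "card {x \<in> ?F. (e \<circ> v) x = e i} = local_degree X Y f i" if i: "i \<in> fibre X f b" for i
  proof -
    have "{x \<in> ?F. (e \<circ> v) x = e i} = {x \<in> ?F. v x = i}"
      using v(1) i inj_onD[OF e] by (auto simp: Pi_iff)
    then show ?thesis using v(2)[OF i] by simp
  qed
  show ?thesis
    unfolding vertex_type_def
  proof (intro exI[of _ "e \<circ> v"] conjI ballI allI impI)
    have evF: "(e \<circ> v) ` ?F = e ` fibre X f b" unfolding image_comp[symmetric] vF ..
    have "image_mset (\<lambda>i. card {x \<in> ?F. (e \<circ> v) x = i}) (mset_set ((e \<circ> v) ` ?F))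
       = image_mset (\<lambda>i. card {x \<in> ?F. (e \<circ> v) x = i}) (image_mset e (mset_set (fibre X f b)))"
      by (simp only: evF image_mset_mset_set[OF e])
    also have "\<dots> = image_mset (\<lambda>i. card {x \<in> ?F. (e \<circ> v) x = e i}) (mset_set (fibre X f b))"
      by (simp add: image_mset.compositionality comp_def)
    also have "\<dots> = image_mset (local_degree X Y f) (mset_set (fibre X f b))"
      by (rule image_mset_cong) (use card_e finb in auto)
    finally show "image_mset (\<lambda>i. card {x \<in> ?F. (e \<circ> v) x = i}) (mset_set ((e \<circ> v) ` ?F)) = local_degree_partition X Y f b"
      by (simp add: local_degree_partition_def)
  next
    fix x y assume "x \<in> ?F" "y \<in> ?F" "transport E (c \<circ> g) slit0 x = transport E (c \<circ> g) slit1 y"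
    then have "v x = v y" by (rule v(3))
    then show "(e \<circ> v) x = (e \<circ> v) y" by simp
  next
    fix A x y assume A: "A \<subseteq> ?F" "transport E (c \<circ> g) slit0 ` A = transport E (c \<circ> g) slit1 ` A" "x \<in> A" "y \<in> ?F"
      "(e \<circ> v) x = (e \<circ> v) y"
    then have "v x = v y" using ev[of x y] by auto
    then show "y \<in> A" by (rule v(4)[OF A(1-4)])
  qed
qed

lemma w_neq: "y \<in> topspace Y - B \<Longrightarrow> w y \<noteq> 0 \<and> w y \<noteq> 1"
  using w_bij BY dist wb unfolding bij_betw_def inj_on_def by (metis DiffD1 DiffD2 DiffI insertCI singletonD)

lemma w_bij': "bij_betw w (topspace Y - B) (- {0, 1})"
proof (rule bij_betw_imageI)
  show "inj_on w (topspace Y - B)" using w_bij by (auto simp: bij_betw_def inj_on_def)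
  show "w ` (topspace Y - B) = - {0, 1}"
  proof (intro subset_antisym subsetI)
    fix z assume z: "z \<in> - {0, 1 :: complex}"
    have "z \<in> w ` (topspace Y - {b3})" using w_bij by (auto simp: bij_betw_def)
    then show "z \<in> w ` (topspace Y - B)" using z wb by auto
  qed (use w_neq in auto)
qed

lemma mob_bij: "bij_betw mob (- {0, 1}) (- {0, 1})"
  using homeomorphism_mob by (auto simp: homeomorphism_def intro!: bij_betwI[of _ _ _ "\<lambda>z. (z - 1) / z"])

lemma w_nhds:
  assumes "openin Y V" "b \<in> V" "b \<in> topspace Y - {b3}"
  obtains e where "e > 0" "\<And>y. y \<in> topspace Y - {b3} \<Longrightarrow> w y \<in> ball (w b) e \<Longrightarrow> y \<in> V"
proof -
  have "openin Y (V \<inter> (topspace Y - {b3}))" using assms(1) openY by blast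
  then have "open (w ` (V \<inter> (topspace Y - {b3})))" by (intro open_w_image) auto
  moreover have "w b \<in> w ` (V \<inter> (topspace Y - {b3}))" using assms by blast
  ultimately obtain e where e: "e > 0" "ball (w b) e \<subseteq> w ` (V \<inter> (topspace Y - {b3}))"
    by (meson open_contains_ball)
  have "y \<in> V" if "y \<in> topspace Y - {b3}" "w y \<in> ball (w b) e" for y
  proof -
    have "w y \<in> w ` (V \<inter> (topspace Y - {b3}))" using e(2) that(2) by blast
    then obtain y' where y': "y' \<in> V" "y' \<in> topspace Y - {b3}" "w y = w y'" by blast
    have "inj_on w (topspace Y - {b3})" using w_bij by (simp add: bij_betw_def)
    then have "y = y'" using y'(2,3) that(1) by (meson inj_onD)
    then show ?thesis using y' by simp
  qed
  then show ?thesis using that e(1) by blast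
qed

lemma vertex1:
  "vertex_type {x \<in> E. g x = base_pt} (transport E g slit0) (transport E g slit1) (local_degree_partition X Y f b1)"
proof -
  have "vertex_type {x \<in> E. (id \<circ> g) x = base_pt} (transport E (id \<circ> g) slit0) (transport E (id \<circ> g) slit1)
    (local_degree_partition X Y f b1)"
  proof (rule vertex[where N = "\<lambda>r. {y \<in> topspace Y - {b3}. w y \<in> ball 0 r}"])
    show "covering_space E (id \<circ> g) (- {0, 1})" using covering by simp
    show "bij_betw (id \<circ> w) (topspace Y - B) (- {0, 1})" using w_bij' by simp
    fix r :: real assume r: "0 < r" "r \<le> 1"
    show "openin Y {y \<in> topspace Y - {b3}. w y \<in> ball 0 r}" by (rule open_w_preimage) simp
    show "{y \<in> topspace Y - {b3}. w y \<in> ball 0 r} \<inter> B = {b1}" using r BY dist wb by auto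
  next
    fix V assume V: "openin Y V" "b1 \<in> V"
    obtain e where e: "e > 0" "\<And>y. y \<in> topspace Y - {b3} \<Longrightarrow> w y \<in> ball (w b1) e \<Longrightarrow> y \<in> V"
      by (rule w_nhds[OF V]) (use BY dist in auto)
    show "\<exists>r. 0 < r \<and> r \<le> 1 \<and> {y \<in> topspace Y - {b3}. w y \<in> ball 0 r} \<subseteq> V"
      using e wb by (intro exI[of _ "min e 1"]) auto
  qed auto
  then show ?thesis by simp
qed

lemma mob_mob: "z \<noteq> 0 \<Longrightarrow> z \<noteq> 1 \<Longrightarrow> mob (mob z) = (z - 1) / z"
  by (auto simp: mob_def field_simps)

lemma mob_eq_base_pt:
  assumes "x \<in> E"
  shows "mob (g x) = base_pt \<longleftrightarrow> g x = base_pt" "mob (mob (g x)) = base_pt \<longleftrightarrow> g x = base_pt"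
proof -
  have inj: "mob z = base_pt \<Longrightarrow> z = base_pt" if "z \<in> - {0, 1}" for z
  proof -
    assume "mob z = base_pt"
    then have "mob z = mob base_pt" by simp
    moreover have "base_pt \<in> - {0, 1}" by (auto simp: base_pt_def complex_eq_iff)
    ultimately show ?thesis using mob_bij that unfolding bij_betw_def inj_on_def by blast
  qed
  have "g x \<in> - {0, 1}" using g_range assms by blast
  moreover from this have "mob (g x) \<in> - {0, 1}" using mob_neq by auto
  ultimately show "mob (g x) = base_pt \<longleftrightarrow> g x = base_pt" "mob (mob (g x)) = base_pt \<longleftrightarrow> g x = base_pt"
    using inj by (metis mob_base_pt(1))+
qed

text \<open>\<open>mob\<close> applied twice is \<open>(z - 1) / z\<close>, which moves 1 to 0. Its
  discs are written as \<open>norm (z - 1) < r * norm z\<close>, a condition that makes sense (and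
  fails) at \<open>b1\<close>, where \<open>z = 0\<close>.\<close>

lemma vertex2:
  "vertex_type {x \<in> E. g x = base_pt} (transport E g slit1) (transport E g slit2) (local_degree_partition X Y f b2)"
proof -
  let ?N = "\<lambda>r. {y \<in> topspace Y - {b3}. w y \<in> {z. norm (z - 1) < r * norm z}}"
  have cm: "covering_space E (mob \<circ> g) (- {0, 1})" "covering_space E (mob \<circ> (mob \<circ> g)) (- {0, 1})"
    using covering covering_mob by blast+
  have "vertex_type {x \<in> E. ((mob \<circ> mob) \<circ> g) x = base_pt} (transport E ((mob \<circ> mob) \<circ> g) slit0)
     (transport E ((mob \<circ> mob) \<circ> g) slit1) (local_degree_partition X Y f b2)"
  proof (rule vertex[where N = ?N])
    show "covering_space E ((mob \<circ> mob) \<circ> g) (- {0, 1})" using cm(2) by (simp add: comp_assoc)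
    show "bij_betw ((mob \<circ> mob) \<circ> w) (topspace Y - B) (- {0, 1})"
      using w_bij' mob_bij by (meson bij_betw_trans)
    fix r :: real assume r: "0 < r" "r \<le> 1"
    show "openin Y (?N r)" by (intro open_w_preimage open_Collect_less continuous_intros)
    show "?N r \<inter> B = {b2}" using r BY dist wb by auto
    fix y assume y: "y \<in> topspace Y - B"
    then have "w y \<noteq> 0 \<and> w y \<noteq> 1" by (rule w_neq)
    then show "y \<in> ?N r \<longleftrightarrow> norm ((mob \<circ> mob) (w y)) < r" using y
      by (simp add: mob_mob norm_divide field_simps)
  next
    fix V assume V: "openin Y V" "b2 \<in> V"
    obtain e where e: "e > 0" "\<And>y. y \<in> topspace Y - {b3} \<Longrightarrow> w y \<in> ball (w b2) e \<Longrightarrow> y \<in> V"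
      by (rule w_nhds[OF V]) (use BY dist in auto)
    \<comment> \<open>From \<open>norm (w y - 1) < r * norm (w y)\<close>, which is at most
      \<open>r * (1 + norm (w y - 1))\<close>, and \<open>r \<le> 1 / 2\<close> it follows that
      \<open>norm (w y - 1) < 2 * r\<close>, and \<open>2 * r \<le> e\<close>.\<close>
    define r where "r = min (e / 2) (1 / 2)"
    have r: "0 < r" "r \<le> 1/2" "2 * r \<le> e" using e by (auto simp: r_def min_def)
    have "?N r \<subseteq> V"
    proof
      fix y assume y: "y \<in> ?N r"
      then have "norm (w y - 1) < r * norm (w y)" by auto
      moreover have "norm (w y) \<le> 1 + norm (w y - 1)" using norm_triangle_sub[of "w y" 1] by simp
      then have "r * norm (w y) \<le> r * (1 + norm (w y - 1))" using r by (intro mult_left_mono) auto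
      moreover have "r * norm (w y - 1) \<le> (1/2) * norm (w y - 1)" using r by (intro mult_right_mono) auto
      ultimately have "norm (w y - 1) < 2 * r" by (simp add: distrib_left)
      then have "w y \<in> ball (w b2) e" using r wb by (simp add: dist_norm norm_minus_commute)
      then show "y \<in> V" using e(2) y by blast
    qed
    then show "\<exists>r. 0 < r \<and> r \<le> 1 \<and> ?N r \<subseteq> V" using r by (intro exI[of _ r]) auto
  qed auto
  moreover have "{x \<in> E. ((mob \<circ> mob) \<circ> g) x = base_pt} = {x \<in> E. g x = base_pt}"
    using mob_eq_base_pt by auto
  ultimately show ?thesis
    using transport_mob[OF cm(1)] transport_mob[OF covering] by (simp add: comp_assoc)
qed

text \<open>Near \<open>b3\<close> the coordinate is \<open>1 / (1 - w y)\<close>, whose discs are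
  complements of closed discs about 1. These are open in \<open>Y\<close> because the closed discs
  have compact, hence closed, preimages under \<open>w\<close>.\<close>

lemma vertex3:
  "vertex_type {x \<in> E. g x = base_pt} (transport E g slit2) (transport E g slit0) (local_degree_partition X Y f b3)"
proof -
  let ?N = "\<lambda>r. {b3} \<union> {y \<in> topspace Y - {b3}. 1 < r * norm (w y - 1)}"
  have cm: "covering_space E (mob \<circ> g) (- {0, 1})"
    using covering covering_mob by blast
  have "vertex_type {x \<in> E. (mob \<circ> g) x = base_pt} (transport E (mob \<circ> g) slit0)
     (transport E (mob \<circ> g) slit1) (local_degree_partition X Y f b3)"
  proof (rule vertex[where N = ?N])
    show "covering_space E (mob \<circ> g) (- {0, 1})" by fact
    show "bij_betw (mob \<circ> w) (topspace Y - B) (- {0, 1})"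
      using w_bij' mob_bij by (meson bij_betw_trans)
    fix r :: real assume r: "0 < r" "r \<le> 1"
    show "openin Y (?N r)"
    proof -
      obtain w' where w': "homeomorphic_maps (subtopology Y (topspace Y - {b3})) euclidean w w'"
        using w homeomorphic_map_maps by blast
      have "compactin Y (w' ` cball 1 (1 / r))"
        using w' by (intro image_compactin[of euclidean]) (auto simp: homeomorphic_maps_def continuous_map_in_subtopology)
      then have "closedin Y (w' ` cball 1 (1 / r))" using XY(4) compactin_imp_closedin by blast
      moreover have "?N r = topspace Y - w' ` cball 1 (1 / r)"
      proof -
        have ww: "w (w' z) = z" "w' z \<in> topspace Y - {b3}" for z
          using w' by (auto simp: homeomorphic_maps_def continuous_map_def Pi_iff)
        have w'w: "w' (w y) = y" if "y \<in> topspace Y - {b3}" for y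
          using w' that by (auto simp: homeomorphic_maps_def)
        have "y \<in> w' ` cball 1 (1 / r) \<longleftrightarrow> \<not> 1 < r * norm (w y - 1)" if y: "y \<in> topspace Y - {b3}" for y
        proof -
          have "y \<in> w' ` cball 1 (1 / r) \<longleftrightarrow> w y \<in> cball 1 (1 / r)"
            using ww w'w[OF y] by (metis imageE imageI)
          then show ?thesis using r by (simp add: dist_norm norm_minus_commute field_simps not_less)
        qed
        moreover have "b3 \<notin> w' ` cball 1 (1 / r)" using ww(2) by auto
        ultimately show ?thesis using BY by blast
      qed
      ultimately show ?thesis by auto
    qed
    show "?N r \<inter> B = {b3}" using r BY dist wb by auto
    fix y assume y: "y \<in> topspace Y - B"
    then have "w y \<noteq> 0 \<and> w y \<noteq> 1" by (rule w_neq)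
    then show "y \<in> ?N r \<longleftrightarrow> norm (mob (w y)) < r" using y
      by (simp add: mob_def norm_divide norm_minus_commute field_simps)
  next
    fix V assume V: "openin Y V" "b3 \<in> V"
    have "closedin Y (topspace Y - V)" using V by blast
    then have "compactin Y (topspace Y - V)" using XY(3) closedin_compact_space by blast
    then have "compactin (subtopology Y (topspace Y - {b3})) (topspace Y - V)"
      using V(2) by (auto simp: compactin_subtopology)
    then have "compactin euclidean (w ` (topspace Y - V))"
      using homeomorphic_imp_continuous_map[OF w] image_compactin by blast
    then have "bounded (w ` (topspace Y - V))" using compact_imp_bounded by auto
    then obtain M where M: "M > 0" "\<And>y. y \<in> topspace Y - V \<Longrightarrow> norm (w y) \<le> M"
      by (auto simp: bounded_pos)
    \<comment> \<open>Off \<open>V\<close> the coordinate is bounded by \<open>M\<close>, whereas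
      \<open>norm (w y - 1) > M + 2\<close> forces \<open>norm (w y) > M + 1\<close>.\<close>
    have "?N (1 / (M + 2)) \<subseteq> V"
    proof
      fix y assume y: "y \<in> ?N (1 / (M + 2))"
      show "y \<in> V"
      proof (rule ccontr)
        assume n: "y \<notin> V"
        then have "y \<noteq> b3" using V by auto
        then have "norm (w y - 1) > M + 2" "y \<in> topspace Y" using y M(1) by (auto simp: field_simps)
        moreover have "norm (w y - 1) \<le> norm (w y) + 1" using norm_triangle_ineq4[of "w y" 1] by simp
        ultimately show False using M(2)[of y] n by auto
      qed
    qed
    then show "\<exists>r. 0 < r \<and> r \<le> 1 \<and> ?N r \<subseteq> V" using M(1) by (intro exI[of _ "1 / (M + 2)"]) auto
  qed auto
  moreover have "{x \<in> E. (mob \<circ> g) x = base_pt} = {x \<in> E. g x = base_pt}"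
    using mob_eq_base_pt by auto
  ultimately show ?thesis
    using transport_mob[OF covering] by simp
qed

end

theorem branched_monodromy:
  assumes bc: "branched_cover X Y f" and X: "X homeomorphic_space nsphere 2" and Y: "Y homeomorphic_space nsphere 2"
    and d: "has_cover_degree X Y f d" "d > 0"
    and P: "branch_data X Y f = {#P1, P2, P3#}" "P1 \<noteq> {#}" "P2 \<noteq> {#}" "P3 \<noteq> {#}"
  obtains F F' :: "complex set" and a0 a1 a2 where "finite F" "card F = d"
    "bij_betw a0 F F'" "bij_betw a1 F F'" "bij_betw a2 F F'"
    "\<And>A. A \<subseteq> F \<Longrightarrow> a0 ` A = a1 ` A \<Longrightarrow> a1 ` A = a2 ` A \<Longrightarrow> A = {} \<or> A = F"
    "vertex_type F a0 a1 P1" "vertex_type F a1 a2 P2" "vertex_type F a2 a0 P3"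
proof -
  let ?B = "branching_points X Y f" and ?L = "local_degree_partition X Y f"
  have finB: "finite ?B"
  proof (rule ccontr)
    assume "infinite ?B"
    then show False using P(1) by (simp add: branch_data_def)
  qed
  have im: "image_mset ?L (mset_set ?B) = {#P1, P2, P3#}" using P(1) by (simp add: branch_data_def)
  obtain b1 M1 where 1: "mset_set ?B = add_mset b1 M1" "?L b1 = P1" "image_mset ?L M1 = {#P2, P3#}"
    using msed_map_invR[OF im] by auto
  obtain b2 M2 where 2: "M1 = add_mset b2 M2" "?L b2 = P2" "image_mset ?L M2 = {#P3#}"
    using msed_map_invR[OF 1(3)] by auto
  obtain b3 M3 where 3: "M2 = add_mset b3 M3" "?L b3 = P3" "image_mset ?L M3 = {#}"
    using msed_map_invR[OF 2(3)] by auto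
  have B: "mset_set ?B = {#b1, b2, b3#}" using 1 2 3 by simp
  have Beq: "?B = {b1, b2, b3}"
    using arg_cong[OF B, of set_mset] finB by simp
  have cnt: "count (mset_set ?B) x \<le> 1" for x by (cases "x \<in> ?B") (auto simp: finB)
  have dist: "b1 \<noteq> b2" "b1 \<noteq> b3" "b2 \<noteq> b3"
    using cnt[of b1] cnt[of b2] unfolding B by (auto split: if_splits)
  have BY: "?B \<subseteq> topspace Y" by (auto simp: branching_points_def)
  \<comment> \<open>\<open>mset_set\<close> of an infinite set is empty, so a nonempty partition
    certifies a finite fibre over a branching point.\<close>
  have fin: "finite (fibre X f y)" if "y \<in> topspace Y" for y
  proof (cases "y \<in> ?B")
    case True
    then have "?L y \<noteq> {#}" using 1 2 3 P Beq by auto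
    then show ?thesis unfolding local_degree_partition_def by (metis image_mset_empty mset_set.infinite)
  next
    case False
    then show ?thesis using d(1) that by (auto simp: has_cover_degree_def)
  qed
  have "fibre X f b3 \<noteq> {}"
    using Beq by (auto simp: branching_points_def)
  then obtain x0 where x0: "x0 \<in> topspace X" "f x0 = b3" by (auto simp: fibre_def)
  have b3: "b3 \<in> topspace Y" "b1 \<in> topspace Y" "b2 \<in> topspace Y" using BY Beq by auto
  have "(euclidean :: complex topology) homeomorphic_space subtopology X (topspace X - {x0})"
    using sphere_minus_point[OF X x0(1)] homeomorphic_space_sym by blast
  then obtain u where u: "homeomorphic_map (euclidean :: complex topology) (subtopology X (topspace X - {x0})) u"
    using homeomorphic_space by blast
  obtain w0 where w0: "homeomorphic_map (subtopology Y (topspace Y - {b3})) (euclidean :: complex topology) w0"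
    using sphere_minus_point[OF Y b3(1)] homeomorphic_space by blast
  \<comment> \<open>An affine change of the plane coordinate puts \<open>b1\<close> at 0 and
    \<open>b2\<close> at 1; its slope is nonzero because the two points differ.\<close>
  define c where "c = w0 b2 - w0 b1"
  have "inj_on w0 (topspace Y - {b3})"
    using homeomorphic_imp_injective_map[OF w0] by (simp add: Int_absorb1 Diff_subset)
  then have c0: "c \<noteq> 0" using b3 dist unfolding c_def inj_on_def by auto
  define w where "w = (\<lambda>z. (z - w0 b1) / c) \<circ> w0"
  have "homeomorphic_maps (euclidean :: complex topology) euclidean (\<lambda>z. (z - w0 b1) / c) (\<lambda>z. z * c + w0 b1)"
    using c0 by (auto simp: homeomorphic_maps_def intro!: continuous_intros)
  then have "homeomorphic_map (euclidean :: complex topology) euclidean (\<lambda>z. (z - w0 b1) / c)"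
    using homeomorphic_map_maps by blast
  then have w: "homeomorphic_map (subtopology Y (topspace Y - {b3})) (euclidean :: complex topology) w"
    unfolding w_def using w0 homeomorphic_map_compose by blast
  have ne: "fibre X f y \<noteq> {}" if "y \<in> topspace Y - {b1, b2, b3}" for y
  proof -
    have "card (fibre X f y) = d" using d(1) that Beq by (auto simp: has_cover_degree_def)
    then show ?thesis using d(2) by auto
  qed
  interpret sphere_cover X Y f b1 b2 b3 x0 u w
    by unfold_locales (use bc fin Beq dist x0 u w c0 ne in \<open>auto simp: w_def c_def\<close>)
  let ?F = "{x \<in> E. g x = base_pt}"
  have base: "base_pt \<in> - {0, 1}" by (auto simp: base_pt_def complex_eq_iff)
  then have "base_pt \<in> w ` (topspace Y - B)" using w_bij' unfolding bij_betw_def by blast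
  then obtain y where y: "y \<in> topspace Y - B" "w y = base_pt" by (rule imageE) (rule that, assumption, rule sym)
  have "bij_betw u ?F (fibre X f y)"
  proof (rule bij_betw_imageI)
    show "inj_on u ?F" using u_bij by (auto simp: bij_betw_def inj_on_def)
    show "u ` ?F = fibre X f y"
    proof (intro subset_antisym subsetI)
      fix p assume "p \<in> u ` ?F"
      then obtain z where z: "z \<in> E" "w (f (u z)) = base_pt" "p = u z" by (auto simp: g_def)
      have injw: "inj_on w (topspace Y - B)" using w_bij' by (simp add: bij_betw_def)
      have "w (f (u z)) = w y" using z(2) y(2) by simp
      then have "f (u z) = y" by (rule inj_onD[OF injw _ g_eq_iff[OF z(1)] y(1)])
      then show "p \<in> fibre X f y" using z u_in by (simp add: fibre_def)
    next
      fix p assume p: "p \<in> fibre X f y"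
      then obtain z where "z \<in> E" "u z = p" using lift_point[of p] y by (auto simp: fibre_def)
      then show "p \<in> u ` ?F" using p y by (auto simp: fibre_def g_def)
    qed
  qed
  moreover have "finite (fibre X f y)" "card (fibre X f y) = d"
    using d(1) y Beq by (auto simp: has_cover_degree_def)
  ultimately have F: "finite ?F" "card ?F = d" by (auto simp: bij_betw_finite bij_betw_same_card)
  have sl: "slit0 \<in> slits" "slit1 \<in> slits" "slit2 \<in> slits" by (auto simp: slits_def[OF covering])
  show ?thesis
  proof (rule that[OF F])
    show "bij_betw (transport E g slit0) ?F {x \<in> E. g x = cnj base_pt}"
      "bij_betw (transport E g slit1) ?F {x \<in> E. g x = cnj base_pt}"
      "bij_betw (transport E g slit2) ?F {x \<in> E. g x = cnj base_pt}"
      using transport_bij[OF covering] sl by blast+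
    show "A = {} \<or> A = ?F" if "A \<subseteq> ?F" "transport E g slit0 ` A = transport E g slit1 ` A"
      "transport E g slit1 ` A = transport E g slit2 ` A" for A
      by (rule monodromy_transitive[OF covering connected_E that])
    show "vertex_type ?F (transport E g slit0) (transport E g slit1) P1" using vertex1 1 by simp
    show "vertex_type ?F (transport E g slit1) (transport E g slit2) P2" using vertex2 2 by simp
    show "vertex_type ?F (transport E g slit2) (transport E g slit0) P3" using vertex3 3 by simp
  qed
qed

section \<open>Cycle types of the monodromy permutations\<close>

text \<open>\<open>m x\<close> is the length of the cycle of \<open>x\<close>. A cycle of length
  \<open>c\<close> has \<open>c\<close> points, so the cycle type is expressed by counting points
  rather than cycles.\<close>

definition has_periods :: "'c set \<Rightarrow> ('c \<Rightarrow> 'c) \<Rightarrow> nat multiset \<Rightarrow> bool" where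
  "has_periods F s P \<longleftrightarrow> (\<exists>m. (\<forall>x\<in>F. m x \<in># P \<and> (s ^^ m x) x = x \<and> (\<forall>k. 0 < k \<and> k < m x \<longrightarrow> (s ^^ k) x \<noteq> x)) \<and>
     (\<forall>c. card {x \<in> F. m x = c} = c * count P c))"

lemma vertex_type_sym: "vertex_type F a b P \<Longrightarrow> vertex_type F b a P"
  unfolding vertex_type_def
proof (elim exE conjE)
  fix v :: "'a \<Rightarrow> nat"
  assume v: "image_mset (\<lambda>i. card {x \<in> F. v x = i}) (mset_set (v ` F)) = P"
    "\<forall>x\<in>F. \<forall>y\<in>F. a x = b y \<longrightarrow> v x = v y"
    "\<forall>A\<subseteq>F. a ` A = b ` A \<longrightarrow> (\<forall>x\<in>A. \<forall>y\<in>F. v x = v y \<longrightarrow> y \<in> A)"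
  have "\<forall>x\<in>F. \<forall>y\<in>F. b x = a y \<longrightarrow> v x = v y"
  proof (intro ballI impI)
    fix x y assume "x \<in> F" "y \<in> F" "b x = a y"
    then have "v y = v x" using v(2) by (metis (full_types))
    then show "v x = v y" ..
  qed
  moreover have "\<forall>A\<subseteq>F. b ` A = a ` A \<longrightarrow> (\<forall>x\<in>A. \<forall>y\<in>F. v x = v y \<longrightarrow> y \<in> A)"
    using v(3) by (intro allI impI) (drule spec, drule mp, assumption, drule mp, erule sym, assumption)
  ultimately show "\<exists>v :: 'a \<Rightarrow> nat. image_mset (\<lambda>i. card {x \<in> F. v x = i}) (mset_set (v ` F)) = P \<and>
     (\<forall>x\<in>F. \<forall>y\<in>F. b x = a y \<longrightarrow> v x = v y) \<and>
     (\<forall>A\<subseteq>F. b ` A = a ` A \<longrightarrow> (\<forall>x\<in>A. \<forall>y\<in>F. v x = v y \<longrightarrow> y \<in> A))"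
    using v(1) by (intro exI[of _ v] conjI)
qed

text \<open>Among \<open>m + 1\<close> iterates two coincide, and injectivity cancels them to a
  return after at most \<open>m\<close> steps. Conversely a return after \<open>k\<close> steps
  confines the orbit to \<open>k\<close> points, so no return comes earlier.\<close>

lemma orbit_period:
  fixes s :: "'c \<Rightarrow> 'c"
  assumes F: "finite F" and s: "s ` F \<subseteq> F" "inj_on s F" and x: "x \<in> F"
    and m: "card {(s ^^ k) x | k. True} = m"
  shows "(s ^^ m) x = x \<and> (\<forall>k. 0 < k \<and> k < m \<longrightarrow> (s ^^ k) x \<noteq> x)"
proof -
  let ?O = "{(s ^^ k) x | k. True}"
  have inF: "(s ^^ k) x \<in> F" for k by (induction k) (use x s in auto)
  then have finO: "finite ?O" using F by (auto intro: finite_subset)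
  have canc: "(s ^^ (j - i)) x = x" if "i \<le> j" "(s ^^ i) x = (s ^^ j) x" for i j
    using that
  proof (induction i arbitrary: j)
    case (Suc i)
    then obtain j' where j: "j = Suc j'" by (cases j) auto
    have "s ((s ^^ i) x) = s ((s ^^ j') x)" using Suc.prems j by simp
    then have "(s ^^ i) x = (s ^^ j') x" by (rule inj_onD[OF s(2) _ inF inF])
    then show ?case using Suc.IH[of j'] Suc.prems j by simp
  qed simp
  have le: "m \<le> k" if k: "0 < k" "(s ^^ k) x = x" for k
  proof -
    have mult: "(s ^^ (k * q)) x = x" for q
    proof (induction q)
      case (Suc q)
      have "(s ^^ (k * Suc q)) x = (s ^^ k) ((s ^^ (k * q)) x)" by (simp add: funpow_add)
      then show ?case using Suc k by simp
    qed simp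
    have "(s ^^ j) x = (s ^^ (j mod k)) x" for j
    proof -
      have "(s ^^ (j mod k + k * (j div k))) x = (s ^^ (j mod k)) ((s ^^ (k * (j div k))) x)"
        by (simp only: funpow_add o_apply)
      then show ?thesis using mult by simp
    qed
    then have "?O \<subseteq> (\<lambda>j. (s ^^ j) x) ` {..<k}" using k(1) by (auto intro!: image_eqI[of _ _ "_ mod k"])
    then have "m \<le> card ((\<lambda>j. (s ^^ j) x) ` {..<k})" unfolding m[symmetric] by (intro card_mono) auto
    also have "\<dots> \<le> k" using card_image_le[of "{..<k}" "\<lambda>j. (s ^^ j) x"] by simp
    finally show ?thesis .
  qed
  have "\<not> inj_on (\<lambda>j. (s ^^ j) x) {..m}"
  proof
    assume "inj_on (\<lambda>j. (s ^^ j) x) {..m}"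
    then have "card ((\<lambda>j. (s ^^ j) x) ` {..m}) = Suc m" by (simp add: card_image)
    moreover have "card ((\<lambda>j. (s ^^ j) x) ` {..m}) \<le> m"
      using card_mono[OF finO, of "(\<lambda>j. (s ^^ j) x) ` {..m}"] m by auto
    ultimately show False by simp
  qed
  then obtain i j where ij: "i \<le> m" "j \<le> m" "i < j" "(s ^^ i) x = (s ^^ j) x"
    unfolding inj_on_def by (metis atMost_iff nat_neq_iff)
  then have "(s ^^ (j - i)) x = x" using canc[of i j] by simp
  moreover from this have "m \<le> j - i" using le[of "j - i"] ij by simp
  then have "j - i = m" using ij by simp
  ultimately show ?thesis using le by (metis leD)
qed

text \<open>An orbit of the permutation is carried by \<open>a\<close> and \<open>b\<close> to the
  same set, so the third clause of \<open>vertex_type\<close> makes it contain a whole label class.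
  Labels are constant along orbits by the second clause, hence orbits and classes coincide.\<close>

lemma vertex_type_periods:
  assumes F: "finite F" and a: "bij_betw a F F'" and b: "bij_betw b F F'" and v: "vertex_type F a b P"
  shows "has_periods F (inv_into F b \<circ> a) P"
proof -
  define s where "s = inv_into F b \<circ> a"
  have bs: "bij_betw s F F" unfolding s_def using bij_betw_trans[OF a bij_betw_inv_into[OF b]] .
  have bsx: "b (s x) = a x" if "x \<in> F" for x
    unfolding s_def using a b that by (simp add: bij_betw_inv_into_right bij_betwE)
  obtain v :: "'a \<Rightarrow> nat" where v: "image_mset (\<lambda>i. card {x \<in> F. v x = i}) (mset_set (v ` F)) = P"
    "\<forall>x\<in>F. \<forall>y\<in>F. a x = b y \<longrightarrow> v x = v y"
    "\<forall>A\<subseteq>F. a ` A = b ` A \<longrightarrow> (\<forall>x\<in>A. \<forall>y\<in>F. v x = v y \<longrightarrow> y \<in> A)"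
    using v unfolding vertex_type_def by blast
  define m where "m x = card {y \<in> F. v y = v x}" for x
  have sF: "s x \<in> F" if "x \<in> F" for x using bs that by (rule bij_betwE[THEN bspec])
  have vs: "v (s x) = v x" if x: "x \<in> F" for x
  proof -
    have "a x = b (s x)" using bsx[OF x] by simp
    then show ?thesis using v(2) x sF[OF x] by (metis (full_types))
  qed
  have orb: "{(s ^^ k) x | k. True} = {y \<in> F. v y = v x}" if x: "x \<in> F" for x
  proof -
    let ?O = "{(s ^^ k) x | k. True}"
    have inF: "(s ^^ k) x \<in> F \<and> v ((s ^^ k) x) = v x" for k
      by (induction k) (use x sF vs in auto)
    have OF: "?O \<subseteq> F" using inF by blast
    have finO: "finite ?O" using OF F by (rule finite_subset)
    have "s ` ?O \<subseteq> ?O"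
    proof
      fix y assume "y \<in> s ` ?O"
      then obtain k where "y = s ((s ^^ k) x)" by blast
      then have "y = (s ^^ Suc k) x" by simp
      then show "y \<in> ?O" by blast
    qed
    then have sO: "s ` ?O = ?O"
      using bs OF finO by (intro card_subset_eq) (auto simp: bij_betw_def card_image inj_on_subset)
    have "b ` ?O = b ` (s ` ?O)" using sO by simp
    also have "\<dots> = (\<lambda>y. b (s y)) ` ?O" by (rule image_image)
    also have "\<dots> = a ` ?O" by (rule image_cong) (use bsx OF in auto)
    finally have "a ` ?O = b ` ?O" by simp
    then have min: "\<forall>z\<in>?O. \<forall>y\<in>F. v z = v y \<longrightarrow> y \<in> ?O" using v(3) OF by blast
    have "(s ^^ 0) x \<in> ?O" by blast
    then have xO: "x \<in> ?O" by simp
    have "y \<in> ?O" if "y \<in> F" "v y = v x" for y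
      using bspec[OF bspec[OF min xO] that(1)] that(2) by simp
    then show ?thesis using inF by blast
  qed
  have s: "s ` F \<subseteq> F" "inj_on s F" using bs by (simp_all add: bij_betw_def)
  have per: "(s ^^ m x) x = x \<and> (\<forall>k. 0 < k \<and> k < m x \<longrightarrow> (s ^^ k) x \<noteq> x)" if "x \<in> F" for x
    by (rule orbit_period[OF F s that]) (simp only: orb[OF that] m_def)
  have inP: "m x \<in># P" if "x \<in> F" for x
    unfolding v(1)[symmetric] m_def using that F by auto
  have cnt: "card {x \<in> F. m x = c} = c * count P c" for c
  proof -
    let ?I = "{i \<in> v ` F. card {x \<in> F. v x = i} = c}"
    have "{x \<in> F. m x = c} = (\<Union>i\<in>?I. {x \<in> F. v x = i})" by (auto simp: m_def)
    also have "card \<dots> = (\<Sum>i\<in>?I. card {x \<in> F. v x = i})"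
    proof (rule card_UN_disjoint)
      show "finite ?I" using F by simp
      show "\<forall>i\<in>?I. finite {x \<in> F. v x = i}" using F by simp
      show "\<forall>i\<in>?I. \<forall>j\<in>?I. i \<noteq> j \<longrightarrow> {x \<in> F. v x = i} \<inter> {x \<in> F. v x = j} = {}" by blast
    qed
    also have "\<dots> = (\<Sum>i\<in>?I. c)" by (rule sum.cong) auto
    also have "\<dots> = c * card ?I" by simp
    also have "card ?I = count P c"
    proof -
      have "count P c = (\<Sum>i\<in>{i \<in> v ` F. c = card {x \<in> F. v x = i}}. 1)"
        unfolding v(1)[symmetric] count_image_mset using F
        by (intro sum.mono_neutral_cong) (auto simp: count_mset_set)
      then show ?thesis by (simp add: eq_commute)
    qed
    finally show ?thesis .
  qed
  show ?thesis unfolding has_periods_def s_def[symmetric]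
  proof (intro exI[of _ m] conjI ballI allI)
    fix x assume x: "x \<in> F"
    show "m x \<in># P" "(s ^^ m x) x = x" using inP[OF x] per[OF x] by blast+
    show "0 < k \<and> k < m x \<longrightarrow> (s ^^ k) x \<noteq> x" for k using per[OF x] by blast
  qed (rule cnt)
qed

lemma funpow_cong_on:
  assumes "\<And>x. x \<in> F \<Longrightarrow> s x = t x" "s ` F \<subseteq> F" "x \<in> F"
  shows "(s ^^ k) x = (t ^^ k) x \<and> (s ^^ k) x \<in> F"
  by (induction k) (use assms in auto)

lemma has_periods_cong:
  assumes "\<And>x. x \<in> F \<Longrightarrow> s x = t x" "s ` F \<subseteq> F" "has_periods F s P"
  shows "has_periods F t P"
proof -
  obtain m where m: "\<forall>x\<in>F. m x \<in># P \<and> (s ^^ m x) x = x \<and> (\<forall>k. 0 < k \<and> k < m x \<longrightarrow> (s ^^ k) x \<noteq> x)"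
     "\<forall>c. card {x \<in> F. m x = c} = c * count P c"
    using assms(3) unfolding has_periods_def by blast
  have "(s ^^ k) x = (t ^^ k) x" if "x \<in> F" for x k
    using funpow_cong_on[of F s t x k, OF assms(1,2) that] by blast
  then have "\<forall>x\<in>F. m x \<in># P \<and> (t ^^ m x) x = x \<and> (\<forall>k. 0 < k \<and> k < m x \<longrightarrow> (t ^^ k) x \<noteq> x)"
    using m(1) by simp
  then show ?thesis using m(2) unfolding has_periods_def by blast
qed

text \<open>\<open>\<sigma>\<close> crosses the first gate and returns through the second, which
  encircles 0; \<open>\<tau>\<close> uses the second and third and encircles 1. In the product the
  middle crossing cancels and a loop around infinity remains. It runs opposite to the order in which
  the third vertex was recorded, hence the use of \<open>vertex_type_sym\<close>.\<close>

theorem branched_cover_permutations: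
  assumes bc: "branched_cover X Y f" and X: "X homeomorphic_space nsphere 2" and Y: "Y homeomorphic_space nsphere 2"
    and d: "has_cover_degree X Y f d" "d > 0"
    and P: "branch_data X Y f = {#P1, P2, P3#}" "P1 \<noteq> {#}" "P2 \<noteq> {#}" "P3 \<noteq> {#}"
  obtains F :: "complex set" and \<sigma> \<tau> where "finite F" "card F = d" "bij_betw \<sigma> F F" "bij_betw \<tau> F F"
    "\<And>A. A \<subseteq> F \<Longrightarrow> \<sigma> ` A \<subseteq> A \<Longrightarrow> \<tau> ` A \<subseteq> A \<Longrightarrow> A = {} \<or> A = F"
    "has_periods F \<sigma> P1" "has_periods F \<tau> P2" "has_periods F (\<tau> \<circ> \<sigma>) P3"
proof -
  obtain F F' :: "complex set" and a0 a1 a2 where F: "finite F" "card F = d"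
    and a: "bij_betw a0 F F'" "bij_betw a1 F F'" "bij_betw a2 F F'"
    and tr: "\<And>A. A \<subseteq> F \<Longrightarrow> a0 ` A = a1 ` A \<Longrightarrow> a1 ` A = a2 ` A \<Longrightarrow> A = {} \<or> A = F"
    and v: "vertex_type F a0 a1 P1" "vertex_type F a1 a2 P2" "vertex_type F a2 a0 P3"
    by (rule branched_monodromy[OF assms]) (rule that)
  let ?\<sigma> = "inv_into F a1 \<circ> a0" and ?\<tau> = "inv_into F a2 \<circ> a1"
  have b: "bij_betw ?\<sigma> F F" "bij_betw ?\<tau> F F"
    using bij_betw_trans[OF a(1) bij_betw_inv_into[OF a(2)]] bij_betw_trans[OF a(2) bij_betw_inv_into[OF a(3)]] .
  \<comment> \<open>On a finite set a permutation that maps \<open>A\<close> into itself maps it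
    onto itself, so inclusion already yields equal images.\<close>
  have img: "p ` A = q ` A" if A: "A \<subseteq> F" and pq: "bij_betw p F F'" "bij_betw q F F'" "(inv_into F q \<circ> p) ` A \<subseteq> A" for A p q
  proof -
    have "bij_betw (inv_into F q \<circ> p) F F" using bij_betw_trans[OF pq(1) bij_betw_inv_into[OF pq(2)]] .
    then have "card ((inv_into F q \<circ> p) ` A) = card A" using A by (intro card_image) (auto simp: bij_betw_def inj_on_subset)
    then have eq: "(inv_into F q \<circ> p) ` A = A" using pq(3) A F by (intro card_subset_eq) (auto intro: finite_subset)
    have "q ` A = q ` ((inv_into F q \<circ> p) ` A)" using eq by simp
    also have "\<dots> = (\<lambda>x. q ((inv_into F q \<circ> p) x)) ` A" by (rule image_image)
    also have "\<dots> = p ` A" by (rule image_cong) (use A pq in \<open>auto simp: bij_betw_inv_into_right bij_betwE\<close>)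
    finally show ?thesis by simp
  qed
  show ?thesis
  proof (rule that[OF F b])
    show "A = {} \<or> A = F" if "A \<subseteq> F" "?\<sigma> ` A \<subseteq> A" "?\<tau> ` A \<subseteq> A" for A
      by (rule tr[OF that(1) img[OF that(1) a(1,2) that(2)] img[OF that(1) a(2,3) that(3)]])
    show "has_periods F ?\<sigma> P1" by (rule vertex_type_periods[OF F(1) a(1,2) v(1)])
    show "has_periods F ?\<tau> P2" by (rule vertex_type_periods[OF F(1) a(2,3) v(2)])
    have "has_periods F (inv_into F a2 \<circ> a0) P3"
      by (rule vertex_type_periods[OF F(1) a(1,3) vertex_type_sym[OF v(3)]])
    then show "has_periods F (?\<tau> \<circ> ?\<sigma>) P3"
    proof (rule has_periods_cong[rotated 2])
      show "(inv_into F a2 \<circ> a0) ` F \<subseteq> F"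
        using bij_betw_trans[OF a(1) bij_betw_inv_into[OF a(3)]] by (simp add: bij_betw_def)
      show "(inv_into F a2 \<circ> a0) x = (?\<tau> \<circ> ?\<sigma>) x" if "x \<in> F" for x
        using a that by (simp add: bij_betw_inv_into_right bij_betwE)
    qed
  qed
qed

section \<open>No permutations for the two exceptional data\<close>

text \<open>A fixed point \<open>x\<close> of \<open>\<tau> \<circ> \<sigma>\<close> is paired by
  \<open>\<sigma>\<close> with its predecessor in its 4-cycle of \<open>\<tau>\<close>. Two fixed
  points in one 4-cycle would close it up under \<open>\<sigma>\<close>, against transitivity. So
  the three fixed points require three disjoint 4-cycles, 12 points among 8.\<close>

lemma no_permutations_degree_8:
  fixes F :: "'c set"
  assumes F: "finite F" "card F = 8" and bij: "bij_betw \<sigma> F F" "bij_betw \<tau> F F"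
    and trans: "\<And>A. A \<subseteq> F \<Longrightarrow> \<sigma> ` A \<subseteq> A \<Longrightarrow> \<tau> ` A \<subseteq> A \<Longrightarrow> A = {} \<or> A = F"
    and per: "has_periods F \<sigma> {#2, 2, 2, 2#}" "has_periods F \<tau> {#4, 4#}" "has_periods F (\<tau> \<circ> \<sigma>) {#5, 1, 1, 1#}"
  shows False
proof -
  have sF: "\<sigma> x \<in> F" "\<tau> x \<in> F" if "x \<in> F" for x using bij that by (auto simp: bij_betw_def)
  have inj: "x = y" if "\<tau> x = \<tau> y" "x \<in> F" "y \<in> F" for x y
    using bij(2) that by (auto simp: bij_betw_def inj_on_def)
  have ss: "\<sigma> (\<sigma> x) = x" if "x \<in> F" for x
    using per(1) that unfolding has_periods_def by (force simp: numeral_2_eq_2)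
  have t4: "\<tau> (\<tau> (\<tau> (\<tau> x))) = x" "\<tau> x \<noteq> x" "\<tau> (\<tau> x) \<noteq> x" "\<tau> (\<tau> (\<tau> x)) \<noteq> x" if x: "x \<in> F" for x
  proof -
    have "(\<tau> ^^ 4) x = x" "\<forall>k. 0 < k \<and> k < 4 \<longrightarrow> (\<tau> ^^ k) x \<noteq> x"
      using per(2) x unfolding has_periods_def by force+
    from this(1) this(2)[rule_format, of 1] this(2)[rule_format, of 2] this(2)[rule_format, of 3]
    show "\<tau> (\<tau> (\<tau> (\<tau> x))) = x" "\<tau> x \<noteq> x" "\<tau> (\<tau> x) \<noteq> x" "\<tau> (\<tau> (\<tau> x)) \<noteq> x"
      by (simp_all add: eval_nat_numeral)
  qed
  obtain m where m: "\<forall>x\<in>F. ((\<tau> \<circ> \<sigma>) ^^ m x) x = x" "card {x \<in> F. m x = 1} = 3"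
  proof -
    obtain m where "\<forall>x\<in>F. ((\<tau> \<circ> \<sigma>) ^^ m x) x = x" "\<forall>c. card {x \<in> F. m x = c} = c * count {#5, 1, 1, 1#} c"
      using per(3) unfolding has_periods_def by blast
    from this(1) this(2)[rule_format, of 1] show ?thesis by (intro that) auto
  qed
  then obtain a1 a2 a3 where a: "a1 \<noteq> a2" "a1 \<noteq> a3" "a2 \<noteq> a3" "{x \<in> F. m x = 1} = {a1, a2, a3}"
    by (auto simp: card_3_iff)
  have fix1: "x \<in> F \<and> \<tau> (\<sigma> x) = x" if "x \<in> {a1, a2, a3}" for x
    using that m(1) unfolding a(4)[symmetric] by force
  have sig: "\<sigma> x = \<tau> (\<tau> (\<tau> x))" if "x \<in> {a1, a2, a3}" for x
    using fix1[OF that] t4(1)[of "\<sigma> x"] sF(1)[of x] by auto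
  define orb where "orb x = {x, \<tau> x, \<tau> (\<tau> x), \<tau> (\<tau> (\<tau> x))}" for x
  have orbF: "orb x \<subseteq> F" if "x \<in> F" for x using sF that by (auto simp: orb_def)
  have orb_card: "card (orb x) = 4" if x: "x \<in> F" for x
  proof -
    have "\<tau> x \<noteq> \<tau> (\<tau> x)" "\<tau> x \<noteq> \<tau> (\<tau> (\<tau> x))" "\<tau> (\<tau> x) \<noteq> \<tau> (\<tau> (\<tau> x))"
      using t4[OF sF(2)[OF x]] t4(2)[OF sF(2)[OF sF(2)[OF x]]] by metis+
    then show ?thesis using t4[OF x] by (auto simp: orb_def)
  qed
  have orb_eq: "orb y = orb x" if "x \<in> F" "y \<in> orb x" for x y
    using that t4(1)[of x] by (auto simp: orb_def)
  have diff: "orb x \<inter> orb y = {}" if x: "x \<in> {a1, a2, a3}" and y: "y \<in> {a1, a2, a3}" and ne: "x \<noteq> y" for x y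
  proof (rule ccontr)
    assume "orb x \<inter> orb y \<noteq> {}"
    then obtain z where "z \<in> orb x" "z \<in> orb y" by blast
    then have e: "orb x = orb y" using orb_eq fix1[OF x] fix1[OF y] by metis
    then have yx: "y \<in> orb x" by (simp add: orb_def)
    note X = fix1[OF x] sig[OF x] and Y = fix1[OF y] sig[OF y]
    note tx = t4[of x] and ty = t4[of y]
    have "\<sigma> x \<noteq> y"
    proof
      assume sy: "\<sigma> x = y"
      then have "\<sigma> y = x" using ss[of x] X(1) by simp
      have "\<tau> y = x" using X sy by simp
      moreover have "\<tau> x = y" using Y \<open>\<sigma> y = x\<close> by simp
      ultimately show False using t4(3)[of x] X by simp
    qed
    \<comment> \<open>Of the other points of the 4-cycle only the one opposite to \<open>x\<close>
      survives; then \<open>\<sigma>\<close> exchanges \<open>x\<close> with its predecessor and the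
      two remaining points with each other.\<close>
    then have "y = \<tau> x \<or> y = \<tau> (\<tau> x)" using yx ne X by (auto simp: orb_def)
    moreover have "\<sigma> (\<tau> x) = x" if "y = \<tau> x" using Y(2) that tx X(1) by auto
    moreover have "\<sigma> (\<tau> x) = \<tau> (\<tau> x)" if "y = \<tau> (\<tau> x)"
    proof -
      have "\<sigma> y = \<tau> x" using Y(2) that tx X(1) by auto
      then show ?thesis using ss[of y] Y(1) that by auto
    qed
    ultimately have y2: "y = \<tau> (\<tau> x)" "\<sigma> (\<tau> x) = \<tau> (\<tau> x)"
    proof -
      have "y \<noteq> \<tau> x"
      proof
        assume y1: "y = \<tau> x"
        then have "\<sigma> y = x" using Y(2) tx X(1) by auto
        then have "\<sigma> x = y" using ss[of y] Y(1) by auto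
        then show False using \<open>\<sigma> x \<noteq> y\<close> by blast
      qed
      then show "y = \<tau> (\<tau> x)" "\<sigma> (\<tau> x) = \<tau> (\<tau> x)"
        using \<open>y = \<tau> x \<or> y = \<tau> (\<tau> x)\<close> \<open>y = \<tau> (\<tau> x) \<Longrightarrow> \<sigma> (\<tau> x) = \<tau> (\<tau> x)\<close> by auto
    qed
    have "\<sigma> ` orb x \<subseteq> orb x"
    proof -
      have "\<sigma> (\<tau> (\<tau> x)) = \<tau> x" using ss[of "\<tau> x"] y2 sF X(1) by auto
      moreover have "\<sigma> (\<tau> (\<tau> (\<tau> x))) = x" using ss[of x] X by simp
      ultimately show ?thesis using X(2) y2(2) by (auto simp: orb_def)
    qed
    moreover have "\<tau> ` orb x \<subseteq> orb x" using tx X(1) by (auto simp: orb_def)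
    ultimately have "orb x = {} \<or> orb x = F" using trans orbF X(1) by blast
    then show False using orb_card[of x] F(2) X(1) by auto
  qed
  have "card (orb a1 \<union> (orb a2 \<union> orb a3)) = 12"
    using diff[of a1 a2] diff[of a1 a3] diff[of a2 a3] a orb_card fix1
    by (subst card_Un_disjoint; (subst card_Un_disjoint)?) (auto simp: orb_def)
  moreover have "orb a1 \<union> (orb a2 \<union> orb a3) \<subseteq> F" using orbF fix1 by auto
  ultimately show False using card_mono[OF F(1), of "orb a1 \<union> (orb a2 \<union> orb a3)"] F(2) by simp
qed

text \<open>Read cycles of \<open>\<tau>\<close> as vertices, pairs of \<open>\<sigma>\<close> as
  edges, points as half-edges and cycles of \<open>\<tau> \<circ> \<sigma>\<close> as faces: a plane
  graph with five trivalent vertices, one leaf \<open>u\<close>, two loops bounding faces of length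
  1, and two faces of length 7. Stripping the leaf and the two vertices with loops leaves three
  vertices with nine half-edges, three of which lead to the stripped pieces. Every way of pairing
  the other six creates a further face shorter than 7 or a separate component.\<close>

lemma no_permutations_degree_16:
  fixes F :: "'c set"
  assumes F: "finite F" "card F = 16" and bij: "bij_betw \<sigma> F F" "bij_betw \<tau> F F"
    and trans: "\<And>A. A \<subseteq> F \<Longrightarrow> \<sigma> ` A \<subseteq> A \<Longrightarrow> \<tau> ` A \<subseteq> A \<Longrightarrow> A = {} \<or> A = F"
    and per: "has_periods F \<sigma> {#2, 2, 2, 2, 2, 2, 2, 2#}" "has_periods F \<tau> {#3, 3, 3, 3, 3, 1#}"
      "has_periods F (\<tau> \<circ> \<sigma>) {#7, 7, 1, 1#}"
  shows False
proof -
  have sF: "\<sigma> x \<in> F" "\<tau> x \<in> F" if "x \<in> F" for x using bij that by (auto simp: bij_betw_def)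
  have tinj: "x = y" if "\<tau> x = \<tau> y" "x \<in> F" "y \<in> F" for x y
    using bij(2) that by (auto simp: bij_betw_def inj_on_def)
  have ss: "\<sigma> (\<sigma> x) = x" "\<sigma> x \<noteq> x" if x: "x \<in> F" for x
  proof -
    have "(\<sigma> ^^ 2) x = x" "\<forall>k. 0 < k \<and> k < 2 \<longrightarrow> (\<sigma> ^^ k) x \<noteq> x"
      using per(1) x unfolding has_periods_def by force+
    from this(1) this(2)[rule_format, of 1] show "\<sigma> (\<sigma> x) = x" "\<sigma> x \<noteq> x"
      by (simp_all add: eval_nat_numeral)
  qed
  obtain u where u: "u \<in> F" "\<tau> u = u" and t3: "\<And>x. x \<in> F \<Longrightarrow> \<tau> (\<tau> (\<tau> x)) = x"
    and t1: "\<And>x. x \<in> F \<Longrightarrow> x \<noteq> u \<Longrightarrow> \<tau> x \<noteq> x"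
  proof -
    obtain m where m: "\<forall>x\<in>F. m x \<in># {#3, 3, 3, 3, 3, 1#} \<and> (\<tau> ^^ m x) x = x \<and> (\<forall>k. 0 < k \<and> k < m x \<longrightarrow> (\<tau> ^^ k) x \<noteq> x)"
      "\<forall>c. card {x \<in> F. m x = c} = c * count {#3, 3, 3, 3, 3, 1#} c"
      using per(2) unfolding has_periods_def by blast
    have "card {x \<in> F. m x = 1} = 1" using m(2) by simp
    then obtain u where u: "{x \<in> F. m x = 1} = {u}" by (auto simp: card_1_singleton_iff)
    then have uF: "u \<in> F" "m u = 1" by auto
    have "\<tau> u = u" using m(1) uF by force
    have m3: "m x = 3" if "x \<in> F" "x \<noteq> u" for x using m(1) u that by auto
    have x3: "\<tau> (\<tau> (\<tau> x)) = x" "\<tau> x \<noteq> x" if x: "x \<in> F" "x \<noteq> u" for x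
    proof -
      have "(\<tau> ^^ 3) x = x" "\<forall>k. 0 < k \<and> k < 3 \<longrightarrow> (\<tau> ^^ k) x \<noteq> x" using m(1) m3[OF x] x(1) by auto
      from this(1) this(2)[rule_format, of 1] show "\<tau> (\<tau> (\<tau> x)) = x" "\<tau> x \<noteq> x"
        by (simp_all add: eval_nat_numeral)
    qed
    show ?thesis
    proof (rule that[OF uF(1) \<open>\<tau> u = u\<close>])
      show "\<tau> (\<tau> (\<tau> x)) = x" if "x \<in> F" for x using x3 that \<open>\<tau> u = u\<close> by (cases "x = u") auto
    qed (use x3 in auto)
  qed
  define \<phi> where "\<phi> x = \<tau> (\<sigma> x)" for x
  obtain a b where ab: "a \<noteq> b" "a \<in> F" "b \<in> F" "\<phi> a = a" "\<phi> b = b"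
    and short: "\<And>x k. x \<in> F \<Longrightarrow> (\<phi> ^^ k) x = x \<Longrightarrow> 0 < k \<Longrightarrow> k < 7 \<Longrightarrow> x = a \<or> x = b"
  proof -
    have \<phi>: "\<tau> \<circ> \<sigma> = \<phi>" by (auto simp: \<phi>_def)
    obtain m where m: "\<forall>x\<in>F. m x \<in># {#7, 7, 1, 1#} \<and> (\<phi> ^^ m x) x = x \<and> (\<forall>k. 0 < k \<and> k < m x \<longrightarrow> (\<phi> ^^ k) x \<noteq> x)"
      "\<forall>c. card {x \<in> F. m x = c} = c * count {#7, 7, 1, 1#} c"
      using per(3) unfolding has_periods_def \<phi> by blast
    have "card {x \<in> F. m x = 1} = 2" using m(2) by simp
    then obtain a b where ab: "a \<noteq> b" "{x \<in> F. m x = 1} = {a, b}" by (auto simp: card_2_iff)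
    then have abF: "a \<in> F" "b \<in> F" "m a = 1" "m b = 1" by auto
    have m7: "m x = 7" if "x \<in> F" "x \<noteq> a" "x \<noteq> b" for x using m(1) ab that by auto
    show ?thesis
    proof (rule that[OF ab(1) abF(1,2)])
      have "(\<phi> ^^ m a) a = a" "(\<phi> ^^ m b) b = b" using m(1) abF(1,2) by blast+
      then show "\<phi> a = a" "\<phi> b = b" using abF(3,4) by simp_all
      show "x = a \<or> x = b" if "x \<in> F" "(\<phi> ^^ k) x = x" "0 < k" "k < 7" for x k
      proof (rule ccontr)
        assume "\<not> (x = a \<or> x = b)"
        then have "m x = 7" using m7 that(1) by blast
        then show False using m(1) that by metis
      qed
    qed
  qed
  have noloop: "x = a \<or> x = b" if "x \<in> F" "\<tau> (\<sigma> x) = x" for x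
    using short[of x 1] that by (simp add: \<phi>_def)
  \<comment> \<open>\<open>\<phi> y = x\<close> closes the path after \<open>k + 1\<close> steps, so
    \<open>k < 6\<close> keeps the return below 7.\<close>
  have nocycle: "x = a \<or> x = b" if "x \<in> F" "\<phi> y = x" "(\<phi> ^^ k) x = y" "k < 6" for x y k
    using short[of x "Suc k"] that by simp
  have t2: "\<tau> (\<tau> x) \<noteq> x" "\<tau> (\<tau> x) \<noteq> \<tau> x" "\<tau> x \<noteq> x" if "x \<in> F" "x \<noteq> u" for x
  proof -
    show "\<tau> x \<noteq> x" using t1 that by blast
    then show "\<tau> (\<tau> x) \<noteq> \<tau> x" using tinj[of "\<tau> x" x] sF that by blast
    show "\<tau> (\<tau> x) \<noteq> x" using t3[OF that(1)] \<open>\<tau> x \<noteq> x\<close> by metis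
  qed
  have tu: "\<tau> x = u \<longleftrightarrow> x = u" if "x \<in> F" for x using tinj[of x u] u that by auto
  have size: "A = {} \<or> A = F" if "A \<subseteq> F" "\<And>x. x \<in> A \<Longrightarrow> \<sigma> x \<in> A" "\<And>x. x \<in> A \<Longrightarrow> \<tau> x \<in> A" for A
    using trans[of A] that by blast
  define L where "L x = {x, \<tau> x, \<tau> (\<tau> x)}" for x
  have LF: "L x \<subseteq> F" if "x \<in> F" for x using sF that by (auto simp: L_def)
  have L_card: "card (L x) = 3" if "x \<in> F" "x \<noteq> u" for x
    using t2[OF that] by (auto simp: L_def)
  have L_t: "\<tau> y \<in> L x" if "x \<in> F" "y \<in> L x" for x y using t3 that by (auto simp: L_def)
  have L_eq: "L y = L x" if "x \<in> F" "y \<in> L x" for x y using t3 that by (auto simp: L_def)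
  have L_u: "u \<in> L x \<longleftrightarrow> x = u" if "x \<in> F" for x using tu sF that by (auto simp: L_def)
  \<comment> \<open>A loop occupies the half-edges \<open>x\<close> and
    \<open>\<tau> (\<tau> x)\<close> of its vertex, and the third one, \<open>\<tau> x\<close>,
    leads to the rest of the graph. A face that enters from \<open>\<sigma> (\<tau> x)\<close> runs
    around the loop and comes out three steps later at the successor of its entry in the cycle of
    \<open>\<tau>\<close>.\<close>
  have loop: "\<sigma> x = \<tau> (\<tau> x) \<and> \<sigma> (\<tau> (\<tau> x)) = x \<and> x \<noteq> u \<and> (\<phi> ^^ 3) (\<sigma> (\<tau> x)) = \<tau> (\<sigma> (\<tau> x)) \<and>
      \<sigma> (\<tau> x) \<notin> L x \<and> \<sigma> (\<tau> x) \<in> F \<and> \<sigma> (\<sigma> (\<tau> x)) = \<tau> x"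
    if x: "x \<in> F" "\<phi> x = x" for x
  proof -
    have 1: "\<sigma> x = \<tau> (\<tau> x)" using t3[OF sF(1)[OF x(1)]] x(2) by (simp add: \<phi>_def)
    have 2: "\<sigma> (\<tau> (\<tau> x)) = x" using ss(1)[OF x(1)] 1 by simp
    have 3: "x \<noteq> u"
    proof
      assume "x = u"
      then have "\<sigma> x = x" using 1 u by simp
      then show False using ss(2)[OF x(1)] by simp
    qed
    have 4: "\<sigma> (\<sigma> (\<tau> x)) = \<tau> x" using ss(1) sF x(1) by blast
    have "\<phi> (\<sigma> (\<tau> x)) = \<tau> (\<tau> x)" using 4 by (simp add: \<phi>_def)
    moreover have "\<phi> (\<tau> (\<tau> x)) = \<tau> x" using 2 by (simp add: \<phi>_def)
    moreover have "\<phi> (\<tau> x) = \<tau> (\<sigma> (\<tau> x))" by (simp add: \<phi>_def)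
    ultimately have 5: "(\<phi> ^^ 3) (\<sigma> (\<tau> x)) = \<tau> (\<sigma> (\<tau> x))" by (simp add: eval_nat_numeral)
    have 6: "\<sigma> (\<tau> x) \<notin> L x"
    proof
      assume "\<sigma> (\<tau> x) \<in> L x"
      then consider "\<sigma> (\<tau> x) = x" | "\<sigma> (\<tau> x) = \<tau> x" | "\<sigma> (\<tau> x) = \<tau> (\<tau> x)" by (auto simp: L_def)
      then show False
      proof cases
        case 1
        then have "\<tau> x = \<tau> (\<tau> x)" using \<open>\<sigma> x = \<tau> (\<tau> x)\<close> 4 by simp
        then show False using t2(2)[OF x(1) 3] by simp
      next
        case 2
        then show False using ss(2)[OF sF(2)[OF x(1)]] by simp
      next
        case 3
        then have "\<tau> x = x" using \<open>\<sigma> (\<tau> (\<tau> x)) = x\<close> 4 by simp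
        then show False using t2(3)[OF x(1) \<open>x \<noteq> u\<close>] by simp
      qed
    qed
    show ?thesis using 1 2 3 4 5 6 sF x by auto
  qed
  note La = loop[OF ab(2,4)] and Lb = loop[OF ab(3,5)]
  \<comment> \<open>The half-edges at which the two loops and the leaf are attached to the
    rest.\<close>
  define c d e where "c = \<sigma> (\<tau> a)" and "d = \<sigma> (\<tau> b)" and "e = \<sigma> u"
  note cde = c_def d_def e_def
  have bLa: "b \<notin> L a"
  proof
    assume "b \<in> L a"
    then consider "b = \<tau> a" | "b = \<tau> (\<tau> a)" using ab(1) by (auto simp: L_def)
    then show False
    proof cases
      case 1
      then have "\<sigma> (\<tau> a) = a" using Lb t3[OF ab(2)] by simp
      then show False using La by (simp add: L_def)
    next
      case 2
      then have "\<sigma> b = a" "\<sigma> b = \<tau> a" using La Lb t3[OF ab(2)] t3[OF sF(2)[OF ab(2)]] by simp_all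
      then show False using t2(3)[OF ab(2)] La by simp
    qed
  qed
  have Ldisj: "L x \<inter> L y = {}" if "x \<in> F" "y \<in> F" "y \<notin> L x" for x y
  proof (rule ccontr)
    assume "L x \<inter> L y \<noteq> {}"
    then obtain z where "z \<in> L x" "z \<in> L y" by blast
    then have "L x = L y" using L_eq that by metis
    then show False using that(3) by (simp add: L_def)
  qed
  have Lab: "L a \<inter> L b = {}" using Ldisj bLa ab by blast
  have sLa: "\<sigma> ` L a \<subseteq> L a \<union> {c}" "\<sigma> ` L b \<subseteq> L b \<union> {d}"
    using La Lb by (auto simp: L_def cde)
  have cF: "c \<in> F" "d \<in> F" "e \<in> F" using La Lb sF u by (auto simp: cde)
  \<comment> \<open>Stated as \<open>x \<notin> B\<close> for every \<open>x\<close>, so that a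
    single element of a small invariant set gives a contradiction.\<close>
  have closed_small: "x \<notin> B" if B: "B \<subseteq> F" "\<And>x. x \<in> B \<Longrightarrow> \<sigma> x \<in> B" "\<And>x. x \<in> B \<Longrightarrow> \<tau> x \<in> B" "card B < 16" for B x
    using size[of B] B F(2) by auto
  \<comment> \<open>Two loops attached to each other would form a component of 6 points.\<close>
  have cLb: "c \<notin> L b"
  proof
    assume "c \<in> L b"
    then have "c = b \<or> c = \<tau> b \<or> c = \<tau> (\<tau> b)" by (auto simp: L_def)
    moreover have "\<sigma> c = \<tau> a" using La by (simp add: cde)
    moreover have "\<tau> a \<notin> L b" using Lab by (auto simp: L_def)
    ultimately have "\<sigma> c \<notin> L b" "c = b \<or> c = \<tau> b \<or> c = \<tau> (\<tau> b)" by auto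
    then have "c = \<tau> b" using Lb by (auto simp: L_def)
    then have "d = \<tau> a" using La by (simp add: cde)
    have "a \<notin> L a \<union> L b"
    proof (rule closed_small)
      show "L a \<union> L b \<subseteq> F" using LF ab by blast
      show "\<sigma> x \<in> L a \<union> L b" if "x \<in> L a \<union> L b" for x
        using sLa that \<open>c = \<tau> b\<close> \<open>d = \<tau> a\<close> by (auto simp: L_def)
      show "\<tau> x \<in> L a \<union> L b" if "x \<in> L a \<union> L b" for x using L_t that ab by blast
      show "card (L a \<union> L b) < 16" using card_Un_le[of "L a" "L b"] L_card La Lb ab by simp
    qed
    then show False by (simp add: L_def)
  qed
  \<comment> \<open>A loop attached to the leaf would form a component of 4 points.\<close>
  have uc: "x \<in> F \<Longrightarrow> \<phi> x = x \<Longrightarrow> \<sigma> (\<tau> x) \<noteq> u" for x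
  proof
    assume x: "x \<in> F" "\<phi> x = x" and su: "\<sigma> (\<tau> x) = u"
    note l = loop[OF x]
    have "x \<notin> L x \<union> {u}"
    proof (rule closed_small)
      show "L x \<union> {u} \<subseteq> F" using LF x u by blast
      show "\<sigma> y \<in> L x \<union> {u}" if "y \<in> L x \<union> {u}" for y
        using that l su by (auto simp: L_def)
      show "\<tau> y \<in> L x \<union> {u}" if "y \<in> L x \<union> {u}" for y using L_t that x u by auto
      show "card (L x \<union> {u}) < 16" using card_Un_le[of "L x" "{u}"] L_card l x by simp
    qed
    then show False by (simp add: L_def)
  qed
  have sinj: "x = y" if "\<sigma> x = \<sigma> y" "x \<in> F" "y \<in> F" for x y
    by (metis ss(1) that)
  \<comment> \<open>What remains without the two vertices carrying loops and the leaf: 16 - 3 - 3 -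
    1 = 9 points, that is three 3-cycles of \<open>\<tau>\<close>.\<close>
  define R where "R = F - (L a \<union> L b \<union> {u})"
  have uL: "u \<notin> L a" "u \<notin> L b" using L_u ab La Lb by auto
  have dLa: "d \<notin> L a"
  proof
    assume "d \<in> L a"
    then have "d = a \<or> d = \<tau> a \<or> d = \<tau> (\<tau> a)" by (auto simp: L_def)
    moreover have "\<sigma> d = \<tau> b" using Lb by (simp add: cde)
    moreover have "\<tau> b \<notin> L a" using Lab by (auto simp: L_def)
    ultimately have "\<sigma> d \<notin> L a" "d = a \<or> d = \<tau> a \<or> d = \<tau> (\<tau> a)" by auto
    then have "d = \<tau> a" using La by (auto simp: L_def)
    then have "c = \<tau> b" using Lb by (simp add: cde)
    then show False using cLb by (simp add: L_def)
  qed
  have eL: "e \<notin> L a" "e \<notin> L b"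
  proof -
    have se: "\<sigma> e = u" using ss u by (simp add: cde)
    show "e \<notin> L a" using se uL La uc[OF ab(2,4)] by (auto simp: L_def)
    show "e \<notin> L b" using se uL Lb uc[OF ab(3,5)] by (auto simp: L_def)
  qed
  have cdeR: "c \<in> R" "d \<in> R" "e \<in> R"
    using cF La Lb cLb dLa eL uc[OF ab(2,4)] uc[OF ab(3,5)] ss(2)[OF u(1)] by (auto simp: R_def cde)
  have dist: "c \<noteq> d" "c \<noteq> e" "d \<noteq> e"
  proof -
    have m: "\<tau> a \<in> L a" "\<tau> b \<in> L b" by (auto simp: L_def)
    have f: "\<tau> a \<in> F" "\<tau> b \<in> F" using sF ab by blast+
    have ne: "\<tau> a \<noteq> \<tau> b" "\<tau> a \<noteq> u" "\<tau> b \<noteq> u"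
    proof -
      show "\<tau> a \<noteq> \<tau> b" using Lab m by (metis disjoint_iff)
      show "\<tau> a \<noteq> u" "\<tau> b \<noteq> u" using uL m by metis+
    qed
    have "\<sigma> c = \<tau> a" "\<sigma> d = \<tau> b" "\<sigma> e = u" using ss(1) f u(1) by (auto simp: cde)
    with ne show "c \<noteq> d" "c \<noteq> e" "d \<noteq> e" by metis+
  qed
  have RF: "R \<subseteq> F" by (auto simp: R_def)
  have Ru: "x \<noteq> u" "x \<noteq> a" "x \<noteq> b" if "x \<in> R" for x using that by (auto simp: R_def L_def)
  have Rt: "\<tau> x \<in> R" if x: "x \<in> R" for x
  proof -
    have xF: "x \<in> F" using RF x by blast
    have "\<tau> x \<notin> L y" if y: "y \<in> F" "x \<notin> L y" for y
    proof
      assume "\<tau> x \<in> L y"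
      then have "\<tau> (\<tau> (\<tau> x)) \<in> L y" using L_t y by blast
      then show False using t3[OF xF] y by simp
    qed
    then show ?thesis using x xF sF tu[OF xF] ab by (auto simp: R_def)
  qed
  have LR: "L x \<subseteq> R" if "x \<in> R" for x using Rt that by (auto simp: L_def)
  have Rs: "\<sigma> x \<in> R \<and> \<sigma> x \<notin> {c, d, e}" if x: "x \<in> R" "x \<notin> {c, d, e}" for x
  proof -
    have xF: "x \<in> F" using RF x by blast
    have s: "\<sigma> x \<in> F" "\<sigma> (\<sigma> x) = x" using sF ss xF by auto
    have "\<sigma> x \<notin> L a"
    proof
      assume "\<sigma> x \<in> L a"
      then have "x \<in> L a \<union> {c}" using sLa(1) s(2) by (metis image_eqI subsetD)
      then show False using x by (auto simp: R_def)
    qed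
    moreover have "\<sigma> x \<notin> L b"
    proof
      assume "\<sigma> x \<in> L b"
      then have "x \<in> L b \<union> {d}" using sLa(2) s(2) by (metis image_eqI subsetD)
      then show False using x by (auto simp: R_def)
    qed
    moreover have "\<sigma> x \<noteq> u" using s x by (auto simp: cde)
    moreover have "\<sigma> c = \<tau> a" "\<sigma> d = \<tau> b" "\<sigma> e = u" using La Lb ss u by (auto simp: cde)
    then have "\<sigma> x \<noteq> c" "\<sigma> x \<noteq> d" "\<sigma> x \<noteq> e" using s(2) x by (auto simp: R_def L_def)
    ultimately show ?thesis using s by (auto simp: R_def)
  qed
  have R9: "card R = 9"
  proof -
    have "card (L a \<union> L b) = 6" using L_card[of a] L_card[of b] La Lb ab Lab
      by (subst card_Un_disjoint) (auto simp: L_def)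
    then have "card (L a \<union> L b \<union> {u}) = 7" using uL by (simp add: card_insert_if L_def)
    moreover have "L a \<union> L b \<union> {u} \<subseteq> F" using LF ab u by blast
    moreover have "finite (L a \<union> L b \<union> {u})" by (simp add: L_def)
    ultimately show ?thesis unfolding R_def using F(2) by (simp only: card_Diff_subset)
  qed
  have finR: "finite R" using RF F(1) finite_subset by blast
  \<comment> \<open>A face needs two steps to run around the leaf and three to run around a loop
    before it continues at the same vertex.\<close>
  have leaf: "\<exists>n\<in>{2, 3}. (\<phi> ^^ n) x = \<tau> x" if "x \<in> {c, d, e}" for x
  proof -
    have "(\<phi> ^^ 2) e = \<tau> e" using ss u by (simp add: cde \<phi>_def eval_nat_numeral)
    moreover have "(\<phi> ^^ 3) c = \<tau> c" "(\<phi> ^^ 3) d = \<tau> d" using La Lb by (simp_all add: cde)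
    ultimately show ?thesis using that by auto
  qed
  \<comment> \<open>An edge joining two half-edges of one vertex would bound a face of length 1, but
    both of these have been removed.\<close>
  have nofix: "\<sigma> x \<noteq> \<tau> x" "\<sigma> x \<noteq> \<tau> (\<tau> x)" "\<sigma> x \<noteq> x" if x: "x \<in> R" for x
  proof -
    have xF: "x \<in> F" using RF x by blast
    show "\<sigma> x \<noteq> x" using ss xF by blast
    show "\<sigma> x \<noteq> \<tau> x"
    proof
      assume "\<sigma> x = \<tau> x"
      then have "\<sigma> (\<tau> x) = x" using ss(1)[OF xF] by simp
      then have "\<tau> x = a \<or> \<tau> x = b" using noloop[OF sF(2)[OF xF]] by simp
      then show False using Ru[OF Rt[OF x]] by blast
    qed
    show "\<sigma> x \<noteq> \<tau> (\<tau> x)"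
    proof
      assume "\<sigma> x = \<tau> (\<tau> x)"
      then have "\<tau> (\<sigma> x) = x" using t3[OF xF] by simp
      then show False using noloop[OF xF] Ru[OF x] by blast
    qed
  qed
  have R3: "\<tau> (\<tau> (\<tau> x)) = x" "\<sigma> (\<sigma> x) = x" if "x \<in> R" for x using t3 ss RF that by auto
  have Rdist: "x \<noteq> \<tau> x" "x \<noteq> \<tau> (\<tau> x)" "\<tau> x \<noteq> \<tau> (\<tau> x)" if "x \<in> R" for x
    using t2[of x] RF Ru(1)[OF that] that by auto
  have cyc: False if "x \<in> R" "\<phi> y = x" "(\<phi> ^^ k) x = y" "k < 6" for x y k
    using nocycle[of x y k] that RF Ru by blast
  \<comment> \<open>At most two ordinary steps, one detour of at most three and the closing step
    give a return after at most 6 steps.\<close>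
  have cyc_leaf: False if x: "x \<in> {c, d, e}" and p: "\<phi> p = x" and q: "(\<phi> ^^ k) (\<tau> x) = p" "k \<le> 2" for x p k
  proof -
    obtain n where n: "n \<in> {2, 3}" "(\<phi> ^^ n) x = \<tau> x" using leaf[OF x] by blast
    have "(\<phi> ^^ (k + n)) x = p" using n q by (simp add: funpow_add)
    moreover have "k + n < 6" using n q(2) by auto
    ultimately show False using cyc[of x p "k + n"] x p cdeR by blast
  qed
  \<comment> \<open>The three pieces sit at different vertices, and those of \<open>x\<close> and
    \<open>y\<close> are joined by an edge. The vertex of \<open>z\<close> must then be joined to
    both, as otherwise its two free half-edges would be paired with each other. The triangle so
    formed has an inner face with at most one detour; the case distinction only records on which
    side the pieces hang.\<close>
  have sep: False
    if xyz: "x \<in> {c, d, e}" "y \<in> {c, d, e}" "z \<in> {c, d, e}" and R: "R = L x \<union> L y \<union> L z"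
      and dj: "L x \<inter> L y = {}" "L x \<inter> L z = {}" "L y \<inter> L z = {}"
      and xy: "\<sigma> (\<tau> x) \<in> {\<tau> y, \<tau> (\<tau> y)}" for x y z
  proof -
    have xR: "x \<in> R" "y \<in> R" "z \<in> R" using xyz cdeR by auto
    have e3: "{c, d, e} = {x, y, z}"
    proof -
      have "x \<noteq> y" "x \<noteq> z" "y \<noteq> z" using dj by (auto simp: L_def)
      then show ?thesis using xyz by auto
    qed
    note S = R3[OF xR(1)] R3[OF xR(2)] R3[OF xR(3)]
      R3(2)[OF Rt[OF xR(1)]] R3(2)[OF Rt[OF Rt[OF xR(1)]]]
      R3(2)[OF Rt[OF xR(2)]] R3(2)[OF Rt[OF Rt[OF xR(2)]]]
      R3(2)[OF Rt[OF xR(3)]] R3(2)[OF Rt[OF Rt[OF xR(3)]]]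
    have tgt: "\<sigma> p \<in> {\<tau> x, \<tau> (\<tau> x), \<tau> y, \<tau> (\<tau> y), \<tau> z, \<tau> (\<tau> z)}"
      if "p \<in> {\<tau> x, \<tau> (\<tau> x), \<tau> y, \<tau> (\<tau> y), \<tau> z, \<tau> (\<tau> z)}" for p
    proof -
      have pR: "p \<in> R" using that Rt xR by auto
      have "(p \<in> L x \<and> p \<noteq> x) \<or> (p \<in> L y \<and> p \<noteq> y) \<or> (p \<in> L z \<and> p \<noteq> z)"
        using that Rdist(1,2)[OF xR(1)] Rdist(1,2)[OF xR(2)] Rdist(1,2)[OF xR(3)] unfolding L_def by fastforce
      moreover have "x \<in> L x" "y \<in> L y" "z \<in> L z" by (auto simp: L_def)
      ultimately have "p \<notin> {c, d, e}" unfolding e3 using dj by blast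
      then have "\<sigma> p \<in> R" "\<sigma> p \<notin> {c, d, e}" using Rs pR by blast+
      then show ?thesis unfolding e3 unfolding R by (auto simp: L_def)
    qed
    have D: "\<tau> x \<noteq> \<tau> (\<tau> x)" "\<tau> y \<noteq> \<tau> (\<tau> y)" "\<tau> z \<noteq> \<tau> (\<tau> z)" using Rdist xR by auto
    have DJ: "\<tau> x \<noteq> \<tau> y" "\<tau> x \<noteq> \<tau> (\<tau> y)" "\<tau> (\<tau> x) \<noteq> \<tau> y" "\<tau> (\<tau> x) \<noteq> \<tau> (\<tau> y)"
      "\<tau> x \<noteq> \<tau> z" "\<tau> x \<noteq> \<tau> (\<tau> z)" "\<tau> (\<tau> x) \<noteq> \<tau> z" "\<tau> (\<tau> x) \<noteq> \<tau> (\<tau> z)"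
      "\<tau> y \<noteq> \<tau> z" "\<tau> y \<noteq> \<tau> (\<tau> z)" "\<tau> (\<tau> y) \<noteq> \<tau> z" "\<tau> (\<tau> y) \<noteq> \<tau> (\<tau> z)"
    proof -
      have m: "\<tau> w \<in> L w" "\<tau> (\<tau> w) \<in> L w" for w by (auto simp: L_def)
      show "\<tau> x \<noteq> \<tau> y" "\<tau> x \<noteq> \<tau> (\<tau> y)" "\<tau> (\<tau> x) \<noteq> \<tau> y" "\<tau> (\<tau> x) \<noteq> \<tau> (\<tau> y)"
        using dj(1) m by (metis disjoint_iff)+
      show "\<tau> x \<noteq> \<tau> z" "\<tau> x \<noteq> \<tau> (\<tau> z)" "\<tau> (\<tau> x) \<noteq> \<tau> z" "\<tau> (\<tau> x) \<noteq> \<tau> (\<tau> z)"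
        using dj(2) m by (metis disjoint_iff)+
      show "\<tau> y \<noteq> \<tau> z" "\<tau> y \<noteq> \<tau> (\<tau> z)" "\<tau> (\<tau> y) \<noteq> \<tau> z" "\<tau> (\<tau> y) \<noteq> \<tau> (\<tau> z)"
        using dj(3) m by (metis disjoint_iff)+
    qed
    have NX: "\<sigma> (\<tau> w) \<noteq> \<tau> (\<tau> w)" "\<sigma> (\<tau> (\<tau> w)) \<noteq> \<tau> w" "\<sigma> (\<tau> w) \<noteq> \<tau> w" "\<sigma> (\<tau> (\<tau> w)) \<noteq> \<tau> (\<tau> w)" if "w \<in> R" for w
      using nofix[OF Rt[OF that]] nofix[OF Rt[OF Rt[OF that]]] R3[OF Rt[OF that]] by auto
    have P: "\<phi> p = \<tau> (\<sigma> p)" for p by (simp add: \<phi>_def)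
    have two: "(\<phi> ^^ 2) p = \<phi> (\<phi> p)" "(\<phi> ^^ 1) p = \<phi> p" for p by (simp_all add: eval_nat_numeral)
    from xy consider (1) "\<sigma> (\<tau> x) = \<tau> y" | (2) "\<sigma> (\<tau> x) = \<tau> (\<tau> y)" by blast
    then show False
    proof cases
      case 1
      then have h1: "\<sigma> (\<tau> y) = \<tau> x" using S by metis
      have "\<sigma> (\<tau> (\<tau> x)) \<in> {\<tau> z, \<tau> (\<tau> z)}"
      proof -
        have "\<sigma> (\<tau> (\<tau> x)) \<noteq> \<tau> (\<tau> y)"
        proof
          assume h: "\<sigma> (\<tau> (\<tau> x)) = \<tau> (\<tau> y)"
          then have "\<sigma> (\<tau> (\<tau> y)) = \<tau> (\<tau> x)" using S by metis
          then have "\<sigma> (\<tau> z) \<notin> {\<tau> x, \<tau> (\<tau> x), \<tau> y, \<tau> (\<tau> y)}" using S 1 h1 h DJ by (metis insert_iff singletonD)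
          then show False using tgt[of "\<tau> z"] NX[OF xR(3)] by auto
        qed
        moreover have "\<sigma> (\<tau> (\<tau> x)) \<noteq> \<tau> y" using h1 S D by metis
        ultimately show ?thesis using tgt[of "\<tau> (\<tau> x)"] NX[OF xR(1)] by auto
      qed
      then consider (a) "\<sigma> (\<tau> (\<tau> x)) = \<tau> z" | (b) "\<sigma> (\<tau> (\<tau> x)) = \<tau> (\<tau> z)" by blast
      then show False
      proof cases
        case a
        then have a': "\<sigma> (\<tau> z) = \<tau> (\<tau> x)" using S by metis
        have "\<sigma> (\<tau> (\<tau> y)) \<noteq> \<tau> z" "\<sigma> (\<tau> (\<tau> y)) \<noteq> \<tau> x" "\<sigma> (\<tau> (\<tau> y)) \<noteq> \<tau> (\<tau> x)" using S a a' 1 h1 DJ D by metis+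
        then have b: "\<sigma> (\<tau> (\<tau> y)) = \<tau> (\<tau> z)" using tgt[of "\<tau> (\<tau> y)"] NX[OF xR(2)] by auto
        then have b': "\<sigma> (\<tau> (\<tau> z)) = \<tau> (\<tau> y)" using S by metis
        have "\<phi> (\<tau> y) = \<tau> (\<tau> x)" "\<phi> (\<tau> (\<tau> x)) = \<tau> (\<tau> z)" "\<phi> (\<tau> (\<tau> z)) = y"
          unfolding P using h1 a b' S by simp_all
        then show False using cyc_leaf[OF xyz(2), of "\<tau> (\<tau> z)" 2] two by simp
      next
        case b
        then have a': "\<sigma> (\<tau> (\<tau> z)) = \<tau> (\<tau> x)" using S by metis
        have "\<sigma> (\<tau> (\<tau> y)) \<noteq> \<tau> (\<tau> z)" "\<sigma> (\<tau> (\<tau> y)) \<noteq> \<tau> x" "\<sigma> (\<tau> (\<tau> y)) \<noteq> \<tau> (\<tau> x)" using S b a' 1 h1 DJ D by metis+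
        then have b: "\<sigma> (\<tau> (\<tau> y)) = \<tau> z" using tgt[of "\<tau> (\<tau> y)"] NX[OF xR(2)] by auto
        have "\<phi> (\<tau> x) = \<tau> (\<tau> y)" "\<phi> (\<tau> (\<tau> y)) = \<tau> (\<tau> z)" "\<phi> (\<tau> (\<tau> z)) = x"
          unfolding P using 1 a' b S by simp_all
        then show False using cyc_leaf[OF xyz(1), of "\<tau> (\<tau> z)" 2] two by simp
      qed
    next
      case 2
      then have h2: "\<sigma> (\<tau> (\<tau> y)) = \<tau> x" using S by metis
      have "\<sigma> (\<tau> (\<tau> x)) \<in> {\<tau> z, \<tau> (\<tau> z)}"
      proof -
        have "\<sigma> (\<tau> (\<tau> x)) \<noteq> \<tau> y"
        proof
          assume h: "\<sigma> (\<tau> (\<tau> x)) = \<tau> y"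
          then have "\<sigma> (\<tau> y) = \<tau> (\<tau> x)" using S by metis
          then have "\<sigma> (\<tau> z) \<notin> {\<tau> x, \<tau> (\<tau> x), \<tau> y, \<tau> (\<tau> y)}" using S 2 h2 h DJ by (metis insert_iff singletonD)
          then show False using tgt[of "\<tau> z"] NX[OF xR(3)] by auto
        qed
        moreover have "\<sigma> (\<tau> (\<tau> x)) \<noteq> \<tau> (\<tau> y)" using h2 S D by metis
        ultimately show ?thesis using tgt[of "\<tau> (\<tau> x)"] NX[OF xR(1)] by auto
      qed
      then consider (a) "\<sigma> (\<tau> (\<tau> x)) = \<tau> z" | (b) "\<sigma> (\<tau> (\<tau> x)) = \<tau> (\<tau> z)" by blast
      then show False
      proof cases
        case a
        then have a': "\<sigma> (\<tau> z) = \<tau> (\<tau> x)" using S by metis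
        have "\<sigma> (\<tau> y) \<noteq> \<tau> z" "\<sigma> (\<tau> y) \<noteq> \<tau> x" "\<sigma> (\<tau> y) \<noteq> \<tau> (\<tau> x)" using S a a' 2 h2 DJ D by metis+
        then have b: "\<sigma> (\<tau> y) = \<tau> (\<tau> z)" using tgt[of "\<tau> y"] NX[OF xR(2)] by auto
        then have b': "\<sigma> (\<tau> (\<tau> z)) = \<tau> y" using S by metis
        have "\<phi> (\<tau> (\<tau> x)) = \<tau> (\<tau> z)" "\<phi> (\<tau> (\<tau> z)) = \<tau> (\<tau> y)" "\<phi> (\<tau> (\<tau> y)) = \<tau> (\<tau> x)"
          unfolding P using a b' h2 by simp_all
        then show False using cyc[of "\<tau> (\<tau> x)" "\<tau> (\<tau> y)" 2] two Rt xR by simp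
      next
        case b
        then have a': "\<sigma> (\<tau> (\<tau> z)) = \<tau> (\<tau> x)" using S by metis
        have "\<sigma> (\<tau> y) \<noteq> \<tau> (\<tau> z)" "\<sigma> (\<tau> y) \<noteq> \<tau> x" "\<sigma> (\<tau> y) \<noteq> \<tau> (\<tau> x)" using S b a' 2 h2 DJ D by metis+
        then have b1: "\<sigma> (\<tau> y) = \<tau> z" using tgt[of "\<tau> y"] NX[OF xR(2)] by auto
        then have b': "\<sigma> (\<tau> z) = \<tau> y" using S by metis
        have "\<phi> (\<tau> z) = \<tau> (\<tau> y)" "\<phi> (\<tau> (\<tau> y)) = \<tau> (\<tau> x)" "\<phi> (\<tau> (\<tau> x)) = z"
          unfolding P using b b' h2 S by simp_all
        then show False using cyc_leaf[OF xyz(3), of "\<tau> (\<tau> x)" 2] two by simp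
      qed
    qed
  qed
  have L3: "card (L x) = 3" if "x \<in> R" for x using L_card[of x] Ru(1)[OF that] RF that by blast
  have finL: "finite (L x)" for x by (simp add: L_def)
  \<comment> \<open>Two pieces sit at the vertex of \<open>x\<close> and the third at that of
    \<open>z\<close>, so the vertex of \<open>r\<close> carries none. Its three half-edges go to the
    three that are still free elsewhere, two of them to \<open>z\<close>. This double edge encloses
    a face with at most one detour, which is too short.\<close>
  have together: False
    if xz: "x \<in> {c, d, e}" "\<tau> x \<in> {c, d, e}" "\<tau> (\<tau> x) \<notin> {c, d, e}" "z \<in> {c, d, e}" "z \<notin> L x" for x z
  proof -
    have xR: "x \<in> R" "z \<in> R" using xz cdeR by auto
    have e3: "{c, d, e} = {x, \<tau> x, z}"
      using xz Rdist(1)[OF xR(1)] by (auto simp: L_def)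
    have Lxz: "L x \<inter> L z = {}" using Ldisj xz xR RF by blast
    have c6: "card (L x \<union> L z) = 6"
      using card_Un_disjoint[OF finL finL Lxz] L3[OF xR(1)] L3[OF xR(2)] by simp
    have "\<not> R \<subseteq> L x \<union> L z"
    proof
      assume "R \<subseteq> L x \<union> L z"
      then have "card R \<le> card (L x \<union> L z)" by (intro card_mono) (auto simp: L_def)
      then show False using c6 R9 by simp
    qed
    then obtain r where r: "r \<in> R" "r \<notin> L x" "r \<notin> L z" by blast
    have rF: "r \<in> F" "x \<in> F" "z \<in> F" using r xR RF by auto
    have dj: "L x \<inter> L r = {}" "L z \<inter> L r = {}" using Ldisj[OF rF(2,1)] Ldisj[OF rF(3,1)] r by auto
    have "(L x \<union> L z) \<inter> L r = {}" using dj by blast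
    then have "card (L x \<union> L z \<union> L r) = 9"
      using card_Un_disjoint[of "L x \<union> L z" "L r"] finL c6 L3[OF r(1)] by simp
    then have RU: "R = L x \<union> L z \<union> L r"
      using R9 LR[OF xR(1)] LR[OF xR(2)] LR[OF r(1)] by (intro card_subset_eq[symmetric] finR) auto
    have tgt: "\<sigma> p \<in> {\<tau> (\<tau> x), \<tau> z, \<tau> (\<tau> z)}" if p: "p \<in> L r" for p
    proof -
      have pR: "p \<in> R" using LR[OF r(1)] p by blast
      have "p \<notin> {c, d, e}" unfolding e3 using p dj by (auto simp: L_def)
      then have s: "\<sigma> p \<in> R" "\<sigma> p \<notin> {x, \<tau> x, z}" using Rs[OF pR] e3 by auto
      moreover have "L r = {p, \<tau> p, \<tau> (\<tau> p)}" using L_eq[OF rF(1) p] by (simp add: L_def)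
      then have "\<sigma> p \<notin> L r" using nofix[OF pR] by auto
      ultimately show ?thesis unfolding RU by (auto simp: L_def)
    qed
    have "inj_on \<sigma> (L r)" using sinj LF[OF rF(1)] by (auto simp: inj_on_def)
    then have "card (\<sigma> ` L r) = 3" using L_card[OF rF(1)] Ru[OF r(1)] by (simp add: card_image)
    moreover have "\<sigma> ` L r \<subseteq> {\<tau> (\<tau> x), \<tau> z, \<tau> (\<tau> z)}" using tgt by blast
    ultimately have "\<sigma> ` L r = {\<tau> (\<tau> x), \<tau> z, \<tau> (\<tau> z)}"
      by (intro card_seteq) (auto simp: card_insert_if)
    then obtain p where p: "p \<in> L r" "\<sigma> p = \<tau> (\<tau> x)" by (metis imageE insertI1)
    have pR: "p \<in> R" "p \<in> F" using LR[OF r(1)] p RF by auto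
    have q: "\<tau> p \<in> L r" "\<tau> (\<tau> p) \<in> L r" using L_t[OF rF(1)] p by auto
    have D: "\<tau> p \<noteq> p" "\<tau> (\<tau> p) \<noteq> p" "\<tau> (\<tau> p) \<noteq> \<tau> p" using Rdist[OF pR(1)] by auto
    have qF: "\<tau> p \<in> F" "\<tau> (\<tau> p) \<in> F" using sF pR by auto
    have "\<sigma> (\<tau> p) \<noteq> \<tau> (\<tau> x)" "\<sigma> (\<tau> (\<tau> p)) \<noteq> \<tau> (\<tau> x)" "\<sigma> (\<tau> p) \<noteq> \<sigma> (\<tau> (\<tau> p))"
      using sinj[of "\<tau> p" p] sinj[of "\<tau> (\<tau> p)" p] sinj[of "\<tau> p" "\<tau> (\<tau> p)"] p(2) D pR(2) qF by auto
    then consider (i) "\<sigma> (\<tau> p) = \<tau> z" "\<sigma> (\<tau> (\<tau> p)) = \<tau> (\<tau> z)" | (ii) "\<sigma> (\<tau> p) = \<tau> (\<tau> z)" "\<sigma> (\<tau> (\<tau> p)) = \<tau> z"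
      using tgt[OF q(1)] tgt[OF q(2)] by auto
    then show False
    proof cases
      case i
      have "\<sigma> (\<tau> z) = \<tau> p" using i ss(1)[OF qF(1)] by simp
      then have "\<phi> (\<tau> z) = \<tau> (\<tau> p)" "\<phi> (\<tau> (\<tau> p)) = z" using i R3[OF xR(2)] by (simp_all add: \<phi>_def)
      then show False using cyc_leaf[OF xz(4), of "\<tau> (\<tau> p)" 1] by simp
    next
      case ii
      have "\<sigma> (\<tau> (\<tau> z)) = \<tau> p" using ii ss(1)[OF qF(1)] by simp
      then have "\<phi> (\<tau> (\<tau> z)) = \<tau> (\<tau> p)" "\<phi> (\<tau> (\<tau> p)) = \<tau> (\<tau> z)" using ii by (simp_all add: \<phi>_def)
      then show False using cyc[OF Rt[OF Rt[OF pR(1)]], of "\<tau> (\<tau> z)" 1] by simp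
    qed
  qed
  \<comment> \<open>Reduces to \<open>together\<close> by letting the one of \<open>p\<close> and
    \<open>q\<close> come first whose image under \<open>\<tau>\<close> is the other.\<close>
  have pair: False
    if pq: "p \<in> {c, d, e}" "q \<in> {c, d, e}" "z \<in> {c, d, e}" "p \<noteq> q" "q \<in> L p" "z \<notin> L p" for p q z
  proof -
    have pR: "p \<in> R" "p \<in> F" "q \<in> R" using pq cdeR RF by auto
    have e3: "{c, d, e} = {p, q, z}" using pq dist by (auto simp: L_def)
    consider (1) "q = \<tau> p" | (2) "q = \<tau> (\<tau> p)" using pq by (auto simp: L_def)
    then show False
    proof cases
      case 1
      have "\<tau> (\<tau> p) \<notin> {c, d, e}" unfolding e3 1 using Rdist[OF pR(1)] pq(6) by (auto simp: L_def)
      then show False using together[of p z] 1 pq by simp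
    next
      case 2
      have "\<tau> q = p" using 2 R3[OF pR(1)] by simp
      moreover have "\<tau> p \<notin> {c, d, e}" unfolding e3 2 using Rdist[OF pR(1)] pq(6) by (auto simp: L_def)
      moreover have "z \<notin> L q" using L_eq[OF pR(2) pq(5)] pq(6) by simp
      ultimately show False using together[of q z] pq by simp
    qed
  qed
  show False
  proof (cases "d \<in> L c")
    case True
    \<comment> \<open>When two pieces share a vertex, \<open>pair\<close> forces the third one there
      too, and then the other 6 points of \<open>R\<close> are cut off.\<close>
    have "e \<in> L c" using pair[of c d e] True dist by blast
    then have "{c, d, e} \<subseteq> L c" using True by (auto simp: L_def)
    moreover have "card {c, d, e} = 3" using dist by simp
    ultimately have Lc: "L c = {c, d, e}"
      using L3[OF cdeR(1)] by (intro card_subset_eq[symmetric] finL) auto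
    have "card (R - L c) = 6" using R9 Lc cdeR \<open>card {c, d, e} = 3\<close> by (subst card_Diff_subset) auto
    then have "R - L c \<noteq> {}" by force
    then obtain x where x: "x \<in> R - L c" by blast
    have "x \<notin> R - L c"
    proof (rule closed_small)
      show "R - L c \<subseteq> F" using RF by blast
      show "\<sigma> y \<in> R - L c" if "y \<in> R - L c" for y using Rs[of y] that unfolding Lc by blast
      show "\<tau> y \<in> R - L c" if "y \<in> R - L c" for y
      proof -
        have "\<tau> y \<notin> L c"
        proof
          assume "\<tau> y \<in> L c"
          then have "\<tau> (\<tau> (\<tau> y)) \<in> L c" using L_t[OF cF(1)] by blast
          then show False using R3(1)[of y] that by simp
        qed
        then show ?thesis using Rt that by blast
      qed
      show "card (R - L c) < 16" using \<open>card (R - L c) = 6\<close> by simp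
    qed
    then show False using x by blast
  next
    case False
    have ec: "e \<notin> L c" using pair[of c e d] False dist by blast
    have ed: "e \<notin> L d"
    proof
      assume "e \<in> L d"
      moreover have "c \<notin> L d" using False L_eq[OF cF(2), of c] by (auto simp: L_def)
      ultimately show False using pair[of d e c] dist by blast
    qed
    have dj: "L c \<inter> L d = {}" "L c \<inter> L e = {}" "L d \<inter> L e = {}"
      using Ldisj cF False ec ed by blast+
    have 9: "card (L c \<union> L d \<union> L e) = 9"
    proof -
      have "card (L c \<union> L d) = 6" using card_Un_disjoint[OF finL finL dj(1)] L3 cdeR by simp
      moreover have "(L c \<union> L d) \<inter> L e = {}" using dj by blast
      ultimately show ?thesis using card_Un_disjoint[of "L c \<union> L d" "L e"] finL L3[OF cdeR(3)] by simp
    qed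
    then have RU: "R = L c \<union> L d \<union> L e"
      using R9 LR cdeR by (intro card_subset_eq[symmetric] finR) auto
    have tcR: "\<tau> c \<in> R" using Rt cdeR by blast
    have "\<tau> c \<notin> {c, d, e}" using Rdist[OF cdeR(1)] dj by (auto simp: L_def)
    then have "\<sigma> (\<tau> c) \<in> R" "\<sigma> (\<tau> c) \<notin> {c, d, e}" using Rs[OF tcR] by auto
    moreover have "\<sigma> (\<tau> c) \<notin> L c" using nofix[OF tcR] R3[OF cdeR(1)] by (auto simp: L_def)
    ultimately have "\<sigma> (\<tau> c) \<in> {\<tau> d, \<tau> (\<tau> d)} \<or> \<sigma> (\<tau> c) \<in> {\<tau> e, \<tau> (\<tau> e)}"
      unfolding RU by (auto simp: L_def)
    then show False
    proof
      assume "\<sigma> (\<tau> c) \<in> {\<tau> d, \<tau> (\<tau> d)}"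
      then show False using sep[of c d e] RU dj by blast
    next
      assume h: "\<sigma> (\<tau> c) \<in> {\<tau> e, \<tau> (\<tau> e)}"
      have "R = L c \<union> L e \<union> L d" "L e \<inter> L d = {}" using RU dj by auto
      then show False using sep[of c e d] h dj by blast
    qed
  qed
qed

section \<open>The sphere as the projective line\<close>

text \<open>Inverse stereographic projection of \<open>a / b\<close> in homogeneous coordinates,
  also known as the Hopf map. The north pole is \<open>b = 0\<close>, so infinity needs no separate
  formula.\<close>

definition sph :: "complex \<Rightarrow> complex \<Rightarrow> nat \<Rightarrow> real" where
  "sph a b i = (if i = 0 then 2 * Re (a * cnj b) / ((cmod a)\<^sup>2 + (cmod b)\<^sup>2)
     else if i = 1 then 2 * Im (a * cnj b) / ((cmod a)\<^sup>2 + (cmod b)\<^sup>2)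
     else if i = 2 then ((cmod a)\<^sup>2 - (cmod b)\<^sup>2) / ((cmod a)\<^sup>2 + (cmod b)\<^sup>2) else 0)"

text \<open>Collects what the treatment of rational maps uses: homogeneous coordinates and the two
  affine charts. It is stated for an arbitrary topology so that it can be carried to every space
  homeomorphic to the sphere.\<close>

definition proj_line :: "'a topology \<Rightarrow> (complex \<Rightarrow> complex \<Rightarrow> 'a) \<Rightarrow> bool" where
  "proj_line X \<pi> \<longleftrightarrow> topspace X = {\<pi> a b | a b. a \<noteq> 0 \<or> b \<noteq> 0} \<and>
     (\<forall>a b c d. a \<noteq> 0 \<or> b \<noteq> 0 \<longrightarrow> c \<noteq> 0 \<or> d \<noteq> 0 \<longrightarrow> \<pi> a b = \<pi> c d \<longleftrightarrow> a * d = b * c) \<and>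
     openin X (range (\<lambda>z. \<pi> z 1)) \<and> openin X (range (\<lambda>z. \<pi> 1 z)) \<and>
     homeomorphic_map euclidean (subtopology X (range (\<lambda>z. \<pi> z 1))) (\<lambda>z. \<pi> z 1) \<and>
     homeomorphic_map euclidean (subtopology X (range (\<lambda>z. \<pi> 1 z))) (\<lambda>z. \<pi> 1 z)"

lemma topspace_nsphere_2: "topspace (nsphere 2) = {x. (x 0)\<^sup>2 + (x 1)\<^sup>2 + (x 2)\<^sup>2 = 1 \<and> (\<forall>i>2. x i = (0::real))}"
  by (auto simp: nsphere eval_nat_numeral)

lemma nsphere_2_top_of_set: "nsphere 2 = top_of_set {x. (x 0)\<^sup>2 + (x 1)\<^sup>2 + (x 2)\<^sup>2 = 1 \<and> (\<forall>i>2. x i = (0::real))}"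
  by (simp add: nsphere euclidean_product_topology eval_nat_numeral)

lemma norm_sum_pos: "a \<noteq> 0 \<or> b \<noteq> 0 \<Longrightarrow> (cmod a)\<^sup>2 + (cmod b)\<^sup>2 > 0"
  by (metis add_nonneg_pos add_pos_nonneg zero_le_power2 zero_less_norm_iff zero_less_power)

lemma norm_sum_neq: "a \<noteq> 0 \<or> b \<noteq> 0 \<Longrightarrow> (cmod a)\<^sup>2 + (cmod b)\<^sup>2 \<noteq> 0"
  using norm_sum_pos by (metis less_irrefl)

lemma sph_in: assumes "a \<noteq> 0 \<or> b \<noteq> 0" shows "sph a b \<in> topspace (nsphere 2)"
proof -
  define N where "N = (cmod a)\<^sup>2 + (cmod b)\<^sup>2"
  have N: "N > 0" using norm_sum_pos[OF assms] by (simp add: N_def)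
  have "(2 * Re (a * cnj b))\<^sup>2 + (2 * Im (a * cnj b))\<^sup>2 + ((cmod a)\<^sup>2 - (cmod b)\<^sup>2)\<^sup>2 = N\<^sup>2"
    unfolding N_def cmod_power2 by (simp add: algebra_simps power2_eq_square)
  then have "(2 * Re (a * cnj b) / N)\<^sup>2 + (2 * Im (a * cnj b) / N)\<^sup>2 + (((cmod a)\<^sup>2 - (cmod b)\<^sup>2) / N)\<^sup>2 = 1"
    using N by (simp only: power_divide add_divide_distrib[symmetric]) (simp add: less_imp_neq[symmetric])
  moreover have "sph a b 0 = 2 * Re (a * cnj b) / N" "sph a b 1 = 2 * Im (a * cnj b) / N"
    "sph a b 2 = ((cmod a)\<^sup>2 - (cmod b)\<^sup>2) / N" "\<forall>i>2. sph a b i = 0"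
    by (simp_all add: sph_def N_def)
  ultimately show ?thesis unfolding topspace_nsphere_2 by simp
qed

lemma sph_stereo:
  assumes "a \<noteq> 0 \<or> b \<noteq> 0"
  shows "1 - sph a b 2 = 2 * (cmod b)\<^sup>2 / ((cmod a)\<^sup>2 + (cmod b)\<^sup>2)"
    "1 + sph a b 2 = 2 * (cmod a)\<^sup>2 / ((cmod a)\<^sup>2 + (cmod b)\<^sup>2)"
    "Complex (sph a b 0) (sph a b 1) = 2 * (a * cnj b) / of_real ((cmod a)\<^sup>2 + (cmod b)\<^sup>2)"
proof -
  have N: "(cmod a)\<^sup>2 + (cmod b)\<^sup>2 \<noteq> 0" using norm_sum_neq[OF assms] .
  show "1 - sph a b 2 = 2 * (cmod b)\<^sup>2 / ((cmod a)\<^sup>2 + (cmod b)\<^sup>2)"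
    "1 + sph a b 2 = 2 * (cmod a)\<^sup>2 / ((cmod a)\<^sup>2 + (cmod b)\<^sup>2)"
    using N assms by (auto simp: sph_def field_simps)
  show "Complex (sph a b 0) (sph a b 1) = 2 * (a * cnj b) / of_real ((cmod a)\<^sup>2 + (cmod b)\<^sup>2)"
    by (simp add: complex_eq_iff sph_def Re_divide_of_real Im_divide_of_real)
qed

lemma stereo_north:
  assumes "b \<noteq> 0"
  shows "Complex (sph a b 0) (sph a b 1) / of_real (1 - sph a b 2) = a / b"
proof -
  define N where "N = (cmod a)\<^sup>2 + (cmod b)\<^sup>2"
  have nz: "a \<noteq> 0 \<or> b \<noteq> 0" using assms by simp
  have N: "N \<noteq> 0" unfolding N_def by (rule norm_sum_neq[OF nz])
  have "Complex (sph a b 0) (sph a b 1) / of_real (1 - sph a b 2) = (2 * (a * cnj b) / of_real N) / (2 * of_real ((cmod b)\<^sup>2) / of_real N)"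
    unfolding sph_stereo[OF nz] N_def[symmetric] by simp
  also have "\<dots> = a * cnj b / of_real ((cmod b)\<^sup>2)" using N assms by (simp add: field_simps)
  also have "\<dots> = a * cnj b / (b * cnj b)" by (simp only: complex_norm_square)
  also have "\<dots> = a / b" using assms by simp
  finally show ?thesis .
qed

lemma stereo_south:
  assumes "a \<noteq> 0"
  shows "Complex (sph a b 0) (- sph a b 1) / of_real (1 + sph a b 2) = b / a"
proof -
  define N where "N = (cmod a)\<^sup>2 + (cmod b)\<^sup>2"
  have nz: "a \<noteq> 0 \<or> b \<noteq> 0" using assms by simp
  have N: "N \<noteq> 0" unfolding N_def by (rule norm_sum_neq[OF nz])
  have "Complex (sph a b 0) (- sph a b 1) = cnj (Complex (sph a b 0) (sph a b 1))" by (simp add: complex_eq_iff)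
  also have "\<dots> = 2 * (b * cnj a) / of_real N" unfolding sph_stereo(3)[OF nz] N_def by (simp add: mult.commute)
  finally have "Complex (sph a b 0) (- sph a b 1) / of_real (1 + sph a b 2) = (2 * (b * cnj a) / of_real N) / (2 * of_real ((cmod a)\<^sup>2) / of_real N)"
    unfolding sph_stereo(2)[OF nz] N_def[symmetric] by simp
  also have "\<dots> = b * cnj a / of_real ((cmod a)\<^sup>2)" using N assms by (simp add: field_simps)
  also have "\<dots> = b * cnj a / (a * cnj a)" by (simp only: complex_norm_square)
  also have "\<dots> = b / a" using assms by simp
  finally show ?thesis .
qed

lemma sph_scale: "c \<noteq> 0 \<Longrightarrow> sph (c * a) (c * b) = sph a b"
proof
  fix i assume c: "c \<noteq> 0"
  have N: "(cmod (c * a))\<^sup>2 + (cmod (c * b))\<^sup>2 = (cmod c)\<^sup>2 * ((cmod a)\<^sup>2 + (cmod b)\<^sup>2)"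
    by (simp add: norm_mult power_mult_distrib algebra_simps)
  have M: "(cmod (c * a))\<^sup>2 - (cmod (c * b))\<^sup>2 = (cmod c)\<^sup>2 * ((cmod a)\<^sup>2 - (cmod b)\<^sup>2)"
    by (simp add: norm_mult power_mult_distrib algebra_simps)
  have e: "c * a * cnj (c * b) = of_real ((cmod c)\<^sup>2) * (a * cnj b)"
    by (simp add: complex_norm_square[unfolded of_real_power] mult_ac)
  have R: "Re (c * a * cnj (c * b)) = (cmod c)\<^sup>2 * Re (a * cnj b)" "Im (c * a * cnj (c * b)) = (cmod c)\<^sup>2 * Im (a * cnj b)"
    by (subst e, simp)+
  have c2: "(cmod c)\<^sup>2 \<noteq> 0" using c by simp
  show "sph (c * a) (c * b) i = sph a b i"
    unfolding sph_def N M R using c2 by (simp add: mult.left_commute[of 2] del: times_complex.sel mult_eq_0_iff)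
qed

lemma sph_eq_iff:
  assumes "a \<noteq> 0 \<or> b \<noteq> 0" "c \<noteq> 0 \<or> d \<noteq> 0"
  shows "sph a b = sph c d \<longleftrightarrow> a * d = b * c"
proof
  assume eq: "sph a b = sph c d"
  have "b = 0 \<longleftrightarrow> sph a b 2 = 1"
    using sph_stereo(1)[OF assms(1)] norm_sum_neq[OF assms(1)] by auto
  moreover have "d = 0 \<longleftrightarrow> sph c d 2 = 1"
    using sph_stereo(1)[OF assms(2)] norm_sum_neq[OF assms(2)] by auto
  ultimately have bd: "b = 0 \<longleftrightarrow> d = 0" using eq by simp
  show "a * d = b * c"
  proof (cases "b = 0")
    case False
    then have "a / b = c / d" using stereo_north[of b a] stereo_north[of d c] eq bd by simp
    then show ?thesis using False bd by (simp add: field_simps)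
  qed (use bd in simp)
next
  assume eq: "a * d = b * c"
  have "\<exists>l. l \<noteq> 0 \<and> a = l * c \<and> b = l * d"
  proof (cases "d = 0")
    case True
    then have "c \<noteq> 0" "b = 0" "a \<noteq> 0" using eq assms by auto
    then show ?thesis using True by (intro exI[of _ "a / c"]) auto
  next
    case False
    have "b \<noteq> 0" using eq assms False by auto
    then show ?thesis using False eq by (intro exI[of _ "b / d"]) (auto simp: field_simps)
  qed
  then show "sph a b = sph c d" using sph_scale by metis
qed

lemma sph_surj:
  assumes "x \<in> topspace (nsphere 2)"
  shows "\<exists>a b. (a \<noteq> 0 \<or> b \<noteq> 0) \<and> x = sph a b"
proof -
  have x: "(x 0)\<^sup>2 + (x 1)\<^sup>2 + (x 2)\<^sup>2 = 1" "\<And>i. i > 2 \<Longrightarrow> x i = 0" using assms by (auto simp: topspace_nsphere_2)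
  show ?thesis
  proof (cases "x 2 = 1")
    case True
    then have "x 0 = 0" "x 1 = 0" using x(1) by (auto simp: sum_power2_eq_zero_iff)
    then have "x = sph 1 0" using True x(2)
      by (intro ext) (auto simp: sph_def numeral_2_eq_2 not_less less_Suc_eq_le le_Suc_eq)
    then show ?thesis by (intro exI[of _ 1] exI[of _ 0]) simp
  next
    case False
    \<comment> \<open>Stereographic projection from the north pole, with \<open>a\<close> as
      numerator and \<open>b\<close> as denominator.\<close>
    define a b where "a = Complex (x 0) (x 1)" and "b = complex_of_real (1 - x 2)"
    have b0: "b \<noteq> 0" using False unfolding b_def by (simp del: of_real_diff)
    have Na: "(cmod a)\<^sup>2 = (1 - x 2) * (1 + x 2)" using x(1) unfolding a_def cmod_power2
      by (simp add: algebra_simps power2_eq_square)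
    have Nb: "(cmod b)\<^sup>2 = (1 - x 2) * (1 - x 2)" unfolding b_def norm_of_real by (simp add: power2_eq_square)
    have N: "(cmod a)\<^sup>2 + (cmod b)\<^sup>2 = 2 * (1 - x 2)" unfolding Na Nb by (simp add: algebra_simps)
    have D: "(cmod a)\<^sup>2 - (cmod b)\<^sup>2 = 2 * (1 - x 2) * x 2" unfolding Na Nb by (simp add: algebra_simps)
    have R: "Re (a * cnj b) = x 0 * (1 - x 2)" "Im (a * cnj b) = x 1 * (1 - x 2)"
      by (simp_all add: a_def b_def)
    have "x i = sph a b i" for i
    proof -
      consider "i = 0" | "i = 1" | "i = 2" | "i > 2" by linarith
      then show ?thesis unfolding sph_def N D R using False x(2) by cases (auto simp: field_simps)
    qed
    then show ?thesis using b0 by (intro exI[of _ a] exI[of _ b]) auto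
  qed
qed

lemma continuous_map_sph:
  assumes "continuous_on UNIV p" "continuous_on UNIV q" "\<And>z. p z \<noteq> 0 \<or> q z \<noteq> 0"
  shows "continuous_map (euclidean :: complex topology) (nsphere 2) (\<lambda>z. sph (p z) (q z))"
proof -
  have N: "(cmod (p z))\<^sup>2 + (cmod (q z))\<^sup>2 \<noteq> 0" for z using norm_sum_neq[OF assms(3)[of z]] .
  have "continuous_on UNIV (\<lambda>z. sph (p z) (q z) i)" for i
  proof -
    consider "i = 0" | "i = 1" | "i = 2" | "i > 2" by linarith
    moreover have "continuous_on UNIV (\<lambda>z. 2 * Re (p z * cnj (q z)) / ((cmod (p z))\<^sup>2 + (cmod (q z))\<^sup>2))"
      "continuous_on UNIV (\<lambda>z. 2 * Im (p z * cnj (q z)) / ((cmod (p z))\<^sup>2 + (cmod (q z))\<^sup>2))"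
      "continuous_on UNIV (\<lambda>z. ((cmod (p z))\<^sup>2 - (cmod (q z))\<^sup>2) / ((cmod (p z))\<^sup>2 + (cmod (q z))\<^sup>2))"
      using N by (intro continuous_intros assms; blast)+
    ultimately show ?thesis by cases (simp_all add: sph_def del: times_complex.sel)
  qed
  then have "continuous_map euclidean (powertop_real UNIV) (\<lambda>z. sph (p z) (q z))"
    by (simp add: continuous_map_componentwise_UNIV)
  moreover have "sph (p z) (q z) \<in> {x. (\<Sum>i\<le>2. (x i)\<^sup>2) = 1 \<and> (\<forall>i>2. x i = 0)}" for z
    using sph_in[OF assms(3)[of z]] by (simp add: nsphere)
  ultimately show ?thesis unfolding nsphere by (auto simp: continuous_map_in_subtopology)
qed

text \<open>The inverses of the two charts are the stereographic projections from the poles. The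
  southern one includes a complex conjugation, since the plain projection would recover the
  conjugate of \<open>z\<close> from \<open>sph 1 z\<close>.\<close>

lemma proj_line_nsphere: "proj_line (nsphere 2) sph"
  unfolding proj_line_def
proof (intro conjI allI impI)
  show "topspace (nsphere 2) = {sph a b |a b. a \<noteq> 0 \<or> b \<noteq> 0}"
    using sph_in sph_surj by blast
  show "sph a b = sph c d \<longleftrightarrow> a * d = b * c" if "a \<noteq> 0 \<or> b \<noteq> 0" "c \<noteq> 0 \<or> d \<noteq> 0" for a b c d
    using sph_eq_iff[OF that] .
  have r1: "range (\<lambda>z. sph z 1) = {x \<in> topspace (nsphere 2). x 2 \<in> - {1}}"
  proof (intro subset_antisym subsetI)
    fix x assume "x \<in> range (\<lambda>z. sph z 1)"
    then obtain z where "x = sph z 1" by auto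
    then show "x \<in> {x \<in> topspace (nsphere 2). x 2 \<in> - {1}}"
      using sph_in[of z 1] sph_stereo(1)[of z 1] norm_sum_neq[of z 1] by auto
  next
    fix x assume x: "x \<in> {x \<in> topspace (nsphere 2). x 2 \<in> - {1}}"
    then obtain a b where ab: "a \<noteq> 0 \<or> b \<noteq> 0" "x = sph a b" using sph_surj by blast
    then have "b \<noteq> 0" using x sph_stereo(1)[OF ab(1)] by auto
    then have "x = sph (a / b) 1" using ab sph_eq_iff[OF ab(1), of "a / b" 1] by simp
    then show "x \<in> range (\<lambda>z. sph z 1)" by blast
  qed
  have r2: "range (\<lambda>z. sph 1 z) = {x \<in> topspace (nsphere 2). x 2 \<in> - {-1}}"
  proof (intro subset_antisym subsetI)
    fix x assume "x \<in> range (\<lambda>z. sph 1 z)"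
    then obtain z where "x = sph 1 z" by auto
    then show "x \<in> {x \<in> topspace (nsphere 2). x 2 \<in> - {-1}}"
      using sph_in[of 1 z] sph_stereo(2)[of 1 z] norm_sum_neq[of 1 z] by auto
  next
    fix x assume x: "x \<in> {x \<in> topspace (nsphere 2). x 2 \<in> - {-1}}"
    then obtain a b where ab: "a \<noteq> 0 \<or> b \<noteq> 0" "x = sph a b" using sph_surj by blast
    then have "a \<noteq> 0" using x sph_stereo(2)[OF ab(1)] by auto
    then have "x = sph 1 (b / a)" using ab sph_eq_iff[OF ab(1), of 1 "b / a"] by simp
    then show "x \<in> range (\<lambda>z. sph 1 z)" by blast
  qed
  show "openin (nsphere 2) (range (\<lambda>z. sph z 1))" "openin (nsphere 2) (range (\<lambda>z. sph 1 z))"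
    unfolding r1 r2 by (rule openin_continuous_map_preimage[OF continuous_map_nsphere_projection]; simp add: open_Compl)+
  have coord: "continuous_on S (\<lambda>x :: nat \<Rightarrow> real. x i)" for S i
    by (rule continuous_on_subset[OF continuous_on_product_coordinates]) simp
  have "continuous_on (range (\<lambda>z. sph z 1)) (\<lambda>x. (of_real (x 0) + \<i> * of_real (x 1)) / complex_of_real (1 - x 2))"
    unfolding r1 by (intro continuous_intros coord) auto
  then have c1: "continuous_on (range (\<lambda>z. sph z 1)) (\<lambda>x. Complex (x 0) (x 1) / complex_of_real (1 - x 2))"
    by (simp add: Complex_eq)
  have "continuous_on (range (\<lambda>z. sph 1 z)) (\<lambda>x. (of_real (x 0) + \<i> * of_real (- x 1)) / complex_of_real (1 + x 2))"
  proof (intro continuous_intros coord ballI)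
    fix x assume "x \<in> range (\<lambda>z. sph 1 z)"
    then have "1 + x 2 \<noteq> 0" unfolding r2 by auto
    then show "complex_of_real (1 + x 2) \<noteq> 0" by (simp only: of_real_eq_0_iff not_False_eq_True)
  qed
  then have c2: "continuous_on (range (\<lambda>z. sph 1 z)) (\<lambda>x. Complex (x 0) (- x 1) / complex_of_real (1 + x 2))"
    by (simp add: Complex_eq)
  have st: "subtopology (nsphere 2) S = top_of_set S" if "S \<subseteq> topspace (nsphere 2)" for S
    using that unfolding topspace_nsphere_2 unfolding nsphere_2_top_of_set by (simp add: subtopology_subtopology Int_absorb1)
  have s1: "subtopology (nsphere 2) (range (\<lambda>z. sph z 1)) = top_of_set (range (\<lambda>z. sph z 1))"
    "subtopology (nsphere 2) (range (\<lambda>z. sph 1 z)) = top_of_set (range (\<lambda>z. sph 1 z))"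
    by (rule st; use sph_in in force)+
  show "homeomorphic_map euclidean (subtopology (nsphere 2) (range (\<lambda>z. sph z 1))) (\<lambda>z. sph z 1)"
    unfolding homeomorphic_map_maps
  proof (intro exI)
    show "homeomorphic_maps euclidean (subtopology (nsphere 2) (range (\<lambda>z. sph z 1))) (\<lambda>z. sph z 1)
       (\<lambda>x. Complex (x 0) (x 1) / complex_of_real (1 - x 2))"
      unfolding homeomorphic_maps_def
    proof (intro conjI)
      show "continuous_map euclidean (subtopology (nsphere 2) (range (\<lambda>z. sph z 1))) (\<lambda>z. sph z 1)"
        by (auto simp: continuous_map_in_subtopology intro!: continuous_map_sph continuous_intros)
      show "continuous_map (subtopology (nsphere 2) (range (\<lambda>z. sph z 1))) euclidean (\<lambda>x. Complex (x 0) (x 1) / complex_of_real (1 - x 2))"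
        unfolding s1 using c1 by simp
    qed (use stereo_north[of 1] in auto)
  qed
  show "homeomorphic_map euclidean (subtopology (nsphere 2) (range (\<lambda>z. sph 1 z))) (\<lambda>z. sph 1 z)"
    unfolding homeomorphic_map_maps
  proof (intro exI)
    show "homeomorphic_maps euclidean (subtopology (nsphere 2) (range (\<lambda>z. sph 1 z))) (\<lambda>z. sph 1 z)
       (\<lambda>x. Complex (x 0) (- x 1) / complex_of_real (1 + x 2))"
      unfolding homeomorphic_maps_def
    proof (intro conjI)
      show "continuous_map euclidean (subtopology (nsphere 2) (range (\<lambda>z. sph 1 z))) (\<lambda>z. sph 1 z)"
        by (auto simp: continuous_map_in_subtopology intro!: continuous_map_sph continuous_intros)
      show "continuous_map (subtopology (nsphere 2) (range (\<lambda>z. sph 1 z))) euclidean (\<lambda>x. Complex (x 0) (- x 1) / complex_of_real (1 + x 2))"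
        unfolding s1 using c2 by simp
    qed (use stereo_south[of 1] in auto)
  qed
qed

lemma proj_line_homeomorphic:
  assumes "proj_line X \<pi>" and h: "homeomorphic_map X Y h"
  shows "proj_line Y (\<lambda>a b. h (\<pi> a b))"
proof -
  note P = assms(1)[unfolded proj_line_def]
  have inj: "inj_on h (topspace X)" and sur: "h ` topspace X = topspace Y"
    using homeomorphic_imp_injective_map[OF h] homeomorphic_imp_surjective_map[OF h] by blast+
  have op: "openin Y (range (\<lambda>z. h (p z))) \<and> homeomorphic_map euclidean (subtopology Y (range (\<lambda>z. h (p z)))) (\<lambda>z. h (p z))"
    if p: "openin X (range p)" "homeomorphic_map euclidean (subtopology X (range p)) p" for p :: "complex \<Rightarrow> 'a"
  proof -
    have r: "range (\<lambda>z. h (p z)) = h ` range p" by auto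
    have "open_map X Y h" using h by (simp add: homeomorphic_imp_open_map)
    then have "openin Y (h ` range p)" using p(1) by (simp add: open_map_def)
    moreover have "homeomorphic_map (subtopology X (range p)) (subtopology Y (h ` range p)) h"
      by (rule homeomorphic_map_subtopologies_alt[OF h])
         (use openin_subset[OF p(1)] inj in \<open>auto simp: inj_on_def\<close>)
    then have "homeomorphic_map euclidean (subtopology Y (h ` range p)) (h \<circ> p)"
      using p(2) homeomorphic_map_compose by blast
    ultimately show ?thesis unfolding r by (simp add: comp_def)
  qed
  show ?thesis
    unfolding proj_line_def
  proof (intro conjI allI impI)
    show "topspace Y = {h (\<pi> a b) |a b. a \<noteq> 0 \<or> b \<noteq> 0}"
      unfolding sur[symmetric] P[THEN conjunct1] by blast
    fix a b c d :: complex assume nz: "a \<noteq> 0 \<or> b \<noteq> 0" "c \<noteq> 0 \<or> d \<noteq> 0"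
    then have "\<pi> a b \<in> topspace X" "\<pi> c d \<in> topspace X" using P by blast+
    then have "h (\<pi> a b) = h (\<pi> c d) \<longleftrightarrow> \<pi> a b = \<pi> c d" using inj by (auto simp: inj_on_def)
    then show "h (\<pi> a b) = h (\<pi> c d) \<longleftrightarrow> a * d = b * c" using P nz by blast
  next
    show "openin Y (range (\<lambda>z. h (\<pi> z 1)))" "homeomorphic_map euclidean (subtopology Y (range (\<lambda>z. h (\<pi> z 1)))) (\<lambda>z. h (\<pi> z 1))"
      using op[of "\<lambda>z. \<pi> z 1"] P by blast+
    show "openin Y (range (\<lambda>z. h (\<pi> 1 z)))" "homeomorphic_map euclidean (subtopology Y (range (\<lambda>z. h (\<pi> 1 z)))) (\<lambda>z. h (\<pi> 1 z))"
      using op[of "\<lambda>z. \<pi> 1 z"] P by blast+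
  qed
qed

lemma proj_line_exists:
  assumes "X homeomorphic_space nsphere 2"
  obtains \<pi> where "proj_line X \<pi>"
proof -
  have "nsphere 2 homeomorphic_space X" using assms homeomorphic_space_sym by blast
  then obtain h where "homeomorphic_map (nsphere 2) X h" using homeomorphic_space by blast
  then show ?thesis using proj_line_homeomorphic[OF proj_line_nsphere] that by blast
qed

text \<open>Invariance of domain makes an injective continuous change of coordinate \<open>g\<close>
  a homeomorphism onto an open set, so it may follow the inverse of the parametrization
  \<open>p\<close>.\<close>

lemma chart_param:
  assumes U: "openin X (range p)" and p: "homeomorphic_map (euclidean :: complex topology) (subtopology X (range p)) p"
    and T: "open T" "continuous_on T g" "inj_on g T"
  shows "chart X (p ` T) (g \<circ> inv_into UNIV p)" and "inj p"
proof -
  have rX: "topspace (subtopology X (range p)) = range p" using openin_subset[OF U] by auto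
  show inj: "inj p" using homeomorphic_imp_injective_map[OF p] by simp
  have "open_map euclidean (subtopology X (range p)) p" using p by (simp add: homeomorphic_imp_open_map)
  then have "openin (subtopology X (range p)) (p ` T)" using T by (simp add: open_map_def)
  then have o: "openin X (p ` T)" using U openin_trans_full by blast
  have og: "open (g ` T)" using invariance_of_domain T by blast
  have "homeomorphic_map (subtopology euclidean T) (subtopology (subtopology X (range p)) (p ` T)) p"
    by (rule homeomorphic_map_subtopologies_alt[OF p]) (use inj in \<open>auto simp: inj_on_def\<close>)
  then have "homeomorphic_map (top_of_set T) (subtopology X (p ` T)) p"
    by (simp add: subtopology_subtopology Int_absorb1 image_mono)
  then obtain q where q: "homeomorphic_maps (top_of_set T) (subtopology X (p ` T)) p q"
    using homeomorphic_map_maps by blast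
  have "inv_into UNIV p x = q x" if "x \<in> topspace (subtopology X (p ` T))" for x
    using q that inj by (auto simp: homeomorphic_maps_def)
  then have "homeomorphic_maps (top_of_set T) (subtopology X (p ` T)) p (inv_into UNIV p)"
    using homeomorphic_maps_eq[OF q, of p "inv_into UNIV p"] by simp
  then have 1: "homeomorphic_map (subtopology X (p ` T)) (top_of_set T) (inv_into UNIV p)"
    using homeomorphic_maps_map homeomorphic_maps_sym by metis
  obtain g' where "homeomorphism T (g ` T) g g'"
    using invariance_of_domain_homeomorphism[OF T(1,2) _ T(3)] by auto
  then have "homeomorphic_maps (top_of_set T) (top_of_set (g ` T)) g g'"
    by (auto simp: homeomorphism_def homeomorphic_maps_def continuous_map_in_subtopology)
  then have "homeomorphic_map (top_of_set T) (top_of_set (g ` T)) g" using homeomorphic_map_maps by blast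
  then have "homeomorphic_map (subtopology X (p ` T)) (top_of_set (g ` T)) (g \<circ> inv_into UNIV p)"
    using 1 homeomorphic_map_compose by blast
  moreover have "(g \<circ> inv_into UNIV p) ` (p ` T) = g ` T" using inj by (simp add: image_comp comp_def)
  ultimately show "chart X (p ` T) (g \<circ> inv_into UNIV p)" using o og by (simp add: chart_def)
qed

section \<open>Homology and Euler characteristic of the sphere\<close>

text \<open>The only nonempty candidate is the singleton of the unit, which is dependent because its
  first power is already trivial.\<close>

lemma trivial_group_rank:
  fixes G (structure)
  assumes "trivial_group G"
  shows "abelian_rank G = 0"
proof -
  have G: "group G" "carrier G = {\<one>}" using assms by (auto simp: trivial_group_def)
  interpret group G by fact
  have "{B. int_independent G B} = {{}}"
  proof (intro subset_antisym subsetI)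
    fix B assume "B \<in> {B. int_independent G B}"
    then have B: "B \<subseteq> {\<one>}" "finprod G (\<lambda>b. b [^] (\<lambda>_. 1 :: int) b) B = \<one> \<longrightarrow> (\<forall>b\<in>B. (1 :: int) = 0)"
      using G unfolding int_independent_def by auto
    have "B = {}"
    proof (rule ccontr)
      assume "B \<noteq> {}"
      then have "B = {\<one>}" using B(1) by blast
      moreover have "finprod G (\<lambda>b. b [^] (1::int)) {\<one>} = \<one>"
      proof -
        have "comm_group G" by (rule group_comm_groupI) (use G in auto)
        then interpret comm_group G .
        show ?thesis by simp
      qed
      ultimately show False using B(2) by auto
    qed
    then show "B \<in> {{}}" by simp
  qed (auto simp: int_independent_def)
  then show ?thesis by (simp add: abelian_rank_def)
qed

text \<open>Any two elements \<open>b\<close> and \<open>b'\<close> satisfy the relation with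
  exponents \<open>h b'\<close> and \<open>- h b\<close>, which is nontrivial when they differ; a
  generator alone is independent.\<close>

lemma infinite_cyclic_rank:
  fixes G (structure)
  assumes G: "comm_group G" "G \<cong> integer_group"
  shows "abelian_rank G = 1"
proof -
  interpret comm_group G by fact
  obtain h where h: "h \<in> iso G integer_group" using G(2) by (auto simp: is_iso_def)
  then have hh: "h \<in> hom G integer_group" and hb: "bij_betw h (carrier G) UNIV"
    by (auto simp: iso_def integer_group_def)
  have hm: "h (x \<otimes> y) = h x + h y" if "x \<in> carrier G" "y \<in> carrier G" for x y
    by (rule hom_mult[OF hh that, unfolded mult_integer_group])
  have h1: "h \<one> = 0" using hm[OF one_closed one_closed] by simp
  have hn: "h (x [^] n) = int n * h x" if "x \<in> carrier G" for x and n :: nat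
    by (induction n) (use that h1 hm in \<open>auto simp: algebra_simps\<close>)
  have hi: "h (inv x) = - h x" if "x \<in> carrier G" for x
  proof -
    have "h x + h (inv x) = h (x \<otimes> inv x)" by (rule hm[symmetric]) (use that in auto)
    then show ?thesis using that h1 by simp
  qed
  have hp: "h (x [^] c) = c * h x" if "x \<in> carrier G" for x and c :: int
  proof (cases "c \<ge> 0")
    case True
    then obtain n where "c = int n" by (rule nonneg_int_cases)
    then show ?thesis using hn that by (simp add: int_pow_int)
  next
    case False
    then have "c = - int (nat (- c))" by simp
    then obtain n where "c = - int n" by blast
    then show ?thesis using hn hi that by (simp add: int_pow_neg int_pow_int)
  qed
  have inj: "x = y" if "h x = h y" "x \<in> carrier G" "y \<in> carrier G" for x y
    using hb that by (auto simp: bij_betw_def inj_on_def)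
  have le: "card B \<le> 1" if B: "int_independent G B" for B
  proof (rule ccontr)
    assume "\<not> card B \<le> 1"
    then obtain b b' where b: "b \<in> B" "b' \<in> B" "b \<noteq> b'"
      using card_le_Suc0_iff_eq[of B] B unfolding int_independent_def by auto
    have Bc: "finite B" "B \<subseteq> carrier G" using B by (auto simp: int_independent_def)
    define c where "c x = (if x = b then h b' else if x = b' then - h b else 0)" for x
    have bc: "b \<in> carrier G" "b' \<in> carrier G" using b Bc by auto
    have "finprod G (\<lambda>x. x [^] c x) B = finprod G (\<lambda>x. x [^] c x) {b, b'}"
      by (rule finprod_mono_neutral_cong_right) (use b Bc in \<open>auto simp: c_def\<close>)
    also have "\<dots> = b [^] h b' \<otimes> b' [^] (- h b)"
      using bc b(3) by (simp add: c_def)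
    also have "\<dots> = \<one>"
      by (rule inj) (use bc hm hp h1 in \<open>simp_all add: mult.commute\<close>)
    finally have "\<forall>x\<in>B. c x = 0" using B unfolding int_independent_def by blast
    then have "h b' = 0" "h b = 0" using b by (auto simp: c_def split: if_splits)
    then show False using inj[of b b'] bc b(3) by simp
  qed
  obtain g where g: "g \<in> carrier G" "h g = 1" using hb unfolding bij_betw_def by (metis UNIV_I imageE)
  have "int_independent G {g}"
    unfolding int_independent_def
  proof (intro conjI allI impI ballI)
    fix c :: "'a \<Rightarrow> int" and b assume c: "finprod G (\<lambda>b. b [^] c b) {g} = \<one>" "b \<in> {g}"
    then have "h (g [^] c g) = 0" using g h1 by simp
    then show "c b = 0" using hp[OF g(1)] g c by simp
  qed (use g in auto)
  moreover have "int_independent G {}" by (auto simp: int_independent_def)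
  ultimately have "{0, 1} \<subseteq> card ` {B. int_independent G B}"
    by (auto intro: image_eqI[of _ _ "{}"] image_eqI[of _ _ "{g}"])
  moreover have "card ` {B. int_independent G B} \<subseteq> {0, 1}" using le by fastforce
  ultimately have "card ` {B. int_independent G B} = {0, 1}" by blast
  then show ?thesis by (simp add: abelian_rank_def Sup_nat_def)
qed

lemma nsphere_2_homeomorphic: "nsphere 2 homeomorphic_space top_of_set (sphere (0 :: complex \<times> real) 1)"
proof -
  obtain f g where "homeomorphic_maps (nsphere 2) (top_of_set (sphere (0 :: complex \<times> real) 1)) f g"
    using homeomorphic_maps_nsphere_euclidean_sphere[of "Basis :: (complex \<times> real) set" 3]
    by (auto simp: independent_Basis orthogonal_Basis)
  then show ?thesis unfolding homeomorphic_space_def by blast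
qed

lemma path_connected_nsphere_2: "path_connected_space (nsphere 2)"
proof -
  have "path_connected (sphere (0 :: complex \<times> real) 1)" by (rule path_connected_sphere) simp
  then show ?thesis
    using homeomorphic_path_connected_space[OF nsphere_2_homeomorphic]
      path_connectedin_euclidean[of "sphere (0 :: complex \<times> real) 1"]
    by (simp add: path_connectedin_def)
qed

text \<open>The reduced homology of the sphere is infinite cyclic in degree 2 and trivial elsewhere.
  It agrees with homology except in degree 0, where path connectedness gives the integers.\<close>

lemma euler_characteristic_sphere:
  assumes "X homeomorphic_space nsphere 2"
  shows "euler_characteristic X = 2"
proof -
  have iso: "homology_group p X \<cong> homology_group p (nsphere 2)" for p
    using assms by (rule homeomorphic_space_imp_isomorphic_homology_groups)
  have "path_connected_space (nsphere 2)" by (rule path_connected_nsphere_2)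
  then have h0: "homology_group 0 (nsphere 2) \<cong> integer_group"
    by (intro isomorphic_integer_zeroth_homology_group) auto
  have b0: "betti_number 0 X = 1"
    unfolding betti_number_def using iso_trans[OF iso h0] by (intro infinite_cyclic_rank) auto
  have "homology_group (int 2) (nsphere 2) \<cong> integer_group"
    using reduced_homology_group_nsphere(1)[of 2] un_reduced_homology_group[of 2 "nsphere 2"] by simp
  then have b2: "betti_number 2 X = 1"
    unfolding betti_number_def using iso_trans[OF iso] by (intro infinite_cyclic_rank) auto
  have bp: "betti_number p X = 0" if "p \<noteq> 0" "p \<noteq> 2" for p
  proof -
    have "trivial_group (reduced_homology_group (int p) (nsphere 2))"
      by (rule reduced_homology_group_nsphere(2)) (use that in simp)
    then have "trivial_group (homology_group (int p) (nsphere 2))"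
      using un_reduced_homology_group[of "int p" "nsphere 2"] that by simp
    then have "trivial_group (homology_group (int p) X)"
      using isomorphic_group_triviality[OF iso] by simp
    then show ?thesis unfolding betti_number_def by (rule trivial_group_rank)
  qed
  have "betti_number p X \<noteq> 0 \<longleftrightarrow> p = 0 \<or> p = 2" for p
    using b0 b2 bp[of p] by (cases "p = 0"; cases "p = 2") simp_all
  then have "{p. betti_number p X \<noteq> 0} = {0, 2}" by blast
  then show ?thesis by (simp add: euler_characteristic_def b0 b2)
qed

section \<open>Orientability of the sphere\<close>

lemma orientation_preserving_on_cong:
  assumes "\<And>z. z \<in> W \<Longrightarrow> h z = k z" "orientation_preserving_on W k"
  shows "orientation_preserving_on W h"
  unfolding orientation_preserving_on_def
proof (intro ballI allI impI)
  fix z r assume z: "z \<in> W" and r: "r > (0 :: real)" "cball z r \<subseteq> W"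
  have "circlepath z r t \<in> cball z r" for t
    using r by (simp add: circlepath dist_norm norm_mult norm_exp_eq_Re)
  then have "circlepath z r t \<in> W" for t using r by blast
  then have "h \<circ> circlepath z r = k \<circ> circlepath z r" using assms(1) by auto
  then show "winding_number (h \<circ> circlepath z r) (h z) = 1"
    using assms z r by (simp add: orientation_preserving_on_def)
qed

lemma orientation_preserving_on_id: "orientation_preserving_on W (\<lambda>z. z)"
  by (auto simp: orientation_preserving_on_def comp_def winding_number_circlepath_centre)

text \<open>Substituting \<open>1 / w\<close> turns the winding integral into that of
  \<open>1 / (w - z) - 1 / w\<close>. The second term contributes nothing because the closed disc
  avoids 0.\<close>

lemma orientation_preserving_on_inverse: "orientation_preserving_on (- {0}) (\<lambda>z. 1 / z)"
  unfolding orientation_preserving_on_def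
proof (intro ballI allI impI)
  fix z :: complex and r :: real assume z: "z \<in> - {0}" and r: "r > 0" "cball z r \<subseteq> - {0}"
  let ?c = "circlepath z r" and ?h = "\<lambda>z :: complex. 1 / z"
  have img: "path_image ?c = sphere z r" using r by simp
  have imgz: "path_image ?c \<subseteq> - {0}" using r(2) sphere_cball unfolding img by blast
  have hol: "?h holomorphic_on (- {0})" by (intro holomorphic_intros) auto
  have an: "?h analytic_on (- {0})" using hol by (simp add: analytic_on_open open_Compl)
  have vp: "valid_path (?h \<circ> ?c)"
    by (rule valid_path_compose_holomorphic[OF valid_path_circlepath hol _ imgz]) auto
  have nin: "?h z \<notin> path_image (?h \<circ> ?c)"
    using img z r by (auto simp: path_image_compose image_iff)
  have "winding_number (?h \<circ> ?c) (?h z) = 1 / (2 * pi * \<i>) * contour_integral (?h \<circ> ?c) (\<lambda>w. 1 / (w - ?h z))"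
    by (rule winding_number_valid_path[OF vp nin])
  also have "contour_integral (?h \<circ> ?c) (\<lambda>w. 1 / (w - ?h z)) = contour_integral ?c (\<lambda>w. deriv ?h w * (1 / (?h w - ?h z)))"
    by (rule contour_integral_comp_analyticW[OF an valid_path_circlepath imgz])
  also have "\<dots> = contour_integral ?c (\<lambda>w. 1 / (w - z) - 1 / w)"
  proof (rule contour_integral_eq)
    fix w assume "w \<in> path_image ?c"
    then have w: "w \<noteq> 0" "w \<noteq> z" using imgz img r by auto
    have "(?h has_field_derivative - 1 / w\<^sup>2) (at w)"
      using w by (auto intro!: derivative_eq_intros simp: power2_eq_square)
    then have "deriv ?h w = - 1 / w\<^sup>2" by (rule DERIV_imp_deriv)
    then show "deriv ?h w * (1 / (?h w - ?h z)) = 1 / (w - z) - 1 / w"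
      using w z by (simp add: divide_simps power2_eq_square) (simp add: algebra_simps)
  qed
  also have "\<dots> = contour_integral ?c (\<lambda>w. 1 / (w - z)) - contour_integral ?c (\<lambda>w. 1 / w)"
    using img r imgz by (intro contour_integral_diff contour_integrable_continuous_circlepath continuous_intros) auto
  also have "contour_integral ?c (\<lambda>w. 1 / w) = 0"
  proof (rule contour_integral_unique, rule Cauchy_theorem_convex_simple)
    show "?h holomorphic_on cball z r" using hol r(2) holomorphic_on_subset by blast
  qed (use img sphere_cball in auto)
  also have "contour_integral ?c (\<lambda>w. 1 / (w - z)) = 2 * pi * \<i>"
    using r by (simp add: contour_integral_circlepath)
  finally show "winding_number (?h \<circ> ?c) (?h z) = 1" by (simp add: comp_def)
qed

text \<open>The two affine charts form an oriented atlas, since both changes of coordinate are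
  \<open>1 / z\<close> off 0; the other properties come from the Euclidean unit sphere.\<close>

lemma closed_surface_nsphere_2: "closed_surface (nsphere 2)"
  unfolding closed_surface_def
proof (intro conjI)
  note hs = nsphere_2_homeomorphic
  show "topspace (nsphere 2) \<noteq> {}" using sph_in[of 1 0] by auto
  show "compact_space (nsphere 2)"
    using homeomorphic_compact_space[OF hs] by (simp add: compact_space_subtopology)
  show "Hausdorff_space (nsphere 2)"
    using homeomorphic_Hausdorff_space[OF hs] by (simp add: Hausdorff_space_subtopology)
  show "connected_space (nsphere 2)"
    using path_connected_nsphere_2 by (rule path_connected_imp_connected_space)
  let ?p = "\<lambda>z. sph z 1" and ?q = "\<lambda>z. sph 1 z"
  note P = proj_line_nsphere[unfolded proj_line_def]
  have c1: "chart (nsphere 2) (range ?p) (inv_into UNIV ?p)" and i1: "inj ?p"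
    using chart_param[of "nsphere 2" ?p UNIV "\<lambda>z. z"] P by (auto simp: comp_def)
  have c2: "chart (nsphere 2) (range ?q) (inv_into UNIV ?q)" and i2: "inj ?q"
    using chart_param[of "nsphere 2" ?q UNIV "\<lambda>z. z"] P by (auto simp: comp_def)
  have bk: "inv_into (range p) (inv_into UNIV p) z = p z" if "inj p" for z and p :: "complex \<Rightarrow> nat \<Rightarrow> real"
  proof -
    have "inj_on (inv_into UNIV p) (range p)" by (rule inj_on_inv_into) simp
    then have "inv_into (range p) (inv_into UNIV p) (inv_into UNIV p (p z)) = p z"
      by (rule inv_into_f_f) simp
    then show ?thesis using that by simp
  qed
  have pq: "?p z = ?q (1 / z)" if "z \<noteq> 0" for z using sph_eq_iff[of z 1 1 "1 / z"] that by simp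
  have qp: "?q z = ?p (1 / z)" if "z \<noteq> 0" for z using sph_eq_iff[of 1 z "1 / z" 1] that by simp
  have W: "inv_into UNIV ?p ` (range ?p \<inter> range ?q) \<subseteq> - {0}" "inv_into UNIV ?q ` (range ?q \<inter> range ?p) \<subseteq> - {0}"
  proof -
    have nz: "z \<noteq> 0" "w \<noteq> 0" if "?p z = ?q w" for z w using that sph_eq_iff[of z 1 1 w] by auto
    have pp: "inv_into UNIV ?p (?p z) = z" for z by (rule inv_into_f_f[OF i1 UNIV_I])
    have qq: "inv_into UNIV ?q (?q z) = z" for z by (rule inv_into_f_f[OF i2 UNIV_I])
    show "inv_into UNIV ?p ` (range ?p \<inter> range ?q) \<subseteq> - {0}"
    proof (rule image_subsetI)
      fix x assume "x \<in> range ?p \<inter> range ?q"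
      then obtain z w where zw: "x = ?p z" "x = ?q w" by blast
      then show "inv_into UNIV ?p x \<in> - {0}" using nz(1)[of z w] pp[of z] by simp
    qed
    show "inv_into UNIV ?q ` (range ?q \<inter> range ?p) \<subseteq> - {0}"
    proof (rule image_subsetI)
      fix x assume "x \<in> range ?q \<inter> range ?p"
      then obtain z w where zw: "x = ?p z" "x = ?q w" by blast
      then show "inv_into UNIV ?q x \<in> - {0}" using nz(2)[of z w] qq[of w] by simp
    qed
  qed
  have same: "orientation_preserving_on V (inv_into UNIV p \<circ> inv_into (range p) (inv_into UNIV p))"
    if "inj p" for V and p :: "complex \<Rightarrow> nat \<Rightarrow> real"
    by (rule orientation_preserving_on_cong[OF _ orientation_preserving_on_id]) (simp add: bk that)
  have sub: "orientation_preserving_on V h" if "orientation_preserving_on W h" "V \<subseteq> W" for V W h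
    using that unfolding orientation_preserving_on_def by blast
  have e1: "(inv_into UNIV ?q \<circ> inv_into (range ?p) (inv_into UNIV ?p)) z = 1 / z" if "z \<noteq> 0" for z
    by (simp only: o_apply bk[OF i1] pq[OF that] inv_into_f_f[OF i2 UNIV_I])
  have e2: "(inv_into UNIV ?p \<circ> inv_into (range ?q) (inv_into UNIV ?q)) z = 1 / z" if "z \<noteq> 0" for z
    by (simp only: o_apply bk[OF i2] qp[OF that] inv_into_f_f[OF i1 UNIV_I])
  have o1: "orientation_preserving_on (inv_into UNIV ?p ` (range ?p \<inter> range ?q)) (inv_into UNIV ?q \<circ> inv_into (range ?p) (inv_into UNIV ?p))"
    by (rule orientation_preserving_on_cong[OF _ sub[OF orientation_preserving_on_inverse W(1)]])
       (use W(1) in \<open>blast intro: e1\<close>)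
  have o2: "orientation_preserving_on (inv_into UNIV ?q ` (range ?q \<inter> range ?p)) (inv_into UNIV ?p \<circ> inv_into (range ?q) (inv_into UNIV ?q))"
    by (rule orientation_preserving_on_cong[OF _ sub[OF orientation_preserving_on_inverse W(2)]])
       (use W(2) in \<open>blast intro: e2\<close>)
  have cover: "range ?p \<union> range ?q = topspace (nsphere 2)"
  proof -
    have "sph a b \<in> range ?p \<union> range ?q" if "a \<noteq> 0 \<or> b \<noteq> 0" for a b
    proof (cases "b = 0")
      case True
      then have "sph a b = ?q 0" using that sph_eq_iff[of a b 1 0] by simp
      then show ?thesis by blast
    next
      case False
      then have "sph a b = ?p (a / b)" using sph_eq_iff[of a b "a / b" 1] by simp
      then show ?thesis by blast
    qed
    then have "topspace (nsphere 2) \<subseteq> range ?p \<union> range ?q" unfolding P[THEN conjunct1] by blast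
    moreover have "?p z \<in> topspace (nsphere 2)" "?q z \<in> topspace (nsphere 2)" for z
      by (rule sph_in; simp)+
    ultimately show ?thesis by blast
  qed
  show "orientable_surface (nsphere 2)"
    unfolding orientable_surface_def
    by (rule exI[of _ "{(range ?p, inv_into UNIV ?p), (range ?q, inv_into UNIV ?q)}"])
       (simp only: c1 c2 same[OF i1] same[OF i2] o1 o2 cover ball_simps bex_simps prod.case UN_insert UN_empty Un_empty_right simp_thms Int_absorb)
qed

section \<open>Rational maps\<close>

text \<open>Near \<open>z0\<close> the factor \<open>Q\<close> has a holomorphic \<open>k\<close>-th
  root \<open>h\<close>. Then \<open>(z - z0) * h z\<close> has the nonzero derivative
  \<open>h z0\<close> at \<open>z0\<close>, hence is a local coordinate, and in it the map is
  exactly the \<open>k\<close>-th power.\<close>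

lemma locally_power_param:
  fixes p :: "complex \<Rightarrow> 'a" and q :: "complex \<Rightarrow> 'b"
  assumes X: "openin X (range p)" "homeomorphic_map euclidean (subtopology X (range p)) p"
    and Y: "openin Y (range q)" "homeomorphic_map euclidean (subtopology Y (range q)) q"
    and T: "open T" "z0 \<in> T" and f: "\<And>z. z \<in> T \<Longrightarrow> f (p z) = q (G z)"
    and Q: "Q holomorphic_on T" "Q z0 \<noteq> 0" and G: "\<And>z. z \<in> T \<Longrightarrow> G z = G z0 + (z - z0) ^ k * Q z" and k: "k \<ge> 1"
  shows "locally_power X Y f (p z0) k"
proof -
  have "open (T \<inter> Q -` ball (Q z0) (cmod (Q z0)))"
    using holomorphic_on_imp_continuous_on[OF Q(1)] T(1) by (rule continuous_open_preimage) simp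
  then have "open {z \<in> T. Q z \<in> ball (Q z0) (cmod (Q z0))}"
    by (simp only: vimage_def Int_def mem_Collect_eq)
  moreover have "z0 \<in> {z \<in> T. Q z \<in> ball (Q z0) (cmod (Q z0))}" using T Q by simp
  ultimately obtain r where r: "r > 0" "ball z0 r \<subseteq> {z \<in> T. Q z \<in> ball (Q z0) (cmod (Q z0))}"
    using open_contains_ball by blast
  have rT: "ball z0 r \<subseteq> T" using r by auto
  \<comment> \<open>The disc keeps \<open>Q z\<close> closer to \<open>Q z0\<close> than 0 is, so
    the quotient has positive real part and avoids the branch cut of \<open>Ln\<close>.\<close>
  have slit: "Q z / Q z0 \<notin> \<real>\<^sub>\<le>\<^sub>0" if "z \<in> ball z0 r" for z
  proof
    assume "Q z / Q z0 \<in> \<real>\<^sub>\<le>\<^sub>0"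
    then have re: "Re (Q z / Q z0) \<le> 0" by (simp add: complex_nonpos_Reals_iff)
    have "cmod (Q z0 - Q z) < cmod (Q z0)" using r that by (auto simp: dist_norm)
    moreover have "1 - Q z / Q z0 = (Q z0 - Q z) / Q z0" using Q(2) by (simp add: diff_divide_distrib)
    ultimately have "cmod (1 - Q z / Q z0) < 1" using Q(2) by (simp add: norm_divide)
    then have "Re (1 - Q z / Q z0) < 1" using complex_Re_le_cmod le_less_trans by blast
    then show False using re by simp
  qed
  obtain c where c: "c ^ k = Q z0"
  proof -
    have "card {z. z ^ k = Q z0} \<noteq> 0" using card_nth_roots[of "Q z0" k] k Q by simp
    then have "{z. z ^ k = Q z0} \<noteq> {}" by force
    then show ?thesis using that by blast
  qed
  define h where "h z = c * exp (Ln (Q z / Q z0) / of_nat k)" for z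
  have hol: "h holomorphic_on ball z0 r"
    unfolding h_def using slit Q rT
    by (intro holomorphic_intros) (auto intro: holomorphic_on_subset)
  have hk: "h z ^ k = Q z" if "z \<in> ball z0 r" for z
  proof -
    have "Q z / Q z0 \<noteq> 0" using slit[OF that] by auto
    then have "exp (Ln (Q z / Q z0) / of_nat k) ^ k = Q z / Q z0"
      using k by (simp add: exp_of_nat_mult[symmetric])
    then show ?thesis using c Q(2) by (simp add: h_def power_mult_distrib)
  qed
  have "c \<noteq> 0" using c Q k by (metis not_one_le_zero power_0_left)
  then have h0: "h z0 \<noteq> 0" by (simp add: h_def)
  define \<phi> where "\<phi> z = (z - z0) * h z" for z
  have \<phi>hol: "\<phi> holomorphic_on ball z0 r" unfolding \<phi>_def by (intro holomorphic_intros hol)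
  have "(h has_field_derivative deriv h z0) (at z0)"
    using hol r(1) by (intro holomorphic_derivI[of h "ball z0 r"]) auto
  then have "(\<phi> has_field_derivative h z0) (at z0)"
    unfolding \<phi>_def by (auto intro!: derivative_eq_intros)
  then have "deriv \<phi> z0 \<noteq> 0" using h0 DERIV_imp_deriv by fastforce
  then obtain s where s: "s > 0" "ball z0 s \<subseteq> ball z0 r" "inj_on \<phi> (ball z0 s)"
    using has_complex_derivative_locally_injective[OF \<phi>hol, of z0] r(1) by auto
  have "continuous_on (ball z0 s) \<phi>"
    using \<phi>hol s(2) by (intro holomorphic_on_imp_continuous_on) (rule holomorphic_on_subset)
  then have c1: "chart X (p ` ball z0 s) (\<phi> \<circ> inv_into UNIV p)" and ip: "inj p"
    using chart_param[OF X, of "ball z0 s" \<phi>] s(3) by auto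
  have c2: "chart Y (q ` UNIV) ((\<lambda>w. w - G z0) \<circ> inv_into UNIV q)" and iq: "inj q"
  proof -
    have cont: "continuous_on UNIV (\<lambda>w. w - G z0)" by (intro continuous_intros)
    have inj: "inj_on (\<lambda>w. w - G z0) UNIV" by (simp add: inj_on_def)
    show "chart Y (q ` UNIV) ((\<lambda>w. w - G z0) \<circ> inv_into UNIV q)" "inj q"
      using chart_param[OF Y open_UNIV cont inj] by blast+
  qed
  have invp: "inv_into UNIV p (p z) = z" for z by (rule inv_into_f_f[OF ip UNIV_I])
  have invq: "inv_into UNIV q (q z) = z" for z by (rule inv_into_f_f[OF iq UNIV_I])
  show ?thesis
    unfolding locally_power_def
  proof (intro conjI exI)
    show "k \<ge> 1" by fact
    show "chart X (p ` ball z0 s) (\<phi> \<circ> inv_into UNIV p)" "chart Y (q ` UNIV) ((\<lambda>w. w - G z0) \<circ> inv_into UNIV q)" by fact+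
    show "p z0 \<in> p ` ball z0 s" using s by simp
    show "(\<phi> \<circ> inv_into UNIV p) (p z0) = 0" by (simp add: invp \<phi>_def)
    show "f ` p ` ball z0 s \<subseteq> range q" using f s(2) rT by auto
    show "((\<lambda>w. w - G z0) \<circ> inv_into UNIV q) (f (p z0)) = 0" using f[OF T(2)] by (simp add: invq)
    show "\<forall>u\<in>p ` ball z0 s. ((\<lambda>w. w - G z0) \<circ> inv_into UNIV q) (f u) = (\<phi> \<circ> inv_into UNIV p) u ^ k"
    proof
      fix u assume "u \<in> p ` ball z0 s"
      then obtain z where z: "z \<in> ball z0 s" "u = p z" by blast
      then have zr: "z \<in> ball z0 r" "z \<in> T" using s(2) rT by auto
      have "((\<lambda>w. w - G z0) \<circ> inv_into UNIV q) (f u) = G z - G z0" using z f[OF zr(2)] by (simp add: invq)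
      also have "\<dots> = (z - z0) ^ k * Q z" using G[OF zr(2)] by simp
      also have "\<dots> = \<phi> z ^ k" using hk[OF zr(1)] by (simp add: \<phi>_def power_mult_distrib)
      finally show "((\<lambda>w. w - G z0) \<circ> inv_into UNIV q) (f u) = (\<phi> \<circ> inv_into UNIV p) u ^ k" using z by (simp add: invp)
    qed
  qed
qed

text \<open>The only point of the projective line off the affine chart is \<open>\<pi> 1 0\<close>;
  its value is infinity because the maps considered have a pole there.\<close>

definition rational_map ::
  "(complex \<Rightarrow> complex \<Rightarrow> 'a) \<Rightarrow> (complex \<Rightarrow> complex \<Rightarrow> 'b) \<Rightarrow> complex poly \<Rightarrow> complex poly \<Rightarrow> 'a \<Rightarrow> 'b" where
  "rational_map \<pi> \<rho> A C x = (if x \<in> range (\<lambda>z. \<pi> z 1)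
     then \<rho> (poly A (inv_into UNIV (\<lambda>z. \<pi> z 1) x)) (poly C (inv_into UNIV (\<lambda>z. \<pi> z 1) x)) else \<rho> 1 0)"

definition root_orders :: "complex poly \<Rightarrow> nat multiset" where
  "root_orders p = image_mset (\<lambda>z. Polynomial.order z p) (mset_set {z. poly p z = 0})"

locale rational_pair =
  fixes X :: "'a topology" and Y :: "'b topology" and \<pi> \<rho> and A C :: "complex poly"
  assumes X: "proj_line X \<pi>" and Y: "proj_line Y \<rho>"
    and deg: "degree C < degree A" and C0: "C \<noteq> 0"
    and cop: "\<And>z. poly A z = 0 \<Longrightarrow> poly C z = 0 \<Longrightarrow> False"
begin

abbreviation "f \<equiv> rational_map \<pi> \<rho> A C"

lemma \<pi>_eq_iff: "a \<noteq> 0 \<or> b \<noteq> 0 \<Longrightarrow> c \<noteq> 0 \<or> d \<noteq> 0 \<Longrightarrow> \<pi> a b = \<pi> c d \<longleftrightarrow> a * d = b * c"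
  using X unfolding proj_line_def by blast

lemma \<rho>_eq_iff: "a \<noteq> 0 \<or> b \<noteq> 0 \<Longrightarrow> c \<noteq> 0 \<or> d \<noteq> 0 \<Longrightarrow> \<rho> a b = \<rho> c d \<longleftrightarrow> a * d = b * c"
  using Y unfolding proj_line_def by blast

lemma inj_\<pi>: "inj (\<lambda>z. \<pi> z 1)"
  by (rule injI) (simp add: \<pi>_eq_iff)

lemma f_finite [simp]: "f (\<pi> z 1) = \<rho> (poly A z) (poly C z)"
  using inv_into_f_f[OF inj_\<pi> UNIV_I, of z] by (simp add: rational_map_def)

lemma f_infinity [simp]: "f (\<pi> 1 0) = \<rho> 1 0"
  using \<pi>_eq_iff[of 1 0 _ 1] by (auto simp: rational_map_def)

lemma A0: "A \<noteq> 0" using deg by auto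

lemma nz: "poly A z \<noteq> 0 \<or> poly C z \<noteq> 0" using cop by blast

lemma X_cases:
  assumes "x \<in> topspace X"
  obtains z where "x = \<pi> z 1" | "x = \<pi> 1 0"
proof -
  have "topspace X = {\<pi> a b | a b. a \<noteq> 0 \<or> b \<noteq> 0}" using X unfolding proj_line_def by blast
  then obtain a b where ab: "a \<noteq> 0 \<or> b \<noteq> 0" "x = \<pi> a b" using assms by blast
  show ?thesis
  proof (cases "b = 0")
    case True
    then show ?thesis using ab that(2) \<pi>_eq_iff[of a b 1 0] by simp
  next
    case False
    then show ?thesis using ab that(1)[of "a / b"] \<pi>_eq_iff[of a b "a / b" 1] by simp
  qed
qed

lemma Y_cases:
  assumes "y \<in> topspace Y"
  obtains c where "y = \<rho> c 1" | "y = \<rho> 1 0"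
proof -
  have "topspace Y = {\<rho> a b | a b. a \<noteq> 0 \<or> b \<noteq> 0}" using Y unfolding proj_line_def by blast
  then obtain a b where ab: "a \<noteq> 0 \<or> b \<noteq> 0" "y = \<rho> a b" using assms by blast
  show ?thesis
  proof (cases "b = 0")
    case True
    then show ?thesis using ab that(2) \<rho>_eq_iff[of a b 1 0] by simp
  next
    case False
    then show ?thesis using ab that(1)[of "a / b"] \<rho>_eq_iff[of a b "a / b" 1] by simp
  qed
qed

lemma in_X: "\<pi> z 1 \<in> topspace X" "\<pi> 1 0 \<in> topspace X"
proof -
  have "topspace X = {\<pi> a b | a b. a \<noteq> 0 \<or> b \<noteq> 0}" using X unfolding proj_line_def by blast
  moreover have "z \<noteq> 0 \<or> (1 :: complex) \<noteq> 0" "(1 :: complex) \<noteq> 0 \<or> (0 :: complex) \<noteq> 0" by simp_all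
  ultimately show "\<pi> z 1 \<in> topspace X" "\<pi> 1 0 \<in> topspace X" by blast+
qed

lemma in_Y: "\<rho> z 1 \<in> topspace Y" "\<rho> 1 0 \<in> topspace Y"
proof -
  have "topspace Y = {\<rho> a b | a b. a \<noteq> 0 \<or> b \<noteq> 0}" using Y unfolding proj_line_def by blast
  moreover have "z \<noteq> 0 \<or> (1 :: complex) \<noteq> 0" "(1 :: complex) \<noteq> 0 \<or> (0 :: complex) \<noteq> 0" by simp_all
  ultimately show "\<rho> z 1 \<in> topspace Y" "\<rho> 1 0 \<in> topspace Y" by blast+
qed

lemma params:
  "openin X (range (\<lambda>z. \<pi> z 1))" "homeomorphic_map euclidean (subtopology X (range (\<lambda>z. \<pi> z 1))) (\<lambda>z. \<pi> z 1)"
  "openin X (range (\<lambda>z. \<pi> 1 z))" "homeomorphic_map euclidean (subtopology X (range (\<lambda>z. \<pi> 1 z))) (\<lambda>z. \<pi> 1 z)"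
  "openin Y (range (\<lambda>z. \<rho> z 1))" "homeomorphic_map euclidean (subtopology Y (range (\<lambda>z. \<rho> z 1))) (\<lambda>z. \<rho> z 1)"
  "openin Y (range (\<lambda>z. \<rho> 1 z))" "homeomorphic_map euclidean (subtopology Y (range (\<lambda>z. \<rho> 1 z))) (\<lambda>z. \<rho> 1 z)"
  using X Y unfolding proj_line_def by blast+

lemma poly_factor:
  fixes p :: "complex poly"
  assumes "p \<noteq> 0"
  obtains q where "p = [:- a, 1:] ^ Polynomial.order a p * q" "poly q a \<noteq> 0"
proof -
  obtain q where q: "p = [:- a, 1:] ^ Polynomial.order a p * q" "\<not> [:- a, 1:] dvd q"
    using order_decomp[OF assms, of a] by blast
  then show ?thesis using that by (simp add: poly_eq_0_iff_dvd)
qed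

lemma open_poly_neq: "open {z. poly p z \<noteq> (0 :: complex)}"
  by (intro open_Collect_neq continuous_intros)

lemma sub_neq0: "A - Polynomial.smult c C \<noteq> 0"
proof
  assume "A - Polynomial.smult c C = 0"
  then have "A = Polynomial.smult c C" by simp
  then have "degree A \<le> degree C" by (simp add: degree_smult_le)
  then show False using deg by simp
qed

text \<open>\<open>A / C - c\<close> is \<open>A - Polynomial.smult c C\<close> divided by
  \<open>C\<close>, which does not vanish at \<open>z0\<close>; so the exponent is the order of
  \<open>z0\<close> as a root of the numerator.\<close>

lemma lp_finite:
  assumes "poly C z0 \<noteq> 0" and c: "poly A z0 = c * poly C z0"
  shows "locally_power X Y f (\<pi> z0 1) (Polynomial.order z0 (A - Polynomial.smult c C))"
proof -
  let ?p = "A - Polynomial.smult c C"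
  obtain q where q: "?p = [:- z0, 1:] ^ Polynomial.order z0 ?p * q" "poly q z0 \<noteq> 0" using poly_factor[OF sub_neq0] by blast
  have val: "poly A z = c * poly C z + (z - z0) ^ Polynomial.order z0 ?p * poly q z" for z
    using arg_cong[OF q(1), of "\<lambda>p. poly p z"] by (simp add: diff_eq_eq add.commute)
  have "poly ?p z0 = 0" using c by simp
  then have "Polynomial.order z0 ?p \<noteq> 0" using order_root[of ?p z0] sub_neq0 by blast
  show ?thesis
  proof (rule locally_power_param[OF params(1,2) params(5,6), where T = "{z. poly C z \<noteq> 0}" and G = "\<lambda>z. poly A z / poly C z" and Q = "\<lambda>z. poly q z / poly C z"])
    show "open {z. poly C z \<noteq> 0}" by (rule open_poly_neq)
    show "z0 \<in> {z. poly C z \<noteq> 0}" using assms by simp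
    show "f (\<pi> z 1) = \<rho> (poly A z / poly C z) 1" if "z \<in> {z. poly C z \<noteq> 0}" for z
      using that by (simp add: \<rho>_eq_iff)
    show "(\<lambda>z. poly q z / poly C z) holomorphic_on {z. poly C z \<noteq> 0}" by (intro holomorphic_intros) auto
    show "poly q z0 / poly C z0 \<noteq> 0" using q assms by simp
    show "poly A z / poly C z = poly A z0 / poly C z0 + (z - z0) ^ Polynomial.order z0 ?p * (poly q z / poly C z)"
      if "z \<in> {z. poly C z \<noteq> 0}" for z
      using that assms val[of z] by (simp add: field_simps)
    show "1 \<le> Polynomial.order z0 ?p" using \<open>Polynomial.order z0 ?p \<noteq> 0\<close> by simp
  qed
qed

lemma lp_pole:
  assumes "poly C z0 = 0"
  shows "locally_power X Y f (\<pi> z0 1) (Polynomial.order z0 C)"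
proof -
  have A: "poly A z0 \<noteq> 0" using nz assms by blast
  obtain q where q: "C = [:- z0, 1:] ^ Polynomial.order z0 C * q" "poly q z0 \<noteq> 0" using poly_factor[OF C0] by blast
  have val: "poly C z = (z - z0) ^ Polynomial.order z0 C * poly q z" for z
    using arg_cong[OF q(1), of "\<lambda>p. poly p z"] by simp
  have "Polynomial.order z0 C \<noteq> 0" using assms C0 by (simp add: order_root)
  show ?thesis
  proof (rule locally_power_param[OF params(1,2) params(7,8), where T = "{z. poly A z \<noteq> 0}" and G = "\<lambda>z. poly C z / poly A z" and Q = "\<lambda>z. poly q z / poly A z"])
    show "open {z. poly A z \<noteq> 0}" by (rule open_poly_neq)
    show "z0 \<in> {z. poly A z \<noteq> 0}" using A by simp
    show "f (\<pi> z 1) = \<rho> 1 (poly C z / poly A z)" if "z \<in> {z. poly A z \<noteq> 0}" for z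
      using that by (simp add: \<rho>_eq_iff)
    show "(\<lambda>z. poly q z / poly A z) holomorphic_on {z. poly A z \<noteq> 0}" by (intro holomorphic_intros) auto
    show "poly q z0 / poly A z0 \<noteq> 0" using q A by simp
    show "poly C z / poly A z = poly C z0 / poly A z0 + (z - z0) ^ Polynomial.order z0 C * (poly q z / poly A z)"
      if "z \<in> {z. poly A z \<noteq> 0}" for z
      using val[of z] assms by simp
    show "1 \<le> Polynomial.order z0 C" using \<open>Polynomial.order z0 C \<noteq> 0\<close> by simp
  qed
qed

text \<open>In the coordinate at infinity numerator and denominator become the reflected
  polynomials, which do not vanish at 0, and the surplus degree of \<open>A\<close> remains as a
  power of \<open>z\<close> in the reciprocal of the function.\<close>

lemma lp_infinity: "locally_power X Y f (\<pi> 1 0) (degree A - degree C)"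
proof -
  define m where "m = degree A - degree C"
  let ?A = "reflect_poly A" and ?C = "reflect_poly C"
  have r0: "poly ?A 0 \<noteq> 0" "poly ?C 0 \<noteq> 0" using A0 C0 by simp_all
  have fz: "f (\<pi> 1 z) = \<rho> 1 (z ^ m * poly ?C z / poly ?A z)" if z: "poly ?A z \<noteq> 0" for z
  proof (cases "z = 0")
    case True
    then show ?thesis using deg by (simp add: m_def power_0_left)
  next
    case False
    have "\<pi> 1 z = \<pi> (1 / z) 1" using False by (simp add: \<pi>_eq_iff)
    then have "f (\<pi> 1 z) = \<rho> (poly A (1 / z)) (poly C (1 / z))" by simp
    also have "\<dots> = \<rho> 1 (z ^ m * poly ?C z / poly ?A z)"
    proof -
      have a: "poly ?A z = z ^ degree A * poly A (1 / z)" "poly ?C z = z ^ degree C * poly C (1 / z)"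
        using False by (simp_all add: poly_reflect_poly_nz inverse_eq_divide)
      have "z ^ m * z ^ degree C = z ^ degree A" using deg by (simp add: m_def flip: power_add)
      then have "z ^ m * poly ?C z = z ^ degree A * poly C (1 / z)" unfolding a by (simp flip: mult.assoc)
      moreover have "poly A (1 / z) \<noteq> 0" using z a by auto
      ultimately have "poly A (1 / z) * (z ^ m * poly ?C z / poly ?A z) = poly C (1 / z) * 1"
        using False by (simp add: a(1))
      then show ?thesis using iffD2[OF \<rho>_eq_iff[OF nz[of "1 / z"], of 1 "z ^ m * poly ?C z / poly ?A z"]] by simp
    qed
    finally show ?thesis .
  qed
  show ?thesis unfolding m_def[symmetric]
  proof (rule locally_power_param[OF params(3,4) params(7,8), where T = "{z. poly ?A z \<noteq> 0}" and G = "\<lambda>z. z ^ m * poly ?C z / poly ?A z" and Q = "\<lambda>z. poly ?C z / poly ?A z"])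
    show "open {z. poly ?A z \<noteq> 0}" by (rule open_poly_neq)
    show "0 \<in> {z. poly ?A z \<noteq> 0}" using r0 by simp
    show "f (\<pi> 1 z) = \<rho> 1 (z ^ m * poly ?C z / poly ?A z)" if "z \<in> {z. poly ?A z \<noteq> 0}" for z
      using that fz by blast
    show "(\<lambda>z. poly ?C z / poly ?A z) holomorphic_on {z. poly ?A z \<noteq> 0}" by (intro holomorphic_intros) auto
    show "poly ?C 0 / poly ?A 0 \<noteq> 0" using r0 by simp
    show "1 \<le> m" using deg by (simp add: m_def)
    then show "z ^ m * poly ?C z / poly ?A z = 0 ^ m * poly ?C 0 / poly ?A 0 + (z - 0) ^ m * (poly ?C z / poly ?A z)" for z
      by (simp add: power_0_left)
  qed
qed

lemma branched_cover_f:
  assumes "closed_surface X" "closed_surface Y"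
  shows "branched_cover X Y f"
  unfolding branched_cover_def
proof (intro conjI assms ballI)
  fix x assume "x \<in> topspace X"
  then show "\<exists>k. locally_power X Y f x k"
  proof (cases rule: X_cases)
    case (1 z)
    show ?thesis
    proof (cases "poly C z = 0")
      case True
      then show ?thesis using lp_pole 1 by blast
    next
      case False
      then have "poly A z = (poly A z / poly C z) * poly C z" by simp
      then show ?thesis using lp_finite[OF False] 1 by blast
    qed
  next
    case 2
    then show ?thesis using lp_infinity by blast
  qed
qed

lemma fibre_finite: "fibre X f (\<rho> c 1) = (\<lambda>z. \<pi> z 1) ` {z. poly (A - Polynomial.smult c C) z = 0}"
proof (intro subset_antisym subsetI)
  fix x assume x: "x \<in> fibre X f (\<rho> c 1)"
  then have "x \<in> topspace X" "f x = \<rho> c 1" by (auto simp: fibre_def)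
  then show "x \<in> (\<lambda>z. \<pi> z 1) ` {z. poly (A - Polynomial.smult c C) z = 0}"
  proof (cases rule: X_cases)
    case (1 z)
    then have "\<rho> (poly A z) (poly C z) = \<rho> c 1" using \<open>f x = \<rho> c 1\<close> by simp
    then have "poly A z = poly C z * c" using \<rho>_eq_iff[OF nz] by simp
    then show ?thesis using 1 by (auto simp: mult.commute)
  next
    case 2
    then have "\<rho> 1 0 = \<rho> c 1" using \<open>f x = \<rho> c 1\<close> by simp
    then show ?thesis by (simp add: \<rho>_eq_iff)
  qed
next
  fix x assume "x \<in> (\<lambda>z. \<pi> z 1) ` {z. poly (A - Polynomial.smult c C) z = 0}"
  then obtain z where z: "poly A z = c * poly C z" "x = \<pi> z 1" by auto
  have "\<rho> (poly A z) (poly C z) = \<rho> c 1"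
    by (rule iffD2[OF \<rho>_eq_iff[OF nz]]) (use z(1) in \<open>simp_all add: mult.commute\<close>)
  then show "x \<in> fibre X f (\<rho> c 1)" using z in_X by (simp add: fibre_def)
qed

lemma fibre_infinity: "fibre X f (\<rho> 1 0) = insert (\<pi> 1 0) ((\<lambda>z. \<pi> z 1) ` {z. poly C z = 0})"
proof (intro subset_antisym subsetI)
  fix x assume x: "x \<in> fibre X f (\<rho> 1 0)"
  then have "x \<in> topspace X" "f x = \<rho> 1 0" by (auto simp: fibre_def)
  then show "x \<in> insert (\<pi> 1 0) ((\<lambda>z. \<pi> z 1) ` {z. poly C z = 0})"
  proof (cases rule: X_cases)
    case (1 z)
    then have "\<rho> (poly A z) (poly C z) = \<rho> 1 0" using \<open>f x = \<rho> 1 0\<close> by simp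
    then have "poly C z = 0" using \<rho>_eq_iff[OF nz] by simp
    then show ?thesis using 1 by auto
  qed simp
next
  fix x assume "x \<in> insert (\<pi> 1 0) ((\<lambda>z. \<pi> z 1) ` {z. poly C z = 0})"
  then consider "x = \<pi> 1 0" | z where "poly C z = 0" "x = \<pi> z 1" by auto
  then show "x \<in> fibre X f (\<rho> 1 0)"
  proof cases
    case 2
    have "\<rho> (poly A z) (poly C z) = \<rho> 1 0"
      by (rule iffD2[OF \<rho>_eq_iff[OF nz]]) (use 2(1) in simp_all)
    then show ?thesis using 2 in_X by (simp add: fibre_def)
  qed (simp add: fibre_def in_X)
qed

lemma ld_finite: "poly (A - Polynomial.smult c C) z = 0 \<Longrightarrow> local_degree X Y f (\<pi> z 1) = Polynomial.order z (A - Polynomial.smult c C)"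
  using lp_finite[of z c] nz[of z] by (intro local_degree_eq) auto

lemma ld_pole: "poly C z = 0 \<Longrightarrow> local_degree X Y f (\<pi> z 1) = Polynomial.order z C"
  using lp_pole by (rule local_degree_eq)

lemma ld_infinity: "local_degree X Y f (\<pi> 1 0) = degree A - degree C"
  using lp_infinity by (rule local_degree_eq)

lemma partition_finite: "local_degree_partition X Y f (\<rho> c 1) = root_orders (A - Polynomial.smult c C)"
proof -
  have "local_degree_partition X Y f (\<rho> c 1) = image_mset (local_degree X Y f) (image_mset (\<lambda>z. \<pi> z 1) (mset_set {z. poly (A - Polynomial.smult c C) z = 0}))"
    unfolding local_degree_partition_def fibre_finite
    by (subst image_mset_mset_set) (use inj_\<pi> in \<open>auto intro: inj_on_subset\<close>)
  also have "\<dots> = image_mset (\<lambda>z. local_degree X Y f (\<pi> z 1)) (mset_set {z. poly (A - Polynomial.smult c C) z = 0})"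
    by (simp add: image_mset.compositionality comp_def)
  also have "\<dots> = root_orders (A - Polynomial.smult c C)"
    unfolding root_orders_def
    by (rule image_mset_cong) (use poly_roots_finite[OF sub_neq0] in \<open>simp add: ld_finite del: poly_diff poly_smult\<close>)
  finally show ?thesis .
qed

lemma partition_infinity: "local_degree_partition X Y f (\<rho> 1 0) = add_mset (degree A - degree C) (root_orders C)"
proof -
  let ?R = "(\<lambda>z. \<pi> z 1) ` {z. poly C z = 0}"
  have fin: "finite ?R" using poly_roots_finite[OF C0] by simp
  have nin: "\<pi> 1 0 \<notin> ?R" by (auto simp: \<pi>_eq_iff)
  have "local_degree_partition X Y f (\<rho> 1 0) = add_mset (degree A - degree C) (image_mset (local_degree X Y f) (mset_set ?R))"
    unfolding local_degree_partition_def fibre_infinity using fin nin by (simp add: ld_infinity)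
  also have "image_mset (local_degree X Y f) (mset_set ?R) = image_mset (local_degree X Y f) (image_mset (\<lambda>z. \<pi> z 1) (mset_set {z. poly C z = 0}))"
    by (subst image_mset_mset_set) (use inj_\<pi> in \<open>auto intro: inj_on_subset\<close>)
  also have "\<dots> = image_mset (\<lambda>z. local_degree X Y f (\<pi> z 1)) (mset_set {z. poly C z = 0})"
    by (simp add: image_mset.compositionality comp_def)
  also have "\<dots> = root_orders C"
    unfolding root_orders_def
    by (rule image_mset_cong) (use poly_roots_finite[OF C0] in \<open>simp add: ld_pole\<close>)
  finally show ?thesis .
qed

end

section \<open>Wronskians and the branching of rational functions\<close>

text \<open>If \<open>F\<close> is the \<open>n\<close>-th power of \<open>[:- a, 1:]\<close> times
  \<open>q\<close>, then \<open>W\<close> is the power with exponent \<open>n - 1\<close> times a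
  polynomial whose value at \<open>a\<close> is \<open>n\<close> times the values of
  \<open>q\<close> and \<open>G\<close> there, hence nonzero.\<close>

lemma order_wronskian:
  fixes F G :: "complex poly"
  assumes F: "F \<noteq> 0" "poly F a = 0" and G: "poly G a \<noteq> 0" and W: "W = pderiv F * G - F * pderiv G"
  shows "Polynomial.order a W = Polynomial.order a F - 1" "W \<noteq> 0"
proof -
  define n where "n = Polynomial.order a F"
  have n0: "n \<noteq> 0" using F by (simp add: n_def order_root)
  then obtain k where k: "n = Suc k" using not0_implies_Suc by blast
  obtain q where q: "F = [:- a, 1:] ^ n * q" "\<not> [:- a, 1:] dvd q"
    using order_decomp[OF F(1), of a] by (auto simp: n_def)
  have "W = [:- a, 1:] ^ k * (Polynomial.smult (of_nat n) (q * G) + [:- a, 1:] * (pderiv q * G - q * pderiv G))"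
    unfolding W q(1) k pderiv_mult pderiv_power_Suc
    by (simp add: pderiv_pCons algebra_simps smult_add_left)
  moreover have "\<not> [:- a, 1:] dvd (Polynomial.smult (of_nat n) (q * G) + [:- a, 1:] * (pderiv q * G - q * pderiv G))"
    using q(2) G n0 by (simp add: poly_eq_0_iff_dvd[symmetric])
  ultimately have W': "[:- a, 1:] ^ k dvd W" "\<not> [:- a, 1:] ^ Suc k dvd W"
    by (simp_all only: power_Suc2 dvd_mult_cancel_left dvd_triv_left) (simp add: power_0_left)
  show "W \<noteq> 0" using W'(2) by auto
  show "Polynomial.order a W = Polynomial.order a F - 1"
    using order_unique_lemma[OF W'] k n_def by simp
qed

text \<open>Over the complex numbers the absence of common roots means coprimality. The induction
  takes one linear factor of \<open>q\<close> at a time out of \<open>c\<close>; it must come from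
  the cofactor of \<open>p\<close>, because \<open>p\<close> does not vanish at its root.\<close>

lemma complex_poly_divides_mult:
  fixes p q c :: "complex poly"
  assumes "p dvd c" "q dvd c" "q \<noteq> 0" "\<And>z. poly p z = 0 \<Longrightarrow> poly q z = 0 \<Longrightarrow> False"
  shows "p * q dvd c"
  using assms
proof (induction "degree q" arbitrary: q c)
  case 0
  then have "q dvd 1" by (simp add: is_unit_iff_degree)
  then show ?case using 0(2) by (simp add: mult_unit_dvd_iff)
next
  case (Suc n)
  have "\<not> constant (poly q)" using Suc.hyps(2) by (simp add: constant_degree)
  then obtain a where a: "poly q a = 0" using Fundamental_Theorem_Algebra.fundamental_theorem_of_algebra by blast
  then obtain q' where q': "q = [:-a, 1:] * q'" using poly_eq_0_iff_dvd by (metis dvdE)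
  obtain c' where c': "c = p * c'" using Suc.prems(1) by (rule dvdE)
  have "poly c a = 0" using Suc.prems(2) a by (auto elim: dvdE)
  moreover have "poly p a \<noteq> 0" using Suc.prems(4) a by blast
  ultimately have "poly c' a = 0" using c' by simp
  then obtain c2 where c2: "c' = [:-a, 1:] * c2" using poly_eq_0_iff_dvd by (metis dvdE)
  have c: "c = [:-a, 1:] * (p * c2)" unfolding c' c2 by (simp only: ac_simps)
  have n0: "[:-a, 1:] \<noteq> 0" by simp
  have "q' dvd p * c2" using Suc.prems(2) unfolding q' c by (simp only: dvd_mult_cancel_left n0 simp_thms)
  moreover have "q' \<noteq> 0" using Suc.prems(3) q' by auto
  moreover have "degree q = degree [:-a, 1:] + degree q'" unfolding q' using n0 \<open>q' \<noteq> 0\<close> by (rule degree_mult_eq)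
  then have "n = degree q'" using Suc.hyps(2) by simp
  moreover have "poly p z = 0 \<Longrightarrow> poly q' z = 0 \<Longrightarrow> False" for z using Suc.prems(4)[of z] unfolding q' by simp
  ultimately have "p * q' dvd p * c2" using Suc.hyps(1)[OF \<open>n = degree q'\<close> dvd_triv_left] by blast
  then have "[:-a, 1:] * (p * q') dvd [:-a, 1:] * (p * c2)" by (rule mult_dvd_mono[OF dvd_refl])
  moreover have "p * q = [:-a, 1:] * (p * q')" unfolding q' by (simp only: ac_simps)
  ultimately show ?case using c by simp
qed

lemma power_dvd_pderiv:
  fixes P R :: "complex poly"
  assumes "F = P ^ e * R" "e \<ge> 1"
  shows "P ^ (e - 1) dvd F" "P ^ (e - 1) dvd pderiv F"
proof -
  obtain k where k: "e = Suc k" using assms(2) by (cases e) auto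
  have F: "F = P ^ k * (P * R)" using assms k by simp
  show "P ^ (e - 1) dvd F" using F k by simp
  have "pderiv F = P ^ k * (P * pderiv R + Polynomial.smult (of_nat (Suc k)) (pderiv P * R))"
    unfolding assms(1) k pderiv_mult pderiv_power_Suc by (simp add: algebra_simps smult_add_left)
  then show "P ^ (e - 1) dvd pderiv F" using k by simp
qed

lemma order_power_mult:
  fixes P R :: "complex poly"
  assumes "P ^ e * R \<noteq> 0"
  shows "Polynomial.order a (P ^ e * R) = e * Polynomial.order a P + Polynomial.order a R"
proof -
  have "P ^ e \<noteq> 0" using assms by auto
  then have "Polynomial.order a (P ^ e) = e * Polynomial.order a P"
  proof (induction e)
    case (Suc e)
    then show ?case by (subst power_Suc, subst order_mult) auto
  qed simp
  then show ?thesis using order_mult[OF assms] by simp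
qed

text \<open>With all orders at most 1 the multiset of roots is a set, and its size is the degree by
  the fundamental theorem of algebra.\<close>

lemma card_simple_roots:
  fixes p :: "complex poly"
  assumes "p \<noteq> 0" "\<And>a. Polynomial.order a p = 0 \<or> Polynomial.order a p = 1"
  shows "card {z. poly p z = 0} = degree p"
proof -
  have fin: "finite {z. poly p z = 0}" using assms(1) poly_roots_finite by blast
  have "proots p = mset_set {z. poly p z = 0}"
  proof (rule multiset_eqI)
    fix a
    show "count (proots p) a = count (mset_set {z. poly p z = 0}) a"
      using assms(2)[of a] assms(1) fin order_root[of p a] by (auto simp: count_mset_set')
  qed
  then show ?thesis using size_proots_complex[of p] by simp
qed

text \<open>The hypothesis \<open>simple\<close> says that at each root of \<open>F\<close> exactly
  one of \<open>P\<close> and \<open>R\<close> vanishes, and only to first order; so every root has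
  multiplicity \<open>e\<close> or 1.\<close>

lemma root_orders_power_mult:
  fixes P R :: "complex poly"
  assumes F: "F = P ^ e * R" "F \<noteq> 0" and e: "e \<ge> 1"
    and simple: "\<And>a. poly F a = 0 \<Longrightarrow> Polynomial.order a P + Polynomial.order a R = 1"
  shows "root_orders F = replicate_mset (degree P) e + replicate_mset (degree R) 1"
proof -
  have P0: "P \<noteq> 0" "R \<noteq> 0" using F e by auto
  let ?p = "{z. poly P z = 0}" and ?r = "{z. poly R z = 0}"
  have root: "poly F a = 0" if "poly P a = 0 \<or> poly R a = 0" for a using that F e by auto
  have oP: "Polynomial.order a P = 0 \<or> Polynomial.order a P = 1" for a
    using simple[of a] root[of a] P0 by (cases "poly P a = 0") (auto simp: order_root)
  have oR: "Polynomial.order a R = 0 \<or> Polynomial.order a R = 1" for a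
    using simple[of a] root[of a] P0 by (cases "poly R a = 0") (auto simp: order_root)
  have c: "card ?p = degree P" "card ?r = degree R"
    using card_simple_roots[OF P0(1) oP] card_simple_roots[OF P0(2) oR] by blast+
  have fin: "finite ?p" "finite ?r" using P0 poly_roots_finite by blast+
  have dj: "?p \<inter> ?r = {}"
  proof (rule ccontr)
    assume "?p \<inter> ?r \<noteq> {}"
    then obtain a where "poly P a = 0" "poly R a = 0" by blast
    then have "Polynomial.order a P \<noteq> 0" "Polynomial.order a R \<noteq> 0" "poly F a = 0" using P0 root by (auto simp: order_root)
    then show False using simple[of a] by simp
  qed
  have roots: "{z. poly F z = 0} = ?p \<union> ?r" using F e by auto
  have p: "Polynomial.order a F = e" if "a \<in> ?p" for a
  proof -
    have "Polynomial.order a P \<noteq> 0" "poly F a = 0" using that P0 root by (auto simp: order_root)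
    then have "Polynomial.order a P = 1" "Polynomial.order a R = 0" using simple[of a] by auto
    then show ?thesis using order_power_mult[of P e R a] F by simp
  qed
  have r: "Polynomial.order a F = 1" if "a \<in> ?r" for a
  proof -
    have "Polynomial.order a R \<noteq> 0" "poly F a = 0" using that P0 root by (auto simp: order_root)
    then have "Polynomial.order a R = 1" "Polynomial.order a P = 0" using simple[of a] by auto
    then show ?thesis using order_power_mult[of P e R a] F by simp
  qed
  have "root_orders F = image_mset (\<lambda>z. Polynomial.order z F) (mset_set ?p) + image_mset (\<lambda>z. Polynomial.order z F) (mset_set ?r)"
    unfolding root_orders_def roots using mset_set_Union[OF fin dj] by simp
  also have "image_mset (\<lambda>z. Polynomial.order z F) (mset_set ?p) = image_mset (\<lambda>z. e) (mset_set ?p)"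
    by (rule image_mset_cong) (use p fin in auto)
  also have "image_mset (\<lambda>z. Polynomial.order z F) (mset_set ?r) = image_mset (\<lambda>z. 1) (mset_set ?r)"
    by (rule image_mset_cong) (use r fin in auto)
  finally show ?thesis using c by (simp add: image_mset_const_eq)
qed

text \<open>\<open>RH\<close> is the Riemann--Hurwitz count: it gives
  \<open>P ^ (e - 1) * T ^ (g - 1) * Q\<close> the degree \<open>2 * d - m - 1\<close>, which also
  bounds the degree of the Wronskian from above, \<open>m\<close> being the order of the pole at
  infinity. As the product divides the Wronskian, both agree up to a constant, and the order of the
  Wronskian at every point can be read off from the factors.\<close>

theorem rational_map_branch_data:
  fixes A C P R T U Q V :: "complex poly"
  assumes SX: "closed_surface X" "X homeomorphic_space nsphere 2" and SY: "closed_surface Y" "Y homeomorphic_space nsphere 2"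
    and A: "A = P ^ e * R" and C: "C = T ^ g * U" and B: "A - C = Q ^ 2 * V"
    and dg: "degree A = d" "degree C = d - m" "2 \<le> m" "m \<le> d" and C0: "C \<noteq> 0"
    and cop: "\<And>z. poly A z = 0 \<Longrightarrow> poly C z = 0 \<Longrightarrow> False"
    and eg: "e \<ge> 2" "g \<ge> 1" "degree P > 0" "degree Q > 0"
    and RH: "(e - 1) * degree P + (g - 1) * degree T + degree Q = 2 * d - m - 1"
  shows "\<exists>f. branched_cover X Y f \<and> has_cover_degree X Y f d \<and> branch_data X Y f =
    {# replicate_mset (degree Q) 2 + replicate_mset (degree V) 1, replicate_mset (degree P) e + replicate_mset (degree R) 1,
       add_mset m (replicate_mset (degree T) g + replicate_mset (degree U) 1) #}"
proof -
  obtain \<pi> where \<pi>: "proj_line X \<pi>" using proj_line_exists[OF SX(2)] by blast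
  obtain \<rho> where \<rho>: "proj_line Y \<rho>" using proj_line_exists[OF SY(2)] by blast
  interpret rational_pair X Y \<pi> \<rho> A C
    by unfold_locales (use \<pi> \<rho> dg C0 cop in auto)
  define B where "B = A - C"
  have B0: "B \<noteq> 0" using sub_neq0[of 1] by (simp add: B_def)
  have BQ: "B = Q ^ 2 * V" using B by (simp add: B_def)
  have P0: "P \<noteq> 0" "R \<noteq> 0" "T ^ (g - 1) \<noteq> 0" "U \<noteq> 0" "Q \<noteq> 0" "V \<noteq> 0"
    using A0 C0 B0 A C BQ eg by (auto simp: power_0_left)
  define W where "W = pderiv A * C - A * pderiv C"
  \<comment> \<open>Subtracting a multiple of \<open>C\<close> from \<open>A\<close> leaves the
    Wronskian unchanged, so one polynomial governs the fibres over all finite values.\<close>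
  have WF: "W = pderiv (A - Polynomial.smult c C) * C - (A - Polynomial.smult c C) * pderiv C" for c
    by (simp add: W_def pderiv_diff pderiv_smult algebra_simps)
  define D where "D = P ^ (e - 1) * T ^ (g - 1) * Q"
  have rA: "poly A z = 0" if "poly (P ^ (e - 1)) z = 0" for z using that A eg by (auto simp: poly_power)
  have rC: "poly C z = 0" if "poly (T ^ (g - 1)) z = 0" for z using that C eg by (auto simp: poly_power)
  have rB: "poly B z = 0" if "poly Q z = 0" for z using that BQ by auto
  have ABC: "poly B z = poly A z - poly C z" for z by (simp add: B_def)
  have D0: "D \<noteq> 0" using P0 by (simp add: D_def)
  \<comment> \<open>A root of \<open>A\<close> at which \<open>C\<close> does not vanish shows that
    the Wronskian is not the zero polynomial.\<close>
  obtain a0 where "poly P a0 = 0"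
    using Fundamental_Theorem_Algebra.fundamental_theorem_of_algebra[of P] eg(3) by (auto simp: constant_degree)
  then have a0: "poly A a0 = 0" "poly C a0 \<noteq> 0" using A eg cop by auto
  have W0: "W \<noteq> 0" using order_wronskian(2)[OF A0 a0 W_def] .
  have "D dvd W"
    unfolding D_def
  proof -
    have d1: "P ^ (e - 1) dvd W" unfolding W_def
      using power_dvd_pderiv[OF A] eg by (intro dvd_diff dvd_mult2) auto
    have d2: "T ^ (g - 1) dvd W" unfolding W_def
      using power_dvd_pderiv[OF C] eg by (intro dvd_diff dvd_mult) auto
    have "Q ^ (2 - 1) dvd B" "Q ^ (2 - 1) dvd pderiv B" using power_dvd_pderiv[OF BQ] by auto
    moreover have "W = pderiv B * C - B * pderiv C" using WF[of 1] by (simp add: B_def)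
    ultimately have d3: "Q dvd W" by (simp add: dvd_diff dvd_mult2)
    have d12: "P ^ (e - 1) * T ^ (g - 1) dvd W"
      by (rule complex_poly_divides_mult[OF d1 d2 P0(3)]) (use rA rC cop in blast)
    show "P ^ (e - 1) * T ^ (g - 1) * Q dvd W"
    proof (rule complex_poly_divides_mult[OF d12 d3 P0(5)])
      fix z assume z: "poly (P ^ (e - 1) * T ^ (g - 1)) z = 0" "poly Q z = 0"
      then have "poly A z = 0 \<or> poly C z = 0" "poly A z = poly C z" using rA[of z] rC[of z] rB[of z] ABC[of z] by auto
      then show False using cop[of z] by auto
    qed
  qed
  then obtain K where K: "W = D * K" by blast
  have "degree D = 2 * d - m - 1"
  proof -
    have "degree (T ^ (g - 1)) = (g - 1) * degree T"
      using P0(3) by (cases "T = 0") (auto simp: degree_power_eq power_0_left split: if_splits)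
    moreover have "degree (P ^ (e - 1)) = (e - 1) * degree P" using P0(1) by (rule degree_power_eq)
    moreover have "degree D = degree (P ^ (e - 1)) + degree (T ^ (g - 1)) + degree Q"
      unfolding D_def using P0(1,3,5) by (simp add: degree_mult_eq del: One_nat_def)
    ultimately show ?thesis using RH by linarith
  qed
  moreover have "degree W \<le> 2 * d - m - 1"
    unfolding W_def
  proof (rule degree_diff_le)
    have "degree (pderiv A * C) \<le> degree (pderiv A) + degree C" by (rule degree_mult_le)
    moreover have "degree (pderiv A) = d - 1" by (simp only: degree_pderiv dg(1))
    ultimately show "degree (pderiv A * C) \<le> 2 * d - m - 1" using dg by linarith
    have "degree (A * pderiv C) \<le> degree A + degree (pderiv C)" by (rule degree_mult_le)
    moreover have "degree (pderiv C) = d - m - 1" using dg by (simp add: degree_pderiv)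
    \<comment> \<open>For \<open>d = m\<close> the subtraction \<open>d - m - 1\<close> is truncated
      and the estimate by degrees would be too weak by one; in that case \<open>C\<close> is
      constant and the product vanishes.\<close>
    moreover have z: "A * pderiv C = 0" if "d = m"
    proof -
      have "degree C = 0" using that dg by simp
      then show ?thesis by (simp add: pderiv_eq_0_iff)
    qed
    ultimately show "degree (A * pderiv C) \<le> 2 * d - m - 1" using dg
    proof (cases "d = m")
      case True
      then have "A * pderiv C = 0" by (rule z)
      then show ?thesis by (simp only: degree_0 le0)
    qed linarith
  qed
  moreover have "K \<noteq> 0" using K W0 by auto
  ultimately have "degree K = 0" using K D0 by (simp add: degree_mult_eq)
  then obtain \<kappa> where \<kappa>: "K = [:\<kappa>:]" using degree_eq_zeroE by blast
  have oK: "Polynomial.order a K = 0" for a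
    using \<open>K \<noteq> 0\<close> \<kappa> order_root[of K a] by auto
  have oW: "Polynomial.order a W = Polynomial.order a (P ^ (e - 1)) + Polynomial.order a (T ^ (g - 1)) + Polynomial.order a Q" for a
  proof -
    have "D * K \<noteq> 0" using K W0 by auto
    then show ?thesis unfolding K D_def using P0 oK D0 by (simp add: order_mult D_def)
  qed
  have opow: "Polynomial.order a (p ^ n) = n * Polynomial.order a p" if "p ^ n \<noteq> 0" for a n and p :: "complex poly"
    using order_power_mult[of p n 1 a] that by simp
  have o0: "Polynomial.order a p = 0" if "poly p a \<noteq> 0" for a and p :: "complex poly"
    using that order_root by blast
  \<comment> \<open>The order of the Wronskian is one less than that of \<open>A\<close> by
    \<open>order_wronskian\<close>, and \<open>e - 1\<close> times the order of \<open>P\<close> by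
    the factorization. Comparing the two leaves 1 for the sum of the orders of \<open>P\<close> and
    \<open>R\<close>.\<close>
  have simA: "Polynomial.order a P + Polynomial.order a R = 1" if a: "poly A a = 0" for a
  proof -
    have Ca: "poly C a \<noteq> 0" using cop a by blast
    have "poly (T ^ (g - 1)) a \<noteq> 0" "poly Q a \<noteq> 0" using rC[of a] rB[of a] ABC[of a] a Ca by auto
    then have "Polynomial.order a W = (e - 1) * Polynomial.order a P"
      using oW[of a] o0 opow[of P "e - 1" a] P0 by simp
    moreover have "Polynomial.order a A = e * Polynomial.order a P + Polynomial.order a R"
      using order_power_mult[of P e R a] A A0 by simp
    moreover have "Polynomial.order a A \<noteq> 0" using a A0 by (simp add: order_root)
    moreover have "e * Polynomial.order a P = (e - 1) * Polynomial.order a P + Polynomial.order a P"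
      using eg by (cases e) auto
    ultimately show ?thesis using order_wronskian(1)[OF A0 a Ca W_def] by linarith
  qed
  have simC: "Polynomial.order a T + Polynomial.order a U = 1" if a: "poly C a = 0" for a
  proof -
    have Aa: "poly A a \<noteq> 0" using cop a by blast
    have W': "- W = pderiv C * A - C * pderiv A" by (simp add: W_def)
    have "poly (P ^ (e - 1)) a \<noteq> 0" "poly Q a \<noteq> 0" using rA[of a] rB[of a] ABC[of a] a Aa by auto
    then have "Polynomial.order a W = (g - 1) * Polynomial.order a T"
      using oW[of a] o0 opow[of T "g - 1" a] P0 by simp
    moreover have "Polynomial.order a C = g * Polynomial.order a T + Polynomial.order a U"
      using order_power_mult[of T g U a] C C0 by simp
    moreover have "Polynomial.order a C \<noteq> 0" using a C0 by (simp add: order_root)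
    moreover have "g * Polynomial.order a T = (g - 1) * Polynomial.order a T + Polynomial.order a T"
      using eg by (cases g) auto
    moreover have "Polynomial.order a (- W) = Polynomial.order a W" by (simp add: order_uminus)
    ultimately show ?thesis using order_wronskian(1)[OF C0 a Aa W'] by linarith
  qed
  have simB: "Polynomial.order a Q + Polynomial.order a V = 1" if a: "poly B a = 0" for a
  proof -
    have Ca: "poly C a \<noteq> 0" "poly A a \<noteq> 0" using cop[of a] a ABC[of a] by auto
    have W': "W = pderiv B * C - B * pderiv C" using WF[of 1] by (simp add: B_def)
    have "poly (P ^ (e - 1)) a \<noteq> 0" "poly (T ^ (g - 1)) a \<noteq> 0" using rA[of a] rC[of a] Ca by auto
    then have "Polynomial.order a W = Polynomial.order a Q"
      using oW[of a] o0 by simp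
    moreover have "Polynomial.order a B = 2 * Polynomial.order a Q + Polynomial.order a V"
      using order_power_mult[of Q 2 V a] BQ B0 by simp
    moreover have "Polynomial.order a B \<noteq> 0" using a B0 by (simp add: order_root)
    ultimately show ?thesis using order_wronskian(1)[OF B0 a Ca(1) W'] by linarith
  qed
  \<comment> \<open>Over a value other than 0, 1 and infinity none of the factors vanishes, hence
    neither does the Wronskian, and all roots are simple.\<close>
  have gen: "Polynomial.order a (A - Polynomial.smult c C) = 1"
    if c: "c \<noteq> 0" "c \<noteq> 1" and a: "poly (A - Polynomial.smult c C) a = 0" for a c
  proof -
    have ac: "poly A a = c * poly C a" using a by simp
    have Ca: "poly C a \<noteq> 0" using cop[of a] ac by auto
    have Aa: "poly A a \<noteq> 0" using ac c Ca by simp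
    have "poly B a = (c - 1) * poly C a" using ABC[of a] ac by (simp add: algebra_simps)
    then have Ba: "poly B a \<noteq> 0" using c Ca by simp
    have "poly (P ^ (e - 1)) a \<noteq> 0" "poly (T ^ (g - 1)) a \<noteq> 0" "poly Q a \<noteq> 0"
      using rA[of a] rC[of a] rB[of a] Ca Aa Ba by auto
    then have "Polynomial.order a W = 0" using oW[of a] o0 by simp
    moreover have "Polynomial.order a (A - Polynomial.smult c C) \<noteq> 0" using a sub_neq0[of c] by (simp only: order_root simp_thms)
    ultimately show ?thesis using order_wronskian(1)[OF sub_neq0 a Ca WF] by simp
  qed
  have pA: "local_degree_partition X Y f (\<rho> 0 1) = replicate_mset (degree P) e + replicate_mset (degree R) 1"
    using partition_finite[of 0] root_orders_power_mult[OF A A0 _ simA] eg by simp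
  have pB: "local_degree_partition X Y f (\<rho> 1 1) = replicate_mset (degree Q) 2 + replicate_mset (degree V) 1"
    using partition_finite[of 1] root_orders_power_mult[OF BQ B0 _ simB] by (simp add: B_def)
  have pC: "local_degree_partition X Y f (\<rho> 1 0) = add_mset m (replicate_mset (degree T) g + replicate_mset (degree U) 1)"
    using partition_infinity root_orders_power_mult[OF C C0 eg(2) simC] dg by simp
  have finfib: "finite (fibre X f (\<rho> c 1))" for c
    unfolding fibre_finite using poly_roots_finite[OF sub_neq0] by blast
  have big: "y \<in> branching_points X Y f" if y: "y \<in> topspace Y" and k: "k \<in># local_degree_partition X Y f y" "k > 1" for y k
  proof -
    have fin: "finite (fibre X f y)" using k(1) unfolding local_degree_partition_def by (metis empty_iff mset_set.infinite image_mset_empty set_mset_empty)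
    then obtain x where "x \<in> fibre X f y" "local_degree X Y f x = k"
      using k(1) unfolding local_degree_partition_def by auto
    then show ?thesis using y k(2) by (auto simp: branching_points_def)
  qed
  have nb: "\<rho> c 1 \<notin> branching_points X Y f" if "c \<noteq> 0" "c \<noteq> 1" for c
  proof
    assume "\<rho> c 1 \<in> branching_points X Y f"
    then obtain x where x: "x \<in> fibre X f (\<rho> c 1)" "local_degree X Y f x > 1" by (auto simp: branching_points_def)
    then obtain z where z: "poly (A - Polynomial.smult c C) z = 0" "x = \<pi> z 1" unfolding fibre_finite by blast
    then show False using x(2) ld_finite[OF z(1)] gen[OF that z(1)] by simp
  qed
  have bp: "branching_points X Y f = {\<rho> 1 1, \<rho> 0 1, \<rho> 1 0}"
  proof (intro subset_antisym subsetI)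
    fix y assume y: "y \<in> branching_points X Y f"
    then have "y \<in> topspace Y" by (simp add: branching_points_def)
    then show "y \<in> {\<rho> 1 1, \<rho> 0 1, \<rho> 1 0}"
    proof (cases rule: Y_cases)
      case (1 c)
      then show ?thesis using nb[of c] y by (cases "c = 0"; cases "c = 1") auto
    qed simp
  next
    have "e \<in># local_degree_partition X Y f (\<rho> 0 1)" "2 \<in># local_degree_partition X Y f (\<rho> 1 1)"
      "m \<in># local_degree_partition X Y f (\<rho> 1 0)" using pA pB pC eg by auto
    then have "\<rho> 0 1 \<in> branching_points X Y f" "\<rho> 1 1 \<in> branching_points X Y f" "\<rho> 1 0 \<in> branching_points X Y f"
      using big in_Y eg dg(3) by (auto simp: Suc_le_eq numeral_2_eq_2)
    then show "y \<in> branching_points X Y f" if "y \<in> {\<rho> 1 1, \<rho> 0 1, \<rho> 1 0}" for y using that by blast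
  qed
  have hd: "has_cover_degree X Y f d"
    unfolding has_cover_degree_def
  proof
    fix y assume y: "y \<in> topspace Y - branching_points X Y f"
    then have yY: "y \<in> topspace Y" by simp
    from yY show "finite (fibre X f y) \<and> card (fibre X f y) = d"
    proof (cases rule: Y_cases)
      case (1 c)
      then have c: "c \<noteq> 0" "c \<noteq> 1" using y bp by auto
      let ?p = "A - Polynomial.smult c C"
      have "Polynomial.order a ?p = 0 \<or> Polynomial.order a ?p = 1" for a
        using gen[OF c, of a] o0 by blast
      then have "card {z. poly ?p z = 0} = degree ?p" by (rule card_simple_roots[OF sub_neq0])
      also have "degree ?p = d"
      proof -
        have "degree (Polynomial.smult c C) < degree A" using dg c(1) by simp
        then have "degree (A + - Polynomial.smult c C) = degree A" by (intro degree_add_eq_left) simp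
        then show ?thesis using dg by simp
      qed
      finally have "card {z. poly ?p z = 0} = d" .
      moreover have "card (fibre X f y) = card {z. poly ?p z = 0}"
        unfolding 1 fibre_finite using inj_\<pi> by (intro card_image) (auto intro: inj_on_subset)
      ultimately show ?thesis using finfib 1 by simp
    qed (use y bp in simp)
  qed
  have ne: "\<rho> 1 1 \<noteq> \<rho> 0 1" "\<rho> 1 1 \<noteq> \<rho> 1 0" "\<rho> 0 1 \<noteq> \<rho> 1 0" by (simp_all add: \<rho>_eq_iff)
  have "branch_data X Y f = {# replicate_mset (degree Q) 2 + replicate_mset (degree V) 1,
       replicate_mset (degree P) e + replicate_mset (degree R) 1,
       add_mset m (replicate_mset (degree T) g + replicate_mset (degree U) 1) #}"
    unfolding branch_data_def bp using ne by (simp add: pA pB pC)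
  then show ?thesis using branched_cover_f[OF SX(1) SY(1)] hd by blast
qed

section \<open>The seven realizations\<close>

text \<open>The second identity is a Bezout certificate for the absence of common roots of \<open>A\<close> and \<open>C\<close>.\<close>

lemma rational_realization:
  fixes P R T U Q V S1 S2 :: "complex poly" and X :: "'a topology" and Y :: "'b topology"
  assumes XY: "closed_surface X" "X homeomorphic_space nsphere 2" "closed_surface Y" "Y homeomorphic_space nsphere 2"
    and deg: "degree P = p" "degree R = r" "degree T = t" "degree U = u" "degree Q = q" "degree V = v"
    and nz: "P \<noteq> 0" "R \<noteq> 0" "T \<noteq> 0" "U \<noteq> 0"
    and n: "e * p + r = d" "g * t + u + m = d" "2 \<le> m" "2 \<le> e" "1 \<le> g" "0 < p" "0 < q" "(e - 1) * p + (g - 1) * t + q + m + 1 = 2 * d"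
    and id: "P ^ e * R - T ^ g * U = Q ^ 2 * V" "S1 * (P * R) + S2 * (T * U) = [:k:]" "k \<noteq> 0"
  shows "\<exists>f. branched_cover X Y f \<and> has_cover_degree X Y f d \<and> branch_data X Y f =
    {# replicate_mset q 2 + replicate_mset v 1, replicate_mset p e + replicate_mset r 1,
       add_mset m (replicate_mset t g + replicate_mset u 1) #}"
proof -
  have dA: "degree (P ^ e * R) = d" and dC: "degree (T ^ g * U) = d - m"
    using nz n(1,2) deg by (simp_all add: degree_mult_eq degree_power_eq)
  have cop: False if "poly (P ^ e * R) z = 0" "poly (T ^ g * U) z = 0" for z
  proof -
    have "poly (P * R) z = 0" "poly (T * U) z = 0" using that by auto
    then have "poly (S1 * (P * R) + S2 * (T * U)) z = 0" by (simp only: poly_add poly_mult) simp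
    then show False unfolding id(2) using id(3) by simp
  qed
  show ?thesis
    using rational_map_branch_data[OF XY refl refl id(1) dA dC n(3) _ _ cop n(4,5)] nz n deg by simp
qed

context
  fixes X :: "'a topology" and Y :: "'b topology"
  assumes XY: "closed_surface X" "X homeomorphic_space nsphere 2" "closed_surface Y" "Y homeomorphic_space nsphere 2"
begin

lemma power7: "x ^ 7 = x * (x * (x * (x * (x * (x * x)))))" for x :: "'c :: monoid_mult"
  by (simp add: numeral_eq_Suc)

lemma power4: "x ^ 4 = x * (x * (x * x))" for x :: "'c :: monoid_mult"
  by (simp add: numeral_eq_Suc)

text \<open>A pole of order 5 requires \<open>z ^ 4 * R\<close> to differ from a square by a
  polynomial of degree 1, so \<open>Q\<close> is the polynomial part of its square root at infinity.
  With \<open>R\<close> scaled to \<open>z ^ 2 + 2 * z + b\<close>, the coefficient of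
  \<open>1 / z\<close> in that root vanishes only for \<open>b = 5\<close> and the degenerate
  \<open>b = 1\<close>.\<close>

lemma realize_6:
  "\<exists>f. branched_cover X Y f \<and> has_cover_degree X Y f 6 \<and> branch_data X Y f =
    {# replicate_mset 3 2, add_mset 4 (replicate_mset 2 1), {#5, 1#} #}"
proof -
  have pq: "[:0, 1:] ^ 4 * [:5, 2, 1:] - 1 ^ 1 * [:-4, 8:] = ([:-2, 2, 1, 1:] :: complex poly) ^ 2 * 1"
    by (simp add: power2_eq_square power3_eq_cube power4 power7)
  have co: "[:32:] * ([:0, 1:] * [:5, 2, 1:]) + [:-25, -10, -4:] * (1 * [:-4, 8:]) = [:100 :: complex:]"
    by simp
  show ?thesis
    using rational_realization[OF XY, of "[:0, 1:]" 1 "[:5, 2, 1:]" 2 "1" 0 "[:-4, 8:]" 1 "[:-2, 2, 1, 1:]" 3 "1" 0 4 6 1 5, OF _ _ _ _ _ _ _ _ _ _ _ _ _ _ _ _ _ _ pq co]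
    by (simp add: add_mset_commute numeral_2_eq_2 numeral_3_eq_3)
qed

text \<open>This is the classical formula for \<open>j / 1728\<close> on the modular curve X_0(7),
  whose cusps have widths 7 and 1.\<close>

lemma realize_8:
  "\<exists>f. branched_cover X Y f \<and> has_cover_degree X Y f 8 \<and> branch_data X Y f =
    {# replicate_mset 4 2, replicate_mset 2 3 + replicate_mset 2 1, {#7, 1#} #}"
proof -
  have pq: "[:1, 5, 1:] ^ 3 * [:49, 13, 1:] - 1 ^ 1 * [:0, 1728:] = ([:-7, 70, 63, 14, 1:] :: complex poly) ^ 2 * 1"
    by (simp add: power2_eq_square power3_eq_cube power4 power7)
  have co: "[:1728:] * ([:1, 5, 1:] * [:49, 13, 1:]) + [:-258, -115, -18, -1:] * (1 * [:0, 1728:]) = [:84672 :: complex:]"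
    by simp
  show ?thesis
    using rational_realization[OF XY, of "[:1, 5, 1:]" 2 "[:49, 13, 1:]" 2 "1" 0 "[:0, 1728:]" 1 "[:-7, 70, 63, 14, 1:]" 4 "1" 0 3 8 1 7, OF _ _ _ _ _ _ _ _ _ _ _ _ _ _ _ _ _ _ pq co]
    by (simp add: add_mset_commute numeral_2_eq_2 numeral_3_eq_3)
qed

text \<open>With \<open>V\<close> placed at 0, \<open>Q\<close> is the polynomial part at infinity
  of the square root of \<open>P ^ 3 / z\<close>. The pole of order 7 means that the coefficients of
  the root at \<open>1 / z\<close> and \<open>1 / z ^ 2\<close> vanish: two equations for the three
  coefficients of \<open>P\<close>, which matter only up to scaling of \<open>z\<close>.\<close>

lemma realize_9:
  "\<exists>f. branched_cover X Y f \<and> has_cover_degree X Y f 9 \<and> branch_data X Y f =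
    {# add_mset 1 (replicate_mset 4 2), replicate_mset 3 3, add_mset 7 (replicate_mset 2 1) #}"
proof -
  have pq: "[:48, 40, 8, 1:] ^ 3 * 1 - 1 ^ 1 * [:110592, 22464, 3456:] = ([:504, 280, 84, 12, 1:] :: complex poly) ^ 2 * [:0, 1:]"
    by (simp add: power2_eq_square power3_eq_cube power4 power7)
  have co: "[:22464, 3456:] * ([:48, 40, 8, 1:] * 1) + [:-8, -8, -1:] * (1 * [:110592, 22464, 3456:]) = [:193536 :: complex:]"
    by simp
  show ?thesis
    using rational_realization[OF XY, of "[:48, 40, 8, 1:]" 3 "1" 0 "1" 0 "[:110592, 22464, 3456:]" 2 "[:504, 280, 84, 12, 1:]" 4 "[:0, 1:]" 1 3 9 1 7, OF _ _ _ _ _ _ _ _ _ _ _ _ _ _ _ _ _ _ pq co]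
    by (simp add: add_mset_commute numeral_2_eq_2 numeral_3_eq_3)
qed

text \<open>With \<open>R\<close> placed at 0, \<open>Q\<close> is the polynomial part at infinity
  of the square root of \<open>z * P ^ 3\<close>. The pole of order 8 again means that the next two
  coefficients of the root vanish, which determines \<open>P\<close> up to scaling and finitely many
  choices.\<close>

lemma realize_10:
  "\<exists>f. branched_cover X Y f \<and> has_cover_degree X Y f 10 \<and> branch_data X Y f =
    {# replicate_mset 5 2, add_mset 1 (replicate_mset 3 3), add_mset 8 (replicate_mset 2 1) #}"
proof -
  have pq: "[:96, 60, 12, 1:] ^ 3 * [:0, 1:] - 1 ^ 1 * [:-186624, -48384, -5184:] = ([:432, 1080, 576, 144, 18, 1:] :: complex poly) ^ 2 * 1"
    by (simp add: power2_eq_square power3_eq_cube power4 power7)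
  have co: "[:198720, 36288:] * ([:96, 60, 12, 1:] * [:0, 1:]) + [:24, 96, 57, 7:] * (1 * [:-186624, -48384, -5184:]) = [:-4478976 :: complex:]"
    by simp
  show ?thesis
    using rational_realization[OF XY, of "[:96, 60, 12, 1:]" 3 "[:0, 1:]" 1 "1" 0 "[:-186624, -48384, -5184:]" 2 "[:432, 1080, 576, 144, 18, 1:]" 5 "1" 0 3 10 1 8, OF _ _ _ _ _ _ _ _ _ _ _ _ _ _ _ _ _ _ pq co]
    by (simp add: add_mset_commute numeral_2_eq_2 numeral_3_eq_3)
qed

text \<open>This is \<open>j / 1728\<close> on the modular curve X_0(8), whose cusps have widths 8,
  2, 1 and 1; the double pole at 0 is the cusp of width 2.\<close>

lemma realize_12a:
  "\<exists>f. branched_cover X Y f \<and> has_cover_degree X Y f 12 \<and> branch_data X Y f =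
    {# replicate_mset 6 2, replicate_mset 4 3, {#8, 2, 1, 1#} #}"
proof -
  have pq: "[:16, 0, -16, 0, 1:] ^ 3 * 1 - [:0, 1:] ^ 2 * [:-27648, 0, 1728:] = ([:64, 0, 120, 0, -24, 0, 1:] :: complex poly) ^ 2 * 1"
    by (simp add: power2_eq_square power3_eq_cube power4 power7)
  have co: "[:1728:] * ([:16, 0, -16, 0, 1:] * 1) + [:0, -1:] * ([:0, 1:] * [:-27648, 0, 1728:]) = [:27648 :: complex:]"
    by simp
  show ?thesis
    using rational_realization[OF XY, of "[:16, 0, -16, 0, 1:]" 4 "1" 0 "[:0, 1:]" 1 "[:-27648, 0, 1728:]" 2 "[:64, 0, 120, 0, -24, 0, 1:]" 6 "1" 0 3 12 2 8, OF _ _ _ _ _ _ _ _ _ _ _ _ _ _ _ _ _ _ pq co]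
    by (simp add: add_mset_commute numeral_2_eq_2 numeral_3_eq_3)
qed

text \<open>This is \<open>j / 1728\<close> on the modular curve X_0(9), whose cusps have widths 9,
  1, 1 and 1; the denominator is \<open>1728 * (z ^ 3 - 27)\<close>.\<close>

lemma realize_12b:
  "\<exists>f. branched_cover X Y f \<and> has_cover_degree X Y f 12 \<and> branch_data X Y f =
    {# replicate_mset 6 2, replicate_mset 4 3, add_mset 9 (replicate_mset 3 1) #}"
proof -
  have pq: "[:0, -24, 0, 0, 1:] ^ 3 * 1 - 1 ^ 1 * [:-46656, 0, 0, 1728:] = ([:216, 0, 0, -36, 0, 0, 1:] :: complex poly) ^ 2 * 1"
    by (simp add: power2_eq_square power3_eq_cube power4 power7)
  have co: "[:0, 0, -1728:] * ([:0, -24, 0, 0, 1:] * 1) + [:3, 0, 0, 1:] * (1 * [:-46656, 0, 0, 1728:]) = [:-139968 :: complex:]"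
    by simp
  show ?thesis
    using rational_realization[OF XY, of "[:0, -24, 0, 0, 1:]" 4 "1" 0 "1" 0 "[:-46656, 0, 0, 1728:]" 3 "[:216, 0, 0, -36, 0, 0, 1:]" 6 "1" 0 3 12 1 9, OF _ _ _ _ _ _ _ _ _ _ _ _ _ _ _ _ _ _ pq co]
    by (simp add: add_mset_commute numeral_2_eq_2 numeral_3_eq_3)
qed

text \<open>This is \<open>j / 1728\<close> on the modular curve X_1(7), with cusps of width 7 at 0,
  -1 and infinity and cusps of width 1 at the roots of the cubic factor.\<close>

lemma realize_24:
  "\<exists>f. branched_cover X Y f \<and> has_cover_degree X Y f 24 \<and> branch_data X Y f =
    {# replicate_mset 12 2, replicate_mset 8 3, replicate_mset 3 7 + replicate_mset 3 1 #}"
proof -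
  have pq: "[:1, 12, 42, 56, 35, 0, -14, -4, 1:] ^ 3 * 1 - [:0, 1, 1:] ^ 7 * [:-1728, -13824, -8640, 1728:] = ([:1, 18, 117, 354, 570, 486, 273, 222, 174, 46, -15, -6, 1:] :: complex poly) ^ 2 * 1"
    by (simp add: power2_eq_square power3_eq_cube power4 power7)
  have co: "[:84672, -64872576, -118571904, -43533504, 10165824:] * ([:1, 12, 42, 56, 35, 0, -14, -4, 1:] * 1) + [:-36954, -184478, -281925, -195671, -17066, 74501, 25193, -5883:] * ([:0, 1, 1:] * [:-1728, -13824, -8640, 1728:]) = [:84672 :: complex:]"
    by simp
  show ?thesis
    using rational_realization[OF XY, of "[:1, 12, 42, 56, 35, 0, -14, -4, 1:]" 8 "1" 0 "[:0, 1, 1:]" 2 "[:-1728, -13824, -8640, 1728:]" 3 "[:1, 18, 117, 354, 570, 486, 273, 222, 174, 46, -15, -6, 1:]" 12 "1" 0 3 24 7 7, OF _ _ _ _ _ _ _ _ _ _ _ _ _ _ _ _ _ _ pq co]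
    by (simp add: add_mset_commute numeral_2_eq_2 numeral_3_eq_3)
qed

end

section \<open>Enumeration of the data\<close>

lemma mult_eq_small:
  fixes a t :: nat
  shows "a * t = 1 \<Longrightarrow> a = 1 \<and> t = 1"
    "a * t = 2 \<Longrightarrow> (a = 1 \<and> t = 2) \<or> (a = 2 \<and> t = 1)"
    "a * t = 3 \<Longrightarrow> (a = 1 \<and> t = 3) \<or> (a = 3 \<and> t = 1)"
proof -
  show "a * t = 1 \<Longrightarrow> a = 1 \<and> t = 1" by simp
  have pr: "a * t = p \<Longrightarrow> (a = 1 \<and> t = p) \<or> (a = p \<and> t = 1)" if p: "prime p" for p :: nat
  proof -
    assume e: "a * t = p"
    then have "a dvd p" by (simp flip: e)
    then have "a = 1 \<or> a = p" using p by (simp add: prime_nat_iff)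
    moreover have "p > 0" using p by (rule prime_gt_0_nat)
    ultimately show ?thesis using e by auto
  qed
  show "a * t = 2 \<Longrightarrow> (a = 1 \<and> t = 2) \<or> (a = 2 \<and> t = 1)" by (rule pr) simp
  show "a * t = 3 \<Longrightarrow> (a = 1 \<and> t = 3) \<or> (a = 3 \<and> t = 1)" by (rule pr) simp
qed

lemma mult_le_part:
  fixes m :: nat
  shows "m \<le> L \<Longrightarrow> a * L = d \<Longrightarrow> m * a \<le> d" "m \<le> L \<Longrightarrow> a * L + s = d \<Longrightarrow> m * a + s \<le> d"
  using mult_le_mono[of m L a a] by (auto simp: mult.commute)

text \<open>In the numeric lemmas \<open>L\<^sub>i\<close> is the least common multiple of the \<open>i\<close>-th partition, \<open>a\<^sub>i\<close> the number
  of entries equal to it, and the summands \<open>k\<close> and \<open>s\<close> are the sums of the remaining entries; the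
  digits in a lemma name count those remaining entries.\<close>

lemma numeric_003:
  fixes d :: nat
  assumes e: "a1 * L1 = d" "a2 * L2 = d" "a3 * L3 + s = d" "a1 + a2 + a3 + 1 = d"
    and L: "L1 \<ge> 2" "L2 \<ge> 2" "L3 \<ge> 2" and s: "s \<ge> 3" "L3 \<in> {2, 3, 5, 7} \<Longrightarrow> s = 3"
    and hyp: "L2 * L3 + L1 * L3 + L1 * L2 < L1 * L2 * L3"
    and z: "a3 = 0 \<Longrightarrow> d = 6 \<Longrightarrow> L3 \<le> 6" "a3 = 0 \<Longrightarrow> d \<le> 4 \<Longrightarrow> L3 \<le> 3"
    and one: "L1 \<noteq> 2 \<Longrightarrow> L2 \<noteq> 2"
  shows "L1 = 2" and "(L2 = 3 \<and> ((L3 = 8 \<and> a3 = 1 \<and> s = 4 \<and> d = 12) \<or> (L3 = 9 \<and> a3 = 1 \<and> s = 3 \<and> d = 12) \<or>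
      (L3 = 7 \<and> a3 = 3 \<and> s = 3 \<and> d = 24))) \<or> (L2 = 4 \<and> L3 = 5 \<and> a3 = 1 \<and> s = 3 \<and> d = 8)"
proof -
  have d0: "d > 0" using e(3) s(1) by linarith
  have pos: "a1 > 0" "a2 > 0" using e(1,2) d0 by (intro Nat.gr0I, simp)+
  note b1 = mult_le_part(1)[OF _ e(1)] and b2 = mult_le_part(1)[OF _ e(2)] and b3 = mult_le_part(2)[OF _ e(3)]
  show L12: "L1 = 2"
  proof (rule ccontr)
    assume n1: "L1 \<noteq> 2"
    \<comment> \<open>By \<open>one\<close> neither \<open>L1\<close> nor \<open>L2\<close> is 2
      now, and entries of size at least 3 are too few to number \<open>d - 1\<close>.\<close>
    then have g: "L1 \<ge> 3" "L2 \<ge> 3" using one L by auto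
    have c: "3 * a1 \<le> d" "3 * a2 \<le> d" using g by (auto intro!: b1 b2)
    show False
    proof (cases "L3 = 2")
      case True
      then have s3: "s = 3" and d: "d = 2 * a3 + 3" using s e by auto
      consider "L1 = 3" | "L2 = 3" | "L1 \<ge> 4" "L2 \<ge> 4" using g by linarith
      then show False
      proof cases
        case 1
        then have "L2 \<ge> 7" using hyp True by simp
        then have "7 * a2 \<le> d" by (rule b2)
        then show False using e 1 d pos by simp
      next
        case 2
        then have "L1 \<ge> 7" using hyp True by simp
        then have "7 * a1 \<le> d" by (rule b1)
        then show False using e 2 d pos by simp
      next
        case 3
        then have "4 * a1 \<le> d" "4 * a2 \<le> d" by (auto intro!: b1 b2)
        then show False using e d by linarith
      qed
    next
      case False
      then have L3: "L3 \<ge> 3" using L by simp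
      then have c3: "3 * a3 + s \<le> d" by (rule b3)
      have "\<not> (L1 = 3 \<and> L2 = 3 \<and> L3 = 3)" using hyp by auto
      then consider "L1 \<ge> 4" | "L2 \<ge> 4" | "L1 = 3" "L2 = 3" "L3 \<ge> 4" using g L3 by linarith
      then show False
      proof cases
        case 1
        then have "4 * a1 \<le> d" by (rule b1)
        then show False using c c3 s e pos by linarith
      next
        case 2
        then have "4 * a2 \<le> d" by (rule b2)
        then show False using c c3 s e pos by linarith
      next
        case 3
        then have "4 * a3 + s \<le> d" by (auto intro!: b3)
        then have "a3 = 0" "d = 3" using c c3 s e 3 by linarith+
        then show False using z 3 by simp
      qed
    qed
  qed
  then have d2: "d = 2 * a1" using e by simp
  have h: "2 * L2 + 2 * L3 < L2 * L3" using hyp L12 by (simp add: algebra_simps)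
  have "L2 \<noteq> 2" "L3 \<noteq> 2" using h by auto
  then consider "L2 = 3" | "L2 = 4" | "L2 \<ge> 5" "L3 = 3" | "L2 \<ge> 5" "L3 = 4" | "L2 \<ge> 5" "L3 \<ge> 5" using L by linarith
  then show "(L2 = 3 \<and> ((L3 = 8 \<and> a3 = 1 \<and> s = 4 \<and> d = 12) \<or> (L3 = 9 \<and> a3 = 1 \<and> s = 3 \<and> d = 12) \<or>
      (L3 = 7 \<and> a3 = 3 \<and> s = 3 \<and> d = 24))) \<or> (L2 = 4 \<and> L3 = 5 \<and> a3 = 1 \<and> s = 3 \<and> d = 8)"
  proof cases
    case 1
    then have "L3 \<ge> 7" using h by simp
    \<comment> \<open>The triple 2, 3, 6 is Euclidean, and \<open>t\<close> measures how far
      \<open>L3\<close> exceeds it. Eliminating \<open>a1\<close> and \<open>a2\<close> leaves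
      \<open>a3 * t + s = 6\<close>, which has few solutions.\<close>
    then obtain t where t: "L3 = 6 + t" "t \<ge> 1" by (intro that[of "L3 - 6"]) auto
    have d6: "d = 6 * a3 + 6" using e 1 d2 by simp
    have "a3 * t + s = 6" using e(3) d6 t by (simp add: algebra_simps)
    then consider "a3 * t = 0" "s = 6" | "a3 * t = 1" "s = 5" | "a3 * t = 2" "s = 4" | "a3 * t = 3" "s = 3" using s by linarith
    then show ?thesis
    proof cases
      case 1
      then have "a3 = 0" using t by simp
      then show ?thesis using z d6 \<open>L3 \<ge> 7\<close> by simp
    next
      case 2
      then show ?thesis using mult_eq_small(1)[OF 2(1)] t s by simp
    next
      case 3
      then show ?thesis using mult_eq_small(2)[OF 3(1)] t s d6 1 \<open>L2 = 3\<close> by auto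
    next
      case 4
      then show ?thesis using mult_eq_small(3)[OF 4(1)] t s d6 \<open>L2 = 3\<close> by auto
    qed
  next
    case 2
    then have "L3 \<ge> 5" using h by simp
    then obtain t where t: "L3 = 4 + t" "t \<ge> 1" by (intro that[of "L3 - 4"]) auto
    have d4: "d = 4 * a3 + 4" using e 2 d2 by simp
    have "a3 * t + s = 4" using e(3) d4 t by (simp add: algebra_simps)
    then consider "a3 * t = 0" "s = 4" | "a3 * t = 1" "s = 3" using s by linarith
    then show ?thesis
    proof cases
      case 1
      then have "a3 = 0" using t by simp
      then show ?thesis using z d4 \<open>L3 \<ge> 5\<close> by simp
    next
      case 2
      then show ?thesis using mult_eq_small(1)[OF 2(1)] t d4 \<open>L2 = 4\<close> by simp
    qed
  next
    case 3
    then have "L2 \<ge> 7" using h by simp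
    then have "7 * a2 \<le> d" by (rule b2)
    moreover have "s = 3" using s 3 by simp
    ultimately show ?thesis using e 3 d2 pos by simp
  next
    case 4
    then obtain t where t: "L2 = 4 + t" "t \<ge> 1" by (intro that[of "L2 - 4"]) auto
    have "4 * a2 + 4 = d + s" using e 4 d2 by simp
    moreover have "d = 4 * a2 + a2 * t" using e(2) t by (simp add: algebra_simps)
    moreover have "a2 \<le> a2 * t" using t by simp
    ultimately have "a2 * t + s = 4" "a2 = 1" using s pos by linarith+
    \<comment> \<open>An odd degree contradicts \<open>d = 2 * a1\<close>.\<close>
    then have "d = 5" using \<open>d = 4 * a2 + a2 * t\<close> s \<open>a2 \<le> a2 * t\<close> by linarith
    then show ?thesis using d2 by presburger
  next
    case 5
    then have "5 * a2 \<le> d" "5 * a3 + s \<le> d" by (auto intro!: b2 b3)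
    then show ?thesis using e d2 s pos by linarith
  qed
qed

text \<open>If no \<open>L\<close> were 2, there would be too few entries. The three positions of
  the 2 are not equivalent here; each reduces hyperbolicity to an inequality in two unknowns. Where
  solutions remain, the excess over a Euclidean triple, multiplied by a number of entries, is
  bounded by a small constant.\<close>

lemma numeric_012:
  fixes d :: nat
  assumes e: "a1 * L1 = d" "a2 * L2 + k = d" "a3 * L3 + s = d" "a1 + a2 + a3 + 1 = d"
    and L: "L1 \<ge> 2" "L2 \<ge> 2" "L3 \<ge> 2" and s: "s \<ge> 2" "L3 \<in> {2, 3, 5, 7} \<Longrightarrow> s = 2"
    and k: "k \<ge> 1" "L2 \<in> {2, 3, 5, 7} \<Longrightarrow> k = 1" "L2 = 4 \<Longrightarrow> k \<le> 2" and a2: "a2 \<ge> 1"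
    and hyp: "L2 * L3 + L1 * L3 + L1 * L2 < L1 * L2 * L3"
    and z: "a3 = 0 \<Longrightarrow> d \<le> 4 \<Longrightarrow> L3 \<le> 3"
  shows "(L1 = 2 \<and> L2 = 3 \<and> k = 1 \<and> s = 2 \<and> ((L3 = 8 \<and> a3 = 1 \<and> d = 10) \<or> (L3 = 7 \<and> a3 = 2 \<and> d = 16))) \<or>
    (L1 = 2 \<and> L2 = 7 \<and> L3 = 3 \<and> k = 1 \<and> s = 2 \<and> d = 8) \<or> (L1 = 2 \<and> L2 = 5 \<and> L3 = 4 \<and> k = 1 \<and> s = 2 \<and> d = 6) \<or>
    (L1 = 3 \<and> L2 = 2 \<and> L3 = 7 \<and> k = 1 \<and> s = 2 \<and> d = 9)"
proof -
  have d0: "d > 0" using e(3) s(1) by linarith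
  have pos: "a1 > 0" using e(1) d0 by (intro Nat.gr0I) simp
  note b1 = mult_le_part(1)[OF _ e(1)] and b2 = mult_le_part(2)[OF _ e(2)] and b3 = mult_le_part(2)[OF _ e(3)]
  have "L1 = 2 \<or> L2 = 2 \<or> L3 = 2"
  proof (rule ccontr)
    assume "\<not> ?thesis"
    then have g: "L1 \<ge> 3" "L2 \<ge> 3" "L3 \<ge> 3" using L by auto
    have c: "3 * a1 \<le> d" "3 * a2 + k \<le> d" "3 * a3 + s \<le> d" using g by (auto intro!: b1 b2 b3)
    have "\<not> (L1 = 3 \<and> L2 = 3 \<and> L3 = 3)" using hyp by auto
    then consider "L1 \<ge> 4" | "L2 \<ge> 4" | "L1 = 3" "L2 = 3" "L3 \<ge> 4" using g by linarith
    then show False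
    proof cases
      case 1
      then have "4 * a1 \<le> d" by (rule b1)
      then show False using c s k e pos by linarith
    next
      case 2
      then have "4 * a2 + k \<le> d" by (rule b2)
      then show False using c s k e a2 by linarith
    next
      case 3
      then have "4 * a3 + s \<le> d" by (auto intro!: b3)
      then have "a3 = 0" "d \<le> 4" using c s k e 3 by linarith+
      have "a1 * 3 = d" "a2 * 3 + k = d" using e 3 by auto
      then show False using \<open>d \<le> 4\<close> pos a2 k(1) by presburger
    qed
  qed
  then consider "L1 = 2" | "L2 = 2" | "L3 = 2" by blast
  then show ?thesis
  proof cases
    case 1
    then have d2: "d = 2 * a1" using e by simp
    have h: "2 * L2 + 2 * L3 < L2 * L3" using hyp 1 by (simp add: algebra_simps)
    have "L2 \<noteq> 2" "L3 \<noteq> 2" using h by auto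
    then consider "L2 = 3" | "L2 = 4" | "L2 \<ge> 5" "L3 = 3" | "L2 \<ge> 5" "L3 = 4" | "L2 \<ge> 5" "L3 \<ge> 5" using L by linarith
    then show ?thesis
    proof cases
      case 1
      then have "L3 \<ge> 7" using h by simp
      then obtain t where t: "L3 = 6 + t" "t \<ge> 1" by (intro that[of "L3 - 6"]) auto
      have k1: "k = 1" using k 1 by simp
      have d6: "d = 6 * a3 + 4" using e 1 d2 k1 by simp
      have "a3 * t + s = 4" using e(3) d6 t by (simp add: algebra_simps)
      then consider "a3 * t = 0" "s = 4" | "a3 * t = 1" "s = 3" | "a3 * t = 2" "s = 2" using s by linarith
      then show ?thesis
      proof cases
        case 1
        then have "a3 = 0" using t by simp
        then show ?thesis using z d6 \<open>L3 \<ge> 7\<close> by simp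
      next
        case 2
        then show ?thesis using mult_eq_small(1)[OF 2(1)] t s by simp
      next
        case 3
        then show ?thesis using mult_eq_small(2)[OF 3(1)] t d6 k1 \<open>L2 = 3\<close> \<open>L1 = 2\<close> by auto
      qed
    next
      case 2
      then have "L3 \<ge> 5" using h by simp
      then have c: "5 * a3 + s \<le> d" by (rule b3)
      have d4: "d + k = 4 * a3 + 4" using e 2 d2 by simp
      have "a3 + s + k \<le> 4" using c d4 by linarith
      moreover have "k \<noteq> 1"
      proof
        assume "k = 1"
        then have "2 * a1 + 1 = 4 * a3 + 4" using d4 d2 by simp
        then show False by presburger
      qed
      ultimately have "k = 2" "a3 = 0" using s(1) k(1) by linarith+
      then show ?thesis using z d4 \<open>L3 \<ge> 5\<close> by simp
    next
      case 3
      then have "L2 \<ge> 7" using h by simp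
      then obtain t where t: "L2 = 6 + t" "t \<ge> 1" by (intro that[of "L2 - 6"]) auto
      have s2: "s = 2" using s 3 by simp
      have "d = 6 * a2 + 2" using e 3 d2 s2 by simp
      moreover have "d = 6 * a2 + a2 * t + k" using e(2) t by (simp add: algebra_simps)
      ultimately have "a2 * t + k = 2" by simp
      moreover have "a2 * t \<ge> 1" using a2 t by simp
      ultimately have "a2 * t = 1" "k = 1" using k by linarith+
      then show ?thesis using mult_eq_small(1)[of a2 t] t s2 3 \<open>d = 6 * a2 + 2\<close> \<open>L1 = 2\<close> by simp
    next
      case 4
      then obtain t where t: "L2 = 4 + t" "t \<ge> 1" by (intro that[of "L2 - 4"]) auto
      have "d + s = 4 * a2 + 4" using e 4 d2 by simp
      moreover have "d = 4 * a2 + a2 * t + k" using e(2) t by (simp add: algebra_simps)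
      moreover have "a2 * t \<ge> 1" using a2 t by simp
      ultimately have "a2 * t = 1" "k = 1" "s = 2" using k s by linarith+
      then show ?thesis using mult_eq_small(1)[of a2 t] t 4 \<open>d + s = 4 * a2 + 4\<close> \<open>L1 = 2\<close> by simp
    next
      case 5
      then have "5 * a2 + k \<le> d" "5 * a3 + s \<le> d" by (auto intro!: b2 b3)
      then show ?thesis using e d2 s k a2 by linarith
    qed
  next
    case 2
    then have k1: "k = 1" and d2: "d = 2 * a2 + 1" using k e by auto
    have h: "2 * L1 + 2 * L3 < L1 * L3" using hyp 2 by (simp add: algebra_simps)
    have "L1 \<noteq> 2" "L3 \<noteq> 2" using h by auto
    then consider "L1 = 3" | "L1 = 4" | "L1 \<ge> 5" "L3 = 3" | "L1 \<ge> 5" "L3 = 4" | "L1 \<ge> 5" "L3 \<ge> 5" using L by linarith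
    then show ?thesis
    proof cases
      case 1
      then have "L3 \<ge> 7" using h by simp
      then obtain t where t: "L3 = 6 + t" "t \<ge> 1" by (intro that[of "L3 - 6"]) auto
      have d6: "d = 6 * a3 + 3" using e 1 d2 by simp
      have "a3 * t + s = 3" using e(3) d6 t by (simp add: algebra_simps)
      then consider "a3 * t = 0" "s = 3" | "a3 * t = 1" "s = 2" using s by linarith
      then show ?thesis
      proof cases
        case 1
        then have "a3 = 0" using t by simp
        then show ?thesis using z d6 \<open>L3 \<ge> 7\<close> by simp
      next
        case 2
        then show ?thesis using mult_eq_small(1)[OF 2(1)] t d6 k1 \<open>L2 = 2\<close> \<open>L1 = 3\<close> by simp
      qed
    next
      case 2
      then show ?thesis using e d2 by presburger
    next
      case 3
      then have "L1 \<ge> 7" using h by simp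
      then have "7 * a1 \<le> d" by (rule b1)
      moreover have "s = 2" using s 3 by simp
      ultimately show ?thesis using e 3 d2 by simp
    next
      case 4
      then have "5 * a1 \<le> d" by (auto intro!: b1)
      then show ?thesis using e 4 d2 s pos by simp
    next
      case 5
      then have "5 * a1 \<le> d" "5 * a3 + s \<le> d" by (auto intro!: b1 b3)
      then show ?thesis using e d2 s pos by linarith
    qed
  next
    case 3
    then have s2: "s = 2" and d2: "d = 2 * a3 + 2" using s e by auto
    have h: "2 * L1 + 2 * L2 < L1 * L2" using hyp 3 by (simp add: algebra_simps)
    have "L1 \<noteq> 2" "L2 \<noteq> 2" using h by auto
    then consider "L1 = 3" | "L2 = 3" | "L1 \<ge> 4" "L2 \<ge> 4" using L by linarith
    then show ?thesis
    proof cases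
      case 1
      then have "L2 \<ge> 7" using h by simp
      then have "7 * a2 + k \<le> d" by (rule b2)
      then show ?thesis using e 1 d2 k by simp
    next
      case 2
      then have "L1 \<ge> 7" using h by simp
      then have "7 * a1 \<le> d" by (rule b1)
      moreover have "k = 1" using k 2 by simp
      ultimately show ?thesis using e 2 d2 pos by simp
    next
      case 3
      then have "4 * a1 \<le> d" "4 * a2 + k \<le> d" by (auto intro!: b1 b2)
      then show ?thesis using e d2 k by linarith
    qed
  qed
qed

text \<open>Each number of entries is at most \<open>d - 1\<close> divided by the respective least
  common multiple. By hyperbolicity these bounds add up to less than \<open>d - 1\<close>, which is
  the exact number of such entries.\<close>

lemma numeric_111:
  fixes d :: nat
  assumes e: "a1 * L1 + k1 = d" "a2 * L2 + k2 = d" "a3 * L3 + k3 = d" "a1 + a2 + a3 + 1 = d"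
    and k: "k1 \<ge> 1" "k2 \<ge> 1" "k3 \<ge> 1" and d: "d \<ge> 2" and L: "L1 \<ge> 2" "L2 \<ge> 2" "L3 \<ge> 2"
    and hyp: "L2 * L3 + L1 * L3 + L1 * L2 < L1 * L2 * L3"
  shows False
proof -
  define n where "n = d - 1"
  have n: "a1 * L1 \<le> n" "a2 * L2 \<le> n" "a3 * L3 \<le> n" "a1 + a2 + a3 = n" "n > 0" using e k d by (auto simp: n_def)
  have "n * (L1 * L2 * L3) = a1 * L1 * (L2 * L3) + a2 * L2 * (L1 * L3) + a3 * L3 * (L1 * L2)"
    unfolding n(4)[symmetric] by (simp add: algebra_simps)
  also have "\<dots> \<le> n * (L2 * L3) + n * (L1 * L3) + n * (L1 * L2)"
    using n by (intro add_mono mult_right_mono) auto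
  also have "\<dots> = n * (L2 * L3 + L1 * L3 + L1 * L2)" by (simp add: algebra_simps)
  also have "\<dots> < n * (L1 * L2 * L3)" using hyp n by simp
  finally show False by simp
qed

section \<open>Partitions and their entries below the least common multiple\<close>

abbreviation "mlcm P \<equiv> Lcm (set_mset P)"
text \<open>These are the entries that produce a cone point upstairs, of order
  \<open>mlcm P div k\<close>.\<close>

abbreviation "defect P \<equiv> filter_mset (\<lambda>k. k \<noteq> mlcm P) P"

lemma size_le_sum_mset: "(\<And>k. k \<in># R \<Longrightarrow> (1::nat) \<le> k) \<Longrightarrow> size R \<le> sum_mset R"
proof (induction R)
  case (add x R)
  have "size R \<le> sum_mset R" by (rule add.IH) (rule add.prems, simp)
  moreover have "1 \<le> x" by (rule add.prems) simp
  ultimately show ?case by simp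
qed simp

lemma elem_le_sum_mset:
  assumes "k \<in># R" "\<And>k. k \<in># R \<Longrightarrow> (1::nat) \<le> k"
  shows "k + size R \<le> sum_mset R + 1"
proof -
  obtain R' where R: "R = add_mset k R'" using multi_member_split[OF assms(1)] ..
  have ge: "1 \<le> j" if "j \<in># R'" for j by (rule assms(2)) (use that R in simp)
  have "size R' \<le> sum_mset R'" by (rule size_le_sum_mset[OF ge])
  then show ?thesis using R by simp
qed

lemma all_ones: "(\<And>k. k \<in># R \<Longrightarrow> (1::nat) \<le> k) \<Longrightarrow> sum_mset R = size R \<Longrightarrow> R = replicate_mset (size R) 1"
proof (induction R)
  case (add x R)
  have ge: "1 \<le> k" if "k \<in># R" for k by (rule add.prems(1)) (use that in simp)
  have "size R \<le> sum_mset R" by (rule size_le_sum_mset[OF ge])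
  moreover have "1 \<le> x" by (rule add.prems(1)) simp
  ultimately have x: "x = 1" and s: "sum_mset R = size R" using add.prems(2) by auto
  show ?case unfolding size_add_mset replicate_mset_Suc by (rule arg_cong2[where f = add_mset, OF x add.IH[OF ge s]])
qed simp

lemma all_ones_size:
  assumes "\<And>k. k \<in># R \<Longrightarrow> (1::nat) \<le> k" "size R = n" "sum_mset R = n"
  shows "R = replicate_mset n 1"
proof -
  have "sum_mset R = size R" using assms(2,3) by simp
  then have e: "R = replicate_mset (size R) 1" using assms(1) by (rule all_ones[rotated])
  show ?thesis using e unfolding assms(2) .
qed

text \<open>The \<open>a\<close> copies of the least common multiple are split off. If it is prime,
  only 1 is left as a proper divisor; the last two clauses treat \<open>a = 0\<close>, when the
  least common multiple is no entry itself but is still bounded for small \<open>d\<close>.\<close>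

lemma partition_facts:
  assumes P: "partition_of d P" "\<exists>k\<in>#P. k > 1" and L: "L = mlcm P" and R: "R = defect P"
  obtains a where "P = replicate_mset a L + R" "d = a * L + sum_mset R" "size P = a + size R"
    "L \<ge> 2" "\<And>k. k \<in># R \<Longrightarrow> 1 \<le> k \<and> k < L \<and> k dvd L" "size R \<le> 1 \<Longrightarrow> a \<ge> 1"
    "L \<in> {2, 3, 5, 7} \<Longrightarrow> sum_mset R = size R" "size R \<le> sum_mset R"
    "a = 0 \<Longrightarrow> d \<le> 4 \<Longrightarrow> L \<le> 3" "a = 0 \<Longrightarrow> d = 6 \<Longrightarrow> size R = 3 \<Longrightarrow> L \<le> 6"
proof -
  define a where "a = count P L"
  have split: "P = replicate_mset a L + R"
    unfolding R L[symmetric] a_def by (rule multiset_eqI) simp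
  have pos: "k \<ge> 1" if "k \<in># P" for k using P(1) that unfolding partition_of_def by (cases k) auto
  have "0 \<notin> set_mset P" using P(1) by (simp add: partition_of_def)
  then have L0: "L > 0" unfolding L using Lcm_0_iff_nat[of "set_mset P"] by (intro Nat.gr0I) auto
  have dv: "k dvd L" if "k \<in># P" for k unfolding L using that by (rule dvd_Lcm)
  obtain k0 where k0: "k0 \<in># P" "k0 > 1" using P(2) by blast
  have L2: "L \<ge> 2" using dvd_imp_le[OF dv[OF k0(1)] L0] k0(2) by simp
  have Rk: "1 \<le> k \<and> k < L \<and> k dvd L" if "k \<in># R" for k
  proof -
    have "k \<in># P" "k \<noteq> L" using that by (auto simp: R L)
    then show ?thesis using pos dv dvd_imp_le[OF dv L0] by (simp add: le_neq_implies_less)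
  qed
  \<comment> \<open>A single entry is its own least common multiple, so without a copy of the latter
    there are at least two defective entries.\<close>
  have a1: "a \<ge> 1" if "size R \<le> 1"
  proof (rule ccontr)
    assume "\<not> a \<ge> 1"
    then have "P = R" using split by simp
    moreover have "size P \<noteq> 0" using k0(1) by (cases P) auto
    moreover have "size P \<le> 1" using that unfolding \<open>P = R\<close> .
    ultimately have "size P = 1" by linarith
    then obtain x where "P = {#x#}" using size_1_singleton_mset by blast
    then have "L = x" "x \<in># R" using \<open>P = R\<close> by (auto simp: L)
    then show False using Rk by blast
  qed
  have prime: "sum_mset R = size R" if p: "L \<in> {2, 3, 5, 7}"
  proof -
    have "prime L" using p by (auto simp: prime_nat_numeral_eq)
    then have "k = 1" if "k \<in># R" for k using Rk[OF that] by (auto simp: prime_nat_iff)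
    then have "image_mset (\<lambda>k. k) R = image_mset (\<lambda>k. 1) R" by (intro image_mset_cong) auto
    then have "sum_mset R = sum_mset (image_mset (\<lambda>k. 1) R)" by simp
    then show ?thesis by (simp only: size_eq_sum_mset)
  qed
  have R1: "1 \<le> k" if "k \<in># R" for k using Rk[OF that] by simp
  have sle: "size R \<le> sum_mset R" by (rule size_le_sum_mset[OF R1])
  have dsum: "d = a * L + sum_mset R" using P(1) split by (simp add: partition_of_def)
  have bound: "L \<le> M" if "a = 0" "M > 0" "\<And>k. k \<in># R \<Longrightarrow> k dvd M" for M
  proof -
    have "P = R" using split that(1) by simp
    then have "L dvd M" unfolding L using that(3) by (intro Lcm_least) auto
    then show ?thesis using that(2) by (rule dvd_imp_le)
  qed
  have el: "k + size R \<le> d + 1" if "a = 0" "k \<in># R" for k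
  proof -
    have "k + size R \<le> sum_mset R + 1" by (rule elem_le_sum_mset[OF that(2) R1])
    then show ?thesis using dsum that(1) by simp
  qed
  have sz: "size R \<ge> 2" if "a = 0" using a1 that by (cases "size R \<le> 1") auto
  \<comment> \<open>If 3 occurs in a partition of at most 4, the other entries divide 3 as well;
    otherwise all entries are 1 or 2.\<close>
  have z4: "L \<le> 3" if a0: "a = 0" and d4: "d \<le> 4"
  proof (cases "3 \<in># R")
    case True
    then obtain R' where R': "R = add_mset 3 R'" by (elim multi_member_split[THEN exE]) (rule that)
    have "k dvd 3" if "k \<in># R" for k
    proof (cases "k \<in># R'")
      case True
      then obtain R'' where "R' = add_mset k R''" by (elim multi_member_split[THEN exE]) (rule that)
      then have "3 + k \<le> d" using dsum a0 R' by simp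
      then show ?thesis using Rk[OF that] d4 by (cases "k = 1") auto
    qed (use that R' in auto)
    then have "L \<le> 3" using bound[of 3] a0 by simp
    then show ?thesis by simp
  next
    case False
    have "k dvd 2" if "k \<in># R" for k
    proof -
      have "k \<le> 3" "k \<noteq> 3" "k \<ge> 1" using el[OF a0 that] sz[OF a0] d4 False Rk[OF that] that by (linarith, blast, blast)
      then have "k = 1 \<or> k = 2" by linarith
      then show ?thesis by auto
    qed
    then have "L \<le> 2" using bound[of 2] a0 by simp
    then show ?thesis by simp
  qed
  \<comment> \<open>Three entries with sum 6 are either 4, 1, 1 or all at most 3, so that the least
    common multiple divides 4 or 6.\<close>
  have z6: "L \<le> 6" if a0: "a = 0" and d6: "d = 6" and s3: "size R = 3"
  proof (cases "4 \<in># R")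
    case True
    then obtain R' where R': "R = add_mset 4 R'" by (elim multi_member_split[THEN exE]) (rule that)
    have "k dvd 4" if "k \<in># R" for k
    proof (cases "k \<in># R'")
      case True
      have "size R' = 2" "sum_mset R' = 2" using s3 R' dsum a0 d6 by auto
      moreover have "k + size R' \<le> sum_mset R' + 1" by (rule elem_le_sum_mset[OF True], rule R1) (simp add: R')
      ultimately have "k \<le> 1" by simp
      then show ?thesis using Rk[OF that] by auto
    qed (use that R' in auto)
    then have "L \<le> 4" using bound[of 4] a0 by simp
    then show ?thesis by simp
  next
    case False
    have "k dvd 6" if "k \<in># R" for k
    proof -
      have "k \<le> 4" "k \<noteq> 4" "k \<ge> 1" using el[OF a0 that] s3 d6 False Rk[OF that] that by (linarith, blast, blast)
      then have "k = 1 \<or> k = 2 \<or> k = 3" by linarith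
      then show ?thesis by auto
    qed
    then show ?thesis using bound[of 6] a0 by simp
  qed
  show ?thesis
    by (rule that[OF split dsum _ L2 Rk a1 prime sle z4 z6]) (use split arg_cong[OF split, of size] in simp_all)
qed

definition nine_data :: "(nat \<times> nat multiset multiset) set" where
  "nine_data = {
     (6, {# replicate_mset 3 2, add_mset 4 (replicate_mset 2 1), {#5, 1#} #}),
     (8, {# replicate_mset 4 2, replicate_mset 2 4, add_mset 5 (replicate_mset 3 1) #}),
     (8, {# replicate_mset 4 2, replicate_mset 2 3 + replicate_mset 2 1, {#7, 1#} #}),
     (9, {# add_mset 1 (replicate_mset 4 2), replicate_mset 3 3, add_mset 7 (replicate_mset 2 1) #}),
     (10, {# replicate_mset 5 2, add_mset 1 (replicate_mset 3 3), add_mset 8 (replicate_mset 2 1) #}),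
     (12, {# replicate_mset 6 2, replicate_mset 4 3, {#8, 2, 1, 1#} #}),
     (12, {# replicate_mset 6 2, replicate_mset 4 3, add_mset 9 (replicate_mset 3 1) #}),
     (16, {# replicate_mset 8 2, add_mset 1 (replicate_mset 5 3), replicate_mset 2 7 + replicate_mset 2 1 #}),
     (24, {# replicate_mset 12 2, replicate_mset 8 3, replicate_mset 3 7 + replicate_mset 3 1 #})}"

lemma size_3_obtain:
  assumes "size R = 3"
  obtains x y z where "R = {#x, y, z#}"
proof -
  have s: "size R = Suc (Suc (Suc 0))" using assms by simp
  obtain x R1 where 1: "R = add_mset x R1" using size_eq_Suc_imp_eq_union[OF s] by (elim exE) (rule that)
  have s1: "size R1 = Suc (Suc 0)" using s 1 by simp
  obtain y R2 where 2: "R1 = add_mset y R2" using size_eq_Suc_imp_eq_union[OF s1] by (elim exE) (rule that)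
  have s2: "size R2 = Suc 0" using s1 2 by simp
  obtain z R3 where 3: "R2 = add_mset z R3" using size_eq_Suc_imp_eq_union[OF s2] by (elim exE) (rule that)
  have "R3 = {#}" using s2 3 by simp
  then show thesis using that[of x y z] 1 2 3 by simp
qed

lemma size_3_sum_4:
  assumes "\<And>k. k \<in># R \<Longrightarrow> (1::nat) \<le> k" "size R = 3" "sum_mset R = 4"
  shows "R = {#2, 1, 1#}"
proof -
  obtain x y z where R: "R = {#x, y, z#}" using size_3_obtain[OF assms(2)] .
  have "1 \<le> x" "1 \<le> y" "1 \<le> z" by (rule assms(1), simp add: R)+
  moreover have "x + y + z = 4" using assms(3) by (simp add: R)
  ultimately consider "x = 2" "y = 1" "z = 1" | "x = 1" "y = 2" "z = 1" | "x = 1" "y = 1" "z = 2" by linarith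
  then show ?thesis unfolding R by cases (auto simp: add_mset_commute)
qed

text \<open>The two partitions without defective entries are interchangeable; \<open>one\<close>
  fixes their order so that a least common multiple 2 comes first.\<close>

lemma nine_data_003:
  assumes P: "partition_of d P1" "\<exists>k\<in>#P1. k > 1" "partition_of d P2" "\<exists>k\<in>#P2. k > 1" "partition_of d P3" "\<exists>k\<in>#P3. k > 1"
    and sz: "size P1 + size P2 + size P3 = d + 2" and r: "size (defect P1) = 0" "size (defect P2) = 0" "size (defect P3) = 3"
    and hyp: "mlcm P2 * mlcm P3 + mlcm P1 * mlcm P3 + mlcm P1 * mlcm P2 < mlcm P1 * mlcm P2 * mlcm P3"
    and one: "mlcm P1 \<noteq> 2 \<Longrightarrow> mlcm P2 \<noteq> 2"
  shows "(d, {#P1, P2, P3#}) \<in> nine_data"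
proof -
  obtain a1 where 1: "P1 = replicate_mset a1 (mlcm P1) + defect P1" "d = a1 * mlcm P1 + sum_mset (defect P1)" "size P1 = a1 + size (defect P1)" "mlcm P1 \<ge> 2"
    by (rule partition_facts[OF P(1,2) refl refl]) (rule that; assumption)
  obtain a2 where 2: "P2 = replicate_mset a2 (mlcm P2) + defect P2" "d = a2 * mlcm P2 + sum_mset (defect P2)" "size P2 = a2 + size (defect P2)" "mlcm P2 \<ge> 2"
    by (rule partition_facts[OF P(3,4) refl refl]) (rule that; assumption)
  obtain a3 where 3: "P3 = replicate_mset a3 (mlcm P3) + defect P3" "d = a3 * mlcm P3 + sum_mset (defect P3)" "size P3 = a3 + size (defect P3)" "mlcm P3 \<ge> 2"
    "\<And>k. k \<in># defect P3 \<Longrightarrow> 1 \<le> k \<and> k < mlcm P3 \<and> k dvd mlcm P3"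
    "mlcm P3 \<in> {2, 3, 5, 7} \<Longrightarrow> sum_mset (defect P3) = size (defect P3)" "size (defect P3) \<le> sum_mset (defect P3)"
    "a3 = 0 \<Longrightarrow> d \<le> 4 \<Longrightarrow> mlcm P3 \<le> 3" "a3 = 0 \<Longrightarrow> d = 6 \<Longrightarrow> size (defect P3) = 3 \<Longrightarrow> mlcm P3 \<le> 6"
    by (rule partition_facts[OF P(5,6) refl refl]) (rule that; assumption)
  have e0: "defect P1 = {#}" "defect P2 = {#}" using r by simp_all
  define L1 L2 L3 R where "L1 = mlcm P1" and "L2 = mlcm P2" and "L3 = mlcm P3" and "R = defect P3"
  note fl = L1_def[symmetric] L2_def[symmetric] L3_def[symmetric] R_def[symmetric]
  have p: "P1 = replicate_mset a1 L1" "P2 = replicate_mset a2 L2" "P3 = replicate_mset a3 L3 + R"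
    using 1(1) 2(1) 3(1) unfolding L1_def L2_def L3_def R_def e0 empty_neutral by (simp_all only: )
  have d: "a1 * L1 = d" "a2 * L2 = d" "a3 * L3 + sum_mset R = d" "a1 + a2 + a3 + 1 = d"
    using 1(2) 2(2) 3(2) 1(3) 2(3) 3(3) sz r unfolding L1_def L2_def L3_def R_def e0 sum_mset.empty by linarith+
  have R: "\<And>k. k \<in># R \<Longrightarrow> 1 \<le> k" "size R = 3" using 3(5) r(3) unfolding R_def by blast+
  have num: "L1 = 2" "(L2 = 3 \<and> ((L3 = 8 \<and> a3 = 1 \<and> sum_mset R = 4 \<and> d = 12) \<or> (L3 = 9 \<and> a3 = 1 \<and> sum_mset R = 3 \<and> d = 12) \<or>
      (L3 = 7 \<and> a3 = 3 \<and> sum_mset R = 3 \<and> d = 24))) \<or> (L2 = 4 \<and> L3 = 5 \<and> a3 = 1 \<and> sum_mset R = 3 \<and> d = 8)"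
  proof -
    have c: "L1 \<ge> 2" "L2 \<ge> 2" "L3 \<ge> 2" "3 \<le> sum_mset R" "L3 \<in> {2, 3, 5, 7} \<Longrightarrow> sum_mset R = 3"
      "L2 * L3 + L1 * L3 + L1 * L2 < L1 * L2 * L3" "a3 = 0 \<Longrightarrow> d = 6 \<Longrightarrow> L3 \<le> 6" "a3 = 0 \<Longrightarrow> d \<le> 4 \<Longrightarrow> L3 \<le> 3" "L1 \<noteq> 2 \<Longrightarrow> L2 \<noteq> 2"
      using 1(4) 2(4) 3(4,6-9) hyp one r(3) unfolding L1_def L2_def L3_def R_def r(3) by blast+
    show "L1 = 2" "(L2 = 3 \<and> ((L3 = 8 \<and> a3 = 1 \<and> sum_mset R = 4 \<and> d = 12) \<or> (L3 = 9 \<and> a3 = 1 \<and> sum_mset R = 3 \<and> d = 12) \<or>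
      (L3 = 7 \<and> a3 = 3 \<and> sum_mset R = 3 \<and> d = 24))) \<or> (L2 = 4 \<and> L3 = 5 \<and> a3 = 1 \<and> sum_mset R = 3 \<and> d = 8)"
      using numeric_003[OF d c] by blast+
  qed
  have R3: "R = replicate_mset 3 1" if "sum_mset R = 3" by (rule all_ones_size[OF R that])
  have R4: "R = {#2, 1, 1#}" if "sum_mset R = 4" by (rule size_3_sum_4[OF R that])
  from num(2) consider
    "L2 = 3" "L3 = 8" "a3 = 1" "sum_mset R = 4" "d = 12" | "L2 = 3" "L3 = 9" "a3 = 1" "sum_mset R = 3" "d = 12" |
    "L2 = 3" "L3 = 7" "a3 = 3" "sum_mset R = 3" "d = 24" | "L2 = 4" "L3 = 5" "a3 = 1" "sum_mset R = 3" "d = 8" by blast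
  then show ?thesis
  proof cases
    case 1
    then have "a1 = 6" "a2 = 4" using d num(1) by auto
    then show ?thesis unfolding nine_data_def p using 1 num(1) R4 by simp
  next
    case 2
    then have "a1 = 6" "a2 = 4" using d num(1) by auto
    then show ?thesis unfolding nine_data_def p using 2 num(1) R3 by simp
  next
    case 3
    then have "a1 = 12" "a2 = 8" using d num(1) by auto
    then show ?thesis unfolding nine_data_def p using 3 num(1) R3 by simp
  next
    case 4
    then have "a1 = 4" "a2 = 2" using d num(1) by auto
    then show ?thesis unfolding nine_data_def p using 4 num(1) R3 by simp
  qed
qed

lemma nine_data_012:
  assumes P: "partition_of d P1" "\<exists>k\<in>#P1. k > 1" "partition_of d P2" "\<exists>k\<in>#P2. k > 1" "partition_of d P3" "\<exists>k\<in>#P3. k > 1"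
    and sz: "size P1 + size P2 + size P3 = d + 2" and r: "size (defect P1) = 0" "size (defect P2) = 1" "size (defect P3) = 2"
    and hyp: "mlcm P2 * mlcm P3 + mlcm P1 * mlcm P3 + mlcm P1 * mlcm P2 < mlcm P1 * mlcm P2 * mlcm P3"
  shows "(d, {#P1, P2, P3#}) \<in> nine_data"
proof -
  obtain a1 where 1: "P1 = replicate_mset a1 (mlcm P1) + defect P1" "d = a1 * mlcm P1 + sum_mset (defect P1)" "size P1 = a1 + size (defect P1)" "mlcm P1 \<ge> 2"
    by (rule partition_facts[OF P(1,2) refl refl]) (rule that; assumption)
  obtain a2 where 2: "P2 = replicate_mset a2 (mlcm P2) + defect P2" "d = a2 * mlcm P2 + sum_mset (defect P2)" "size P2 = a2 + size (defect P2)" "mlcm P2 \<ge> 2"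
    "\<And>k. k \<in># defect P2 \<Longrightarrow> 1 \<le> k \<and> k < mlcm P2 \<and> k dvd mlcm P2" "size (defect P2) \<le> 1 \<Longrightarrow> a2 \<ge> 1"
    "mlcm P2 \<in> {2, 3, 5, 7} \<Longrightarrow> sum_mset (defect P2) = size (defect P2)"
    by (rule partition_facts[OF P(3,4) refl refl]) (rule that; assumption)
  obtain a3 where 3: "P3 = replicate_mset a3 (mlcm P3) + defect P3" "d = a3 * mlcm P3 + sum_mset (defect P3)" "size P3 = a3 + size (defect P3)" "mlcm P3 \<ge> 2"
    "\<And>k. k \<in># defect P3 \<Longrightarrow> 1 \<le> k \<and> k < mlcm P3 \<and> k dvd mlcm P3"
    "mlcm P3 \<in> {2, 3, 5, 7} \<Longrightarrow> sum_mset (defect P3) = size (defect P3)" "size (defect P3) \<le> sum_mset (defect P3)"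
    "a3 = 0 \<Longrightarrow> d \<le> 4 \<Longrightarrow> mlcm P3 \<le> 3"
    by (rule partition_facts[OF P(5,6) refl refl]) (rule that; assumption)
  have e0: "defect P1 = {#}" using r by simp
  obtain k where k: "defect P2 = {#k#}" using r(2) size_1_singleton_mset by blast
  define L1 L2 L3 R where "L1 = mlcm P1" and "L2 = mlcm P2" and "L3 = mlcm P3" and "R = defect P3"
  note fl = L1_def[symmetric] L2_def[symmetric] L3_def[symmetric] R_def[symmetric]
  have p: "P1 = replicate_mset a1 L1" "P2 = replicate_mset a2 L2 + {#k#}" "P3 = replicate_mset a3 L3 + R"
    using 1(1) 2(1) 3(1) unfolding L1_def L2_def L3_def R_def e0 k empty_neutral by (simp_all only: )
  have d: "a1 * L1 = d" "a2 * L2 + k = d" "a3 * L3 + sum_mset R = d" "a1 + a2 + a3 + 1 = d"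
    using 1(2) 2(2) 3(2) 1(3) 2(3) 3(3) sz r unfolding L1_def L2_def L3_def R_def e0 k sum_mset.empty sum_mset.singleton by linarith+
  have R: "\<And>k. k \<in># R \<Longrightarrow> 1 \<le> k" "size R = 2" using 3(5) r(3) unfolding R_def by blast+
  have k4: "k \<le> 2" if "L2 = 4"
  proof -
    have "1 \<le> k \<and> k < L2 \<and> k dvd L2" using 2(5)[of k] unfolding L2_def k by simp
    then have "k dvd 4" "k < 4" "k \<ge> 1" using that by auto
    then show ?thesis by (cases "k = 3") auto
  qed
  have c: "L1 \<ge> 2" "L2 \<ge> 2" "L3 \<ge> 2" "2 \<le> sum_mset R" "L3 \<in> {2, 3, 5, 7} \<Longrightarrow> sum_mset R = 2"
    "k \<ge> 1" "L2 \<in> {2, 3, 5, 7} \<Longrightarrow> k = 1" "L2 = 4 \<Longrightarrow> k \<le> 2" "a2 \<ge> 1"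
    "L2 * L3 + L1 * L3 + L1 * L2 < L1 * L2 * L3" "a3 = 0 \<Longrightarrow> d \<le> 4 \<Longrightarrow> L3 \<le> 3"
    using 1(4) 2(4) 2(5)[of k] 2(6,7) 3(4,6-8) hyp r k4 unfolding L1_def L2_def L3_def R_def k by simp_all
  have R2: "R = replicate_mset 2 1" if "sum_mset R = 2" by (rule all_ones_size[OF R that])
  have num: "(L1 = 2 \<and> L2 = 3 \<and> k = 1 \<and> sum_mset R = 2 \<and> ((L3 = 8 \<and> a3 = 1 \<and> d = 10) \<or> (L3 = 7 \<and> a3 = 2 \<and> d = 16))) \<or>
    (L1 = 2 \<and> L2 = 7 \<and> L3 = 3 \<and> k = 1 \<and> sum_mset R = 2 \<and> d = 8) \<or> (L1 = 2 \<and> L2 = 5 \<and> L3 = 4 \<and> k = 1 \<and> sum_mset R = 2 \<and> d = 6) \<or>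
    (L1 = 3 \<and> L2 = 2 \<and> L3 = 7 \<and> k = 1 \<and> sum_mset R = 2 \<and> d = 9)"
    by (rule numeric_012[OF d c])
  consider
    "L1 = 2" "L2 = 3" "k = 1" "sum_mset R = 2" "L3 = 8" "a3 = 1" "d = 10" |
    "L1 = 2" "L2 = 3" "k = 1" "sum_mset R = 2" "L3 = 7" "a3 = 2" "d = 16" |
    "L1 = 2" "L2 = 7" "L3 = 3" "k = 1" "sum_mset R = 2" "d = 8" |
    "L1 = 2" "L2 = 5" "L3 = 4" "k = 1" "sum_mset R = 2" "d = 6" |
    "L1 = 3" "L2 = 2" "L3 = 7" "k = 1" "sum_mset R = 2" "d = 9" using num by meson
  then show ?thesis
  proof cases
    case 1
    have a: "a1 = 5" "a2 = 3" using d(1,2)[unfolded 1] by linarith+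
    show ?thesis unfolding nine_data_def p a R2[OF 1(4)] 1 by simp
  next
    case 2
    have a: "a1 = 8" "a2 = 5" using d(1,2)[unfolded 2] by linarith+
    show ?thesis unfolding nine_data_def p a R2[OF 2(4)] 2 by simp
  next
    case 3
    have a: "a1 = 4" "a2 = 1" "a3 = 2" using d(1,2,3)[unfolded 3] by linarith+
    show ?thesis unfolding nine_data_def p a R2[OF 3(5)] 3 by (simp add: add_mset_commute)
  next
    case 4
    have a: "a1 = 3" "a2 = 1" "a3 = 1" using d(1,2,3)[unfolded 4] by linarith+
    show ?thesis unfolding nine_data_def p a R2[OF 4(5)] 4 by (simp add: add_mset_commute)
  next
    case 5
    have a: "a1 = 3" "a2 = 4" "a3 = 1" using d(1,2,3)[unfolded 5] by linarith+
    show ?thesis unfolding nine_data_def p a R2[OF 5(5)] 5 by (simp add: add_mset_commute)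
  qed
qed

text \<open>This form is symmetric in the partitions, so they may be sorted by their numbers of
  defective entries; the swap and the rotation below generate all permutations. The last clause is
  \<open>1/p + 1/q + 1/r < 1\<close> with denominators cleared.\<close>

definition triangle_data :: "nat \<Rightarrow> nat multiset \<Rightarrow> nat multiset \<Rightarrow> nat multiset \<Rightarrow> bool" where
  "triangle_data d P1 P2 P3 \<longleftrightarrow> (\<forall>P \<in> {P1, P2, P3}. partition_of d P \<and> (\<exists>k \<in># P. k > 1)) \<and>
     size P1 + size P2 + size P3 = d + 2 \<and> size (defect P1) + size (defect P2) + size (defect P3) = 3 \<and>
     mlcm P2 * mlcm P3 + mlcm P1 * mlcm P3 + mlcm P1 * mlcm P2 < mlcm P1 * mlcm P2 * mlcm P3"

lemma triangle_data_swap: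
  assumes "triangle_data d P1 P2 P3"
  shows "triangle_data d P2 P1 P3"
proof -
  have "mlcm P2 * mlcm P3 + mlcm P1 * mlcm P3 + mlcm P1 * mlcm P2 < mlcm P1 * mlcm P2 * mlcm P3"
    using assms unfolding triangle_data_def by blast
  then have "mlcm P1 * mlcm P3 + mlcm P2 * mlcm P3 + mlcm P2 * mlcm P1 < mlcm P2 * mlcm P1 * mlcm P3"
    by (simp only: ac_simps)
  moreover have "size P2 + size P1 + size P3 = d + 2" "size (defect P2) + size (defect P1) + size (defect P3) = 3"
    using assms unfolding triangle_data_def by linarith+
  ultimately show ?thesis using assms unfolding triangle_data_def by blast
qed

lemma triangle_data_rotate:
  assumes "triangle_data d P1 P2 P3"
  shows "triangle_data d P2 P3 P1"
proof -
  have "mlcm P2 * mlcm P3 + mlcm P1 * mlcm P3 + mlcm P1 * mlcm P2 < mlcm P1 * mlcm P2 * mlcm P3"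
    using assms unfolding triangle_data_def by blast
  then have "mlcm P3 * mlcm P1 + mlcm P2 * mlcm P1 + mlcm P2 * mlcm P3 < mlcm P2 * mlcm P3 * mlcm P1"
    by (simp only: ac_simps)
  moreover have "size P2 + size P3 + size P1 = d + 2" "size (defect P2) + size (defect P3) + size (defect P1) = 3"
    using assms unfolding triangle_data_def by linarith+
  ultimately show ?thesis using assms unfolding triangle_data_def by blast
qed

lemma nine_data_sorted:
  assumes t: "triangle_data d P1 P2 P3"
    and le: "size (defect P1) \<le> size (defect P2)" "size (defect P2) \<le> size (defect P3)"
  shows "(d, {#P1, P2, P3#}) \<in> nine_data"
proof -
  have P: "partition_of d P1" "\<exists>k\<in>#P1. k > 1" "partition_of d P2" "\<exists>k\<in>#P2. k > 1" "partition_of d P3" "\<exists>k\<in>#P3. k > 1"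
    and sz: "size P1 + size P2 + size P3 = d + 2" and r: "size (defect P1) + size (defect P2) + size (defect P3) = 3"
    and hyp: "mlcm P2 * mlcm P3 + mlcm P1 * mlcm P3 + mlcm P1 * mlcm P2 < mlcm P1 * mlcm P2 * mlcm P3"
    using t unfolding triangle_data_def by blast+
  consider (a) "size (defect P1) = 0" "size (defect P2) = 0" "size (defect P3) = 3"
    | (b) "size (defect P1) = 0" "size (defect P2) = 1" "size (defect P3) = 2"
    | (c) "size (defect P1) = 1" "size (defect P2) = 1" "size (defect P3) = 1"
    using le r by linarith
  then show ?thesis
  proof cases
    case a
    show ?thesis
    proof (cases "mlcm P2 = 2")
      case False
      show ?thesis by (rule nine_data_003[OF P sz a hyp False])
    next
      case True
      \<comment> \<open>Exchanging the first two partitions brings the least common multiple 2 to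
        the front, as \<open>nine_data_003\<close> expects.\<close>
      have sz': "size P2 + size P1 + size P3 = d + 2" using sz by linarith
      have hyp': "mlcm P1 * mlcm P3 + mlcm P2 * mlcm P3 + mlcm P2 * mlcm P1 < mlcm P2 * mlcm P1 * mlcm P3"
        using hyp by (simp only: ac_simps)
      have "(d, {#P2, P1, P3#}) \<in> nine_data"
        by (rule nine_data_003[OF P(3,4,1,2,5,6) sz' a(2,1,3) hyp']) (use True in blast)
      then show ?thesis by (simp only: add_mset_commute)
    qed
  next
    case b
    show ?thesis by (rule nine_data_012[OF P sz b hyp])
  next
    case c
    obtain a1 where 1: "d = a1 * mlcm P1 + sum_mset (defect P1)" "size P1 = a1 + size (defect P1)" "mlcm P1 \<ge> 2"
      "size (defect P1) \<le> 1 \<Longrightarrow> a1 \<ge> 1" "size (defect P1) \<le> sum_mset (defect P1)"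
      by (rule partition_facts[OF P(1,2) refl refl]) (rule that; assumption)
    obtain a2 where 2: "d = a2 * mlcm P2 + sum_mset (defect P2)" "size P2 = a2 + size (defect P2)" "mlcm P2 \<ge> 2"
      "size (defect P2) \<le> 1 \<Longrightarrow> a2 \<ge> 1" "size (defect P2) \<le> sum_mset (defect P2)"
      by (rule partition_facts[OF P(3,4) refl refl]) (rule that; assumption)
    obtain a3 where 3: "d = a3 * mlcm P3 + sum_mset (defect P3)" "size P3 = a3 + size (defect P3)" "mlcm P3 \<ge> 2"
      "size (defect P3) \<le> 1 \<Longrightarrow> a3 \<ge> 1" "size (defect P3) \<le> sum_mset (defect P3)"
      by (rule partition_facts[OF P(5,6) refl refl]) (rule that; assumption)
    have a: "a1 \<ge> 1" using 1(4) c(1) by linarith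
    have s: "a1 + a2 + a3 + 1 = d" using 1(2) 2(2) 3(2) sz c by linarith
    have k: "1 \<le> sum_mset (defect P1)" "1 \<le> sum_mset (defect P2)" "1 \<le> sum_mset (defect P3)"
      using 1(5) 2(5) 3(5) c by linarith+
    have d2: "2 \<le> d" using s a by linarith
    have False by (rule numeric_111[OF 1(1)[symmetric] 2(1)[symmetric] 3(1)[symmetric] s k d2 1(3) 2(3) 3(3) hyp])
    then show ?thesis ..
  qed
qed

lemma nine_data_complete:
  assumes t: "triangle_data d P1 P2 P3"
  shows "(d, {#P1, P2, P3#}) \<in> nine_data"
proof -
  note t213 = triangle_data_swap[OF t] and t231 = triangle_data_rotate[OF t]
  note t312 = triangle_data_rotate[OF t231] and t321 = triangle_data_swap[OF t231]
  note t132 = triangle_data_swap[OF t312]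
  have e: "{#P1, P3, P2#} = {#P1, P2, P3#}" "{#P2, P1, P3#} = {#P1, P2, P3#}" "{#P2, P3, P1#} = {#P1, P2, P3#}"
    "{#P3, P1, P2#} = {#P1, P2, P3#}" "{#P3, P2, P1#} = {#P1, P2, P3#}"
    by (simp_all only: add_mset_commute)
  let ?a = "size (defect P1)" and ?b = "size (defect P2)" and ?c = "size (defect P3)"
  consider "?a \<le> ?b" "?b \<le> ?c" | "?a \<le> ?c" "?c \<le> ?b" | "?b \<le> ?a" "?a \<le> ?c" | "?b \<le> ?c" "?c \<le> ?a"
    | "?c \<le> ?a" "?a \<le> ?b" | "?c \<le> ?b" "?b \<le> ?a" by linarith
  then show ?thesis
  proof cases
    case 1 then show ?thesis by (rule nine_data_sorted[OF t])
  next
    case 2 then show ?thesis by (rule nine_data_sorted[OF t132, unfolded e])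
  next
    case 3 then show ?thesis by (rule nine_data_sorted[OF t213, unfolded e])
  next
    case 4 then show ?thesis by (rule nine_data_sorted[OF t231, unfolded e])
  next
    case 5 then show ?thesis by (rule nine_data_sorted[OF t312, unfolded e])
  next
    case 6 then show ?thesis by (rule nine_data_sorted[OF t321, unfolded e])
  qed
qed

section \<open>From induced orbifolds to numerical data and back\<close>

text \<open>The quotient \<open>mlcm P div k\<close> is 1 exactly when \<open>k\<close> is the least
  common multiple, so the defective entries count the cone points of the cover.\<close>

lemma size_cone_orders:
  assumes "partition_of d P"
  shows "size (filter_mset (\<lambda>p. p \<noteq> 1) (image_mset (\<lambda>k. mlcm P div k) P)) = size (defect P)"
proof -
  have eq: "mlcm P div k \<noteq> 1 \<longleftrightarrow> k \<noteq> mlcm P" if k: "k \<in># P" for k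
  proof -
    obtain j where j: "mlcm P = k * j" by (rule dvdE[OF dvd_Lcm[OF k]])
    have "k \<noteq> 0" 
    proof
      assume "k = 0"
      then show False using k assms by (simp add: partition_of_def)
    qed
    then show ?thesis unfolding j by auto
  qed
  have "size (filter_mset (\<lambda>p. p \<noteq> 1) (image_mset f M)) = size (filter_mset (\<lambda>k. f k \<noteq> 1) M)" for f :: "nat \<Rightarrow> nat" and M
    by (induction M) auto
  then have "size (filter_mset (\<lambda>p. p \<noteq> 1) (image_mset (\<lambda>k. mlcm P div k) P)) = size (filter_mset (\<lambda>k. mlcm P div k \<noteq> 1) P)" .
  also have "filter_mset (\<lambda>k. mlcm P div k \<noteq> 1) P = defect P" by (rule filter_mset_cong[OF refl eq])
  finally show ?thesis .
qed

lemma nat_triangle_inequality: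
  fixes a b c :: nat
  assumes "a \<ge> 2" "b \<ge> 2" "c \<ge> 2" "1 / real a + 1 / real b + 1 / real c < 1"
  shows "b * c + a * c + a * b < a * b * c"
proof -
  have pos: "real a > 0" "real b > 0" "real c > 0" using assms by auto
  then have "real a * real b * real c > 0" by simp
  then have "(1 / real a + 1 / real b + 1 / real c) * (real a * real b * real c) < 1 * (real a * real b * real c)"
    using assms(4) by (rule mult_strict_right_mono[rotated])
  moreover have "(1 / real a + 1 / real b + 1 / real c) * (real a * real b * real c) = real b * real c + real a * real c + real a * real b"
    using pos by (simp add: field_simps)
  ultimately have "real (b * c + a * c + a * b) < real (a * b * c)" by simp
  then show ?thesis by (simp only: of_nat_less_iff)
qed

lemma induced_nine_data:
  fixes c :: "'a surface_cover_data"
  assumes "induces_hyperbolic_triangular c"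
  shows "closed_surface (cover_surface c)" "cover_surface c homeomorphic_space nsphere 2"
    "closed_surface (base_surface c)" "base_surface c homeomorphic_space nsphere 2"
    "(cover_degree c, partitions c) \<in> nine_data"
proof -
  have cand: "candidate_cover c" and hyp: "hyperbolic_orbifold (induced_base_orbifold c)"
    and tc: "triangular_orbifold (induced_cover_orbifold c)" and tb: "triangular_orbifold (induced_base_orbifold c)"
    using assms unfolding induces_hyperbolic_triangular_def by blast+
  show "closed_surface (cover_surface c)" "closed_surface (base_surface c)"
    using cand unfolding candidate_cover_def by blast+
  show h: "cover_surface c homeomorphic_space nsphere 2" "base_surface c homeomorphic_space nsphere 2"
    using tc tb by (simp_all add: triangular_orbifold_def induced_cover_orbifold_def induced_base_orbifold_def)
  note e = euler_characteristic_sphere[OF h(1)] euler_characteristic_sphere[OF h(2)]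
  define d where "d = cover_degree c"
  have part: "partition_of d P" "\<exists>k\<in>#P. k > 1" if "P \<in># partitions c" for P
    using cand that unfolding candidate_cover_def d_def by blast+
  have L2: "mlcm P \<ge> 2" if "P \<in># partitions c" for P
    by (rule partition_facts[OF part[OF that] refl refl])
  \<comment> \<open>No order is dropped downstairs, since every partition has an entry above
    1.\<close>
  have base: "filter_mset (\<lambda>p. p \<noteq> 1) (image_mset mlcm (partitions c)) = image_mset mlcm (partitions c)"
  proof -
    have "p \<noteq> 1 \<longleftrightarrow> True" if "p \<in># image_mset mlcm (partitions c)" for p using that L2 by fastforce
    then have "filter_mset (\<lambda>p. p \<noteq> 1) (image_mset mlcm (partitions c)) = filter_mset (\<lambda>p. True) (image_mset mlcm (partitions c))"
      by (rule filter_mset_cong[OF refl])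
    then show ?thesis by simp
  qed
  have co: "cone_orders (induced_base_orbifold c) = image_mset mlcm (partitions c)"
    unfolding induced_base_orbifold_def using base by simp
  obtain p q r where "cone_orders (induced_base_orbifold c) = {#p, q, r#}"
    using tb unfolding triangular_orbifold_def by blast
  then have "size (image_mset mlcm (partitions c)) = size {#p, q, r#}" unfolding co by (rule arg_cong)
  then have "size (partitions c) = 3" by simp
  then obtain P1 P2 P3 where pc: "partitions c = {#P1, P2, P3#}" by (rule size_3_obtain)
  have in_c: "P1 \<in># partitions c" "P2 \<in># partitions c" "P3 \<in># partitions c" by (simp_all add: pc)
  \<comment> \<open>Both Euler characteristics are 2 and there are three partitions, so the
    Riemann--Hurwitz condition becomes a count of entries.\<close>
  have "2 - (int (size P1) + (int (size P2) + int (size P3))) = int d * (2 - 3)"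
    using cand unfolding candidate_cover_def e d_def by (simp add: pc)
  moreover have "int d * (2 - 3) = - int d" by simp
  ultimately have sz: "size P1 + size P2 + size P3 = d + 2" by linarith
  obtain x y z where "cone_orders (induced_cover_orbifold c) = {#x, y, z#}"
    using tc unfolding triangular_orbifold_def by blast
  then have "size (cone_orders (induced_cover_orbifold c)) = 3" by simp
  then have "size (filter_mset (\<lambda>p. p \<noteq> 1) (image_mset (\<lambda>k. mlcm P1 div k) P1)) +
      (size (filter_mset (\<lambda>p. p \<noteq> 1) (image_mset (\<lambda>k. mlcm P2 div k) P2)) +
      size (filter_mset (\<lambda>p. p \<noteq> 1) (image_mset (\<lambda>k. mlcm P3 div k) P3))) = 3"
    by (simp add: induced_cover_orbifold_def pc)
  then have r: "size (defect P1) + size (defect P2) + size (defect P3) = 3"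
    unfolding size_cone_orders[OF part(1)[OF in_c(1)]] size_cone_orders[OF part(1)[OF in_c(2)]]
      size_cone_orders[OF part(1)[OF in_c(3)]] by linarith
  have "orbifold_euler_characteristic (induced_base_orbifold c) < 0" using hyp unfolding hyperbolic_orbifold_def by blast
  then have "2 - ((1 - 1 / real (mlcm P1)) + ((1 - 1 / real (mlcm P2)) + (1 - 1 / real (mlcm P3)))) < 0"
    unfolding orbifold_euler_characteristic_def co by (simp add: induced_base_orbifold_def e pc)
  then have "1 / real (mlcm P1) + 1 / real (mlcm P2) + 1 / real (mlcm P3) < 1" by linarith
  note ineq = nat_triangle_inequality[OF L2[OF in_c(1)] L2[OF in_c(2)] L2[OF in_c(3)] this]
  have "triangle_data d P1 P2 P3"
    unfolding triangle_data_def using part in_c sz r ineq by blast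
  then show "(cover_degree c, partitions c) \<in> nine_data" unfolding pc d_def[symmetric] by (rule nine_data_complete)
qed

lemma induces_hyperbolic_triangularI:
  fixes c :: "'a surface_cover_data"
  assumes S: "closed_surface (cover_surface c)" "cover_surface c homeomorphic_space nsphere 2"
      "closed_surface (base_surface c)" "base_surface c homeomorphic_space nsphere 2"
    and c: "partitions c = {#P1, P2, P3#}" "cover_degree c = d" "d \<ge> 2"
    and P: "partition_of d P1" "\<exists>k\<in>#P1. k > 1" "partition_of d P2" "\<exists>k\<in>#P2. k > 1" "partition_of d P3" "\<exists>k\<in>#P3. k > 1"
    and sz: "size P1 + size P2 + size P3 = d + 2"
    and L: "mlcm P1 = p" "mlcm P2 = q" "mlcm P3 = r" "2 \<le> p" "2 \<le> q" "2 \<le> r" "1 / real p + 1 / real q + 1 / real r < 1"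
    and cov: "filter_mset (\<lambda>j. j \<noteq> 1) (image_mset (\<lambda>k. p div k) P1) + filter_mset (\<lambda>j. j \<noteq> 1) (image_mset (\<lambda>k. q div k) P2) +
      filter_mset (\<lambda>j. j \<noteq> 1) (image_mset (\<lambda>k. r div k) P3) = {#x, y, z#}"
      "2 \<le> x" "2 \<le> y" "2 \<le> z" "1 / real x + 1 / real y + 1 / real z < 1"
  shows "induces_hyperbolic_triangular c"
proof -
  note e = euler_characteristic_sphere[OF S(2)] euler_characteristic_sphere[OF S(4)]
  have cb: "cone_orders (induced_base_orbifold c) = {#p, q, r#}"
    unfolding induced_base_orbifold_def c using L by simp
  have "cone_orders (induced_cover_orbifold c) = filter_mset (\<lambda>j. j \<noteq> 1) (image_mset (\<lambda>k. p div k) P1) +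
      (filter_mset (\<lambda>j. j \<noteq> 1) (image_mset (\<lambda>k. q div k) P2) + filter_mset (\<lambda>j. j \<noteq> 1) (image_mset (\<lambda>k. r div k) P3))"
    unfolding induced_cover_orbifold_def c by (simp add: L(1-3))
  then have cc: "cone_orders (induced_cover_orbifold c) = {#x, y, z#}" using cov(1) by (simp only: add.assoc)
  have u: "underlying_surface (induced_base_orbifold c) = base_surface c" "underlying_surface (induced_cover_orbifold c) = cover_surface c"
    by (simp_all add: induced_base_orbifold_def induced_cover_orbifold_def)
  have o: "is_two_orbifold (induced_base_orbifold c)" "is_two_orbifold (induced_cover_orbifold c)"
    unfolding is_two_orbifold_def u cb cc using S L cov by simp_all
  have t: "triangular_orbifold (induced_base_orbifold c)" "triangular_orbifold (induced_cover_orbifold c)"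
    unfolding triangular_orbifold_def u cb cc using o S L(4-6) cov(2-4) by blast+
  have h: "hyperbolic_orbifold (induced_base_orbifold c)" "hyperbolic_orbifold (induced_cover_orbifold c)"
    unfolding hyperbolic_orbifold_def orbifold_euler_characteristic_def u cb cc e using o L(7) cov(5) by simp_all
  have "int (size P1) + (int (size P2) + int (size P3)) = int d + 2" using sz by linarith
  then have "candidate_cover c"
    unfolding candidate_cover_def e c using S c(3) P by simp
  then show ?thesis unfolding induces_hyperbolic_triangular_def using t h by blast
qed

lemma filter_mset_replicate: "filter_mset Q (replicate_mset n x) = (if Q x then replicate_mset n x else {#})"
  by (induction n) auto

lemma replicate_mset_2_3: "replicate_mset 2 x = {#x, x#}" "replicate_mset 3 x = {#x, x, x#}"
  by (simp_all add: numeral_eq_Suc)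

text \<open>In each case \<open>p\<close>, \<open>q\<close>, \<open>r\<close> are the cone orders of
  the base and \<open>x\<close>, \<open>y\<close>, \<open>z\<close> those of the cover, the
  quotients of a least common multiple by its defective entries.\<close>

lemma nine_data_induces:
  fixes c :: "'a surface_cover_data"
  assumes S: "closed_surface (cover_surface c)" "cover_surface c homeomorphic_space nsphere 2"
      "closed_surface (base_surface c)" "base_surface c homeomorphic_space nsphere 2"
    and c: "(cover_degree c, partitions c) \<in> nine_data"
  shows "induces_hyperbolic_triangular c"
proof -
  note I = induces_hyperbolic_triangularI[OF S]
  have l: "lcm (8::nat) 2 = 8" by (simp add: lcm_proj1_if_dvd_nat)
  note simps = partition_of_def filter_mset_replicate replicate_mset_2_3 l
  from c consider
    "cover_degree c = 6" "partitions c = {# replicate_mset 3 2, add_mset 4 (replicate_mset 2 1), {#5, 1#} #}" |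
    "cover_degree c = 8" "partitions c = {# replicate_mset 4 2, replicate_mset 2 4, add_mset 5 (replicate_mset 3 1) #}" |
    "cover_degree c = 8" "partitions c = {# replicate_mset 4 2, replicate_mset 2 3 + replicate_mset 2 1, {#7, 1#} #}" |
    "cover_degree c = 9" "partitions c = {# add_mset 1 (replicate_mset 4 2), replicate_mset 3 3, add_mset 7 (replicate_mset 2 1) #}" |
    "cover_degree c = 10" "partitions c = {# replicate_mset 5 2, add_mset 1 (replicate_mset 3 3), add_mset 8 (replicate_mset 2 1) #}" |
    "cover_degree c = 12" "partitions c = {# replicate_mset 6 2, replicate_mset 4 3, {#8, 2, 1, 1#} #}" |
    "cover_degree c = 12" "partitions c = {# replicate_mset 6 2, replicate_mset 4 3, add_mset 9 (replicate_mset 3 1) #}" |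
    "cover_degree c = 16" "partitions c = {# replicate_mset 8 2, add_mset 1 (replicate_mset 5 3), replicate_mset 2 7 + replicate_mset 2 1 #}" |
    "cover_degree c = 24" "partitions c = {# replicate_mset 12 2, replicate_mset 8 3, replicate_mset 3 7 + replicate_mset 3 1 #}"
    unfolding nine_data_def by (simp only: insert_iff empty_iff prod.inject simp_thms) blast
  then show ?thesis
  proof cases
    case 1
    show ?thesis by (rule I[where p = 2 and q = 4 and r = 5 and x = 4 and y = 4 and z = 5, OF 1(2,1)]) (simp_all add: simps add_mset_commute)
  next
    case 2
    show ?thesis by (rule I[where p = 2 and q = 4 and r = 5 and x = 5 and y = 5 and z = 5, OF 2(2,1)]) (simp_all add: simps add_mset_commute)
  next
    case 3
    show ?thesis by (rule I[where p = 2 and q = 3 and r = 7 and x = 3 and y = 3 and z = 7, OF 3(2,1)]) (simp_all add: simps add_mset_commute)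
  next
    case 4
    show ?thesis by (rule I[where p = 2 and q = 3 and r = 7 and x = 2 and y = 7 and z = 7, OF 4(2,1)]) (simp_all add: simps add_mset_commute)
  next
    case 5
    show ?thesis by (rule I[where p = 2 and q = 3 and r = 8 and x = 3 and y = 8 and z = 8, OF 5(2,1)]) (simp_all add: simps add_mset_commute)
  next
    case 6
    show ?thesis by (rule I[where p = 2 and q = 3 and r = 8 and x = 4 and y = 8 and z = 8, OF 6(2,1)]) (simp_all add: simps add_mset_commute)
  next
    case 7
    show ?thesis by (rule I[where p = 2 and q = 3 and r = 9 and x = 9 and y = 9 and z = 9, OF 7(2,1)]) (simp_all add: simps add_mset_commute)
  next
    case 8
    show ?thesis by (rule I[where p = 2 and q = 3 and r = 7 and x = 3 and y = 7 and z = 7, OF 8(2,1)]) (simp_all add: simps add_mset_commute)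
  next
    case 9
    show ?thesis by (rule I[where p = 2 and q = 3 and r = 7 and x = 7 and y = 7 and z = 7, OF 9(2,1)]) (simp_all add: simps add_mset_commute)
  qed
qed

section \<open>Counting the classes of candidates\<close>

definition exceptional_data :: "(nat \<times> nat multiset multiset) set" where
  "exceptional_data = {
     (8, {# replicate_mset 4 2, replicate_mset 2 4, add_mset 5 (replicate_mset 3 1) #}),
     (16, {# replicate_mset 8 2, add_mset 1 (replicate_mset 5 3), replicate_mset 2 7 + replicate_mset 2 1 #})}"

lemma nine_data_realizable:
  fixes c :: "'a surface_cover_data"
  assumes S: "closed_surface (cover_surface c)" "cover_surface c homeomorphic_space nsphere 2"
      "closed_surface (base_surface c)" "base_surface c homeomorphic_space nsphere 2"
    and c: "(cover_degree c, partitions c) \<in> nine_data" "(cover_degree c, partitions c) \<notin> exceptional_data"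
  shows "realizable c"
proof -
  from c consider
    "cover_degree c = 6" "partitions c = {# replicate_mset 3 2, add_mset 4 (replicate_mset 2 1), {#5, 1#} #}" |
    "cover_degree c = 8" "partitions c = {# replicate_mset 4 2, replicate_mset 2 3 + replicate_mset 2 1, {#7, 1#} #}" |
    "cover_degree c = 9" "partitions c = {# add_mset 1 (replicate_mset 4 2), replicate_mset 3 3, add_mset 7 (replicate_mset 2 1) #}" |
    "cover_degree c = 10" "partitions c = {# replicate_mset 5 2, add_mset 1 (replicate_mset 3 3), add_mset 8 (replicate_mset 2 1) #}" |
    "cover_degree c = 12" "partitions c = {# replicate_mset 6 2, replicate_mset 4 3, {#8, 2, 1, 1#} #}" |
    "cover_degree c = 12" "partitions c = {# replicate_mset 6 2, replicate_mset 4 3, add_mset 9 (replicate_mset 3 1) #}" |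
    "cover_degree c = 24" "partitions c = {# replicate_mset 12 2, replicate_mset 8 3, replicate_mset 3 7 + replicate_mset 3 1 #}"
    unfolding nine_data_def exceptional_data_def by (simp only: insert_iff empty_iff prod.inject simp_thms de_Morgan_disj) blast
  then show ?thesis
    unfolding realizable_def
    using realize_6[OF S] realize_8[OF S] realize_9[OF S] realize_10[OF S] realize_12a[OF S] realize_12b[OF S] realize_24[OF S]
    by cases (simp_all only: simp_thms)
qed

lemma exceptional_data_not_realizable:
  fixes c :: "'a surface_cover_data"
  assumes S: "cover_surface c homeomorphic_space nsphere 2" "base_surface c homeomorphic_space nsphere 2"
    and c: "(cover_degree c, partitions c) \<in> exceptional_data"
  shows "\<not> realizable c"
proof
  assume "realizable c"
  then obtain f where f: "branched_cover (cover_surface c) (base_surface c) f"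
      "has_cover_degree (cover_surface c) (base_surface c) f (cover_degree c)"
      "branch_data (cover_surface c) (base_surface c) f = partitions c"
    unfolding realizable_def by blast
  have r: "replicate_mset 4 (2::nat) = {#2, 2, 2, 2#}" "replicate_mset 2 (4::nat) = {#4, 4#}" "add_mset 5 (replicate_mset 3 (1::nat)) = {#5, 1, 1, 1#}"
    "replicate_mset 8 (2::nat) = {#2, 2, 2, 2, 2, 2, 2, 2#}" "add_mset 1 (replicate_mset 5 (3::nat)) = {#3, 3, 3, 3, 3, 1#}"
    "replicate_mset 2 7 + replicate_mset 2 (1::nat) = {#7, 7, 1, 1#}"
    by (simp_all add: numeral_eq_Suc add_mset_commute)
  from c consider
    "cover_degree c = 8" "partitions c = {# {#2, 2, 2, 2#}, {#4, 4#}, {#5, 1, 1, 1#} #}" |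
    "cover_degree c = 16" "partitions c = {# {#2, 2, 2, 2, 2, 2, 2, 2#}, {#3, 3, 3, 3, 3, 1#}, {#7, 7, 1, 1#} #}"
    unfolding exceptional_data_def r by (simp only: insert_iff empty_iff prod.inject simp_thms) blast
  then show False
  proof cases
    case 1
    have d: "has_cover_degree (cover_surface c) (base_surface c) f 8" using f(2) unfolding 1(1) .
    show False
      by (rule branched_cover_permutations[OF f(1) S d _ f(3)[unfolded 1(2)]])
        (simp, simp, simp, simp, rule no_permutations_degree_8)
  next
    case 2
    have d: "has_cover_degree (cover_surface c) (base_surface c) f 16" using f(2) unfolding 2(1) .
    show False
      by (rule branched_cover_permutations[OF f(1) S d _ f(3)[unfolded 2(2)]])
        (simp, simp, simp, simp, rule no_permutations_degree_16)
  qed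
qed

text \<open>Functions that identify the same pairs of arguments have images in bijection; this
  replaces equivalence classes of candidates by their numerical data.\<close>

lemma card_image_eq:
  assumes "\<And>x y. x \<in> A \<Longrightarrow> y \<in> A \<Longrightarrow> f x = f y \<longleftrightarrow> g x = g y"
  shows "card (f ` A) = card (g ` A)"
proof -
  let ?h = "\<lambda>v. f (inv_into A g v)"
  have h: "?h (g x) = f x" if "x \<in> A" for x
  proof -
    have "inv_into A g (g x) \<in> A" "g (inv_into A g (g x)) = g x" using that by (simp_all add: inv_into_into f_inv_into_f)
    then show ?thesis using assms that by blast
  qed
  have "inj_on ?h (g ` A)"
  proof (rule inj_onI)
    fix u v assume "u \<in> g ` A" "v \<in> g ` A" "?h u = ?h v"
    then obtain x y where "x \<in> A" "y \<in> A" "u = g x" "v = g y" by blast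
    then show "u = v" using h assms \<open>?h u = ?h v\<close> by metis
  qed
  moreover have "?h ` (g ` A) = f ` A" unfolding image_image by (rule image_cong[OF refl h])
  ultimately show ?thesis using card_image by metis
qed

text \<open>Equal degrees occur only in these two pairs; the numbers of entries 7 and 9,
  respectively, tell the members apart.\<close>

lemma nine_data_distinct:
  "{# replicate_mset 4 (2::nat), replicate_mset 2 4, add_mset 5 (replicate_mset 3 1) #} \<noteq>
   {# replicate_mset 4 2, replicate_mset 2 3 + replicate_mset 2 1, {#7, 1#} #}"
  "{# replicate_mset 6 (2::nat), replicate_mset 4 3, {#8, 2, 1, 1#} #} \<noteq>
   {# replicate_mset 6 2, replicate_mset 4 3, add_mset 9 (replicate_mset 3 1) #}"
  by (rule notI, drule arg_cong[where f = "\<lambda>M. \<Sum>P\<in>#M. count P 7"], simp)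
    (rule notI, drule arg_cong[where f = "\<lambda>M. \<Sum>P\<in>#M. count P 9"], simp)

lemma card_nine_data: "card nine_data = 9"
  unfolding nine_data_def using nine_data_distinct by simp

lemma card_exceptional_data: "card exceptional_data = 2"
  unfolding exceptional_data_def by simp

lemma exceptional_data_subset: "exceptional_data \<subseteq> nine_data"
  unfolding exceptional_data_def nine_data_def by blast

theorem theorem0p9:
  shows "card ({c :: candidate. induces_hyperbolic_triangular c} // same_candidate) = 9
    \<and> card ({c :: candidate. induces_hyperbolic_triangular c \<and> exceptional c} // same_candidate) = 2
    \<and> cover_degree ` {c :: candidate. induces_hyperbolic_triangular c \<and> exceptional c} = {8, 16}
    \<and> (\<forall>c :: candidate. induces_hyperbolic_triangular c \<and> exceptional c \<longrightarrow> \<not> prime (cover_degree c))"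
proof -
  \<comment> \<open>All surfaces involved are spheres, so degree and partitions determine the class
    of a candidate.\<close>
  define key :: "candidate \<Rightarrow> nat \<times> nat multiset multiset" where "key = (\<lambda>c. (cover_degree c, partitions c))"
  define K where "K = {c :: candidate. induces_hyperbolic_triangular c}"
  define B where "B = {c :: candidate. induces_hyperbolic_triangular c \<and> exceptional c}"
  have K: "closed_surface (cover_surface c)" "cover_surface c homeomorphic_space nsphere 2"
    "closed_surface (base_surface c)" "base_surface c homeomorphic_space nsphere 2" "key c \<in> nine_data" if "c \<in> K" for c
    using induced_nine_data[of c] that unfolding K_def key_def by blast+
  have exc: "exceptional c \<longleftrightarrow> key c \<in> exceptional_data" if "c \<in> K" for c
  proof -
    have "candidate_cover c" using that unfolding K_def induces_hyperbolic_triangular_def by blast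
    then show ?thesis
      using nine_data_realizable[OF K(1-4)[OF that]] exceptional_data_not_realizable[OF K(2,4)[OF that]] K(5)[OF that]
      unfolding exceptional_def key_def by blast
  qed
  have same: "same_candidate `` {c} = same_candidate `` {c'} \<longleftrightarrow> key c = key c'" if "c \<in> K" "c' \<in> K" for c c'
  proof -
    have "cover_surface c homeomorphic_space cover_surface c'" "base_surface c homeomorphic_space base_surface c'"
      using homeomorphic_space_trans homeomorphic_space_sym K(2,4) that by blast+
    then have "(c, c') \<in> same_candidate \<longleftrightarrow> key c = key c'" unfolding same_candidate_def key_def by simp
    then show ?thesis using eq_equiv_class_iff[OF equiv_same_candidate] by blast
  qed
  have quot: "card (A // same_candidate) = card (key ` A)" if "A \<subseteq> K" for A
  proof -
    have "A // same_candidate = (\<lambda>c. same_candidate `` {c}) ` A" unfolding quotient_def by blast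
    then show ?thesis using card_image_eq[of A "\<lambda>c. same_candidate `` {c}" key] same that by (simp add: subset_iff)
  qed
  \<comment> \<open>Taking \<open>nsphere 2\<close> as both surfaces shows that each of the nine
    data is attained by an actual candidate.\<close>
  have K_ex: "\<exists>c\<in>K. key c = v" if "v \<in> nine_data" for v
  proof -
    define c :: candidate where "c = \<lparr>cover_surface = nsphere 2, base_surface = nsphere 2, cover_degree = fst v, partitions = snd v\<rparr>"
    have k: "key c = v" by (simp add: c_def key_def)
    have "induces_hyperbolic_triangular c"
      by (rule nine_data_induces) (use k that closed_surface_nsphere_2 in \<open>simp_all add: c_def key_def homeomorphic_space_refl\<close>)
    then show ?thesis using k unfolding K_def by blast
  qed
  have keyK: "key ` K = nine_data" using K(5) K_ex by blast
  have BK: "B = {c \<in> K. key c \<in> exceptional_data}" using exc unfolding B_def K_def by blast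
  have keyB: "key ` B = exceptional_data" using K_ex exceptional_data_subset unfolding BK by blast
  have "cover_degree ` B = fst ` (key ` B)" unfolding image_image key_def by simp
  then have degs: "cover_degree ` B = {8, 16}" unfolding keyB exceptional_data_def by simp
  have np: "\<not> prime (8::nat)" "\<not> prime (16::nat)" by simp_all
  have "\<not> prime (cover_degree c)" if "c \<in> B" for c
  proof -
    have "cover_degree c \<in> {8, 16}" using that unfolding degs[symmetric] by blast
    then show ?thesis using np by auto
  qed
  moreover have "card (K // same_candidate) = 9" using quot[of K] keyK card_nine_data by simp
  moreover have "card (B // same_candidate) = 2" using quot[of B] keyB card_exceptional_data BK by simp
  ultimately show ?thesis using degs unfolding K_def B_def by blast
qed

end
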